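(* Let $k$ be a field of characteristic zero, $R$ a commutative $k$-algebra and $L$ a Lie algebroid over $R$ which is locally free of rank $d$ as an $R$-module. The jet algebra $\mathrm J_RL=\operatorname{Hom}_R(\mathrm U_RL,R)$ carries the following structures (the maps $1\!\!1_1,1\!\!1_2,\Delta,\epsilon,S$ are defined in the context, and in particular $\Delta$ and $S$ are well defined). All algebras and morphisms are unitary. (a) A commutative associative algebra structure. (b) Two unit maps $1\!\!1_1,1\!\!1_2:R\to\mathrm J_RL$, which are algebra morphisms. (c) A comultiplication $\Delta:\mathrm J_RL\to\mathrm J_RL\,\widehat\otimes_R\,\mathrm J_RL$, which is an algebra morphism and a morphism of $R$-$R$-bimodules, where $R$ acts on the left of $\mathrm J_RL$ through $1\!\!1_1$ and on the right through $1\!\!1_2$ (this convention is also used to form the tensor product). (d) A counit $\epsilon:\mathrm J_RL\to R$, which is an algebra morphism and an $R$-$R$-bimodule morphism. (e) An invertible antipode $S:\mathrm J_RL\to\mathrm J_RL$, which is an algebra morphism and exchanges the $R$-actions on $\mathrm J_RL$ through $1\!\!1_1$ and $1\!\!1_2$. These structures satisfy (writing $\Delta(\alpha)=\sum_\alpha\alpha_{(1)}\otimes\alpha_{(2)}$): (1) $\Delta$ is coassociative; (2) $\epsilon\circ1\!\!1_1=\mathrm{id}_R=\epsilon\circ1\!\!1_2$; (3) for all $\alpha\in\mathrm J_RL$: $\sum_\alpha(1\!\!1_1\circ\epsilon)(\alpha_{(1)})\,\alpha_{(2)}=\alpha=\sum_\alpha\alpha_{(1)}\,(1\!\!1_2\circ\epsilon)(\alpha_{(2)})$;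 (4) for all $\alpha\in\mathrm J_RL$: $\sum_\alpha S(\alpha_{(1)})\alpha_{(2)}=(1\!\!1_2\circ\epsilon)(\alpha)$ and $\sum_\alpha\alpha_{(1)}S(\alpha_{(2)})=(1\!\!1_1\circ\epsilon)(\alpha)$; (5) $S^2=\mathrm{id}_{\mathrm J_RL}$.
   Context: A Lie algebroid $L$ over $R$ is a Lie algebra acting on $R$ which is also an $R$-module, with $(r_1l)(r_2)=r_1l(r_2)$, $l(r_1r_2)=l(r_1)r_2+r_1l(r_2)$, $[l_1,l_2](r)=l_1(l_2(r))-l_2(l_1(r))$, $[l_1,rl_2]=l_1(r)l_2+r[l_1,l_2]$. $\mathrm U_RL$ is the universal enveloping algebra: the quotient of the enveloping algebra of the Lie algebra $R\oplus L$, with bracket $[(r_1,l_1),(r_2,l_2)]=(l_1(r_2)-l_2(r_1),[l_1,l_2])$, by the relations $r\cdot l=rl$ for $r\in R$, $l\in R\oplus L$. It acts on $R$ from the left (extending the action of $L$); write $D(r)$. With its left $R$-module structure it is a cocommutative $R$-coalgebra: $\Delta(r)=r\otimes1$, $\Delta(l)=l\otimes1+1\otimes l$, $\Delta(DE)=\sum D_{(1)}E_{(1)}\otimes D_{(2)}E_{(2)}$, counit $D\mapsto D(1)$. $\mathrm J_RL=\operatorname{Hom}_R(\mathrm U_RL,R)$ has the multiplication dual to the comultiplication of $\mathrm U_RL$, with unit the counit of $\mathrm U_RL$. The counit is $\epsilon(\alpha)=\alpha(1)$; $\mathrm J_RL$ carries the $\ker\epsilon$-adic topology, for which it is complete, and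 $\widehat\otimes_R$ is the completed tensor product. $\mathrm J_RL$ has two commuting left $\mathrm U_RL$-module structures: ${}^1\nabla$ determined by $({}^1\nabla_r\alpha)(D)=r\alpha(D)$ for $r\in R$ and $({}^1\nabla_l\alpha)(D)=l(\alpha(D))-\alpha(lD)$ for $l\in L$; and ${}^2\nabla$ given by $({}^2\nabla_E\alpha)(D)=\alpha(DE)$. Define $1\!\!1_i(r)={}^i\nabla_r(1)$ for $i=1,2$, i.e. $1\!\!1_1(r)(D)=rD(1)$ and $1\!\!1_2(r)(D)=D(r)$. Define pairings $\langle\alpha,D\rangle_i=\epsilon({}^i\nabla_D\alpha)$. The coproduct $\Delta$ on $\mathrm J_RL$ is defined by requiring $\epsilon({}^1\nabla_D{}^2\nabla_E(\alpha))=\sum_\alpha\langle\alpha_{(1)},D\rangle_1\langle\alpha_{(2)},E\rangle_2$ for all $D,E\in\mathrm U_RL$; the antipode $S$ is defined by requiring $\langle S\alpha,D\rangle_1=\langle\alpha,D\rangle_2$ for all $D\in\mathrm U_RL$. *)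

theory Defs
  imports "HOL-Algebra.Algebra"
begin

section \<open>Localization and locally free modules\<close>

definition self_module :: "('r, 'm) ring_scheme \<Rightarrow> ('r, 'r) module" where
  "self_module R = \<lparr>carrier = carrier R, monoid.mult = monoid.mult R, one = one R, ring.zero = ring.zero R, add = add R,
     smult = monoid.mult R\<rparr>"

definition frac_rel ::
    "('r, 'm) ring_scheme \<Rightarrow> 'r set \<Rightarrow> ('r, 'a, 'n) module_scheme \<Rightarrow> (('a \<times> 'r) \<times> ('a \<times> 'r)) set" where
  "frac_rel R S M = {((m, s), (n, t)) | m s n t.
     m \<in> carrier M \<and> n \<in> carrier M \<and> s \<in> S \<and> t \<in> S \<and>
     (\<exists>u\<in>S. u \<odot>\<^bsub>M\<^esub> (t \<odot>\<^bsub>M\<^esub> m \<ominus>\<^bsub>M\<^esub> s \<odot>\<^bsub>M\<^esub> n) = \<zero>\<^bsub>M\<^esub>)}"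

abbreviation frac ::
    "('r, 'm) ring_scheme \<Rightarrow> 'r set \<Rightarrow> ('r, 'a, 'n) module_scheme \<Rightarrow> 'a \<Rightarrow> 'r \<Rightarrow> ('a \<times> 'r) set" where
  "frac R S M m s \<equiv> frac_rel R S M `` {(m, s)}"

definition loc_module ::
    "('r, 'm) ring_scheme \<Rightarrow> 'r set \<Rightarrow> ('r, 'a, 'n) module_scheme \<Rightarrow> (('r \<times> 'r) set, ('a \<times> 'r) set) module"
  where
  "loc_module R S M =
    \<lparr>carrier = (carrier M \<times> S) // frac_rel R S M, monoid.mult = undefined, one = undefined,
     ring.zero = frac R S M \<zero>\<^bsub>M\<^esub> \<one>\<^bsub>R\<^esub>,
     add = (\<lambda>V W. \<Union>(m, s)\<in>V. \<Union>(n, t)\<in>W. frac R S M (t \<odot>\<^bsub>M\<^esub> m \<oplus>\<^bsub>M\<^esub> s \<odot>\<^bsub>M\<^esub> n) (s \<otimes>\<^bsub>R\<^esub> t)),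
     smult = (\<lambda>A W. \<Union>(a, s)\<in>A. \<Union>(m, t)\<in>W. frac R S M (a \<odot>\<^bsub>M\<^esub> m) (s \<otimes>\<^bsub>R\<^esub> t))\<rparr>"

definition loc_ring :: "('r, 'm) ring_scheme \<Rightarrow> 'r set \<Rightarrow> ('r \<times> 'r) set ring" where
  "loc_ring R S = (let M = loc_module R S (self_module R) in
    \<lparr>carrier = carrier M, monoid.mult = smult M, one = frac R S (self_module R) \<one>\<^bsub>R\<^esub> \<one>\<^bsub>R\<^esub>,
     ring.zero = ring.zero M, add = add M\<rparr>)"

definition free_of_rank :: "('r, 'm) ring_scheme \<Rightarrow> ('r, 'a, 'n) module_scheme \<Rightarrow> nat \<Rightarrow> bool" where
  "free_of_rank R M d \<longleftrightarrow>
    (\<exists>b \<in> {..<d} \<rightarrow> carrier M. \<forall>x \<in> carrier M.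
       \<exists>!c. c \<in> ({..<d} \<rightarrow>\<^sub>E carrier R) \<and> x = (\<Oplus>\<^bsub>M\<^esub>i\<in>{..<d}. c i \<odot>\<^bsub>M\<^esub> b i))"

text \<open>The basic open sets of the elements of \<open>F\<close> cover the spectrum of \<open>R\<close> iff \<open>F\<close> generates
  the unit ideal.\<close>

definition locally_free :: "('r, 'm) ring_scheme \<Rightarrow> ('r, 'a, 'n) module_scheme \<Rightarrow> nat \<Rightarrow> bool" where
  "locally_free R M d \<longleftrightarrow>
    (\<exists>F \<subseteq> carrier R. genideal R F = carrier R \<and>
      (\<forall>f\<in>F. let S = range (\<lambda>n::nat. f [^]\<^bsub>R\<^esub> n) in
         free_of_rank (loc_ring R S) (loc_module R S M) d))"


section \<open>Lie algebroids\<close>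

record ('r, 'l) lie_module = "('r, 'l) module" +
  bracket :: "'l \<Rightarrow> 'l \<Rightarrow> 'l"
  anchor :: "'l \<Rightarrow> 'r \<Rightarrow> 'r"

text \<open>The ground field \<open>K\<close> acts on \<open>L\<close> through its image in \<open>R\<close>.\<close>

definition base_scalar :: "('k, 'r, 'm) module_scheme \<Rightarrow> 'k \<Rightarrow> 'r" where
  "base_scalar R c = c \<odot>\<^bsub>R\<^esub> \<one>\<^bsub>R\<^esub>"

locale lie_algebroid =
  fixes K :: "'k ring" and R :: "('k, 'r) module" and L :: "('r, 'l) lie_module"
  assumes field: "field K"
    and algebra: "algebra K R"
    and module: "module R L"
    and bracket_closed: "\<lbrakk>x \<in> carrier L; y \<in> carrier L\<rbrakk> \<Longrightarrow> bracket L x y \<in> carrier L"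
    and bracket_add_left: "\<lbrakk>x \<in> carrier L; y \<in> carrier L; z \<in> carrier L\<rbrakk>
      \<Longrightarrow> bracket L (x \<oplus>\<^bsub>L\<^esub> y) z = bracket L x z \<oplus>\<^bsub>L\<^esub> bracket L y z"
    and bracket_add_right: "\<lbrakk>x \<in> carrier L; y \<in> carrier L; z \<in> carrier L\<rbrakk>
      \<Longrightarrow> bracket L x (y \<oplus>\<^bsub>L\<^esub> z) = bracket L x y \<oplus>\<^bsub>L\<^esub> bracket L x z"
    and bracket_scalar_left: "\<lbrakk>c \<in> carrier K; x \<in> carrier L; y \<in> carrier L\<rbrakk>
      \<Longrightarrow> bracket L (base_scalar R c \<odot>\<^bsub>L\<^esub> x) y = base_scalar R c \<odot>\<^bsub>L\<^esub> bracket L x y"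
    and bracket_scalar_right: "\<lbrakk>c \<in> carrier K; x \<in> carrier L; y \<in> carrier L\<rbrakk>
      \<Longrightarrow> bracket L x (base_scalar R c \<odot>\<^bsub>L\<^esub> y) = base_scalar R c \<odot>\<^bsub>L\<^esub> bracket L x y"
    and bracket_self: "x \<in> carrier L \<Longrightarrow> bracket L x x = \<zero>\<^bsub>L\<^esub>"
    and jacobi: "\<lbrakk>x \<in> carrier L; y \<in> carrier L; z \<in> carrier L\<rbrakk>
      \<Longrightarrow> bracket L x (bracket L y z) \<oplus>\<^bsub>L\<^esub> bracket L y (bracket L z x)
            \<oplus>\<^bsub>L\<^esub> bracket L z (bracket L x y) = \<zero>\<^bsub>L\<^esub>"
    and anchor_closed: "\<lbrakk>x \<in> carrier L; r \<in> carrier R\<rbrakk> \<Longrightarrow> anchor L x r \<in> carrier R"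
    and anchor_add_left: "\<lbrakk>x \<in> carrier L; y \<in> carrier L; r \<in> carrier R\<rbrakk>
      \<Longrightarrow> anchor L (x \<oplus>\<^bsub>L\<^esub> y) r = anchor L x r \<oplus>\<^bsub>R\<^esub> anchor L y r"
    and anchor_smult: "\<lbrakk>a \<in> carrier R; x \<in> carrier L; r \<in> carrier R\<rbrakk>
      \<Longrightarrow> anchor L (a \<odot>\<^bsub>L\<^esub> x) r = a \<otimes>\<^bsub>R\<^esub> anchor L x r"
    and anchor_add_right: "\<lbrakk>x \<in> carrier L; r \<in> carrier R; s \<in> carrier R\<rbrakk>
      \<Longrightarrow> anchor L x (r \<oplus>\<^bsub>R\<^esub> s) = anchor L x r \<oplus>\<^bsub>R\<^esub> anchor L x s"
    and anchor_scalar: "\<lbrakk>c \<in> carrier K; x \<in> carrier L; r \<in> carrier R\<rbrakk>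
      \<Longrightarrow> anchor L x (c \<odot>\<^bsub>R\<^esub> r) = c \<odot>\<^bsub>R\<^esub> anchor L x r"
    and anchor_leibniz: "\<lbrakk>x \<in> carrier L; r \<in> carrier R; s \<in> carrier R\<rbrakk>
      \<Longrightarrow> anchor L x (r \<otimes>\<^bsub>R\<^esub> s) = anchor L x r \<otimes>\<^bsub>R\<^esub> s \<oplus>\<^bsub>R\<^esub> r \<otimes>\<^bsub>R\<^esub> anchor L x s"
    and anchor_bracket: "\<lbrakk>x \<in> carrier L; y \<in> carrier L; r \<in> carrier R\<rbrakk>
      \<Longrightarrow> anchor L (bracket L x y) r = anchor L x (anchor L y r) \<ominus>\<^bsub>R\<^esub> anchor L y (anchor L x r)"
    and bracket_leibniz: "\<lbrakk>x \<in> carrier L; y \<in> carrier L; r \<in> carrier R\<rbrakk>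
      \<Longrightarrow> bracket L x (r \<odot>\<^bsub>L\<^esub> y) = anchor L x r \<odot>\<^bsub>L\<^esub> y \<oplus>\<^bsub>L\<^esub> r \<odot>\<^bsub>L\<^esub> bracket L x y"


section \<open>The universal enveloping algebra\<close>

text \<open>The free associative \<open>K\<close>-algebra on \<open>Z\<close>: finitely supported functions on the words in
  \<open>Z\<close>, with the convolution product.\<close>

definition free_alg :: "('k, 'm) ring_scheme \<Rightarrow> 'x set \<Rightarrow> ('k, 'x list \<Rightarrow> 'k) module" where
  "free_alg K Z =
    \<lparr>carrier = {p. (\<forall>w. p w \<in> carrier K) \<and> finite {w. p w \<noteq> \<zero>\<^bsub>K\<^esub>} \<and>
                   (\<forall>w. p w \<noteq> \<zero>\<^bsub>K\<^esub> \<longrightarrow> w \<in> lists Z)},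
     monoid.mult = (\<lambda>p q w. \<Oplus>\<^bsub>K\<^esub>i\<in>{..length w}. p (take i w) \<otimes>\<^bsub>K\<^esub> q (drop i w)),
     one = (\<lambda>w. if w = [] then \<one>\<^bsub>K\<^esub> else \<zero>\<^bsub>K\<^esub>),
     ring.zero = (\<lambda>w. \<zero>\<^bsub>K\<^esub>),
     add = (\<lambda>p q w. p w \<oplus>\<^bsub>K\<^esub> q w),
     smult = (\<lambda>c p w. c \<otimes>\<^bsub>K\<^esub> p w)\<rparr>"

definition gen :: "('k, 'm) ring_scheme \<Rightarrow> 'x \<Rightarrow> 'x list \<Rightarrow> 'k" where
  "gen K x = (\<lambda>w. if w = [x] then \<one>\<^bsub>K\<^esub> else \<zero>\<^bsub>K\<^esub>)"

text \<open>The Lie algebra \<open>R \<oplus> L\<close>; its anchor field is not used.\<close>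

definition sum_lie :: "('k, 'r) module \<Rightarrow> ('r, 'l) lie_module \<Rightarrow> ('r, 'r \<times> 'l) lie_module" where
  "sum_lie R L =
    \<lparr>carrier = carrier R \<times> carrier L, monoid.mult = undefined, one = undefined,
     ring.zero = (\<zero>\<^bsub>R\<^esub>, \<zero>\<^bsub>L\<^esub>),
     add = (\<lambda>(r, x) (s, y). (r \<oplus>\<^bsub>R\<^esub> s, x \<oplus>\<^bsub>L\<^esub> y)),
     smult = (\<lambda>a (r, x). (a \<otimes>\<^bsub>R\<^esub> r, a \<odot>\<^bsub>L\<^esub> x)),
     bracket = (\<lambda>(r, x) (s, y). (anchor L x s \<ominus>\<^bsub>R\<^esub> anchor L y r, bracket L x y)),
     anchor = undefined\<rparr>"

abbreviation free_RL ::
    "'k ring \<Rightarrow> ('k, 'r) module \<Rightarrow> ('r, 'l) lie_module \<Rightarrow> ('k, ('r \<times> 'l) list \<Rightarrow> 'k) module" where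
  "free_RL K R L \<equiv> free_alg K (carrier (sum_lie R L))"

text \<open>\<open>lie_env_rels\<close> presents the enveloping algebra of the \<open>K\<close>-Lie algebra \<open>R \<oplus> L\<close>: the first two
  families of relations cut the free algebra down to the tensor algebra of the vector space
  \<open>R \<oplus> L\<close>. The relations \<open>r \<cdot> x = r x\<close> are added in \<open>env_rels\<close>; as algebras are unitary
  and \<open>R\<close> acts unitally on the quotient, the unit of \<open>R\<close> is also identified with the empty word.\<close>

definition lie_env_rels ::
    "'k ring \<Rightarrow> ('k, 'r) module \<Rightarrow> ('r, 'l) lie_module \<Rightarrow> (('r \<times> 'l) list \<Rightarrow> 'k) set" where
  "lie_env_rels K R L = (let F = free_RL K R L; G = sum_lie R L in
     {gen K (x \<oplus>\<^bsub>G\<^esub> y) \<ominus>\<^bsub>F\<^esub> (gen K x \<oplus>\<^bsub>F\<^esub> gen K y) | x y. x \<in> carrier G \<and> y \<in> carrier G}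
   \<union> {gen K (base_scalar R c \<odot>\<^bsub>G\<^esub> x) \<ominus>\<^bsub>F\<^esub> (c \<odot>\<^bsub>F\<^esub> gen K x) | c x. c \<in> carrier K \<and> x \<in> carrier G}
   \<union> {(gen K x \<otimes>\<^bsub>F\<^esub> gen K y \<ominus>\<^bsub>F\<^esub> gen K y \<otimes>\<^bsub>F\<^esub> gen K x) \<ominus>\<^bsub>F\<^esub> gen K (bracket G x y)
        | x y. x \<in> carrier G \<and> y \<in> carrier G})"

definition env_rels ::
    "'k ring \<Rightarrow> ('k, 'r) module \<Rightarrow> ('r, 'l) lie_module \<Rightarrow> (('r \<times> 'l) list \<Rightarrow> 'k) set" where
  "env_rels K R L = (let F = free_RL K R L; G = sum_lie R L in
     lie_env_rels K R L
   \<union> {gen K (r, \<zero>\<^bsub>L\<^esub>) \<otimes>\<^bsub>F\<^esub> gen K x \<ominus>\<^bsub>F\<^esub> gen K (r \<odot>\<^bsub>G\<^esub> x) | r x. r \<in> carrier R \<and> x \<in> carrier G}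
   \<union> {gen K (\<one>\<^bsub>R\<^esub>, \<zero>\<^bsub>L\<^esub>) \<ominus>\<^bsub>F\<^esub> \<one>\<^bsub>F\<^esub>})"

definition env_ideal ::
    "'k ring \<Rightarrow> ('k, 'r) module \<Rightarrow> ('r, 'l) lie_module \<Rightarrow> (('r \<times> 'l) list \<Rightarrow> 'k) set" where
  "env_ideal K R L = genideal (free_RL K R L) (env_rels K R L)"

type_synonym ('k, 'r, 'l) env = "(('r \<times> 'l) list \<Rightarrow> 'k) set"

definition env_alg ::
    "'k ring \<Rightarrow> ('k, 'r) module \<Rightarrow> ('r, 'l) lie_module \<Rightarrow> ('k, 'r, 'l) env ring" where
  "env_alg K R L = free_RL K R L Quot env_ideal K R L"

definition env_of_R ::
    "'k ring \<Rightarrow> ('k, 'r) module \<Rightarrow> ('r, 'l) lie_module \<Rightarrow> 'r \<Rightarrow> ('k, 'r, 'l) env" where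
  "env_of_R K R L r = env_ideal K R L +>\<^bsub>free_RL K R L\<^esub> gen K (r, \<zero>\<^bsub>L\<^esub>)"

definition env_of_L ::
    "'k ring \<Rightarrow> ('k, 'r) module \<Rightarrow> ('r, 'l) lie_module \<Rightarrow> 'l \<Rightarrow> ('k, 'r, 'l) env" where
  "env_of_L K R L x = env_ideal K R L +>\<^bsub>free_RL K R L\<^esub> gen K (\<zero>\<^bsub>R\<^esub>, x)"

definition env_smult ::
    "'k ring \<Rightarrow> ('k, 'r) module \<Rightarrow> ('r, 'l) lie_module \<Rightarrow> 'r \<Rightarrow> ('k, 'r, 'l) env \<Rightarrow> ('k, 'r, 'l) env" where
  "env_smult K R L r D = env_of_R K R L r \<otimes>\<^bsub>env_alg K R L\<^esub> D"

text \<open>The extension to the enveloping algebra of an action \<open>g\<close> of the generators on a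
  \<open>K\<close>-vector space \<open>M\<close>: words act by composition, and the value on a class is the common
  value on its representatives.\<close>

definition env_act ::
    "'k ring \<Rightarrow> ('k, 'a, 'm) module_scheme \<Rightarrow> ('r \<times> 'l \<Rightarrow> 'a \<Rightarrow> 'a) \<Rightarrow> ('k, 'r, 'l) env \<Rightarrow> 'a \<Rightarrow> 'a" where
  "env_act K M g D m =
    (THE y. \<forall>p\<in>D. y = (\<Oplus>\<^bsub>M\<^esub>w\<in>{w. p w \<noteq> \<zero>\<^bsub>K\<^esub>}. p w \<odot>\<^bsub>M\<^esub> foldr g w m))"

definition env_act_R ::
    "'k ring \<Rightarrow> ('k, 'r) module \<Rightarrow> ('r, 'l) lie_module \<Rightarrow> ('k, 'r, 'l) env \<Rightarrow> 'r \<Rightarrow> 'r" where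
  "env_act_R K R L = env_act K R (\<lambda>(r, x) s. r \<otimes>\<^bsub>R\<^esub> s \<oplus>\<^bsub>R\<^esub> anchor L x s)"


section \<open>Tensor powers\<close>

text \<open>Let \<open>M\<close> be an abelian group with a right action \<open>ra\<close> and a left action \<open>la\<close> of the
  elements of \<open>A\<close>. The \<open>n\<close>-fold tensor power of \<open>M\<close> over \<open>A\<close> is the free abelian group on the
  \<open>n\<close>-tuples in \<open>M\<close> modulo multiadditivity and \<open>\<dots> \<otimes> a r \<otimes> b \<otimes> \<dots> = \<dots> \<otimes> a \<otimes> r b \<otimes> \<dots>\<close>.
  \<open>tensor_null A M ra la n Z\<close> additionally kills the tensors with some factor in \<open>Z\<close>.\<close>

definition tuples :: "('a, 'm) ring_scheme \<Rightarrow> nat \<Rightarrow> 'a list set" where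
  "tuples M n = {xs \<in> lists (carrier M). length xs = n}"

definition tensor_null ::
    "'r set \<Rightarrow> ('a, 'm) ring_scheme \<Rightarrow> ('a \<Rightarrow> 'r \<Rightarrow> 'a) \<Rightarrow> ('r \<Rightarrow> 'a \<Rightarrow> 'a) \<Rightarrow> nat \<Rightarrow> 'a set
      \<Rightarrow> ('a list \<Rightarrow>\<^sub>0 int) set" where
  "tensor_null A M ra la n Z = generate (free_Abelian_group (tuples M n))
     ({frag_of (xs @ [a \<oplus>\<^bsub>M\<^esub> b] @ ys) - frag_of (xs @ [a] @ ys) - frag_of (xs @ [b] @ ys)
         | xs a b ys. xs @ [a] @ ys \<in> tuples M n \<and> b \<in> carrier M}
    \<union> {frag_of (xs @ [ra a r, b] @ ys) - frag_of (xs @ [a, la r b] @ ys)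
         | xs a b r ys. xs @ [a, b] @ ys \<in> tuples M n \<and> r \<in> A}
    \<union> {frag_of xs | xs. xs \<in> tuples M n \<and> set xs \<inter> Z \<noteq> {}})"

definition tensor_group ::
    "'r set \<Rightarrow> ('a, 'm) ring_scheme \<Rightarrow> ('a \<Rightarrow> 'r \<Rightarrow> 'a) \<Rightarrow> ('r \<Rightarrow> 'a \<Rightarrow> 'a) \<Rightarrow> nat \<Rightarrow> 'a set
      \<Rightarrow> ('a list \<Rightarrow>\<^sub>0 int) set monoid" where
  "tensor_group A M ra la n Z = free_Abelian_group (tuples M n) Mod tensor_null A M ra la n Z"

definition tensor_class ::
    "'r set \<Rightarrow> ('a, 'm) ring_scheme \<Rightarrow> ('a \<Rightarrow> 'r \<Rightarrow> 'a) \<Rightarrow> ('r \<Rightarrow> 'a \<Rightarrow> 'a) \<Rightarrow> nat \<Rightarrow> 'a set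
      \<Rightarrow> ('a list \<Rightarrow>\<^sub>0 int) \<Rightarrow> ('a list \<Rightarrow>\<^sub>0 int) set" where
  "tensor_class A M ra la n Z p = tensor_null A M ra la n Z #>\<^bsub>free_Abelian_group (tuples M n)\<^esub> p"

definition frag_mult ::
    "('a, 'm) ring_scheme \<Rightarrow> ('a list \<Rightarrow>\<^sub>0 int) \<Rightarrow> ('a list \<Rightarrow>\<^sub>0 int) \<Rightarrow> ('a list \<Rightarrow>\<^sub>0 int)" where
  "frag_mult M p q =
    frag_extend (\<lambda>xs. frag_extend (\<lambda>ys. frag_of (map2 (\<lambda>x y. x \<otimes>\<^bsub>M\<^esub> y) xs ys)) q) p"

text \<open>\<open>tensor_lift T \<phi> p\<close> is the sum \<open>\<Sum> \<phi> [a\<^sub>1, \<dots>, a\<^sub>n]\<close> over the terms \<open>a\<^sub>1 \<otimes> \<dots> \<otimes> a\<^sub>n\<close>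
  of the representative \<open>p\<close>.\<close>

definition tensor_lift ::
    "('b, 'm) ring_scheme \<Rightarrow> ('a list \<Rightarrow> 'b) \<Rightarrow> ('a list \<Rightarrow>\<^sub>0 int) \<Rightarrow> 'b" where
  "tensor_lift T \<phi> p =
    (\<Oplus>\<^bsub>T\<^esub>xs\<in>Poly_Mapping.keys p. [Poly_Mapping.lookup p xs] \<cdot>\<^bsub>T\<^esub> \<phi> xs)"


section \<open>The coproduct of the enveloping algebra\<close>

definition env_tensor_class ::
    "'k ring \<Rightarrow> ('k, 'r) module \<Rightarrow> ('r, 'l) lie_module
      \<Rightarrow> (('k, 'r, 'l) env list \<Rightarrow>\<^sub>0 int) \<Rightarrow> (('k, 'r, 'l) env list \<Rightarrow>\<^sub>0 int) set" where
  "env_tensor_class K R L =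
    tensor_class (carrier R) (env_alg K R L) (\<lambda>D r. env_smult K R L r D) (env_smult K R L) 2 {}"

definition env_tensor ::
    "'k ring \<Rightarrow> ('k, 'r) module \<Rightarrow> ('r, 'l) lie_module \<Rightarrow> (('k, 'r, 'l) env list \<Rightarrow>\<^sub>0 int) set monoid" where
  "env_tensor K R L =
    tensor_group (carrier R) (env_alg K R L) (\<lambda>D r. env_smult K R L r D) (env_smult K R L) 2 {}"

text \<open>The factorwise product is not defined on all of the tensor square over \<open>R\<close>. In the last
  condition \<open>p\<close> and \<open>q\<close> range over all representatives of the two coproducts.\<close>

definition is_env_coprod ::
    "'k ring \<Rightarrow> ('k, 'r) module \<Rightarrow> ('r, 'l) lie_module
      \<Rightarrow> (('k, 'r, 'l) env \<Rightarrow> (('k, 'r, 'l) env list \<Rightarrow>\<^sub>0 int) set) \<Rightarrow> bool" where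
  "is_env_coprod K R L \<Delta> \<longleftrightarrow> (let U = env_alg K R L in
     \<Delta> \<in> extensional (carrier U) \<and>
     \<Delta> \<in> hom (add_monoid U) (env_tensor K R L) \<and>
     (\<forall>r\<in>carrier R. \<Delta> (env_of_R K R L r)
        = env_tensor_class K R L (frag_of [env_of_R K R L r, \<one>\<^bsub>U\<^esub>])) \<and>
     (\<forall>x\<in>carrier L. \<Delta> (env_of_L K R L x)
        = env_tensor_class K R L (frag_of [env_of_L K R L x, \<one>\<^bsub>U\<^esub>] + frag_of [\<one>\<^bsub>U\<^esub>, env_of_L K R L x])) \<and>
     (\<forall>D\<in>carrier U. \<forall>E\<in>carrier U. \<forall>p\<in>\<Delta> D. \<forall>q\<in>\<Delta> E.
        \<Delta> (D \<otimes>\<^bsub>U\<^esub> E) = env_tensor_class K R L (frag_mult U p q)))"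

definition env_coprod ::
    "'k ring \<Rightarrow> ('k, 'r) module \<Rightarrow> ('r, 'l) lie_module
      \<Rightarrow> ('k, 'r, 'l) env \<Rightarrow> (('k, 'r, 'l) env list \<Rightarrow>\<^sub>0 int) set" where
  "env_coprod K R L = (THE \<Delta>. is_env_coprod K R L \<Delta>)"


section \<open>The jet algebra\<close>

type_synonym ('k, 'r, 'l) jet = "('k, 'r, 'l) env \<Rightarrow> 'r"

definition jet ::
    "'k ring \<Rightarrow> ('k, 'r) module \<Rightarrow> ('r, 'l) lie_module \<Rightarrow> ('k, ('k, 'r, 'l) jet) module" where
  "jet K R L = (let U = env_alg K R L in
    \<lparr>carrier = {\<alpha> \<in> carrier U \<rightarrow>\<^sub>E carrier R.
        (\<forall>D\<in>carrier U. \<forall>E\<in>carrier U. \<alpha> (D \<oplus>\<^bsub>U\<^esub> E) = \<alpha> D \<oplus>\<^bsub>R\<^esub> \<alpha> E) \<and>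
        (\<forall>r\<in>carrier R. \<forall>D\<in>carrier U. \<alpha> (env_smult K R L r D) = r \<otimes>\<^bsub>R\<^esub> \<alpha> D)},
     monoid.mult = (\<lambda>\<alpha> \<beta>. \<lambda>D\<in>carrier U. THE v. \<forall>p\<in>env_coprod K R L D.
        v = tensor_lift R (\<lambda>Ds. \<alpha> (Ds ! 0) \<otimes>\<^bsub>R\<^esub> \<beta> (Ds ! 1)) p),
     one = (\<lambda>D\<in>carrier U. env_act_R K R L D \<one>\<^bsub>R\<^esub>),
     ring.zero = (\<lambda>D\<in>carrier U. \<zero>\<^bsub>R\<^esub>),
     add = (\<lambda>\<alpha> \<beta>. \<lambda>D\<in>carrier U. \<alpha> D \<oplus>\<^bsub>R\<^esub> \<beta> D),
     smult = (\<lambda>c \<alpha>. \<lambda>D\<in>carrier U. c \<odot>\<^bsub>R\<^esub> \<alpha> D)\<rparr>)"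

definition jet_counit ::
    "'k ring \<Rightarrow> ('k, 'r) module \<Rightarrow> ('r, 'l) lie_module \<Rightarrow> ('k, 'r, 'l) jet \<Rightarrow> 'r" where
  "jet_counit K R L \<alpha> = \<alpha> \<one>\<^bsub>env_alg K R L\<^esub>"

definition nabla1 ::
    "'k ring \<Rightarrow> ('k, 'r) module \<Rightarrow> ('r, 'l) lie_module
      \<Rightarrow> ('k, 'r, 'l) env \<Rightarrow> ('k, 'r, 'l) jet \<Rightarrow> ('k, 'r, 'l) jet" where
  "nabla1 K R L = (let U = env_alg K R L in
    env_act K (jet K R L) (\<lambda>(r, x) \<alpha>. \<lambda>D\<in>carrier U.
      r \<otimes>\<^bsub>R\<^esub> \<alpha> D \<oplus>\<^bsub>R\<^esub> (anchor L x (\<alpha> D) \<ominus>\<^bsub>R\<^esub> \<alpha> (env_of_L K R L x \<otimes>\<^bsub>U\<^esub> D))))"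

definition nabla2 ::
    "'k ring \<Rightarrow> ('k, 'r) module \<Rightarrow> ('r, 'l) lie_module
      \<Rightarrow> ('k, 'r, 'l) env \<Rightarrow> ('k, 'r, 'l) jet \<Rightarrow> ('k, 'r, 'l) jet" where
  "nabla2 K R L E \<alpha> = (\<lambda>D\<in>carrier (env_alg K R L). \<alpha> (D \<otimes>\<^bsub>env_alg K R L\<^esub> E))"

definition jet_unit1 ::
    "'k ring \<Rightarrow> ('k, 'r) module \<Rightarrow> ('r, 'l) lie_module \<Rightarrow> 'r \<Rightarrow> ('k, 'r, 'l) jet" where
  "jet_unit1 K R L r = nabla1 K R L (env_of_R K R L r) \<one>\<^bsub>jet K R L\<^esub>"

definition jet_unit2 ::
    "'k ring \<Rightarrow> ('k, 'r) module \<Rightarrow> ('r, 'l) lie_module \<Rightarrow> 'r \<Rightarrow> ('k, 'r, 'l) jet" where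
  "jet_unit2 K R L r = nabla2 K R L (env_of_R K R L r) \<one>\<^bsub>jet K R L\<^esub>"

definition pairing1 ::
    "'k ring \<Rightarrow> ('k, 'r) module \<Rightarrow> ('r, 'l) lie_module
      \<Rightarrow> ('k, 'r, 'l) jet \<Rightarrow> ('k, 'r, 'l) env \<Rightarrow> 'r" where
  "pairing1 K R L \<alpha> D = jet_counit K R L (nabla1 K R L D \<alpha>)"

definition pairing2 ::
    "'k ring \<Rightarrow> ('k, 'r) module \<Rightarrow> ('r, 'l) lie_module
      \<Rightarrow> ('k, 'r, 'l) jet \<Rightarrow> ('k, 'r, 'l) env \<Rightarrow> 'r" where
  "pairing2 K R L \<alpha> D = jet_counit K R L (nabla2 K R L D \<alpha>)"

text \<open>The powers of the augmentation ideal, which define the topology of the jet algebra.\<close>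

definition jet_filt ::
    "'k ring \<Rightarrow> ('k, 'r) module \<Rightarrow> ('r, 'l) lie_module \<Rightarrow> nat \<Rightarrow> ('k, 'r, 'l) jet set" where
  "jet_filt K R L m =
    (ideal_prod (jet K R L) (a_kernel (jet K R L) R (jet_counit K R L)) ^^ m) (carrier (jet K R L))"

definition jet_left ::
    "'k ring \<Rightarrow> ('k, 'r) module \<Rightarrow> ('r, 'l) lie_module \<Rightarrow> 'r \<Rightarrow> ('k, 'r, 'l) jet \<Rightarrow> ('k, 'r, 'l) jet" where
  "jet_left K R L r \<alpha> = jet_unit1 K R L r \<otimes>\<^bsub>jet K R L\<^esub> \<alpha>"

definition jet_right ::
    "'k ring \<Rightarrow> ('k, 'r) module \<Rightarrow> ('r, 'l) lie_module \<Rightarrow> ('k, 'r, 'l) jet \<Rightarrow> 'r \<Rightarrow> ('k, 'r, 'l) jet" where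
  "jet_right K R L \<alpha> r = \<alpha> \<otimes>\<^bsub>jet K R L\<^esub> jet_unit2 K R L r"


section \<open>Completed tensor powers of the jet algebra\<close>

text \<open>With \<open>J\<close> the jet algebra and \<open>I\<close> its augmentation ideal, the completed \<open>n\<close>-fold tensor
  power is the inverse limit over \<open>m\<close> of the quotients of the \<open>n\<close>-fold tensor power of \<open>J\<close> by
  \<open>\<Sum>\<^sub>i J \<otimes> \<dots> \<otimes> I\<^sup>m \<otimes> \<dots> \<otimes> J\<close>. These quotients are sets of cosets in the free abelian group on
  the tuples, so the transition maps send a coset to the larger coset containing it.\<close>

definition ctensor_group ::
    "'k ring \<Rightarrow> ('k, 'r) module \<Rightarrow> ('r, 'l) lie_module \<Rightarrow> nat \<Rightarrow> nat
      \<Rightarrow> (('k, 'r, 'l) jet list \<Rightarrow>\<^sub>0 int) set monoid" where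
  "ctensor_group K R L n m =
    tensor_group (carrier R) (jet K R L) (jet_right K R L) (jet_left K R L) n (jet_filt K R L m)"

definition ctensor_class ::
    "'k ring \<Rightarrow> ('k, 'r) module \<Rightarrow> ('r, 'l) lie_module \<Rightarrow> nat \<Rightarrow> nat
      \<Rightarrow> (('k, 'r, 'l) jet list \<Rightarrow>\<^sub>0 int) \<Rightarrow> (('k, 'r, 'l) jet list \<Rightarrow>\<^sub>0 int) set" where
  "ctensor_class K R L n m =
    tensor_class (carrier R) (jet K R L) (jet_right K R L) (jet_left K R L) n (jet_filt K R L m)"

type_synonym ('k, 'r, 'l) ctensor = "nat \<Rightarrow> (('k, 'r, 'l) jet list \<Rightarrow>\<^sub>0 int) set"

text \<open>\<open>ctensor_map K R L n f\<close> is induced by the map \<open>f\<close> from tuples to \<open>n\<close>-tuples.\<close>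

definition ctensor_map ::
    "'k ring \<Rightarrow> ('k, 'r) module \<Rightarrow> ('r, 'l) lie_module \<Rightarrow> nat
      \<Rightarrow> (('k, 'r, 'l) jet list \<Rightarrow> ('k, 'r, 'l) jet list)
      \<Rightarrow> ('k, 'r, 'l) ctensor \<Rightarrow> ('k, 'r, 'l) ctensor" where
  "ctensor_map K R L n f x =
    (\<lambda>m. \<Union>p\<in>x m. ctensor_class K R L n m (frag_extend (\<lambda>xs. frag_of (f xs)) p))"

definition ctensor ::
    "'k ring \<Rightarrow> ('k, 'r) module \<Rightarrow> ('r, 'l) lie_module \<Rightarrow> nat \<Rightarrow> ('k, ('k, 'r, 'l) ctensor) module" where
  "ctensor K R L n =
    \<lparr>carrier = {x. \<forall>m. x m \<in> carrier (ctensor_group K R L n m) \<and> x (Suc m) \<subseteq> x m},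
     monoid.mult = (\<lambda>x y m. \<Union>p\<in>x m. \<Union>q\<in>y m. ctensor_class K R L n m (frag_mult (jet K R L) p q)),
     one = (\<lambda>m. ctensor_class K R L n m (frag_of (replicate n \<one>\<^bsub>jet K R L\<^esub>))),
     ring.zero = (\<lambda>m. \<one>\<^bsub>ctensor_group K R L n m\<^esub>),
     add = (\<lambda>x y m. x m \<otimes>\<^bsub>ctensor_group K R L n m\<^esub> y m),
     smult = (\<lambda>c. ctensor_map K R L n (\<lambda>xs. (c \<odot>\<^bsub>jet K R L\<^esub> hd xs) # tl xs))\<rparr>"

definition ctensor_filt ::
    "'k ring \<Rightarrow> ('k, 'r) module \<Rightarrow> ('r, 'l) lie_module \<Rightarrow> nat \<Rightarrow> nat \<Rightarrow> ('k, 'r, 'l) ctensor set" where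
  "ctensor_filt K R L n m = {x \<in> carrier (ctensor K R L n). x m = \<one>\<^bsub>ctensor_group K R L n m\<^esub>}"

definition ctensor_left ::
    "'k ring \<Rightarrow> ('k, 'r) module \<Rightarrow> ('r, 'l) lie_module \<Rightarrow> nat
      \<Rightarrow> 'r \<Rightarrow> ('k, 'r, 'l) ctensor \<Rightarrow> ('k, 'r, 'l) ctensor" where
  "ctensor_left K R L n r = ctensor_map K R L n (\<lambda>xs. jet_left K R L r (hd xs) # tl xs)"

definition ctensor_right ::
    "'k ring \<Rightarrow> ('k, 'r) module \<Rightarrow> ('r, 'l) lie_module \<Rightarrow> nat
      \<Rightarrow> ('k, 'r, 'l) ctensor \<Rightarrow> 'r \<Rightarrow> ('k, 'r, 'l) ctensor" where
  "ctensor_right K R L n x r =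
    ctensor_map K R L n (\<lambda>xs. butlast xs @ [jet_right K R L (last xs) r]) x"

text \<open>\<open>csum T G \<phi> x y\<close> says that for \<open>x = \<Sum> a\<^sub>1 \<otimes> \<dots> \<otimes> a\<^sub>n\<close> in a completed tensor power the sum
  \<open>\<Sum> \<phi> [a\<^sub>1, \<dots>, a\<^sub>n]\<close> exists and is equal to \<open>y\<close>: \<open>y\<close> is the one and only limit, in the linear
  topology on \<open>T\<close> with basis \<open>G\<close> of neighbourhoods of zero, of the sums over the
  representatives of the components of \<open>x\<close>.\<close>

definition csum ::
    "('b, 'm) ring_scheme \<Rightarrow> (nat \<Rightarrow> 'b set) \<Rightarrow> ('a list \<Rightarrow> 'b)
      \<Rightarrow> (nat \<Rightarrow> ('a list \<Rightarrow>\<^sub>0 int) set) \<Rightarrow> 'b \<Rightarrow> bool" where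
  "csum T G \<phi> x y \<longleftrightarrow>
    (\<forall>z. (z \<in> carrier T \<and> (\<forall>i. \<exists>m\<^sub>0. \<forall>m\<ge>m\<^sub>0. \<forall>p\<in>x m. tensor_lift T \<phi> p \<ominus>\<^bsub>T\<^esub> z \<in> G i)) \<longleftrightarrow> z = y)"


section \<open>Coproduct and antipode of the jet algebra\<close>

definition is_jet_coprod ::
    "'k ring \<Rightarrow> ('k, 'r) module \<Rightarrow> ('r, 'l) lie_module
      \<Rightarrow> ('k, 'r, 'l) jet \<Rightarrow> ('k, 'r, 'l) ctensor \<Rightarrow> bool" where
  "is_jet_coprod K R L \<alpha> x \<longleftrightarrow> x \<in> carrier (ctensor K R L 2) \<and>
    (\<forall>D\<in>carrier (env_alg K R L). \<forall>E\<in>carrier (env_alg K R L).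
       csum R (\<lambda>_. {\<zero>\<^bsub>R\<^esub>})
         (\<lambda>as. pairing1 K R L (as ! 0) D \<otimes>\<^bsub>R\<^esub> pairing2 K R L (as ! 1) E) x
         (jet_counit K R L (nabla1 K R L D (nabla2 K R L E \<alpha>))))"

definition jet_coprod ::
    "'k ring \<Rightarrow> ('k, 'r) module \<Rightarrow> ('r, 'l) lie_module \<Rightarrow> ('k, 'r, 'l) jet \<Rightarrow> ('k, 'r, 'l) ctensor" where
  "jet_coprod K R L \<alpha> = (THE x. is_jet_coprod K R L \<alpha> x)"

definition is_jet_antipode ::
    "'k ring \<Rightarrow> ('k, 'r) module \<Rightarrow> ('r, 'l) lie_module
      \<Rightarrow> ('k, 'r, 'l) jet \<Rightarrow> ('k, 'r, 'l) jet \<Rightarrow> bool" where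
  "is_jet_antipode K R L \<alpha> \<beta> \<longleftrightarrow> \<beta> \<in> carrier (jet K R L) \<and>
    (\<forall>D\<in>carrier (env_alg K R L). pairing1 K R L \<beta> D = pairing2 K R L \<alpha> D)"

definition jet_antipode ::
    "'k ring \<Rightarrow> ('k, 'r) module \<Rightarrow> ('r, 'l) lie_module \<Rightarrow> ('k, 'r, 'l) jet \<Rightarrow> ('k, 'r, 'l) jet" where
  "jet_antipode K R L \<alpha> = (THE \<beta>. is_jet_antipode K R L \<alpha> \<beta>)"

definition alg_hom ::
    "('k, 'n) ring_scheme \<Rightarrow> ('k, 'a, 'm) module_scheme \<Rightarrow> ('k, 'b, 'p) module_scheme \<Rightarrow> ('a \<Rightarrow> 'b) set" where
  "alg_hom K A B = {h \<in> ring_hom A B. \<forall>c\<in>carrier K. \<forall>a\<in>carrier A. h (c \<odot>\<^bsub>A\<^esub> a) = c \<odot>\<^bsub>B\<^esub> h a}"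

end

(* A local basis of L gives a connection, and the connection can be corrected degree by degree to
   a flat one on formal symmetric forms: contracting the Bianchi identity with the tautological
   section shows that the lowest component of the curvature vanishes. Horizontal sections are jets
   with prescribed linear part, and with dual bases of L they produce dual bases of the order
   filtration of the enveloping algebra U. Hence I^m, for I the augmentation ideal, consists of the
   jets vanishing on the operators of order < m, and the pairings <a,D>_1 <b,E>_2 separate the
   points of the completed tensor powers. The coproduct is assembled from the dual bases, the
   antipode is S(a)(D) = eps(nabla^1_D a), and all identities are verified on pairings. *)

theory Submission
 imports Defs
begin

text \<open>The presentation of \<open>U\<close> by generators and relations does not show that
  there are enough jets. The flat connection supplies them: it lets \<open>U\<close> act on forms,
  and the value of \<open>D a\<close> at the empty word is a jet in \<open>D\<close>. The correction
  \<open>H\<close> is found as in Fedosov's construction. It is normalised by a vanishing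
  contraction with the tautological section; the contracted curvature equation then determines it,
  with a division by n + 1 in degree n. The second use of denominators is the operator
  \<open>N\<close> on \<open>U\<close>, which is k on the top part of operators of order k: it
  splits off leading terms and gives the dual bases as well as a Hadamard lemma for jets. Tensor
  squares over \<open>R\<close> have no factorwise product, so the coproduct of \<open>D\<close> is
  obtained by letting \<open>D\<close> act on the class of 1 (x) 1, and the product with a jet is
  studied through its transpose, the contraction \<open>con\<close>. Dual bases, unlike bases, exist
  globally: a partition of unity combines the bases of finitely many localisations.\<close>

abbreviation mem_carrier (infix \<open>#:\<close> 50) where "x #: G \<equiv> x \<in> carrier G"
abbreviation add_in (\<open>_ +[_]/ _\<close> [65, 0, 66] 65) where "x +[G] y \<equiv> x \<oplus>\<^bsub>G\<^esub> y"
abbreviation sub_in (\<open>_ -[_]/ _\<close> [65, 0, 66] 65) where "x -[G] y \<equiv> x \<ominus>\<^bsub>G\<^esub> y"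
abbreviation usub_in (\<open>-[_] _\<close> [0, 81] 80) where "-[G] x \<equiv> \<ominus>\<^bsub>G\<^esub> x"
abbreviation mult_in (\<open>_ *[_]/ _\<close> [70, 0, 71] 70) where "x *[G] y \<equiv> x \<otimes>\<^bsub>G\<^esub> y"
abbreviation smult_in (\<open>_ **[_]/ _\<close> [70, 0, 71] 70) where "r **[G] x \<equiv> r \<odot>\<^bsub>G\<^esub> x"
abbreviation zero_in (\<open>0[_]\<close>) where "0[G] \<equiv> \<zero>\<^bsub>G\<^esub>"
abbreviation one_in (\<open>1[_]\<close>) where "1[G] \<equiv> \<one>\<^bsub>G\<^esub>"
notation monoid.mult (\<open>_ .*\<index>/ _\<close> [70, 71] 70)
notation ring.add (\<open>_ .+\<index>/ _\<close> [65, 66] 65)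
notation a_minus (\<open>_ .-\<index>/ _\<close> [65, 66] 65)
notation a_inv (\<open>.-\<index> _\<close> [81] 80)
abbreviation iff_in (infixr \<open><->\<close> 25) where "A <-> B \<equiv> A \<longleftrightarrow> B"
abbreviation funset (infixr \<open>->\<close> 60) where "A -> B \<equiv> A \<rightarrow> B"
abbreviation "supp \<equiv> Poly_Mapping.keys"

section \<open>Sums over the positions of a word\<close>

text \<open>\<open>psum M f w\<close> is the sum of the \<open>f w\<^sub>i (w\<^sub>1 \<dots> w\<^sub>i\<^sub>-\<^sub>1 w\<^sub>i\<^sub>+\<^sub>1 \<dots> w\<^sub>n)\<close>.\<close>

primrec psum :: "('b, 'm) ring_scheme => ('a => 'a list => 'b) => 'a list => 'b" where
 "psum M f [] = 0[M]"
| "psum M f (x # w) = f x w +[M] psum M (%z v. f z (x # v)) w"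

text \<open>Side conditions on \<open>psum\<close> are stated for the pairs with
  \<open>mset w = add_mset z (mset v)\<close>, a condition that survives the recursion. This lemma
  turns it into the facts about letters and lengths used later.\<close>

lemma mset_Cons_lists:
 assumes "mset w = add_mset z (mset v)" "w:lists A"
 shows "z:A & v:lists A & length w = Suc (length v)"
proof -
 have "set w = insert z (set v)" using assms(1) by (metis set_mset_add_mset_insert set_mset_mset)
 moreover have "length w = Suc (length v)" using assms(1) by (metis size_add_mset size_mset)
 ultimately show ?thesis using assms(2) by (auto simp: lists_eq_set)
qed

lemma psum_cong:
 assumes "!!z v. mset w = add_mset z (mset v) ==> f z v = g z v"
 shows "psum M f w = psum M g w"
 using assms
proof (induction w arbitrary: f g)
 case (Cons x w)
 have "psum M (%z v. f z (x # v)) w = psum M (%z v. g z (x # v)) w"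
  by (rule Cons.IH) (auto intro: Cons.prems)
 moreover have "f x w = g x w" by (rule Cons.prems) simp
 ultimately show ?case by simp
qed simp

lemmas (in abelian_group) abelian_group_simprules
 [algebra abelian_group "ring.zero G" "add G" "a_inv G" "a_minus G"] =
 a_closed zero_closed a_inv_closed minus_closed a_assoc l_zero l_neg a_comm minus_eq
 r_zero r_neg r_neg2 r_neg1 minus_add minus_minus minus_zero a_lcomm

context abelian_group
begin

lemma minus_zero_right [simp]: "a#:G ==> a .- \<zero> = a"
 by (simp add: a_minus_def)

lemma minus_self [simp]: "a#:G ==> a .- a = \<zero>"
 by (simp add: a_minus_def r_neg)

lemma psum_closed [simp]:
 assumes "!!z v. mset w = add_mset z (mset v) ==> f z v#:G"
 shows "psum G f w#:G"
 using assms
proof (induction w arbitrary: f)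
 case (Cons x w)
 have "psum G (%z v. f z (x # v)) w#:G"
  by (rule Cons.IH) (auto intro: Cons.prems)
 moreover have "f x w#:G" by (rule Cons.prems) simp
 ultimately show ?case by simp
qed simp

lemma psum_add:
 assumes "!!z v. mset w = add_mset z (mset v) ==> f z v#:G"
  and "!!z v. mset w = add_mset z (mset v) ==> g z v#:G"
 shows "psum G (%z v. f z v .+ g z v) w = psum G f w .+ psum G g w"
 using assms
proof (induction w arbitrary: f g)
 case (Cons x w)
 have 1: "psum G (%z v. f z (x # v) .+ g z (x # v)) w
   = psum G (%z v. f z (x # v)) w .+ psum G (%z v. g z (x # v)) w"
  by (rule Cons.IH) (auto intro: Cons.prems)
 have "psum G (%z v. f z (x # v)) w#:G" "psum G (%z v. g z (x # v)) w#:G"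
  by (rule psum_closed, auto intro: Cons.prems)+
 moreover have "f x w#:G" "g x w#:G" using Cons.prems by simp_all
 ultimately show ?case by (simp add: 1 a_ac)
qed simp

lemma psum_hom:
 assumes "!!z v. mset w = add_mset z (mset v) ==> f z v#:G"
  and "h \<zero> = 0[H]"
  and "!!a b. a#:G ==> b#:G ==> h (a .+ b) = h a +[H] h b"
 shows "h (psum G f w) = psum H (%z v. h (f z v)) w"
 using assms
proof (induction w arbitrary: f)
 case (Cons x w)
 have 1: "h (psum G (%z v. f z (x # v)) w) = psum H (%z v. h (f z (x # v))) w"
  by (rule Cons.IH) (auto intro: Cons.prems)
 have "psum G (%z v. f z (x # v)) w#:G"
  by (rule psum_closed, auto intro: Cons.prems)
 moreover have "f x w#:G" using Cons.prems by simp
 ultimately show ?case by (simp add: 1 Cons.prems(3))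
qed simp

lemma psum_minus:
 assumes "!!z v. mset w = add_mset z (mset v) ==> f z v#:G"
  and "!!z v. mset w = add_mset z (mset v) ==> g z v#:G"
 shows "psum G (%z v. f z v .- g z v) w = psum G f w .- psum G g w"
proof -
 have ".- psum G g w = psum G (%z v. .- g z v) w"
  by (rule psum_hom) (use assms in "auto simp: minus_add")
 thus ?thesis using assms by (simp add: a_minus_def psum_add)
qed

lemma psum_zero [simp]: "psum G (%z v. \<zero>) w = \<zero>"
 by (induction w) simp_all

text \<open>Removing two letters one after the other meets every ordered pair of positions once. In
  the induction the two mixed sums with the head letter trade places.\<close>

lemma psum_swap:
 assumes "!!z z' v. mset w = add_mset z (add_mset z' (mset v)) ==> F z z' v#:G"
 shows "psum G (%z v. psum G (%z' u. F z z' u) v) w = psum G (%z v. psum G (%z' u. F z' z u) v) w"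
 using assms
proof (induction w arbitrary: F)
 case (Cons x w)
 have 1: "psum G (%z v. psum G (%z' u. F z z' (x # u)) v) w
   = psum G (%z v. psum G (%z' u. F z' z (x # u)) v) w"
  by (rule Cons.IH) (auto intro!: Cons.prems simp: add_mset_commute)
 have c: "psum G (F x) w#:G" "psum G (%z. F z x) w#:G"
  "psum G (%z v. psum G (%z' u. F z z' (x # u)) v) w#:G"
  by (rule psum_closed, (rule psum_closed)?, rule Cons.prems, simp add: add_mset_commute)+
 have "psum G (%z v. F z x v .+ psum G (%z' u. F z z' (x # u)) v) w
   = psum G (%z. F z x) w .+ psum G (%z v. psum G (%z' u. F z z' (x # u)) v) w"
  by (rule psum_add) ((rule psum_closed)?, rule Cons.prems, simp add: add_mset_commute)+
 moreover have "psum G (%z v. F x z v .+ psum G (%z' u. F z' z (x # u)) v) w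
   = psum G (F x) w .+ psum G (%z v. psum G (%z' u. F z' z (x # u)) v) w"
  by (rule psum_add) ((rule psum_closed)?, rule Cons.prems, simp add: add_mset_commute)+
 ultimately show ?case using c by (simp add: 1[symmetric] a_lcomm)
qed simp

text \<open>As the summands ignore the order of the remaining word, it is enough to bring the head
  letter to its position in the other word.\<close>

lemma psum_perm:
 assumes "mset w = mset w'"
  and "!!z v. mset w = add_mset z (mset v) ==> f z v#:G"
  and "!!z v v'. mset w = add_mset z (mset v) ==> mset v' = mset v ==> f z v = f z v'"
 shows "psum G f w = psum G f w'"
 using assms
proof (induction w arbitrary: f w')
 case (Cons x w)
 obtain u1 u2 where w': "w' = u1 @ x # u2"
  using Cons.prems(1) by (metis in_set_conv_decomp list.set_intros(1) set_mset_mset)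
 have mw: "mset w = mset (u1 @ u2)" using Cons.prems(1) w' by simp
 have IH: "psum G (%z v. f z (x # v)) w = psum G (%z v. f z (x # v)) (u1 @ u2)"
 proof (rule Cons.IH[OF mw])
  show "f z (x # v)#:G" if "mset w = add_mset z (mset v)" for z v
   using that by (intro Cons.prems(2)) simp
  show "f z (x # v) = f z (x # v')" if "mset w = add_mset z (mset v)" "mset v' = mset v" for z v v'
   using that by (intro Cons.prems(3)) simp_all
 qed
 \<comment> \<open>The induction runs over the prefix in front of \<open>x\<close> with
   \<open>g\<close> arbitrary, because every letter passed over is absorbed into the
   summand.\<close>
 have move: "psum G g (u1 @ x # u2) = g x (u1 @ u2) .+ psum G (%z v. g z (x # v)) (u1 @ u2)"
  if "!!z v. mset (u1 @ x # u2) = add_mset z (mset v) ==> g z v#:G"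
   "!!z v v'. mset (u1 @ x # u2) = add_mset z (mset v) ==> mset v' = mset v ==> g z v = g z v'"
  for g u1
  using that
 proof (induction u1 arbitrary: g)
  case (Cons y u1)
  have "psum G (%z v. g z (y # v)) (u1 @ x # u2)
    = g x (y # u1 @ u2) .+ psum G (%z v. g z (y # x # v)) (u1 @ u2)"
  proof (rule Cons.IH)
   show "g z (y # v)#:G" if "mset (u1 @ x # u2) = add_mset z (mset v)" for z v
    using that by (intro Cons.prems(1)) simp
   show "g z (y # v) = g z (y # v')" if "mset (u1 @ x # u2) = add_mset z (mset v)" "mset v' = mset v" for z v v'
    using that by (intro Cons.prems(2)) simp_all
  qed
  moreover have "psum G (%z v. g z (y # x # v)) (u1 @ u2) = psum G (%z v. g z (x # y # v)) (u1 @ u2)"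
   by (rule psum_cong) (rule Cons.prems(2), auto simp: add_mset_commute)
  moreover have "g y (u1 @ x # u2) = g y (x # u1 @ u2)"
   by (rule Cons.prems) simp_all
  moreover have "psum G (%z v. g z (x # y # v)) (u1 @ u2)#:G"
   by (rule psum_closed) (rule Cons.prems(1), auto simp: add_mset_commute)
  moreover have "g y (x # u1 @ u2)#:G" "g x (y # u1 @ u2)#:G"
   by (rule Cons.prems(1), simp add: add_mset_commute)+
  ultimately show ?case by (simp add: a_lcomm)
 next
  case Nil
  show ?case by simp
 qed
 have "psum G f w' = f x (u1 @ u2) .+ psum G (%z v. f z (x # v)) (u1 @ u2)"
  unfolding w'
 proof (rule move)
  fix z v v' assume v: "mset (u1 @ x # u2) = add_mset z (mset v)"
  thus "f z v#:G" using Cons.prems(1) w' by (intro Cons.prems(2)) simp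
  assume "mset v' = mset v"
  with v show "f z v = f z v'" using Cons.prems(1) w' by (intro Cons.prems(3)) simp_all
 qed
 moreover have "f x w = f x (u1 @ u2)" by (rule Cons.prems(3)) (use mw in auto)
 ultimately show ?case by (simp add: IH)
next
 case Nil
 show ?case using Nil.prems(1) by simp
qed

lemma psum_const:
 assumes "!!z v. mset w = add_mset z (mset v) ==> f z v = c" and c: "c#:G"
 shows "psum G f w = add_pow G (length w) c"
 using assms(1)
proof (induction w arbitrary: f)
 case (Cons x w)
 have "psum G (%z v. f z (x # v)) w = add_pow G (length w) c"
  by (rule Cons.IH) (auto intro!: Cons.prems)
 thus ?case using c Cons.prems[of x w] by (simp add: a_comm)
qed simp

end

section \<open>The base ring\<close>

sublocale lie_algebroid < K: field K
 by (rule field)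

sublocale lie_algebroid < R: cring R
 by (rule algebra.M_cring[OF algebra])

sublocale lie_algebroid < L: abelian_group L
 using module by (simp add: module_def)

sublocale lie_algebroid < L: module R L
 by (rule module)

sublocale lie_algebroid < KR: algebra K R
 by (rule algebra)

context lie_algebroid
begin

abbreviation br where "br x y == bracket L x y"
abbreviation act (infixl \<open>|>\<close> 80) where "x |> r == anchor L x r"
abbreviation radd (infixl \<open>+!\<close> 65) where "r +! s == r +[R] s"
abbreviation rminus (infixl \<open>-!\<close> 65) where "r -! s == r -[R] s"
abbreviation rmult (infixl \<open>*!\<close> 70) where "r *! s == r *[R] s"
abbreviation lsmult (infixr \<open>*:\<close> 75) where "r *: x == r **[L] x"
abbreviation ladd (infixl \<open>+:\<close> 65) where "x +: y == x +[L] y"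

declare anchor_closed [simp] bracket_closed [simp] L.minus_closed [simp] R.minus_closed [simp]

lemma anchor_zero [simp]: "x#:L ==> x |> 0[R] = 0[R]"
 using anchor_add_right[of x "0[R]" "0[R]"]
 by (metis R.add.r_cancel_one' R.r_zero R.zero_closed anchor_closed)

lemma anchor_uminus: "x#:L ==> r#:R ==> x |> (-[R] r) = -[R] (x |> r)"
 by (metis R.a_inv_closed R.minus_equality R.l_neg anchor_add_right anchor_closed anchor_zero)

lemma anchor_minus: "x#:L ==> r#:R ==> s#:R ==> x |> (r -! s) = x |> r -! x |> s"
 by (simp add: a_minus_def anchor_add_right anchor_uminus)

lemma anchor_one [simp]: "x#:L ==> x |> 1[R] = 0[R]"
 using anchor_leibniz[of x "1[R]" "1[R]"] by simp

lemma anchor_zero_left [simp]: "r#:R ==> 0[L] |> r = 0[R]"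
 using anchor_smult[of "0[R]" "0[L]" r] by simp

lemma bracket_zero_right [simp]: "x#:L ==> br x 0[L] = 0[L]"
 using bracket_add_right[of x "0[L]" "0[L]"]
 by (metis L.add.r_cancel_one' L.r_zero L.zero_closed bracket_closed)

lemma bracket_skew:
 assumes "x#:L" "y#:L"
 shows "br y x = -[L] br x y"
proof -
 have "0[L] = br (x +: y) (x +: y)" using assms by (simp add: bracket_self)
 also have "... = br x y +: br y x"
  using assms bracket_self[of x] bracket_self[of y]
  by (simp add: bracket_add_left bracket_add_right L.a_comm[of "br y x"])
 finally show ?thesis using assms by (metis L.minus_equality L.a_comm bracket_closed)
qed

lemma bracket_leibniz_left:
 assumes "x#:L" "y#:L" "r#:R"
 shows "br (r *: x) y = r *: br x y -[L] (y |> r) *: x"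
proof -
 have "br (r *: x) y = -[L] ((y |> r) *: x +: r *: br y x)"
  using assms bracket_skew[of y "r *: x"] by (simp add: bracket_leibniz)
 thus ?thesis
  using assms bracket_skew[of y x]
  by (simp add: L.minus_add a_minus_def L.smult_r_minus[symmetric] L.a_comm)
qed

abbreviation kap where "kap c == base_scalar R c"

lemma kap_closed [simp]: "c#:K ==> kap c#:R"
 by (simp add: base_scalar_def)

lemma kap_mult: "c#:K ==> r#:R ==> c **[R] r = kap c *! r"
 by (simp add: base_scalar_def KR.smult_assoc2)

lemma kap_one [simp]: "kap 1[K] = 1[R]" by (simp add: base_scalar_def)

lemma kap_zero [simp]: "kap 0[K] = 0[R]" by (simp add: base_scalar_def)

lemma kap_add: "c#:K ==> c'#:K ==> kap (c +[K] c') = kap c +! kap c'"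
 by (simp add: base_scalar_def KR.smult_l_distr)

lemma kap_times: "c#:K ==> c'#:K ==> kap (c *[K] c') = kap c *! kap c'"
 by (simp add: base_scalar_def KR.smult_assoc1 KR.smult_assoc2)

lemma anchor_kap [simp]: "x#:L ==> c#:K ==> x |> kap c = 0[R]"
 using anchor_scalar[of c x "1[R]"] by (simp add: base_scalar_def)

lemma anchor_kap_mult:
 "x#:L ==> c#:K ==> r#:R ==> x |> (kap c *! r) = kap c *! x |> r"
 by (simp add: anchor_leibniz)

lemma kap_nat: fixes n :: nat shows "kap (add_pow K n 1[K]) = add_pow R n 1[R]"
 by (induction n) (simp_all add: kap_add)

end

text \<open>\<open>rat n\<close> is the image of \<open>1/(n+1)\<close>.\<close>

locale lie_algebroid_char0 = lie_algebroid +
 assumes char0: "!!n::nat. n > 0 ==> add_pow K n 1[K] ~= 0[K]"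
begin

definition rat :: "nat => 'b" where "rat n = kap (inv\<^bsub>K\<^esub> (add_pow K (Suc n) 1[K]))"

lemma inv_nat: "inv\<^bsub>K\<^esub> (add_pow K (Suc n) 1[K])#:K"
 "inv\<^bsub>K\<^esub> (add_pow K (Suc n) 1[K]) *[K] add_pow K (Suc n) 1[K] = 1[K]"
proof -
 have "add_pow K (Suc n) 1[K]:Units K" using char0[of "Suc n"] K.field_Units
  by (metis Diff_iff K.add.nat_pow_closed K.one_closed singletonD zero_less_Suc)
 thus "inv\<^bsub>K\<^esub> (add_pow K (Suc n) 1[K])#:K"
  "inv\<^bsub>K\<^esub> (add_pow K (Suc n) 1[K]) *[K] add_pow K (Suc n) 1[K] = 1[K]" by (metis K.Units_inv_closed, metis K.Units_l_inv)
qed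

lemma rat_closed [simp]: "rat n#:R"
 unfolding rat_def by (rule kap_closed[OF inv_nat(1)])

lemma rat_one: "rat n *! add_pow R (Suc n) 1[R] = 1[R]"
 unfolding rat_def kap_nat[symmetric] using inv_nat[of n]
 by (metis K.add.nat_pow_closed K.one_closed kap_one kap_times)

lemma rat_cancel:
 assumes a: "a#:R"
 shows "rat n *! add_pow R (Suc n) a = a"
proof -
 have "add_pow R (Suc n) a = add_pow R (Suc n) 1[R] *! a"
  using R.add_pow_ldistr[of "1[R]" a "Suc n"] a by (metis R.l_one R.one_closed)
 hence "rat n *! add_pow R (Suc n) a = (rat n *! add_pow R (Suc n) 1[R]) *! a"
  using a by (simp only: R.m_assoc rat_closed R.add.nat_pow_closed R.one_closed)
 thus ?thesis using a by (simp only: rat_one R.l_one)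
qed

lemma rat_cancel': "a#:R ==> add_pow R (Suc n) (rat n *! a) = a"
 using R.add_pow_rdistr[of "rat n" a "Suc n"] rat_cancel[of a n] by (metis rat_closed)

end

section \<open>A flat connection on symmetric forms\<close>

text \<open>The \<open>ring_id\<close> identities are the additive part of the Leibniz and curvature
  computations, with the values of forms and of their derivatives replaced by variables.\<close>

lemma (in cring) ring_id1: "[|a#:R; b#:R; p#:R; q#:R|]
  ==> a .+ b .- (p .+ q) = (a .- p) .+ (b .- q)"
 by algebra

lemma (in cring) ring_id2: "[|a#:R; b#:R; c#:R; d#:R; p#:R; q#:R|]
  ==> a .+ b .- ((c .+ d) .+ (p .+ q)) = (a .- (c .+ p)) .+ (b .- (d .+ q))"
 by algebra

lemma (in cring) ring_id3: "[|r#:R; a#:R; c#:R; d#:R; p#:R|]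
  ==> a .+ r .* c .- ((a .+ r .* d) .+ r .* p) = r .* (c .- (d .+ p))"
 by algebra

lemma (in cring) ring_id4: "[|r#:R; a#:R; c#:R; p#:R|]
  ==> a .+ r .* c .- r .* p = a .+ r .* (c .- p)"
 by algebra

lemma (in cring) ring_id5: "[|r#:R; c#:R; p#:R|]
  ==> r .* c .- r .* p = r .* (c .- p)"
 by algebra

locale lie_connection = lie_algebroid_char0 +
 fixes nab :: "'c => 'c => 'c"
 assumes nab_closed [simp]: "[|x#:L; y#:L|] ==> nab x y#:L"
  and nab_add_left: "[|x#:L; x'#:L; y#:L|]
   ==> nab (x +: x') y = nab x y +: nab x' y"
  and nab_smult_left: "[|r#:R; x#:L; y#:L|] ==> nab (r *: x) y = r *: nab x y"
  and nab_add_right: "[|x#:L; y#:L; y'#:L|]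
   ==> nab x (y +: y') = nab x y +: nab x y'"
  and nab_leibniz: "[|r#:R; x#:L; y#:L|]
   ==> nab x (r *: y) = (x |> r) *: y +: r *: nab x y"
begin

abbreviation words where "words == lists (carrier L)"

definition tors where "tors x y = nab x y -[L] nab y x -[L] br x y"

lemma tors_closed [simp]: "[|x#:L; y#:L|] ==> tors x y#:L"
 by (simp add: tors_def)

lemma tors_skew: "[|x#:L; y#:L|] ==> tors y x = -[L] tors x y"
proof -
 assume xy: "x#:L" "y#:L"
 hence "nab x y#:L" "nab y x#:L" "br x y#:L" by simp_all
 thus ?thesis unfolding tors_def bracket_skew[OF xy] by algebra
qed

lemma tors_add: 
 assumes "x#:L" "x'#:L" "y#:L"
 shows "tors (x +: x') y = tors x y +: tors x' y"
proof -
 have "nab x y#:L" "nab y x#:L" "br x y#:L"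
  "nab x' y#:L" "nab y x'#:L" "br x' y#:L" using assms by simp_all
 thus ?thesis unfolding tors_def using assms 
  unfolding nab_add_left[OF assms] nab_add_right[OF assms(3,1,2)] bracket_add_left[OF assms] by algebra
qed

lemma tors_smult: 
 assumes "x#:L" "r#:R" "y#:L"
 shows "tors (r *: x) y = r *: tors x y"
proof -
 have c: "r *: nab x y#:L" "r *: nab y x#:L" "r *: br x y#:L"
  "(y |> r) *: x#:L" using assms by simp_all
 have "tors (r *: x) y = r *: nab x y -[L] r *: nab y x -[L] r *: br x y"
  unfolding tors_def
  unfolding nab_smult_left[OF assms(2,1,3)] nab_leibniz[OF assms(2,3,1)] bracket_leibniz_left[OF assms(1,3,2)]
  using c by algebra
 also have "... = r *: tors x y" using assms
  by (simp add: tors_def a_minus_def L.smult_r_distr L.smult_r_minus)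
 finally show ?thesis .
qed

text \<open>A function on words encodes a formal function along the fibres of \<open>L\<close>: on
  words of length n it is a symmetric n-linear form. On these forms \<open>cov\<close> is the
  connection induced by \<open>nab\<close>.\<close>

definition cov :: "'c => ('c list => 'b) => 'c list => 'b" where
 "cov x a w = x |> a w -! psum R (%z v. a (nab x z # v)) w"

text \<open>The curvature of \<open>cov x\<close> plus insertion of \<open>x\<close>. Insertions
  commute with each other, and their commutators with \<open>cov\<close> add up to the insertion of
  the torsion.\<close>

definition C0 :: "'c => 'c => ('c list => 'b) => 'c list => 'b" where
 "C0 x y a w = cov x (cov y a) w -! cov y (cov x a) w -! cov (br x y) a w +! a (tors x y # w)"

text \<open>The degree is bounded because the correction is constructed degree by degree, and
  because inserting a vector lowers the bound by one. Linearity is asked for in the first letter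
  only; symmetry carries it to the others.\<close>

definition good :: "nat => ('c list => 'b) => bool" where
 "good n a <-> (ALL w:words. length w <= n --> a w#:R & (ALL w'. mset w' = mset w --> a w' = a w))
  & (ALL v:words. length v < n -->
    (ALL x:carrier L. ALL y:carrier L. a ((x +: y) # v) = a (x # v) +! a (y # v))
   & (ALL x:carrier L. ALL r:carrier R. a ((r *: x) # v) = r *! a (x # v)))"

lemma goodI:
 assumes "!!w. w:words ==> length w <= n ==> a w#:R"
  and "!!w w'. w:words ==> length w <= n ==> mset w' = mset w ==> a w' = a w"
  and "!!x y v. v:words ==> length v < n ==> x#:L ==> y#:L
   ==> a ((x +: y) # v) = a (x # v) +! a (y # v)"
  and "!!x r v. v:words ==> length v < n ==> x#:L ==> r#:R
   ==> a ((r *: x) # v) = r *! a (x # v)"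
 shows "good n a"
 using assms unfolding good_def by blast

lemma good_closed: "good n a ==> w:words ==> length w <= n ==> a w#:R"
 unfolding good_def by blast

lemma good_sym: "good n a ==> w:words ==> length w <= n ==> mset w' = mset w ==> a w' = a w"
 unfolding good_def by blast

lemma good_add: "good n a ==> x#:L ==> y#:L ==> v:words ==> length v < n
 ==> a ((x +: y) # v) = a (x # v) +! a (y # v)"
 unfolding good_def by blast

lemma good_smult: "good n a ==> x#:L ==> r#:R ==> v:words ==> length v < n
 ==> a ((r *: x) # v) = r *! a (x # v)"
 unfolding good_def by blast

lemma good_mono:
 assumes a: "good n a" and "m <= n" shows "good m a"
proof (rule goodI)
 fix w w' assume w: "w:words" "length w <= m" 
 thus "a w#:R" using good_closed[OF a] assms(2) by simp
 assume "mset w' = mset w"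
 with w show "a w' = a w" using assms(2) by (intro good_sym[OF a]) simp_all
qed (use good_add[OF a] good_smult[OF a] assms(2) in simp_all)

lemma good_swap: "good n a ==> x#:L ==> y#:L ==> v:words ==> Suc (length v) < n
 ==> a (x # y # v) = a (y # x # v)"
 by (rule good_sym[of n]) simp_all

lemma good_cong:
 assumes "good n a" and e: "!!w. set w <= carrier L ==> length w <= n ==> a w = b w"
 shows "good n b"
proof (rule goodI)
 fix w w' assume w: "w:words" "length w <= n" 
 thus "b w#:R" using assms good_closed[of n a w] by (metis in_lists_conv_set subsetI)
 assume m: "mset w' = mset w"
 hence "set w' = set w" "length w' = length w" by (metis set_mset_mset, metis size_mset)
 hence "b w' = a w'" "b w = a w" using e[of w'] e[of w] w by (auto simp: lists_eq_set)
 thus "b w' = b w" using good_sym[OF assms(1) w m] by simp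
next
 fix x y v assume v: "v:words" "length v < n" "x#:L" "y#:L"
 thus "b ((x +: y) # v) = b (x # v) +! b (y # v)"
  using good_add[OF assms(1) v(3,4,1,2)] e[of "(x +: y) # v"] e[of "x # v"] e[of "y # v"] by (simp add: lists_eq_set)
next
 fix x r v assume v: "v:words" "length v < n" "x#:L" "r#:R"
 thus "b ((r *: x) # v) = r *! b (x # v)"
  using good_smult[OF assms(1) v(3,4,1,2)] e[of "(r *: x) # v"] e[of "x # v"] by (simp add: lists_eq_set)
qed

lemma good_plus:
 assumes a: "good n a" and b: "good n b"
 shows "good n (%w. a w +! b w)"
proof (rule goodI)
 fix w w' assume w: "w:words" "length w <= n" 
 thus "a w +! b w#:R" using good_closed[OF a] good_closed[OF b] by simp
 assume m: "mset w' = mset w"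
 show "a w' +! b w' = a w +! b w" using good_sym[OF a w m] good_sym[OF b w m] by simp
next
 fix x y v assume v: "v:words" "length v < n" "x#:L" "y#:L"
 thus "a ((x +: y) # v) +! b ((x +: y) # v) = (a (x # v) +! b (x # v)) +! (a (y # v) +! b (y # v))"
  using good_closed[OF a] good_closed[OF b] by (simp add: good_add[OF a] good_add[OF b] R.a_ac)
next
 fix x r v assume v: "v:words" "length v < n" "x#:L" "r#:R"
 thus "a ((r *: x) # v) +! b ((r *: x) # v) = r *! (a (x # v) +! b (x # v))"
  using good_closed[OF a] good_closed[OF b] by (simp add: good_smult[OF a] good_smult[OF b] R.r_distr)
qed

lemma good_scal:
 assumes a: "good n a" and s: "s#:R"
 shows "good n (%w. s *! a w)"
proof (rule goodI)
 fix w w' assume w: "w:words" "length w <= n" 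
 thus "s *! a w#:R" using good_closed[OF a] s by simp
 assume m: "mset w' = mset w"
 show "s *! a w' = s *! a w" using good_sym[OF a w m] by simp
next
 fix x y v assume v: "v:words" "length v < n" "x#:L" "y#:L"
 thus "s *! a ((x +: y) # v) = s *! a (x # v) +! s *! a (y # v)"
  using good_closed[OF a] s by (simp add: good_add[OF a] R.r_distr)
next
 fix x r v assume v: "v:words" "length v < n" "x#:L" "r#:R"
 thus "s *! a ((r *: x) # v) = r *! (s *! a (x # v))"
  using good_closed[OF a] s by (simp add: good_smult[OF a] R.m_lcomm)
qed

lemma good_minus: 
 assumes "good n a" "good n b" shows "good n (%w. a w -! b w)"
proof -
 have "good n (%w. a w +! (-[R] 1[R]) *! b w)" by (intro good_plus good_scal assms) simp
 thus ?thesis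
  by (rule good_cong) (use good_closed[OF assms(2)] in "simp add: R.l_minus a_minus_def lists_eq_set")
qed

lemma good_zero: "good n (%w. 0[R])"
 by (rule goodI) simp_all

lemma good_insert:
 assumes a: "good (Suc n) a" and x: "x#:L"
 shows "good n (%w. a (x # w))"
proof (rule goodI)
 fix w w' assume w: "w:words" "length w <= n" 
 thus "a (x # w)#:R" using good_closed[OF a] x by simp
 assume "mset w' = mset w"
 with w x show "a (x # w') = a (x # w)" by (intro good_sym[OF a]) simp_all
next
 fix y z v assume v: "v:words" "length v < n" "y#:L" "z#:L"
 thus "a (x # (y +: z) # v) = a (x # y # v) +! a (x # z # v)"
  using x good_add[OF a, of y z "x # v"] good_swap[OF a x, of "y +: z" v] good_swap[OF a x, of y v]
   good_swap[OF a x, of z v] by simp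
next
 fix y r v assume v: "v:words" "length v < n" "y#:L" "r#:R"
 thus "a (x # (r *: y) # v) = r *! a (x # y # v)"
  using x good_smult[OF a, of y r "x # v"] good_swap[OF a x, of "r *: y" v] good_swap[OF a x, of y v] by simp
qed

lemma psum_nab_closed:
 assumes "good n a" "x#:L" "w:words" "length w <= n" "mset w = add_mset z (mset v)"
 shows "a (nab x z # v)#:R"
 using mset_Cons_lists[OF assms(5,3)] assms by (intro good_closed[OF assms(1)]) simp_all

lemma cov_closed:
 assumes "good n a" "x#:L" "w:words" "length w <= n"
 shows "cov x a w#:R"
 unfolding cov_def
 using psum_nab_closed[OF assms] good_closed[OF assms(1,3,4)] assms(2) by simp

lemma cov_cong:
 assumes "x#:L" "w:words" "!!u. u:words ==> length u = length w ==> a u = b u"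
 shows "cov x a w = cov x b w"
proof -
 have "psum R (%z v. a (nab x z # v)) w = psum R (%z v. b (nab x z # v)) w"
  by (rule psum_cong) (drule mset_Cons_lists[OF _ assms(2)], use assms in auto)
 thus ?thesis using assms by (simp add: cov_def)
qed

text \<open>The point is linearity over \<open>R\<close>: differentiating the value produces
  \<open>x |> r\<close>, and the Leibniz rule of \<open>nab\<close> in the argument takes the same
  term away.\<close>

lemma good_cov:
 assumes g: "good n a" and x: "x#:L"
 shows "good n (cov x a)"
proof (rule goodI)
 fix w w' assume w: "w:words" "length w <= n"
 thus "cov x a w#:R" by (rule cov_closed[OF assms])
 assume m: "mset w' = mset w"
 have "psum R (%z v. a (nab x z # v)) w = psum R (%z v. a (nab x z # v)) w'"
 proof (rule R.psum_perm)
  fix z v v' assume zv: "mset w = add_mset z (mset v)" and v': "mset v' = mset v"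
  from mset_Cons_lists[OF zv w(1)] have "z#:L" "v:words" "length w = Suc (length v)" by auto
  thus "a (nab x z # v) = a (nab x z # v')"
   using v' w x by (intro good_sym[OF g, symmetric]) auto
 qed (use m psum_nab_closed[OF g x w] in auto)
 thus "cov x a w' = cov x a w" using good_sym[OF g w m] by (simp add: cov_def)
next
 fix y y' v assume v: "v:words" "length v < n" and y: "y#:L" "y'#:L"
 have c: "a (nab x z # p # u)#:R" "a (p # nab x z # u) = a (nab x z # p # u)"
  if "mset v = add_mset z (mset u)" "p#:L" for z u p
  using mset_Cons_lists[OF that(1) v(1)] that x v by (auto intro!: good_closed[OF g] good_sym[OF g])
 have "psum R (%z u. a (nab x z # (y +: y') # u)) v
   = psum R (%z u. a (nab x z # y # u) +! a (nab x z # y' # u)) v"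
 proof (rule psum_cong)
  fix z u assume zu: "mset v = add_mset z (mset u)"
  thus "a (nab x z # (y +: y') # u) = a (nab x z # y # u) +! a (nab x z # y' # u)"
   using mset_Cons_lists[OF zu v(1)] v x y c(2)[OF zu]
   by (simp add: c(2)[OF zu, symmetric] good_add[OF g])
 qed
 also have "... = psum R (%z u. a (nab x z # y # u)) v +! psum R (%z u. a (nab x z # y' # u)) v"
  by (rule R.psum_add) (use c y in auto)
 finally have e: "psum R (%z u. a (nab x z # (y +: y') # u)) v = ..." .
 have "psum R (%z u. a (nab x z # y # u)) v#:R" "psum R (%z u. a (nab x z # y' # u)) v#:R"
  "a (nab x y # v)#:R" "a (nab x y' # v)#:R" "x |> a (y # v)#:R" "x |> a (y' # v)#:R"
  using c y v x by (auto intro!: R.psum_closed anchor_closed good_closed[OF g])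
 hence "(x |> a (y # v) +! x |> a (y' # v)) -! ((a (nab x y # v) +! a (nab x y' # v)) +!
   (psum R (%z u. a (nab x z # y # u)) v +! psum R (%z u. a (nab x z # y' # u)) v))
  = (x |> a (y # v) -! (a (nab x y # v) +! psum R (%z u. a (nab x z # y # u)) v)) +!
   (x |> a (y' # v) -! (a (nab x y' # v) +! psum R (%z u. a (nab x z # y' # u)) v))"
  by (intro R.ring_id2) (use assms in simp_all)
 thus "cov x a ((y +: y') # v) = cov x a (y # v) +! cov x a (y' # v)"
  using v x y good_closed[OF g] by (simp add: cov_def e nab_add_right good_add[OF g] anchor_add_right)
next
 fix y r v assume v: "v:words" "length v < n" and y: "y#:L" "r#:R"
 have c: "a (nab x z # p # u)#:R" "a (p # nab x z # u) = a (nab x z # p # u)"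
  if "mset v = add_mset z (mset u)" "p#:L" for z u p
  using mset_Cons_lists[OF that(1) v(1)] that x v by (auto intro!: good_closed[OF g] good_sym[OF g])
 have "psum R (%z u. a (nab x z # (r *: y) # u)) v = psum R (%z u. r *! a (nab x z # y # u)) v"
 proof (rule psum_cong)
  fix z u assume zu: "mset v = add_mset z (mset u)"
  thus "a (nab x z # (r *: y) # u) = r *! a (nab x z # y # u)"
   using mset_Cons_lists[OF zu v(1)] v x y
   by (simp add: c(2)[OF zu, symmetric] good_smult[OF g])
 qed
 also have "... = r *! psum R (%z u. a (nab x z # y # u)) v"
  by (rule R.psum_hom[symmetric]) (use c y in "auto simp: R.r_distr")
 finally have e: "psum R (%z u. a (nab x z # (r *: y) # u)) v = ..." .
 have "psum R (%z u. a (nab x z # y # u)) v#:R" "r#:R" "x |> r#:R" "a (y # v)#:R"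
  "a (nab x y # v)#:R" "x |> a (y # v)#:R" 
  using c y v x by (auto intro!: R.psum_closed anchor_closed good_closed[OF g])
 hence "x |> r *! a (y # v) +! r *! x |> a (y # v) -! ((x |> r *! a (y # v) +! r *! a (nab x y # v)) +!
    r *! psum R (%z u. a (nab x z # y # u)) v)
  = r *! (x |> a (y # v) -! (a (nab x y # v) +! psum R (%z u. a (nab x z # y # u)) v))"
  by (intro R.ring_id3) (use assms in simp_all)
 thus "cov x a ((r *: y) # v) = r *! cov x a (y # v)"
  using v x y good_closed[OF g] by (simp add: cov_def e nab_leibniz good_add[OF g] good_smult[OF g] anchor_leibniz)
qed

lemma cov_plus:
 assumes "good n a" "good n b" "x#:L" "w:words" "length w <= n"
 shows "cov x (%u. a u +! b u) w = cov x a w +! cov x b w"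
proof -
 have e: "psum R (%z v. a (nab x z # v) +! b (nab x z # v)) w
   = psum R (%z v. a (nab x z # v)) w +! psum R (%z v. b (nab x z # v)) w"
  by (rule R.psum_add) (use assms psum_nab_closed in blast)+
 have "psum R (%z v. a (nab x z # v)) w#:R" "psum R (%z v. b (nab x z # v)) w#:R"
   "x |> a w#:R" "x |> b w#:R"
  using assms psum_nab_closed[OF assms(1,3-5)] psum_nab_closed[OF assms(2-5)] good_closed by auto
 hence "x |> a w +! x |> b w -! (psum R (%z v. a (nab x z # v)) w +! psum R (%z v. b (nab x z # v)) w)
  = (x |> a w -! psum R (%z v. a (nab x z # v)) w) +! (x |> b w -! psum R (%z v. b (nab x z # v)) w)"
  by (intro R.ring_id1) (use assms in simp_all)
 thus ?thesis unfolding cov_def e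
  using assms good_closed[OF assms(1,4,5)] good_closed[OF assms(2,4,5)] by (simp add: anchor_add_right)
qed

lemma cov_scal:
 assumes "good n a" "r#:R" "x#:L" "w:words" "length w <= n"
 shows "cov x (%u. r *! a u) w = x |> r *! a w +! r *! cov x a w"
proof -
 have e: "psum R (%z v. r *! a (nab x z # v)) w = r *! psum R (%z v. a (nab x z # v)) w"
  by (rule R.psum_hom[symmetric]) (use assms psum_nab_closed R.r_distr in auto)
 have "psum R (%z v. a (nab x z # v)) w#:R" "x |> a w#:R" "a w#:R" "x |> r#:R" 
  using assms psum_nab_closed[OF assms(1,3-5)] good_closed by auto
 hence "x |> r *! a w +! r *! x |> a w -! r *! psum R (%z v. a (nab x z # v)) w =
  x |> r *! a w +! r *! (x |> a w -! psum R (%z v. a (nab x z # v)) w)"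
  by (intro R.ring_id4) (use assms in simp_all)
 thus ?thesis unfolding cov_def e
  using assms good_closed[OF assms(1,4,5)] by (simp add: anchor_leibniz)
qed

lemma cov_add_left:
 assumes "good n a" "x#:L" "x'#:L" "w:words" "length w <= n"
 shows "cov (x +: x') a w = cov x a w +! cov x' a w"
proof -
 have "psum R (%z v. a (nab (x +: x') z # v)) w
   = psum R (%z v. a (nab x z # v) +! a (nab x' z # v)) w"
 proof (rule psum_cong)
  fix z v assume zv: "mset w = add_mset z (mset v)"
  from mset_Cons_lists[OF zv assms(4)] show "a (nab (x +: x') z # v) = a (nab x z # v) +! a (nab x' z # v)"
   using assms by (simp add: nab_add_left good_add[OF assms(1)])
 qed
 also have "... = psum R (%z v. a (nab x z # v)) w +! psum R (%z v. a (nab x' z # v)) w"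
  by (rule R.psum_add) (use assms psum_nab_closed in blast)+
 finally have e: "psum R (%z v. a (nab (x +: x') z # v)) w = ..." .
 have "psum R (%z v. a (nab x z # v)) w#:R" "psum R (%z v. a (nab x' z # v)) w#:R"
   "x |> a w#:R" "x' |> a w#:R"
  using assms psum_nab_closed[OF assms(1,2,4,5)] psum_nab_closed[OF assms(1,3-5)] good_closed by auto
 hence "x |> a w +! x' |> a w -! (psum R (%z v. a (nab x z # v)) w +! psum R (%z v. a (nab x' z # v)) w)
  = (x |> a w -! psum R (%z v. a (nab x z # v)) w) +! (x' |> a w -! psum R (%z v. a (nab x' z # v)) w)"
  by (intro R.ring_id1) (use assms in simp_all)
 thus ?thesis unfolding cov_def e
  using assms good_closed[OF assms(1,4,5)] by (simp add: anchor_add_left)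
qed

lemma cov_smult_left:
 assumes "good n a" "x#:L" "r#:R" "w:words" "length w <= n"
 shows "cov (r *: x) a w = r *! cov x a w"
proof -
 have "psum R (%z v. a (nab (r *: x) z # v)) w = psum R (%z v. r *! a (nab x z # v)) w"
 proof (rule psum_cong)
  fix z v assume zv: "mset w = add_mset z (mset v)"
  from mset_Cons_lists[OF zv assms(4)] show "a (nab (r *: x) z # v) = r *! a (nab x z # v)"
   using assms by (simp add: nab_smult_left good_smult[OF assms(1)])
 qed
 also have "... = r *! psum R (%z v. a (nab x z # v)) w"
  by (rule R.psum_hom[symmetric]) (use assms psum_nab_closed R.r_distr in auto)
 finally have e: "psum R (%z v. a (nab (r *: x) z # v)) w = ..." .
 have "psum R (%z v. a (nab x z # v)) w#:R" "x |> a w#:R" 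
  using assms psum_nab_closed[OF assms(1,2,4,5)] good_closed by auto
 hence "r *! x |> a w -! r *! psum R (%z v. a (nab x z # v)) w
  = r *! (x |> a w -! psum R (%z v. a (nab x z # v)) w)"
  by (intro R.ring_id5) (use assms in simp_all)
 thus ?thesis unfolding cov_def e
  using assms good_closed[OF assms(1,4,5)] by (simp add: anchor_smult)
qed

end

section \<open>The curvature of the uncorrected connection is a tensor\<close>

lemma (in cring) ring_id6: "[|a#:R; b#:R; c#:R; d#:R|]
  ==> b .- a .- (.- c) .+ (.- d) = .- (a .- b .- c .+ d)"
 by algebra

lemma (in cring) ring_id7: "[|a#:R; b#:R; c#:R; d#:R;
  a'#:R; b'#:R; c'#:R; d'#:R|]
  ==> a .+ a' .- (b .+ b') .- (c .+ c') .+ (d .+ d') = (a .- b .- c .+ d) .+ (a' .- b' .- c' .+ d')"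
 by algebra

lemma (in cring) ring_id8: "[|r#:R; s#:R; a#:R; b#:R; c#:R; d#:R; e#:R|]
  ==> r .* a .- (s .* e .+ r .* b) .- (r .* c .- s .* e) .+ r .* d = r .* (a .- b .- c .+ d)"
 by algebra

lemma (in cring) ring_id9: "[|r#:R; p#:R; q#:R; t#:R; t'#:R;
   a#:R; b#:R; c#:R; d#:R; e#:R; f#:R; g#:R|]
  ==> (t .* e .+ p .* f) .+ (q .* g .+ r .* a) .- ((t' .* e .+ q .* g) .+ (p .* f .+ r .* b)) .- ((t .- t') .* e .+ r .* c) .+ r .* d
   = r .* (a .- b .- c .+ d)"
 by algebra

context lie_connection
begin

lemma L_uminus: "x#:L ==> -[L] x = (-[R] 1[R]) *: x"
 by (simp add: L.smult_l_minus)

lemma good_uminus: "good n a ==> x#:L ==> v:words ==> length v < n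
 ==> a ((-[L] x) # v) = -[R] a (x # v)"
 using good_closed[of n a "x # v"] by (simp add: L_uminus good_smult R.l_minus)

lemma cov_uminus_left: "good n a ==> x#:L ==> w:words ==> length w <= n
 ==> cov (-[L] x) a w = -[R] cov x a w"
 using cov_closed[of n a x w] by (simp add: L_uminus cov_smult_left R.l_minus)

lemma good_C0:
 assumes "good (Suc n) a" "x#:L" "y#:L"
 shows "good n (C0 x y a)"
proof -
 have a: "good n a" using assms good_mono by simp
 have "C0 x y a = (%w. cov x (cov y a) w -! cov y (cov x a) w -! cov (br x y) a w +! a (tors x y # w))"
  by (rule ext) (simp add: C0_def)
 thus ?thesis
  using assms by (auto intro!: good_plus good_minus good_cov good_insert a)
qed

lemma C0_skew:
 assumes "good (Suc n) a" "x#:L" "y#:L" "w:words" "length w <= n"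
 shows "C0 y x a w = -[R] C0 x y a w"
proof -
 have a: "good n a" using assms good_mono by simp
 have c: "cov x (cov y a) w#:R" "cov y (cov x a) w#:R" "cov (br x y) a w#:R"
  "a (tors x y # w)#:R"
  using assms a by (auto intro!: cov_closed[of n] good_cov good_closed[OF assms(1)])
 have "C0 y x a w = cov y (cov x a) w -! cov x (cov y a) w -! (-[R] cov (br x y) a w) +! (-[R] a (tors x y # w))"
  using assms by (simp add: C0_def bracket_skew[of x y] tors_skew[of x y] cov_uminus_left[OF a] good_uminus[OF assms(1)])
 thus ?thesis unfolding C0_def using R.ring_id6 c by simp
qed

lemma C0_add:
 assumes "good (Suc n) a" "x#:L" "x'#:L" "y#:L" "w:words" "length w <= n"
 shows "C0 (x +: x') y a w = C0 x y a w +! C0 x' y a w"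
proof -
 have a: "good n a" using assms good_mono by simp
 have "cov y (cov (x +: x') a) w = cov y (%u. cov x a u +! cov x' a u) w"
  by (rule cov_cong) (use assms in "simp_all add: cov_add_left[OF a]")
 hence e: "cov y (cov (x +: x') a) w = cov y (cov x a) w +! cov y (cov x' a) w"
  using assms by (simp add: cov_plus[of n] good_cov a)
 show ?thesis
  unfolding C0_def e bracket_add_left[OF assms(2-4)] tors_add[OF assms(2-4)]
   cov_add_left[OF good_cov[OF a assms(4)] assms(2,3,5,6)]
   cov_add_left[OF a bracket_closed[OF assms(2,4)] bracket_closed[OF assms(3,4)] assms(5,6)]
   good_add[OF assms(1) tors_closed[OF assms(2,4)] tors_closed[OF assms(3,4)] assms(5) le_imp_less_Suc[OF assms(6)]]
  by (rule R.ring_id7) (use assms a in "auto intro!: cov_closed[of n] good_cov good_closed[OF assms(1)]")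
qed

lemma cov_minus_left:
 assumes "good n a" "x#:L" "x'#:L" "w:words" "length w <= n"
 shows "cov (x -[L] x') a w = cov x a w -! cov x' a w"
 using assms by (simp add: a_minus_def cov_add_left cov_uminus_left)

text \<open>The terms with \<open>y |> r\<close> from the second derivative and from
  \<open>br (r *: x) y\<close> cancel.\<close>

lemma C0_smult:
 assumes "good (Suc n) a" "x#:L" "r#:R" "y#:L" "w:words" "length w <= n"
 shows "C0 (r *: x) y a w = r *! C0 x y a w"
proof -
 have a: "good n a" using assms good_mono by simp
 have "cov y (cov (r *: x) a) w = cov y (%u. r *! cov x a u) w"
  by (rule cov_cong) (use assms in "simp_all add: cov_smult_left[OF a]")
 hence e: "cov y (cov (r *: x) a) w = y |> r *! cov x a w +! r *! cov y (cov x a) w"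
  using assms by (simp add: cov_scal[of n] good_cov a)
 have e2: "cov (br (r *: x) y) a w = r *! cov (br x y) a w -! y |> r *! cov x a w"
  using assms by (simp add: bracket_leibniz_left cov_minus_left[OF a] cov_smult_left[OF a])
 have e3: "a (tors (r *: x) y # w) = r *! a (tors x y # w)"
  using assms by (simp add: tors_smult good_smult[OF assms(1)])
 show ?thesis
  unfolding C0_def e e2 e3 cov_smult_left[OF good_cov[OF a assms(4)] assms(2,3,5,6)]
  by (rule R.ring_id8) (use assms a in "auto intro!: cov_closed[of n] good_cov good_closed[OF assms(1)]")
qed

lemma C0_plus:
 assumes "good (Suc n) a" "good (Suc n) b" "x#:L" "y#:L" "w:words" "length w <= n"
 shows "C0 x y (%u. a u +! b u) w = C0 x y a w +! C0 x y b w"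
proof -
 have a: "good n a" "good n b" using assms good_mono by simp_all
 have e: "cov x (cov y (%u. a u +! b u)) w = cov x (cov y a) w +! cov x (cov y b) w" 
  if "x#:L" "y#:L" for x y
 proof -
  have "cov x (cov y (%u. a u +! b u)) w = cov x (%u. cov y a u +! cov y b u) w"
   by (rule cov_cong) (use assms that in "simp_all add: cov_plus[OF a]")
  thus ?thesis
   using assms that by (simp add: cov_plus[of n] good_cov a)
 qed
 show ?thesis
  unfolding C0_def e[OF assms(3,4)] e[OF assms(4,3)] cov_plus[OF a bracket_closed[OF assms(3,4)] assms(5,6)]
  by (rule R.ring_id7) (use assms a in "auto intro!: cov_closed[of n] good_cov good_closed[OF assms(1)] good_closed[OF assms(2)]")
qed

text \<open>The first derivatives of \<open>r\<close> cancel in the commutator, and its second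
  derivatives cancel against the derivative along the bracket, by
  \<open>anchor_bracket\<close>.\<close>

lemma C0_scal:
 assumes "good (Suc n) a" "r#:R" "x#:L" "y#:L" "w:words" "length w <= n"
 shows "C0 x y (%u. r *! a u) w = r *! C0 x y a w"
proof -
 have a: "good n a" using assms good_mono by simp_all
 have e: "cov x (cov y (%u. r *! a u)) w = (x |> (y |> r) *! a w +! y |> r *! cov x a w) 
    +! (x |> r *! cov y a w +! r *! cov x (cov y a) w)" 
  if "x#:L" "y#:L" for x y
 proof -
  have "cov x (cov y (%u. r *! a u)) w = cov x (%u. y |> r *! a u +! r *! cov y a u) w"
   by (rule cov_cong) (use assms that in "simp_all add: cov_scal[OF a]")
  thus ?thesis
   using assms that by (simp add: cov_plus[of n] cov_scal[of n] good_scal good_cov a)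
 qed
 show ?thesis
  unfolding C0_def e[OF assms(3,4)] e[OF assms(4,3)] cov_scal[OF a assms(2) bracket_closed[OF assms(3,4)] assms(5,6)]
   anchor_bracket[OF assms(3,4,2)]
  by (rule R.ring_id9) (use assms a in "auto intro!: cov_closed[of n] good_cov good_closed[OF assms(1)]")
qed

lemma C0_cong:
 assumes "x#:L" "y#:L" "w:words" "!!u. u:words ==> length u <= Suc (length w) ==> a u = b u"
 shows "C0 x y a w = C0 x y b w"
proof -
 have e: "cov x (cov y a) w = cov x (cov y b) w" if "x#:L" "y#:L" for x y
  by (rule cov_cong[OF that(1) assms(3)]) (rule cov_cong[OF that(2)], use assms in simp_all)
 have "cov (br x y) a w = cov (br x y) b w"
  by (rule cov_cong) (use assms in simp_all)
 thus ?thesis using assms by (simp add: C0_def e)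
qed

text \<open>\<open>Hn n\<close> computes on words of length at most \<open>n\<close> the correction \<open>H\<close> for which
  \<open>cov x + i\<^sub>x + H x\<close> is flat and \<open>H\<close> vanishes when contracted with the tautological section.\<close>

primrec Hn :: "nat => 'c => ('c list => 'b) => 'c list => 'b" where
 "Hn 0 = (%y a w. 0[R])"
| "Hn (Suc n) = (%y a w. rat (length w) *! psum R (%x v.
   Hn n y (%u. cov x a u +! a (x # u) +! Hn n x a u) v +! Hn n (nab y x +: br x y) a v
   -! cov x (Hn n y a) v -! C0 x y a v) w)"

definition H where "H y a w = Hn (length w) y a w"

definition D where "D x a w = cov x a w +! a (x # w) +! H x a w"

text \<open>Put the contracted curvature of \<open>D\<close> equal to zero and solve for
  \<open>H y a w\<close>, where \<open>w\<close> has length n: the insertion part of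
  \<open>D x\<close> counts \<open>H y a w\<close> n times, and the normalisation of
  \<open>H\<close> supplies it once more. What is left is the sum of the \<open>G y a x v\<close>,
  whence the factor \<open>rat n\<close> in the recursion.\<close>

definition G where "G y a x v = H y (D x a) v +! H (nab y x +: br x y) a v -! cov x (H y a) v -! C0 x y a v"

lemma Hn_Nil [simp]: "Hn n y a [] = 0[R]"
 by (cases n) simp_all

text \<open>The recursion for \<open>w\<close> passes to words with one letter less, and an
  insertion adds at most one letter again. Hence only values of \<open>a\<close> on words not longer
  than \<open>w\<close> enter, and the bound n does not matter once it reaches the length of
  \<open>w\<close>.\<close>

lemma Hn_local:
 assumes "w:words" "y#:L" "!!u. u:words ==> length u <= length w ==> a u = b u"
  "length w <= n" "length w <= m"
 shows "Hn n y a w = Hn m y b w"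
 using assms
proof (induction "length w" arbitrary: w y a b n m rule: less_induct)
 case less
 show ?case
 proof (cases "w = []")
  case False
  then obtain n' m' where nm: "n = Suc n'" "m = Suc m'" using less.prems(4,5) by (cases n; cases m; cases w) auto
  have "psum R (%x v. Hn n' y (%u. cov x a u +! a (x # u) +! Hn n' x a u) v +! Hn n' (nab y x +: br x y) a v
    -! cov x (Hn n' y a) v -! C0 x y a v) w =
   psum R (%x v. Hn m' y (%u. cov x b u +! b (x # u) +! Hn m' x b u) v +! Hn m' (nab y x +: br x y) b v
    -! cov x (Hn m' y b) v -! C0 x y b v) w"
  proof (rule psum_cong)
   fix x v assume xv: "mset w = add_mset x (mset v)"
   from mset_Cons_lists[OF xv less.prems(1)] have x: "x#:L" and v: "v:words" and l: "length w = Suc (length v)"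
    by auto
   have IH: "Hn n' y' a' u = Hn m' y' b' u" 
    if "u:words" "length u <= length v" "y'#:L" "!!t. t:words ==> length t <= length u ==> a' t = b' t" for u y' a' b'
    by (rule less.hyps) (use that l less.prems nm in auto)
   have "Hn n' y (%u. cov x a u +! a (x # u) +! Hn n' x a u) v = Hn m' y (%u. cov x b u +! b (x # u) +! Hn m' x b u) v"
   proof (rule IH)
    fix t assume t: "t:words" "length t <= length v"
    have "cov x a t = cov x b t"
     by (rule cov_cong[OF x t(1)]) (use less.prems(3) t l in simp)
    moreover have "Hn n' x a t = Hn m' x b t"
     by (rule IH) (use t x less.prems(3) l in simp_all)
    ultimately show "cov x a t +! a (x # t) +! Hn n' x a t = cov x b t +! b (x # t) +! Hn m' x b t"
     using less.prems(3)[of "x # t"] x t l by simp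
   qed (use v less.prems(2) in simp_all)
   moreover have "Hn n' (nab y x +: br x y) a v = Hn m' (nab y x +: br x y) b v"
    by (rule IH) (use v x less.prems(2,3) l in simp_all)
   moreover have "cov x (Hn n' y a) v = cov x (Hn m' y b) v"
    by (rule cov_cong[OF x v], rule IH) (use v x less.prems(2,3) l in simp_all)
   moreover have "C0 x y a v = C0 x y b v"
    by (rule C0_cong[OF x less.prems(2) v]) (use less.prems(3) l in simp)
   ultimately show "Hn n' y (%u. cov x a u +! a (x # u) +! Hn n' x a u) v +! Hn n' (nab y x +: br x y) a v
    -! cov x (Hn n' y a) v -! C0 x y a v = Hn m' y (%u. cov x b u +! b (x # u) +! Hn m' x b u) v 
    +! Hn m' (nab y x +: br x y) b v -! cov x (Hn m' y b) v -! C0 x y b v" by simp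
  qed
  thus ?thesis by (simp add: nm)
 qed simp
qed

lemma H_cong:
 assumes "w:words" "y#:L" "!!u. u:words ==> length u <= length w ==> a u = b u"
 shows "H y a w = H y b w"
 unfolding H_def by (rule Hn_local) (use assms in auto)

lemma H_Nil [simp]: "H y a [] = 0[R]"
 by (simp add: H_def)

lemma H_rec:
 assumes "w:words" "y#:L"
 shows "H y a w = rat (length w) *! psum R (G y a) w"
proof (cases "w = []")
 case False
 then obtain n where n: "length w = Suc n" by (cases w) auto
 have "psum R (%x v. Hn n y (%u. cov x a u +! a (x # u) +! Hn n x a u) v +! Hn n (nab y x +: br x y) a v
    -! cov x (Hn n y a) v -! C0 x y a v) w = psum R (G y a) w"
 proof (rule psum_cong)
  fix x v assume xv: "mset w = add_mset x (mset v)"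
  from mset_Cons_lists[OF xv assms(1)] have x: "x#:L" and v: "v:words" and l: "length v = n"
   using n by auto
  have e: "Hn n y' a' u = H y' a' u" if "length u <= n" "u:words" "y'#:L" for y' a' u
   unfolding H_def by (rule Hn_local) (use that in auto)
  have "Hn n y (%u. cov x a u +! a (x # u) +! Hn n x a u) v = H y (D x a) v"
   unfolding H_def by (rule Hn_local) (use v l x assms in "auto simp: D_def e")
  moreover have "cov x (Hn n y a) v = cov x (H y a) v"
   by (rule cov_cong[OF x v]) (use l v assms in "simp add: e")
  ultimately show "Hn n y (%u. cov x a u +! a (x # u) +! Hn n x a u) v +! Hn n (nab y x +: br x y) a v
    -! cov x (Hn n y a) v -! C0 x y a v = G y a x v"
   using x v l assms by (simp add: G_def e)
 qed
 thus ?thesis by (simp add: H_def n)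
qed simp

end

section \<open>The correction is a one-form with values in the linear endomorphisms of forms\<close>

lemma (in cring) ring_id10: "[|p#:R; q#:R; s#:R; t#:R;
  p'#:R; q'#:R; s'#:R; t'#:R|]
  ==> p .+ p' .+ (q .+ q') .- (s .+ s') .- (t .+ t') = (p .+ q .- s .- t) .+ (p' .+ q' .- s' .- t')"
 by algebra

lemma (in cring) ring_id11: "[|r#:R; p#:R; q#:R; s#:R; t#:R|]
  ==> r .* p .+ r .* q .- r .* s .- r .* t = r .* (p .+ q .- s .- t)"
 by algebra

lemma (in cring) ring_id12: "[|r#:R; e#:R; p#:R; q#:R; s#:R; t#:R|]
  ==> r .* p .+ (e .+ r .* q) .- (e .+ r .* s) .- r .* t = r .* (p .+ q .- s .- t)"
 by algebra

lemma (in cring) ring_id13: "[|r#:R; e#:R; p#:R; q#:R; s#:R; t#:R|]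
  ==> (e .+ r .* p) .+ r .* q .- (e .+ r .* s) .- r .* t = r .* (p .+ q .- s .- t)"
 by algebra

lemma (in cring) ring_id14: "[|p#:R; q#:R; s#:R; p'#:R; q'#:R; s'#:R|]
  ==> p .+ p' .+ (q .+ q') .+ (s .+ s') = (p .+ q .+ s) .+ (p' .+ q' .+ s')"
 by algebra

context lie_connection
begin

lemma C0_add_right:
 assumes "good (Suc n) a" "x#:L" "y#:L" "y'#:L" "w:words" "length w <= n"
 shows "C0 x (y +: y') a w = C0 x y a w +! C0 x y' a w"
 using assms good_closed[OF good_C0[OF assms(1)], of _ _ w]
 by (simp add: C0_skew[OF assms(1) _ assms(2,5,6)] C0_add[OF assms(1)] R.minus_add)

lemma C0_smult_right:
 assumes "good (Suc n) a" "x#:L" "y#:L" "r#:R" "w:words" "length w <= n"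
 shows "C0 x (r *: y) a w = r *! C0 x y a w"
 using assms good_closed[OF good_C0[OF assms(1)], of _ _ w]
 by (simp add: C0_skew[OF assms(1) _ assms(2,5,6)] C0_smult[OF assms(1)] R.r_minus)

text \<open>All tensor properties go through one induction, since \<open>G\<close> applies the
  correction of lower degree to the new form \<open>D x a\<close> and along the new vector
  \<open>nab y x +: br x y\<close>.\<close>

definition PH :: "nat => bool" where
 "PH n <-> (ALL y:carrier L. ALL a. good n a --> good n (H y a)) &
  (ALL y:carrier L. ALL y':carrier L. ALL a w. good n a --> w:words --> length w <= n -->
    H (y +: y') a w = H y a w +! H y' a w) &
  (ALL y:carrier L. ALL r:carrier R. ALL a w. good n a --> w:words --> length w <= n -->
    H (r *: y) a w = r *! H y a w) &
  (ALL y:carrier L. ALL a b w. good n a --> good n b --> w:words --> length w <= n -->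
    H y (%u. a u +! b u) w = H y a w +! H y b w) &
  (ALL y:carrier L. ALL r:carrier R. ALL a w. good n a --> w:words --> length w <= n -->
    H y (%u. r *! a u) w = r *! H y a w)"

context
 fixes n assumes P: "PH n"
begin

lemma Pgood: "good n a ==> y#:L ==> good n (H y a)"
 and Padd: "[|good n a; y#:L; y'#:L; w:words; length w <= n|] ==> H (y +: y') a w = H y a w +! H y' a w"
 and Psmult: "[|good n a; y#:L; r#:R; w:words; length w <= n|] ==> H (r *: y) a w = r *! H y a w"
 and Pplus: "[|good n a; good n b; y#:L; w:words; length w <= n|]
  ==> H y (%u. a u +! b u) w = H y a w +! H y b w"
 and Pscal: "[|good n a; r#:R; y#:L; w:words; length w <= n|]
  ==> H y (%u. r *! a u) w = r *! H y a w"
 using P unfolding PH_def by blast+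

lemma Pgood_D:
 assumes "good (Suc n) a" "x#:L"
 shows "good n (D x a)"
proof -
 have a: "good n a" using assms good_mono by simp
 have "D x a = (%w. cov x a w +! a (x # w) +! H x a w)" by (rule ext) (simp add: D_def)
 thus ?thesis using assms by (auto intro!: good_plus good_cov good_insert Pgood a)
qed

lemma PD_add_left:
 assumes "good (Suc n) a" "x#:L" "x'#:L" "w:words" "length w <= n"
 shows "D (x +: x') a w = D x a w +! D x' a w"
proof -
 have a: "good n a" using assms good_mono by simp
 show ?thesis
  unfolding D_def cov_add_left[OF a assms(2-5)] Padd[OF a assms(2-5)]
   good_add[OF assms(1-4) le_imp_less_Suc[OF assms(5)]]
  by (rule R.ring_id14) (use assms a in \<open>auto intro!: cov_closed[of n] good_closed[of n "H _ a"] Pgood good_closed[OF assms(1)]\<close>)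
qed

lemma PD_smult_left:
 assumes "good (Suc n) a" "x#:L" "r#:R" "w:words" "length w <= n"
 shows "D (r *: x) a w = r *! D x a w"
proof -
 have a: "good n a" using assms good_mono by simp
 have "cov x a w#:R" "a (x # w)#:R" "H x a w#:R"
  using assms a by (auto intro!: cov_closed[of n] good_closed[of n "H _ a"] Pgood good_closed[OF assms(1)])
 thus ?thesis
  unfolding D_def cov_smult_left[OF a assms(2-5)] Psmult[OF a assms(2-5)]
   good_smult[OF assms(1-4) le_imp_less_Suc[OF assms(5)]]
  using assms(3) by (simp add: R.r_distr)
qed

lemma PD_plus:
 assumes "good (Suc n) a" "good (Suc n) b" "x#:L" "w:words" "length w <= n"
 shows "D x (%u. a u +! b u) w = D x a w +! D x b w"
proof -
 have a: "good n a" "good n b" using assms good_mono by simp_all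
 show ?thesis
  unfolding D_def cov_plus[OF a assms(3-5)] Pplus[OF a assms(3-5)]
  by (rule R.ring_id14) (use assms a in \<open>auto intro!: cov_closed[of n] good_closed[of n "H _ _"] Pgood
    good_closed[OF assms(1)] good_closed[OF assms(2)]\<close>)
qed

lemma PD_scal:
 assumes "good (Suc n) a" "r#:R" "x#:L" "w:words" "length w <= n"
 shows "D x (%u. r *! a u) w = x |> r *! a w +! r *! D x a w"
proof -
 have a: "good n a" using assms good_mono by simp
 have "cov x a w#:R" "a (x # w)#:R" "H x a w#:R" "x |> r *! a w#:R"
  using assms a by (auto intro!: cov_closed[of n] good_closed[of n "H _ a"] Pgood good_closed[OF assms(1)])
 thus ?thesis
  unfolding D_def cov_scal[OF a assms(2-5)] Pscal[OF a assms(2-5)]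
  using assms(2) by (simp add: R.r_distr R.a_assoc)
qed

lemma Pgood_G:
 assumes "good (Suc n) a" "x#:L" "y#:L"
 shows "good n (G y a x)"
proof -
 have a: "good n a" using assms good_mono by simp
 have "G y a x = (%v. H y (D x a) v +! H (nab y x +: br x y) a v -! cov x (H y a) v -! C0 x y a v)"
  by (rule ext) (simp add: G_def)
 thus ?thesis using assms by (auto intro!: good_plus good_minus good_cov good_C0 Pgood Pgood_D a)
qed

lemma PG_closed:
 assumes "good (Suc n) a" "x#:L" "y#:L" "w:words" "length w <= n"
 shows "H y (D x a) w#:R" "H (nab y x +: br x y) a w#:R" "cov x (H y a) w#:R"
  "C0 x y a w#:R" "H y a w#:R"
proof -
 have a: "good n a" using assms good_mono by simp
 show "H y (D x a) w#:R" "H (nab y x +: br x y) a w#:R" "cov x (H y a) w#:R"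
  "C0 x y a w#:R" "H y a w#:R"
  using assms by (auto intro!: good_closed[of n "H _ _"] good_closed[of n "cov _ _"] good_closed[of n "C0 _ _ _"] 
   good_cov good_C0 Pgood Pgood_D a)
qed

lemma PG_add_right:
 assumes "good (Suc n) a" "x#:L" "x'#:L" "y#:L" "w:words" "length w <= n"
 shows "G y a (x +: x') w = G y a x w +! G y a x' w"
proof -
 have a: "good n a" using assms good_mono by simp
 have "H y (D (x +: x') a) w = H y (%u. D x a u +! D x' a u) w"
  by (rule H_cong) (use assms in "simp_all add: PD_add_left[OF assms(1)]")
 hence e1: "H y (D (x +: x') a) w = H y (D x a) w +! H y (D x' a) w"
  using assms Pplus Pgood_D by simp
 have "nab y (x +: x') +: br (x +: x') y = (nab y x +: br x y) +: (nab y x' +: br x' y)"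
  using assms by (simp add: nab_add_right bracket_add_left L.a_ac)
 hence e2: "H (nab y (x +: x') +: br (x +: x') y) a w =
   H (nab y x +: br x y) a w +! H (nab y x' +: br x' y) a w"
  using assms Padd[OF a] by simp
 show ?thesis
  unfolding G_def e1 e2 cov_add_left[OF Pgood[OF a assms(4)] assms(2,3,5,6)] C0_add[OF assms]
  by (rule R.ring_id10) (use PG_closed[OF assms(1)] assms in auto)
qed

text \<open>The vector \<open>nab y x +: br x y\<close> is linear over \<open>R\<close> in
  \<open>x\<close>: the two terms with \<open>y |> r\<close> cancel.\<close>

lemma PG_smult_right:
 assumes "good (Suc n) a" "x#:L" "r#:R" "y#:L" "w:words" "length w <= n"
 shows "G y a (r *: x) w = r *! G y a x w"
proof -
 have a: "good n a" using assms good_mono by simp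
 have "H y (D (r *: x) a) w = H y (%u. r *! D x a u) w"
  by (rule H_cong) (use assms in "simp_all add: PD_smult_left[OF assms(1)]")
 hence e1: "H y (D (r *: x) a) w = r *! H y (D x a) w"
  using assms Pscal Pgood_D by simp
 have c: "(y |> r) *: x#:L" "r *: nab y x#:L" "r *: br x y#:L"
  using assms by simp_all
 hence "((y |> r) *: x +: r *: nab y x) +: (r *: br x y -[L] (y |> r) *: x) = r *: nab y x +: r *: br x y"
  by algebra
 hence "nab y (r *: x) +: br (r *: x) y = r *: (nab y x +: br x y)"
  using assms by (simp add: nab_leibniz bracket_leibniz_left L.smult_r_distr)
 hence e2: "H (nab y (r *: x) +: br (r *: x) y) a w = r *! H (nab y x +: br x y) a w"
  using assms Psmult[OF a] by simp
 show ?thesis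
  unfolding G_def e1 e2 cov_smult_left[OF Pgood[OF a assms(4)] assms(2,3,5,6)] C0_smult[OF assms]
  by (rule R.ring_id11) (use PG_closed[OF assms(1)] assms in auto)
qed

lemma PG_add_left:
 assumes "good (Suc n) a" "x#:L" "y#:L" "y'#:L" "w:words" "length w <= n"
 shows "G (y +: y') a x w = G y a x w +! G y' a x w"
proof -
 have a: "good n a" using assms good_mono by simp
 have e1: "H (y +: y') (D x a) w = H y (D x a) w +! H y' (D x a) w"
  using assms Padd Pgood_D by simp
 have "nab (y +: y') x +: br x (y +: y') = (nab y x +: br x y) +: (nab y' x +: br x y')"
  using assms by (simp add: nab_add_left bracket_add_right L.a_ac)
 hence e2: "H (nab (y +: y') x +: br x (y +: y')) a w =
   H (nab y x +: br x y) a w +! H (nab y' x +: br x y') a w"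
  using assms Padd[OF a] by simp
 have "cov x (H (y +: y') a) w = cov x (%u. H y a u +! H y' a u) w"
  by (rule cov_cong) (use assms in "simp_all add: Padd[OF a]")
 hence e3: "cov x (H (y +: y') a) w = cov x (H y a) w +! cov x (H y' a) w"
  using assms by (simp add: cov_plus[of n] Pgood a)
 show ?thesis
  unfolding G_def e1 e2 e3 C0_add_right[OF assms]
  by (rule R.ring_id10) (use PG_closed[OF assms(1)] assms in auto)
qed

text \<open>Here the vector \<open>nab y x +: br x y\<close> contributes \<open>x |> r\<close>, and
  the derivative of \<open>r *! H y a\<close> in the third term of \<open>G\<close> removes
  it.\<close>

lemma PG_smult_left:
 assumes "good (Suc n) a" "x#:L" "y#:L" "r#:R" "w:words" "length w <= n"
 shows "G (r *: y) a x w = r *! G y a x w"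
proof -
 have a: "good n a" using assms good_mono by simp
 have e1: "H (r *: y) (D x a) w = r *! H y (D x a) w"
  using assms Psmult Pgood_D by simp
 have "nab (r *: y) x +: br x (r *: y) = (x |> r) *: y +: r *: (nab y x +: br x y)"
  using assms by (simp add: nab_smult_left bracket_leibniz L.smult_r_distr L.a_ac)
 hence e2: "H (nab (r *: y) x +: br x (r *: y)) a w = x |> r *! H y a w +! r *! H (nab y x +: br x y) a w"
  using assms by (simp add: Psmult[OF a] Padd[OF a])
 have "cov x (H (r *: y) a) w = cov x (%u. r *! H y a u) w"
  by (rule cov_cong) (use assms in "simp_all add: Psmult[OF a]")
 hence e3: "cov x (H (r *: y) a) w = x |> r *! H y a w +! r *! cov x (H y a) w"
  using assms by (simp add: cov_scal[of n] Pgood a)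
 show ?thesis
  unfolding G_def e1 e2 e3 C0_smult_right[OF assms]
  by (rule R.ring_id12) (use PG_closed[OF assms(1)] assms in auto)
qed

lemma PG_plus:
 assumes "good (Suc n) a" "good (Suc n) b" "x#:L" "y#:L" "w:words" "length w <= n"
 shows "G y (%u. a u +! b u) x w = G y a x w +! G y b x w"
proof -
 have a: "good n a" "good n b" using assms good_mono by simp_all
 have "H y (D x (%u. a u +! b u)) w = H y (%u. D x a u +! D x b u) w"
  by (rule H_cong) (use assms in "simp_all add: PD_plus[OF assms(1,2)]")
 hence e1: "H y (D x (%u. a u +! b u)) w = H y (D x a) w +! H y (D x b) w"
  using assms Pplus Pgood_D by simp
 have "cov x (H y (%u. a u +! b u)) w = cov x (%u. H y a u +! H y b u) w"
  by (rule cov_cong) (use assms in "simp_all add: Pplus[OF a]")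
 hence e3: "cov x (H y (%u. a u +! b u)) w = cov x (H y a) w +! cov x (H y b) w"
  using assms by (simp add: cov_plus[of n] Pgood a)
 show ?thesis
  unfolding G_def e1 e3 C0_plus[OF assms] 
   Pplus[OF a L.a_closed[OF nab_closed[OF assms(4,3)] bracket_closed[OF assms(3,4)]] assms(5,6)]
  by (rule R.ring_id10) (use PG_closed[OF assms(1)] PG_closed[OF assms(2)] assms in auto)
qed

text \<open>Now \<open>x |> r\<close> comes from the Leibniz rule for \<open>D x\<close>, and again
  the third term of \<open>G\<close> removes it.\<close>

lemma PG_scal:
 assumes "good (Suc n) a" "r#:R" "x#:L" "y#:L" "w:words" "length w <= n"
 shows "G y (%u. r *! a u) x w = r *! G y a x w"
proof -
 have a: "good n a" using assms good_mono by simp_all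
 have "H y (D x (%u. r *! a u)) w = H y (%u. x |> r *! a u +! r *! D x a u) w"
  by (rule H_cong) (use assms in "simp_all add: PD_scal[OF assms(1)]")
 hence e1: "H y (D x (%u. r *! a u)) w = x |> r *! H y a w +! r *! H y (D x a) w"
  using assms Pgood_D by (simp add: Pplus Pscal good_scal a)
 have "cov x (H y (%u. r *! a u)) w = cov x (%u. r *! H y a u) w"
  by (rule cov_cong) (use assms in "simp_all add: Pscal[OF a]")
 hence e3: "cov x (H y (%u. r *! a u)) w = x |> r *! H y a w +! r *! cov x (H y a) w"
  using assms by (simp add: cov_scal[of n] Pgood a)
 show ?thesis
  unfolding G_def e1 e3 C0_scal[OF assms] 
   Pscal[OF a assms(2) L.a_closed[OF nab_closed[OF assms(4,3)] bracket_closed[OF assms(3,4)]] assms(5,6)]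
  by (rule R.ring_id13) (use PG_closed[OF assms(1)] assms in auto)
qed

lemma PH_psum_G:
 assumes "good (Suc n) a" "y#:L" "w:words" "length w <= Suc n" "mset w = add_mset x (mset v)"
 shows "G y a x v#:R" "x#:L" "v:words" "length v <= n"
 using mset_Cons_lists[OF assms(5,3)] assms good_closed[OF Pgood_G[OF assms(1)]] by auto

lemma PH_Suc: "PH (Suc n)"
 unfolding PH_def
proof (intro conjI ballI allI impI)
 fix y a assume y: "y#:L" and a: "good (Suc n) a"
 note G = PH_psum_G[OF a y]
 show "good (Suc n) (H y a)"
 proof (rule goodI)
  fix w w' assume w: "w:words" "length w <= Suc n"
  show "H y a w#:R" using G(1)[OF w] by (simp add: H_rec w y)
  assume m: "mset w' = mset w"
  hence w': "w':words" by (metis in_lists_conv_set set_mset_mset w(1))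
  have "psum R (G y a) w = psum R (G y a) w'"
  proof (rule R.psum_perm)
   fix z v v' assume zv: "mset w = add_mset z (mset v)" and v: "mset v' = mset v"
   thus "G y a z v = G y a z v'" using G[OF w zv] y by (intro good_sym[OF Pgood_G[OF a], symmetric]) auto
  qed (use m G[OF w] in auto)
  moreover have "length w' = length w" using m by (metis size_mset)
  ultimately show "H y a w' = H y a w" by (simp add: H_rec w w' y)
 next
  fix z z' v assume v: "v:words" "length v < Suc n" and z: "z#:L" "z'#:L"
  have c: "p#:L ==> psum R (%x u. G y a x (p # u)) v#:R" for p
  proof (rule R.psum_closed)
   fix x u assume xu: "mset v = add_mset x (mset u)" and p: "p#:L"
   from mset_Cons_lists[OF xu v(1)] p v y show "G y a x (p # u)#:R"
    by (intro good_closed[OF Pgood_G[OF a]]) auto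
  qed
  have "psum R (%x u. G y a x ((z +: z') # u)) v = psum R (%x u. G y a x (z # u) +! G y a x (z' # u)) v"
  proof (rule psum_cong)
   fix x u assume xu: "mset v = add_mset x (mset u)"
   from mset_Cons_lists[OF xu v(1)] z v y show "G y a x ((z +: z') # u) = G y a x (z # u) +! G y a x (z' # u)"
    by (intro good_add[OF Pgood_G[OF a]]) auto
  qed
  also have "... = psum R (%x u. G y a x (z # u)) v +! psum R (%x u. G y a x (z' # u)) v"
  proof (rule R.psum_add)
   fix x u assume xu: "mset v = add_mset x (mset u)"
   from mset_Cons_lists[OF xu v(1)] z v y show "G y a x (z # u)#:R" "G y a x (z' # u)#:R"
    by (auto intro!: good_closed[OF Pgood_G[OF a]])
  qed
  finally have e: "psum R (%x u. G y a x ((z +: z') # u)) v = ..." .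
  have "G y a z v#:R" "G y a z' v#:R" using z v y good_closed[OF Pgood_G[OF a]] by auto
  thus "H y a ((z +: z') # v) = H y a (z # v) +! H y a (z' # v)"
   using v z y c[OF z(1)] c[OF z(2)] by (simp add: H_rec e PG_add_right[OF a] R.r_distr R.a_ac)
 next
  fix z r v assume v: "v:words" "length v < Suc n" and z: "z#:L" "r#:R"
  have c: "x#:L & u:words & G y a x (z # u)#:R & G y a x ((r *: z) # u) = r *! G y a x (z # u)" 
   if xu: "mset v = add_mset x (mset u)" for x u
   using mset_Cons_lists[OF xu v(1)] z v y good_closed[OF Pgood_G[OF a], of x y "z # u"]
     good_smult[OF Pgood_G[OF a], of x y z r u] by auto
  have "psum R (%x u. G y a x ((r *: z) # u)) v = psum R (%x u. r *! G y a x (z # u)) v"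
   by (rule psum_cong) (use c in blast)
  also have "... = r *! psum R (%x u. G y a x (z # u)) v"
   by (rule R.psum_hom[symmetric]) (use c z in "auto simp: R.r_distr")
  finally have e: "psum R (%x u. G y a x ((r *: z) # u)) v = ..." .
  have "psum R (%x u. G y a x (z # u)) v#:R" by (rule R.psum_closed) (use c in blast)
  moreover have "G y a z v#:R" using z v y good_closed[OF Pgood_G[OF a]] by auto
  ultimately show "H y a ((r *: z) # v) = r *! H y a (z # v)"
   using v z y by (simp add: H_rec e PG_smult_right[OF a] R.r_distr[symmetric] R.m_lcomm)
 qed
next
 fix y y' a w assume y: "y#:L" "y'#:L" and a: "good (Suc n) a" and w: "w:words" "length w <= Suc n"
 note G = PH_psum_G[OF a _ w] 
 have "psum R (G (y +: y') a) w = psum R (%x v. G y a x v +! G y' a x v) w"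
  by (rule psum_cong) (use G[OF y(1)] y in "simp add: PG_add_left[OF a]")
 also have "... = psum R (G y a) w +! psum R (G y' a) w"
  by (rule R.psum_add) (use G y in auto)
 finally show "H (y +: y') a w = H y a w +! H y' a w"
  using G(1)[OF y(1)] G(1)[OF y(2)] y by (simp add: H_rec w R.r_distr)
next
 fix y r a w assume y: "y#:L" "r#:R" and a: "good (Suc n) a" and w: "w:words" "length w <= Suc n"
 note G = PH_psum_G[OF a y(1) w] 
 have "psum R (G (r *: y) a) w = psum R (%x v. r *! G y a x v) w"
  by (rule psum_cong) (use G y in "simp add: PG_smult_left[OF a]")
 also have "... = r *! psum R (G y a) w"
  by (rule R.psum_hom[symmetric]) (use G y in "auto simp: R.r_distr")
 finally show "H (r *: y) a w = r *! H y a w"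
  using G(1) y by (simp add: H_rec w R.m_lcomm)
next
 fix y a b w assume y: "y#:L" and a: "good (Suc n) a" and b: "good (Suc n) b" and w: "w:words" "length w <= Suc n"
 note G = PH_psum_G[OF _ y w]
 have "psum R (G y (%u. a u +! b u)) w = psum R (%x v. G y a x v +! G y b x v) w"
  by (rule psum_cong) (use G[OF a] y in "simp add: PG_plus[OF a b]")
 also have "... = psum R (G y a) w +! psum R (G y b) w"
  by (rule R.psum_add) (use G a b in auto)
 finally show "H y (%u. a u +! b u) w = H y a w +! H y b w"
  using G(1)[OF a] G(1)[OF b] y by (simp add: H_rec w R.r_distr)
next
 fix y r a w assume y: "y#:L" and r: "r#:R" and a: "good (Suc n) a" and w: "w:words" "length w <= Suc n"
 note G = PH_psum_G[OF a y(1) w] 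
 have "psum R (G y (%u. r *! a u)) w = psum R (%x v. r *! G y a x v) w"
  by (rule psum_cong) (use G y r in "simp add: PG_scal[OF a]")
 also have "... = r *! psum R (G y a) w"
  by (rule R.psum_hom[symmetric]) (use G r in "auto simp: R.r_distr")
 finally show "H y (%u. r *! a u) w = r *! H y a w"
  using G(1) y r by (simp add: H_rec w R.m_lcomm)
qed

end

lemma PH_all: "PH n"
proof (induction n)
 case 0
 show ?case unfolding PH_def
  by (auto intro!: goodI)
next
 case (Suc n)
 thus ?case by (rule PH_Suc)
qed

end

section \<open>Contractions of the correction and of the curvature with the tautological
  section\<close>

lemma (in cring) ring_id15: "[|p#:R; q#:R; s#:R|] ==> p .- (q .+ s) = (p .- s) .- q"
 by algebra

lemma (in cring) ring_id16a:
 "[|k#:R; hn#:R; hb#:R; h1#:R; T#:R; d#:R; h2#:R; P#:R|]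
  ==> .- (k .+ (hn .+ hb) .- h1 .- T) .+ (d .+ (hn .- h2) .- P) = .- (k .+ hb .- h1 .- T) .+ (d .- h2 .- P)"
 by algebra
lemma (in cring) ring_id16b:
 "[|A#:R; B#:R; C#:R; p#:R; q#:R; f#:R; m#:R; h1#:R; g#:R|]
  ==> (m .+ (p .+ q) .+ h1) .+ A .- (B .+ (p .+ f .+ g) .+ C) = (m .+ q .+ h1) .+ A .- (B .+ (f .+ g) .+ C)"
 by algebra
lemma (in cring) ring_id16c:
 "[|cxy#:R; cyx#:R; cb#:R; q#:R; p'#:R; q'#:R;
  h1#:R; h2#:R; d#:R; f#:R; g#:R; k#:R;
  b#:R; hb#:R|]
  ==> (cxy .+ q .+ h1) .+ d .- ((cyx .+ (p' .+ q') .+ h2) .+ (f .+ g) .+ k) .- (cb .+ b .+ hb)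
   = .- (k .+ hb .- h1 .- (cxy .- cyx .- cb .+ (q .- q' .- b))) .+ (d .- h2 .- (p' .+ f .+ g))"
 by (simp add: minus_eq minus_add a_ac)
lemma (in cring) ring_id16d: "[|a#:R; b#:R; p#:R; q#:R; r#:R|]
  ==> a .+ b .- p .- q .- r = a .+ b .- (p .+ q .+ r)"
 by algebra

lemma (in cring) ring_id16:
 "[|cxy#:R; cyx#:R; cb#:R; p#:R; q#:R; p'#:R; q'#:R;
  h1#:R; h2#:R; d#:R; e#:R; f#:R; g#:R; k#:R;
  b#:R; hb#:R; hn#:R|]
  ==> (cxy .+ (p .+ q) .+ h1) .+ d .+ e .- ((cyx .+ (p' .+ q') .+ h2) .+ (p .+ f .+ g) .+ k) .- (cb .+ b .+ hb)
   = .- (k .+ (hn .+ hb) .- h1 .- (cxy .- cyx .- cb .+ (q .- q' .- b))) .+ (d .+ e .+ (hn .- h2) .- p' .- f .- g)"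
 using ring_id16a[of k hn hb h1 "cxy .- cyx .- cb .+ (q .- q' .- b)" "d .+ e" h2 "p' .+ f .+ g"]
  ring_id16b[of "d .+ e" "cyx .+ (p' .+ q') .+ h2" k p q f cxy h1 g]
  ring_id16c[of cxy cyx cb q p' q' h1 h2 "d .+ e" f g k b hb] ring_id16d[of "d .+ e" "hn .- h2" p' f g]
 by (simp only: minus_closed a_closed a_assoc[of _ d e, symmetric] a_assoc[of d e])

lemma (in cring) ring_id17:
 "[|H#:R; s#:R; t#:R; n#:R|]
  ==> .- (n .+ H) .+ (s .+ t .+ n .+ \<zero> .+ \<zero> .- s .- t .- (.- H)) = \<zero>"
 by algebra

lemma (in cring) ring_id19: "[|a#:R; b#:R; c#:R; d#:R|]
  ==> a .+ b .- c .- d = a .+ (b .- c) .- d"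
 by algebra

lemma (in cring) ring_id20: "[|p#:R; q#:R; s#:R|] ==> p .- (q .+ s) .+ q = p .- s"
 by algebra

declare in_listsD [rule del] in_listsI [rule del]

context lie_connection
begin

definition form :: "('c list => 'b) => bool" where "form a <-> (ALL n. good n a)"

lemma formD: "form a ==> good n a" by (simp add: form_def)

lemma form_closed: "form a ==> w:words ==> a w#:R"
 by (rule good_closed[OF formD, of a w "length w"]) auto

lemma form_sym: "form a ==> w:words ==> mset w' = mset w ==> a w' = a w"
 by (rule good_sym[OF formD, of a w "length w"]) auto

lemma form_D: "form a ==> x#:L ==> form (D x a)"
 by (simp add: form_def Pgood_D[OF PH_all])

lemma form_H: "form a ==> x#:L ==> form (H x a)"
 by (simp add: form_def Pgood[OF PH_all])

lemma form_cov: "form a ==> x#:L ==> form (cov x a)"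
 by (simp add: form_def good_cov)

lemma form_C0: "form a ==> x#:L ==> y#:L ==> form (C0 x y a)"
 by (simp add: form_def good_C0)

lemma form_insert: "form a ==> x#:L ==> form (%w. a (x # w))"
 by (simp add: form_def good_insert)

lemma form_plus: "form a ==> form b ==> form (%w. a w +! b w)"
 by (simp add: form_def good_plus)

lemma form_minus: "form a ==> form b ==> form (%w. a w -! b w)"
 by (simp add: form_def good_minus)

lemma form_scal: "form a ==> r#:R ==> form (%w. r *! a w)"
 by (simp add: form_def good_scal)

lemma form_zero: "form (%w. 0[R])"
 by (simp add: form_def good_zero)

lemmas fclosed = form_closed[OF form_D] form_closed[OF form_H] form_closed[OF form_cov] form_closed[OF form_C0]

declare fclosed [simp] form_D [simp] form_H [simp] form_cov [simp] form_C0 [simp]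

lemma H_add: "[|form a; y#:L; y'#:L; w:words|] ==> H (y +: y') a w = H y a w +! H y' a w"
 by (rule Padd[OF PH_all formD _ _ _ order_refl])

lemma H_smult: "[|form a; y#:L; r#:R; w:words|] ==> H (r *: y) a w = r *! H y a w"
 by (rule Psmult[OF PH_all formD _ _ _ order_refl])

lemma H_zero: "y#:L ==> w:words ==> H y (%_. 0[R]) w = 0[R]"
 using Pscal[OF PH_all formD[OF form_zero] R.zero_closed, of y w "length w"] form_closed[OF form_H[OF form_zero]]
 by simp

lemma D_add_left: "[|form a; x#:L; x'#:L; w:words|] ==> D (x +: x') a w = D x a w +! D x' a w"
 by (rule PD_add_left[OF PH_all formD _ _ _ order_refl])

lemma D_smult_left: "[|form a; x#:L; r#:R; w:words|] ==> D (r *: x) a w = r *! D x a w"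
 by (rule PD_smult_left[OF PH_all formD _ _ _ order_refl])

lemma D_plus: "[|form a; form b; x#:L; w:words|]
  ==> D x (%u. a u +! b u) w = D x a w +! D x b w"
 by (rule PD_plus[OF PH_all formD formD _ _ order_refl])

lemma D_scal: "[|form a; r#:R; x#:L; w:words|]
  ==> D x (%u. r *! a u) w = x |> r *! a w +! r *! D x a w"
 by (rule PD_scal[OF PH_all formD _ _ _ order_refl])

lemma D_cong:
 assumes "w:words" "x#:L" "!!u. u:words ==> a u = b u"
 shows "D x a w = D x b w"
proof -
 have "cov x a w = cov x b w" by (rule cov_cong) (use assms in auto)
 moreover have "H x a w = H x b w" by (rule H_cong) (use assms in auto)
 ultimately show ?thesis using assms by (simp add: D_def)
qed

lemma D_minus:
 assumes a: "form a" and b: "form b" and x: "x#:L" and w: "w:words"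
 shows "D x (%u. a u -! b u) w = D x a w -! D x b w"
proof -
 let ?m = "-[R] 1[R]"
 have "D x (%u. a u -! b u) w = D x (%u. a u +! ?m *! b u) w"
  by (rule D_cong[OF w x]) (use form_closed[OF b] in "simp add: R.l_minus a_minus_def")
 also have "... = D x a w +! D x (%u. ?m *! b u) w"
  by (rule D_plus[OF a form_scal[OF b] x w]) simp
 also have "D x (%u. ?m *! b u) w = -[R] D x b w"
  using form_closed[OF b w] fclosed(1)[OF b x w] x
  by (simp add: D_scal[OF b _ x w] anchor_uminus R.l_minus)
 finally show ?thesis by (simp add: a_minus_def)
qed

lemma D_uminus_left: "[|form a; x#:L; w:words|] ==> D (-[L] x) a w = -[R] D x a w"
 using fclosed(1)[of a x w] by (simp add: L_uminus D_smult_left R.l_minus)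

lemma H_uminus: "[|form a; x#:L; w:words|] ==> H (-[L] x) a w = -[R] H x a w"
 using fclosed(2)[of a x w] by (simp add: L_uminus H_smult R.l_minus)

lemma cov_zero: "x#:L ==> cov x (%_. 0[R]) w = 0[R]"
 by (simp add: cov_def)

lemma nat_mult_eq_0: "a#:R ==> add_pow R (Suc n) a = 0[R] ==> a = 0[R]"
 using rat_cancel[of a n] by (simp del: R.add.nat_pow_Suc)

abbreviation psumR where "psumR == psum R"

abbreviation dsum where "dsum F w == psum R (%y v. psum R (%x u. F y x u) v) w"

lemma psum_closed_words:
 assumes "w:words" "!!x v. x#:L ==> v:words ==> f x v#:R"
 shows "psumR f w#:R"
 by (rule R.psum_closed; drule mset_Cons_lists[OF _ assms(1)]; elim conjE; rule assms(2))

lemma psum_cong_words: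
 assumes "w:words" "!!x v. x#:L ==> v:words ==> length w = Suc (length v) ==> f x v = g x v"
 shows "psumR f w = psumR g w"
 by (rule psum_cong; drule mset_Cons_lists[OF _ assms(1)]; elim conjE; rule assms(2))

lemma psum_add_words:
 assumes "w:words" "!!x v. x#:L ==> v:words ==> f x v#:R"
  "!!x v. x#:L ==> v:words ==> g x v#:R"
 shows "psumR (%x v. f x v +! g x v) w = psumR f w +! psumR g w"
 by (rule R.psum_add; drule mset_Cons_lists[OF _ assms(1)]; elim conjE; rule assms(2,3))

lemma psum_minus_words:
 assumes "w:words" "!!x v. x#:L ==> v:words ==> f x v#:R"
  "!!x v. x#:L ==> v:words ==> g x v#:R"
 shows "psumR (%x v. f x v -! g x v) w = psumR f w -! psumR g w"
 by (rule R.psum_minus; drule mset_Cons_lists[OF _ assms(1)]; elim conjE; rule assms(2,3))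

lemma psum_uminus_words:
 assumes "w:words" "!!x v. x#:L ==> v:words ==> f x v#:R"
 shows "psumR (%x v. -[R] f x v) w = -[R] psumR f w"
 by (rule R.psum_hom[symmetric]) (use assms mset_Cons_lists[OF _ assms(1)] in "auto simp: R.minus_add")

lemma psum_mult_words:
 assumes "w:words" "!!x v. x#:L ==> v:words ==> f x v#:R" "r#:R"
 shows "psumR (%x v. r *! f x v) w = r *! psumR f w"
 by (rule R.psum_hom[symmetric]) (use assms mset_Cons_lists[OF _ assms(1)] in "auto simp: R.r_distr")

lemma psum_zero_words:
 assumes "w:words" "!!x v. x#:L ==> v:words ==> length w = Suc (length v) ==> f x v = 0[R]"
 shows "psumR f w = 0[R]"
 using psum_cong_words[of w f "%x v. 0[R]"] assms by simp

lemma dsum_swap: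
 assumes "w:words" "!!x y v. x#:L ==> y#:L ==> v:words ==> F x y v#:R"
 shows "dsum F w = dsum (%x y. F y x) w"
proof (rule R.psum_swap)
 fix z z' v assume "mset w = add_mset z (add_mset z' (mset v))"
 hence "set w = insert z (insert z' (set v))"
  by (metis set_mset_add_mset_insert set_mset_mset)
 thus "F z z' v#:R" using assms by (auto simp: lists_eq_set)
qed

lemma dsum_add: 
 assumes "w:words" "!!x y v. x#:L ==> y#:L ==> v:words ==> F x y v#:R"
  "!!x y v. x#:L ==> y#:L ==> v:words ==> F' x y v#:R"
 shows "dsum (%x y v. F x y v +! F' x y v) w = dsum F w +! dsum F' w"
proof -
 have "dsum (%x y v. F x y v +! F' x y v) w = psumR (%x v. psumR (%y u. F x y u) v +! psumR (%y u. F' x y u) v) w"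
  by (rule psum_cong_words[OF assms(1)]) (use assms in "simp add: psum_add_words")
 also have "... = dsum F w +! dsum F' w"
  by (rule psum_add_words[OF assms(1)]) (use assms in "simp_all add: psum_closed_words")
 finally show ?thesis .
qed

lemma dsum_minus: 
 assumes "w:words" "!!x y v. x#:L ==> y#:L ==> v:words ==> F x y v#:R"
  "!!x y v. x#:L ==> y#:L ==> v:words ==> F' x y v#:R"
 shows "dsum (%x y v. F x y v -! F' x y v) w = dsum F w -! dsum F' w"
proof -
 have "dsum (%x y v. F x y v -! F' x y v) w = psumR (%x v. psumR (%y u. F x y u) v -! psumR (%y u. F' x y u) v) w"
  by (rule psum_cong_words[OF assms(1)]) (use assms in "simp add: psum_minus_words")
 also have "... = dsum F w -! dsum F' w"
  by (rule psum_minus_words[OF assms(1)]) (use assms in "simp_all add: psum_closed_words")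
 finally show ?thesis .
qed

lemma dsum_closed: 
 assumes "w:words" "!!x y v. x#:L ==> y#:L ==> v:words ==> F x y v#:R"
 shows "dsum F w#:R"
 by (intro psum_closed_words assms) auto

text \<open>Exchanging the two removed letters turns the sum into its negative, and 2 is
  invertible.\<close>

lemma dsum_skew:
 assumes "w:words" "!!x y v. x#:L ==> y#:L ==> v:words ==> F x y v#:R"
  "!!x y v. x#:L ==> y#:L ==> v:words ==> F y x v = -[R] F x y v"
 shows "dsum F w = 0[R]"
proof -
 have "dsum F w +! dsum F w = dsum F w +! dsum (%x y. F y x) w"
  by (rule arg_cong[where f = "%t. dsum F w +! t"]) (rule dsum_swap[OF assms(1,2)])
 also have "... = dsum (%x y v. F x y v +! F y x v) w"
  by (rule dsum_add[OF assms(1), symmetric]) (use assms(2) in blast)+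
 also have "... = 0[R]"
 proof (intro psum_zero_words assms)
  fix x v y u assume "x#:L" "y#:L" "u:words"
  thus "F x y u +! F y x u = 0[R]" using assms(2)[of x y u] assms(3)[of x y u] by (simp only: R.r_neg)
 qed
 finally show ?thesis using nat_mult_eq_0[of "dsum F w" 1] dsum_closed[OF assms(1,2)] by simp
qed

text \<open>The tautological section is parallel, so the derivative passes through the contraction;
  the second sum is the derivative of the vector argument of \<open>F\<close>.\<close>

lemma cov_psum:
 assumes F: "!!z. z#:L ==> form (F z)" and x: "x#:L" and w: "w:words"
 shows "cov x (psumR F) w = psumR (%y. cov x (F y)) w -! psumR (%y. F (nab x y)) w"
proof -
 note c = form_closed[OF F]
 have e1: "x |> psumR F w = psumR (%y v. x |> F y v) w"
  by (rule R.psum_hom) (use c mset_Cons_lists[OF _ w] x in "auto simp: anchor_add_right")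
 have "psumR (%z v. psumR F (nab x z # v)) w
   = psumR (%z v. F (nab x z) v) w +! dsum (%z y u. F y (nab x z # u)) w"
  unfolding psum.simps by (rule psum_add_words[OF w]) (use c x in "auto intro!: psum_closed_words")
 also have "dsum (%z y u. F y (nab x z # u)) w = dsum (%y z u. F y (nab x z # u)) w"
  by (rule dsum_swap[OF w]) (use c x in auto)
 finally have e2: "psumR (%z v. psumR F (nab x z # v)) w
   = psumR (%z v. F (nab x z) v) w +! dsum (%y z u. F y (nab x z # u)) w" .
 have e3: "psumR (%y. cov x (F y)) w = psumR (%y v. x |> F y v) w -! dsum (%y z u. F y (nab x z # u)) w"
  unfolding cov_def by (rule psum_minus_words[OF w]) (use c x in "auto intro!: psum_closed_words")
 show ?thesis
  unfolding cov_def[of x "psumR F"] e1 e2 e3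
  by (rule R.ring_id15; intro psum_closed_words w) (use c x in "auto intro!: psum_closed_words")
qed

text \<open>The normalisation of the correction. When \<open>G\<close> is contracted in
  \<open>y\<close> as well, each of its parts is a contraction of \<open>H\<close> in lower degree
  or skew in the two removed letters.\<close>

lemma gauge:
 assumes "form a" "w:words"
 shows "psumR (%x. H x a) w = 0[R]"
 using assms
proof (induction "length w" arbitrary: a w rule: less_induct)
 case less
 note a = less.prems(1) and w = less.prems(2)
 have A: "dsum (%y x u. H y (D x a) u) w = 0[R]"
 proof -
  have "dsum (%y x u. H y (D x a) u) w = dsum (%x y u. H y (D x a) u) w"
   by (rule dsum_swap[OF w]) (use a in "auto")
  also have "... = 0[R]"
   by (rule psum_zero_words[OF w], rule less.hyps) (use a in "auto intro: form_D")
  finally show ?thesis .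
 qed
 \<comment> \<open>By \<open>cov_psum\<close> and the induction hypothesis the derivative term
   becomes \<open>H (nab x y) a\<close>. Together with the other term only the torsion remains, and
   it is skew.\<close>
 have B: "dsum (%y x u. H (nab y x +: br x y) a u) w -! dsum (%y x u. cov x (H y a) u) w = 0[R]"
 proof -
  have "dsum (%y x u. cov x (H y a) u) w = dsum (%x y u. cov x (H y a) u) w"
   by (rule dsum_swap[OF w]) (use a in "auto")
  also have "... = dsum (%x y u. H (nab x y) a u) w"
  proof (rule psum_cong_words[OF w])
   fix x v assume x: "x#:L" and v: "v:words" and l: "length w = Suc (length v)"
   have "cov x (psumR (%y. H y a)) v = cov x (%_. 0[R]) v"
    by (rule cov_cong[OF x v], rule less.hyps) (use l a in auto)
   hence "psumR (%y. cov x (H y a)) v -! psumR (%y. H (nab x y) a) v = 0[R]"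
    using cov_psum[OF form_H[OF a] x v] x by (simp add: cov_zero)
   moreover have "psumR (%y. cov x (H y a)) v#:R" "psumR (%y. H (nab x y) a) v#:R"
    by (rule psum_closed_words[OF v]; use x a in "auto")+
   ultimately show "psumR (%y. cov x (H y a)) v = psumR (%y. H (nab x y) a) v" by simp
  qed
  also have "... = dsum (%y x u. H (nab x y) a u) w"
   by (rule dsum_swap[OF w]) (use a in "auto")
  finally have "dsum (%y x u. H (nab y x +: br x y) a u) w -! dsum (%y x u. cov x (H y a) u) w
   = dsum (%y x u. H (nab y x +: br x y) a u -! H (nab x y) a u) w"
   by (subst dsum_minus[OF w]) (use a in "auto")
  also have "... = dsum (%y x u. H (tors y x) a u) w"
  proof (intro psum_cong_words w)
   fix y v x u assume y: "y#:L" "x#:L" "u:words"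
   have "(nab y x +: br x y) +: (-[L] nab x y) = tors y x"
   proof -
    have c: "nab y x#:L" "nab x y#:L" "br x y#:L" using y by simp_all
    thus ?thesis using y unfolding tors_def bracket_skew[OF y(2,1)] by algebra
   qed
   hence "H (tors y x) a u = H ((nab y x +: br x y) +: (-[L] nab x y)) a u" by simp
   also have "... = H (nab y x +: br x y) a u +! H (-[L] nab x y) a u"
    by (rule H_add[OF a]) (use y in auto)
   finally show "H (nab y x +: br x y) a u -! H (nab x y) a u = H (tors y x) a u"
    using y by (simp add: H_uminus[OF a] a_minus_def)
  qed
  also have "... = 0[R]"
  proof (rule dsum_skew[OF w])
   fix y x u assume "y#:L" "x#:L" "u:words"
   thus "H (tors y x) a u#:R" "H (tors x y) a u = -[R] H (tors y x) a u"
    using tors_skew[of y x] H_uminus[OF a, of "tors y x" u] a by simp_all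
  qed
  finally show ?thesis .
 qed
 have E: "dsum (%y x u. C0 x y a u) w = 0[R]"
  by (rule dsum_skew[OF w]; (rule C0_skew[OF formD[OF a] _ _ _ order_refl])?) (use a in simp_all)
 have "dsum (%y x u. G y a x u) w = dsum (%y x u. H y (D x a) u +! (H (nab y x +: br x y) a u -! cov x (H y a) u) -! C0 x y a u) w"
  unfolding G_def 
  by (rule psum_cong_words[OF w], rule psum_cong_words, assumption, rule R.ring_id19) (use a in simp_all)
 also have "... = dsum (%y x u. H y (D x a) u) w +!
   (dsum (%y x u. H (nab y x +: br x y) a u) w -! dsum (%y x u. cov x (H y a) u) w) -! dsum (%y x u. C0 x y a u) w"
  using a by (subst dsum_minus[OF w], (auto)[2], subst dsum_add[OF w], (auto)[2], subst dsum_minus[OF w])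
    (auto)
 finally have G: "dsum (%y x u. G y a x u) w = 0[R]" by (simp add: A B E)
 have Gc: "G y a x u#:R" if "x#:L" "y#:L" "u:words" for x y u
  using a that by (simp add: G_def)
 \<comment> \<open>The words in the inner sum have one letter less than \<open>w\<close>, so the
   common coefficient belongs to \<open>length w - 1\<close>.\<close>
 have "psumR (%x. H x a) w = psumR (%y v. rat (length w - 1) *! psumR (G y a) v) w"
  by (rule psum_cong_words[OF w]) (simp add: H_rec)
 also have "... = rat (length w - 1) *! dsum (%y x u. G y a x u) w"
  by (rule psum_mult_words[OF w]) (auto intro!: psum_closed_words Gc)
 finally show ?case by (simp add: G)
qed

definition Cc where "Cc x y a w = D x (D y a) w -! D y (D x a) w -! D (br x y) a w"

lemma form_Cc: "form a ==> x#:L ==> y#:L ==> form (Cc x y a)"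
proof -
 have e: "Cc x y a = (%w. D x (D y a) w -! D y (D x a) w -! D (br x y) a w)" by (rule ext) (simp add: Cc_def)
 show "form a ==> x#:L ==> y#:L ==> form (Cc x y a)"
  unfolding e by (intro form_minus form_D bracket_closed)
qed

lemma cov_insert:
 assumes a: "form a" and x: "x#:L" and y: "y#:L" and v: "v:words"
 shows "cov x (%u. a (y # u)) v = cov x a (y # v) +! a (nab x y # v)"
proof -
 have e: "psumR (%z u. a (nab x z # y # u)) v = psumR (%z u. a (y # nab x z # u)) v"
  by (rule psum_cong_words[OF v], rule form_sym[OF a]) (use x y in auto)
 have "psumR (%z u. a (y # nab x z # u)) v#:R"
  by (rule psum_closed_words[OF v], rule form_closed[OF a]) (use x y in simp_all)
 moreover have "x |> a (y # v)#:R" "a (nab x y # v)#:R"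
  using x y v by (simp_all add: form_closed[OF a])
 ultimately have "x |> a (y # v) -! psumR (%z u. a (y # nab x z # u)) v =
   x |> a (y # v) -! (a (nab x y # v) +! psumR (%z u. a (y # nab x z # u)) v) +! a (nab x y # v)"
  by (simp only: R.ring_id20)
 thus ?thesis by (simp add: cov_def e)
qed

lemma cov_D:
 assumes a: "form a" and x: "x#:L" and y: "y#:L" and v: "v:words"
 shows "cov x (D y a) v = cov x (cov y a) v +! (cov x a (y # v) +! a (nab x y # v)) +! cov x (H y a) v"
proof -
 have e: "D y a = (%w. (cov y a w +! a (y # w)) +! H y a w)" by (rule ext) (simp add: D_def)
 show ?thesis unfolding e
  using a x y v formD[OF form_cov[OF a]] formD[OF form_H[OF a]] formD[OF form_insert[OF a]]
   formD[OF form_plus[OF form_cov[OF a] form_insert[OF a]]]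
  by (simp add: cov_plus[of "length v"] cov_insert)
qed

lemma psum_sym_const:
 assumes a: "form a" and w: "w:words"
 shows "psumR (%x v. a (x # v)) w = add_pow R (length w) (a w)"
proof (rule R.psum_const)
 fix z v assume "mset w = add_mset z (mset v)"
 thus "a (z # v) = a w" by (intro form_sym[OF a w]) simp
qed (rule form_closed[OF a w])

text \<open>This is the equation that the recursion solves. The part with \<open>G\<close> is minus
  n + 1 times \<open>H y a w\<close>, n being the length of \<open>w\<close>; in the rest, symmetry
  of the forms gives n copies of \<open>H y a w\<close> and \<open>gauge\<close> one more.\<close>

lemma econ:
 assumes a: "form a" and y: "y#:L" and w: "w:words"
 shows "psumR (%x. Cc x y a) w = 0[R]"
proof -
 note c = form_closed[OF a]
 have Gc: "G y a x u#:R" if "x#:L" "u:words" for x u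
  using a y that by (simp add: G_def)
 have "psumR (%x. Cc x y a) w = psumR (%x v. (-[R] G y a x v) +! (D y a (x # v) +! H x (D y a) v
   +! (H (nab y x) a v -! cov y (H x a) v) -! cov y a (x # v) -! a (y # x # v) -! H x a (y # v))) w"
 proof (rule psum_cong_words[OF w])
  fix x v assume x: "x#:L" and v: "v:words"
  have b: "br x y#:L" using x y by simp
  have t: "a (tors x y # v) = a (nab x y # v) -! a (nab y x # v) -! a (br x y # v)"
   unfolding tors_def a_minus_def
   using x y v good_add[OF formD[OF a], of _ _ v "Suc (length v)"] good_uminus[OF formD[OF a], of _ v "Suc (length v)"] by simp
  have h: "H (nab y x +: br x y) a v = H (nab y x) a v +! H (br x y) a v"
   by (rule H_add[OF a]) (use x y v in auto)
  have sw: "a (y # x # v) = a (x # y # v)" by (rule form_sym[OF a]) (use x y v in auto)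
  show "Cc x y a v = (-[R] G y a x v) +! (D y a (x # v) +! H x (D y a) v
   +! (H (nab y x) a v -! cov y (H x a) v) -! cov y a (x # v) -! a (y # x # v) -! H x a (y # v))"
   unfolding Cc_def D_def[of x "D y a"] D_def[of y "D x a"] D_def[of "br x y"]
    cov_D[OF a x y v] cov_D[OF a y x v] D_def[of x a "y # v"] G_def C0_def t h sw
   by (rule R.ring_id16) (use a x y v in "simp_all add: c")
 qed
 also have "... = (-[R] psumR (G y a) w) +! (psumR (%x v. D y a (x # v)) w +! psumR (%x. H x (D y a)) w
   +! (psumR (%x. H (nab y x) a) w -! psumR (%x. cov y (H x a)) w) -! psumR (%x v. cov y a (x # v)) w
   -! psumR (%x v. a (y # x # v)) w -! psumR (%x v. H x a (y # v)) w)"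
  by (subst psum_add_words[OF w], (simp_all add: a y Gc c)[2], subst psum_uminus_words[OF w], simp add: Gc,
   (subst psum_minus_words[OF w], (simp_all add: a y c)[2])+, (subst psum_add_words[OF w], (simp_all add: a y c)[2])+,
   subst psum_minus_words[OF w]) (simp_all add: a y c)
 also have "psumR (%x. H x (D y a)) w = 0[R]" by (rule gauge[OF form_D[OF a y] w])
 also have "psumR (%x. H (nab y x) a) w -! psumR (%x. cov y (H x a)) w = 0[R]"
 proof -
  have "cov y (psumR (%x. H x a)) w = cov y (%_. 0[R]) w"
   by (rule cov_cong[OF y w], rule gauge[OF a])
  hence "psumR (%x. cov y (H x a)) w -! psumR (%x. H (nab y x) a) w = 0[R]"
   using cov_psum[OF form_H[OF a] y w] y by (simp add: cov_zero)
  moreover have "psumR (%x. cov y (H x a)) w#:R" "psumR (%x. H (nab y x) a) w#:R"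
   by (rule psum_closed_words[OF w]; use y a in "auto")+
  ultimately show ?thesis by (metis R.r_right_minus_eq)
 qed
 also have "psumR (%x v. D y a (x # v)) w = add_pow R (length w) (cov y a w) +! add_pow R (length w) (a (y # w)) +! add_pow R (length w) (H y a w)"
  using psum_sym_const[OF form_D[OF a y] w] a y w by (simp add: D_def R.add.nat_pow_distrib c)
 also have "psumR (%x v. cov y a (x # v)) w = add_pow R (length w) (cov y a w)"
  by (rule psum_sym_const[OF form_cov[OF a y] w])
 also have "psumR (%x v. a (y # x # v)) w = add_pow R (length w) (a (y # w))"
  by (rule psum_sym_const[OF form_insert[OF a y] w])
 also have "psumR (G y a) w = add_pow R (length w) (H y a w) +! H y a w"
 proof -
  have "psumR (G y a) w#:R" by (rule psum_closed_words[OF w Gc])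
  hence "psumR (G y a) w = add_pow R (Suc (length w)) (H y a w)"
   using rat_cancel'[of "psumR (G y a) w" "length w"] by (simp only: H_rec[OF w y])
  thus ?thesis by simp
 qed
 \<comment> \<open>\<open>gauge\<close> on the longer word \<open>y # w\<close>, whose first letter
   contributes \<open>H y a w\<close>.\<close>
 also have "psumR (%x v. H x a (y # v)) w = -[R] H y a w"
 proof -
  have "psumR (%x. H x a) (y # w) = 0[R]" by (rule gauge[OF a]) (use y w in simp)
  moreover have "psumR (%x v. H x a (y # v)) w#:R" "H y a w#:R"
   using a y w by (auto intro!: psum_closed_words)
  ultimately show ?thesis using R.minus_equality[of "psumR (%x v. H x a (y # v)) w" "H y a w"]
   by (simp add: R.a_comm)
 qed
 also have "(-[R] (add_pow R (length w) (H y a w) +! H y a w)) +!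
   (add_pow R (length w) (cov y a w) +! add_pow R (length w) (a (y # w)) +! add_pow R (length w) (H y a w) +! 0[R] +! 0[R]
   -! add_pow R (length w) (cov y a w) -! add_pow R (length w) (a (y # w)) -! (-[R] H y a w)) = 0[R]"
  by (rule R.ring_id17) (use a y w in "simp_all add: c")
 finally show ?thesis .
qed

end

section \<open>The Bianchi identity and flatness\<close>

lemma (in cring) ring_id21: "[|a#:R; b#:R; p#:R; q#:R; c#:R; d#:R; e#:R|]
  ==> (a .- b .- p) .- (c .- d .- q) .- (q .- p .- e) = ((a .- b) .- (c .- d)) .+ e"
 by algebra

lemma (in cring) ring_id22: "[|a#:R; b#:R; c#:R; d#:R; e#:R; f#:R|]
  ==> ((a .- b) .- (c .- d)) .+ ((c .- e) .- (f .- b)) .+ ((f .- d) .- (a .- e)) = \<zero>"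
 by algebra

lemma (in cring) ring_id23: "[|a#:R; b#:R; c#:R; p#:R; q#:R; s#:R|]
  ==> (a .+ p) .+ (b .+ q) .+ (c .+ s) = (a .+ b .+ c) .+ (p .+ q .+ s)"
 by algebra

lemma (in cring) ring_id24: "[|a#:R; b#:R; c#:R|] ==> b .- a .- (.- c) = .- (a .- b .- c)"
 by algebra

context lie_connection
begin

declare form_Cc [simp] form_closed[OF form_Cc, simp]

lemma Cc_skew: "[|form a; x#:L; y#:L; w:words|] ==> Cc y x a w = -[R] Cc x y a w"
 by (simp add: Cc_def bracket_skew[of x y] D_uminus_left R.ring_id24)

lemma D_bracket_bracket:
 assumes a: "form a" and xyz: "x#:L" "y#:L" "z#:L" and v: "v:words"
 shows "D x (Cc y z a) v -! Cc y z (D x a) v -! Cc (br y z) x a v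
  = ((D x (D y (D z a)) v -! D x (D z (D y a)) v) -! (D y (D z (D x a)) v -! D z (D y (D x a)) v))
   +! D (br (br y z) x) a v"
proof -
 have "Cc y z a = (%u. (D y (D z a) u -! D z (D y a) u) -! D (br y z) a u)"
  by (rule ext) (simp add: Cc_def)
 hence "D x (Cc y z a) v = D x (D y (D z a)) v -! D x (D z (D y a)) v -! D x (D (br y z) a) v"
  using a xyz v by (simp add: D_minus form_minus)
 thus ?thesis unfolding Cc_def[of y z "D x a"] Cc_def[of "br y z" x]
  by (simp only:) (rule R.ring_id21; use a xyz v in simp)
qed

text \<open>The commutators of the operators \<open>D\<close> satisfy the Jacobi identity, and the
  Jacobi identity of \<open>L\<close> disposes of the derivatives along double brackets.\<close>

lemma bianchi:
 assumes a: "form a" and xyz: "x#:L" "y#:L" "z#:L" and v: "v:words"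
 shows "(D x (Cc y z a) v -! Cc y z (D x a) v -! Cc (br y z) x a v)
  +! (D y (Cc z x a) v -! Cc z x (D y a) v -! Cc (br z x) y a v)
  +! (D z (Cc x y a) v -! Cc x y (D z a) v -! Cc (br x y) z a v) = 0[R]"
proof -
 let ?b = "%x y z. br (br y z) x"
 have "-[L] (br x (br y z) +: br y (br z x) +: br z (br x y)) = 0[L]"
  using jacobi[OF xyz] by simp
 hence j: "?b x y z +: ?b y z x +: ?b z x y = 0[L]"
  using xyz bracket_skew[of x "br y z"] bracket_skew[of y "br z x"] bracket_skew[of z "br x y"]
  by (simp add: L.minus_add)
 have "D 0[L] a v = 0[R]"
  using D_smult_left[OF a L.zero_closed R.zero_closed v] a v by simp
 hence "D (?b x y z) a v +! D (?b y z x) a v +! D (?b z x y) a v = 0[R]"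
  using j xyz a v by (simp add: D_add_left[symmetric])
 moreover have "((D x (D y (D z a)) v -! D x (D z (D y a)) v) -! (D y (D z (D x a)) v -! D z (D y (D x a)) v))
  +! ((D y (D z (D x a)) v -! D y (D x (D z a)) v) -! (D z (D x (D y a)) v -! D x (D z (D y a)) v))
  +! ((D z (D x (D y a)) v -! D z (D y (D x a)) v) -! (D x (D y (D z a)) v -! D y (D x (D z a)) v)) = 0[R]"
  by (rule R.ring_id22) (use a xyz v in simp_all)
 ultimately show ?thesis
  unfolding D_bracket_bracket[OF a xyz v] D_bracket_bracket[OF a xyz(2,3,1) v] D_bracket_bracket[OF a xyz(3,1,2) v]
  by (subst R.ring_id23) (use a xyz v in simp_all)
qed

text \<open>Contracting the Bianchi identity with the tautological section multiplies a component of
  degree \<open>n\<close> of the curvature by \<open>n + 2\<close>, up to components of lower degree.\<close>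

theorem flat:
 assumes "form a" "y#:L" "z#:L" "w:words"
 shows "Cc y z a w = 0[R]"
 using assms
proof (induction "length w" arbitrary: a y z w rule: less_induct)
 case less
 note a = less.prems(1) and y = less.prems(2) and z = less.prems(3) and w = less.prems(4)
 have key: "Cc y z a w +! Cc z x a (y # v) +! Cc x y a (z # v) = 0[R]"
  if x: "x#:L" and v: "v:words" and l: "mset w = add_mset x (mset v)" for x v
 proof -
  have lv: "length w = Suc (length v)" using l by (metis size_add_mset size_mset)
  have IH: "Cc p q b u = 0[R]" if "length u <= length v" "form b" "p#:L" "q#:L" "u:words" for p q b u
   by (rule less.hyps) (use that lv in auto)
  \<comment> \<open>On words shorter than \<open>w\<close> the curvature vanishes. Of the three
    parts of \<open>D p\<close> the connection and the correction see only such words, so the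
    insertion alone survives.\<close>
  have DC: "D p (Cc q r a) v = Cc q r a (p # v)" if pqr: "p#:L" "q#:L" "r#:L" for p q r
  proof -
   have "cov p (Cc q r a) v = cov p (%_. 0[R]) v" by (rule cov_cong[OF pqr(1) v], rule IH) (use a pqr in auto)
   moreover have "H p (Cc q r a) v = H p (%_. 0[R]) v" by (rule H_cong[OF v pqr(1)], rule IH) (use a pqr in auto)
   ultimately show ?thesis using a pqr v by (simp add: D_def cov_zero H_zero)
  qed
  have "Cc y z a (x # v) = Cc y z a w"
   by (rule form_sym) (use a y z w l in simp_all)
  thus ?thesis using bianchi[OF a x y z v] a x y z v w by (simp add: DC IH)
 qed
 have c: "psumR (%x v. Cc x z a (y # v)) w#:R" "psumR (%x v. Cc x y a (z # v)) w#:R"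
  by (rule psum_closed_words[OF w]; use a y z in simp)+
 \<comment> \<open>\<open>econ\<close> on the word \<open>y # w\<close>, whose first letter
   contributes \<open>Cc y z a w\<close>. This and the next fact add two copies of the curvature to
   the n copies from the insertions.\<close>
 have 1: "psumR (%x v. Cc x z a (y # v)) w = -[R] Cc y z a w"
  using econ[OF a z, of "y # w"] a y z w c R.minus_equality[of "psumR (%x v. Cc x z a (y # v)) w" "Cc y z a w"]
  by (simp add: R.a_comm)
 have 2: "psumR (%x v. Cc x y a (z # v)) w = Cc y z a w"
  using econ[OF a y, of "z # w"] a y z w c R.minus_equality[of "psumR (%x v. Cc x y a (z # v)) w" "Cc z y a w"]
  by (simp add: R.a_comm Cc_skew[OF a z y w])
 have "0[R] = psumR (%x v. Cc y z a w +! Cc z x a (y # v) +! Cc x y a (z # v)) w"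
 proof -
  have "psumR (%x v. Cc y z a w +! Cc z x a (y # v) +! Cc x y a (z # v)) w = psumR (%x v. 0[R]) w"
   by (rule psum_cong, rule key) (use mset_Cons_lists[OF _ w] in blast)+
  thus ?thesis by simp
 qed
 also have "... = psumR (%x v. Cc y z a w +! (-[R] Cc x z a (y # v)) +! Cc x y a (z # v)) w"
  by (rule psum_cong_words[OF w]) (subst Cc_skew[OF a], use a y z in simp_all)
 also have "... = psumR (%x v. Cc y z a w) w +! (-[R] psumR (%x v. Cc x z a (y # v)) w) +! psumR (%x v. Cc x y a (z # v)) w"
  by (subst psum_add_words[OF w], (use a y z w in simp_all)[2], subst psum_add_words[OF w], (use a y z w in simp_all)[2],
    subst psum_uminus_words[OF w]) (use a y z w in simp_all)
 also have "psumR (%x v. Cc y z a w) w = add_pow R (length w) (Cc y z a w)"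
  by (rule R.psum_const) (use a y z w in simp_all)
 finally have "add_pow R (Suc (Suc (length w))) (Cc y z a w) = 0[R]"
  using a y z w by (simp add: 1 2)
 thus ?case by (rule nat_mult_eq_0[rotated]) (use a y z w in simp)
qed

lemma flat': "[|form a; x#:L; y#:L; w:words|]
  ==> D (br x y) a w = D x (D y a) w -! D y (D x a) w"
 using flat[of a x y w] by (simp add: Cc_def)

end

section \<open>The free algebra\<close>

context cring
begin

definition conv :: "('x list => 'a) => ('x list => 'a) => 'x list => 'a" where
 "conv p q w = (\<Oplus>i\<in>{..length w}. p (take i w) .* q (drop i w))"

definition single :: "'a => 'x list => 'x list => 'a" where
 "single c w = (%u. if u = w then c else \<zero>)"

lemma conv_closed: "(!!w. p w#:R) ==> (!!w. q w#:R) ==> conv p q w#:R"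
 unfolding conv_def by (rule finsum_closed) auto

lemma conv_Nil: "(!!w. p w#:R) ==> (!!w. q w#:R) ==> conv p q [] = p [] .* q []"
 by (simp add: conv_def)

lemma conv_Cons:
 assumes "!!w. p w#:R" "!!w. q w#:R"
 shows "conv p q (z # w) = p [] .* q (z # w) .+ conv (%u. p (z # u)) q w"
proof -
 have s: "{..length (z # w)} = insert 0 (Suc ` {..length w})"
  by (simp add: atMost_Suc_eq_insert_0)
 have "(\<Oplus>i\<in>Suc ` {..length w}. p (take i (z # w)) .* q (drop i (z # w)))
   = (\<Oplus>i\<in>{..length w}. p (take (Suc i) (z # w)) .* q (drop (Suc i) (z # w)))"
  by (rule add.finprod_reindex[symmetric, folded finsum_def, simplified o_def, symmetric]) (use assms in auto)
 thus ?thesis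
  unfolding conv_def s using assms by (subst finsum_insert) auto
qed

lemma conv_add_left:
 assumes "!!w. p w#:R" "!!w. p' w#:R" "!!w. q w#:R"
 shows "conv (%u. p u .+ p' u) q w = conv p q w .+ conv p' q w"
 unfolding conv_def using assms by (simp add: l_distr finsum_addf)

lemma conv_add_right:
 assumes "!!w. p w#:R" "!!w. q w#:R" "!!w. q' w#:R"
 shows "conv p (%u. q u .+ q' u) w = conv p q w .+ conv p q' w"
 unfolding conv_def using assms by (simp add: r_distr finsum_addf)

lemma conv_scal_left:
 assumes "!!w. p w#:R" "c#:R" "!!w. q w#:R"
 shows "conv (%u. c .* p u) q w = c .* conv p q w"
 unfolding conv_def using assms by (simp add: m_assoc finsum_rdistr)

lemma conv_zero_left: "(!!w. q w#:R) ==> conv (%u. \<zero>) q w = \<zero>"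
 unfolding conv_def by simp

text \<open>Removing the first letter acts on convolutions like a left derivative, by
  \<open>conv_Cons\<close>. Induction on the word then replaces the reindexing of a double
  sum.\<close>

lemma conv_assoc:
 assumes "!!w. p w#:R" "!!w. q w#:R" "!!w. r w#:R"
 shows "conv (conv p q) r w = conv p (conv q r) w"
 using assms
proof (induction w arbitrary: p q)
 case Nil
 thus ?case by (simp add: conv_Nil conv_closed m_assoc)
next
 case (Cons z w)
 let ?p = "%u. p (z # u)" and ?q = "%u. q (z # u)"
 note c = conv_closed Cons.prems
 have "(%u. conv p q (z # u)) = (%u. p [] .* ?q u .+ conv ?p q u)"
  using Cons.prems by (simp add: conv_Cons)
 hence "conv (%u. conv p q (z # u)) r w = p [] .* conv ?q r w .+ conv ?p (conv q r) w"
  using Cons.prems by (simp add: conv_add_left conv_scal_left Cons.IH c)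
 thus ?case using Cons.prems
  by (simp add: conv_Cons c conv_Nil r_distr m_assoc a_assoc)
qed

lemma conv_single:
 assumes "!!w. q w#:R" "c#:R"
 shows "conv (single c u) q w = (if take (length u) w = u then c .* q (drop (length u) w) else \<zero>)"
proof (induction u arbitrary: w)
 case Nil
 show ?case
 proof (cases w)
  case (Cons z v)
  have "(%u. single c [] (z # u)) = (%u. \<zero>)" by (simp add: single_def)
  thus ?thesis using assms Cons by (simp add: conv_Cons single_def conv_zero_left)
 qed (use assms in "simp add: conv_Nil single_def")
next
 case (Cons x u)
 show ?case
 proof (cases w)
  case (Cons z v)
  have "(%t. single c (x # u) (z # t)) = (if z = x then single c u else (%_. \<zero>))"
   by (auto simp: single_def)
  thus ?thesis using assms Cons Cons.IH[of v]
   by (simp add: conv_Cons conv_zero_left single_def)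
 qed (use assms in "simp add: conv_Nil single_def")
qed

lemma conv_single_single:
 assumes "c#:R" "d#:R"
 shows "conv (single c u) (single d v) = single (c .* d) (u @ v)"
proof
 fix w
 have "conv (single c u) (single d v) w = (if take (length u) w = u then c .* single d v (drop (length u) w) else \<zero>)"
  by (rule conv_single) (use assms in "auto simp: single_def")
 also have "... = single (c .* d) (u @ v) w"
  using assms append_eq_conv_conj[of u v w] by (auto simp: single_def)
 finally show "conv (single c u) (single d v) w = single (c .* d) (u @ v) w" .
qed

lemma free_alg_simps:
 "ring.zero (free_alg R Z) = (%w. \<zero>)" "add (free_alg R Z) p q = (%w. p w .+ q w)"
 "monoid.one (free_alg R Z) = single \<one> []" "monoid.mult (free_alg R Z) p q = conv p q" "smult (free_alg R Z) c p = (%w. c .* p w)"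
 by (auto simp: free_alg_def single_def conv_def)

lemma free_alg_carrier: "p#:(free_alg R Z) <->
  (ALL w. p w#:R) & finite {w. p w ~= \<zero>} & (ALL w. p w ~= \<zero> --> w:lists Z)"
 by (simp add: free_alg_def)

lemma single_closed [simp]: "c#:R ==> w:lists Z ==> single c w#:(free_alg R Z)"
 by (auto simp: free_alg_carrier single_def)

lemma gen_single: "gen R x = single \<one> [x]"
 by (auto simp: gen_def single_def)

lemma conv_support:
 assumes "!!w. p w#:R" "!!w. q w#:R" "conv p q w ~= \<zero>"
 shows "EX u v. w = u @ v & p u ~= \<zero> & q v ~= \<zero>"
proof (rule ccontr)
 assume n: "~ ?thesis"
 have "conv p q w = (\<Oplus>i\<in>{..length w}. \<zero>)"
  unfolding conv_def
 proof (rule finsum_cong')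
  fix i
  have "p (take i w) = \<zero> | q (drop i w) = \<zero>" using n by (metis append_take_drop_id)
  thus "p (take i w) .* q (drop i w) = \<zero>" using assms by auto
 qed auto
 thus False using assms(3) by simp
qed

lemma free_alg_ring: "ring (free_alg R Z)"
proof (rule ringI)
 let ?F = "free_alg R Z"
 show "abelian_group ?F"
 proof (rule abelian_groupI)
  fix p q assume p: "p#:?F" and q: "q#:?F"
  have "{w. p w .+ q w ~= \<zero>} <= {w. p w ~= \<zero>} \<union> {w. q w ~= \<zero>}" using p q by (auto simp: free_alg_carrier)
  hence "finite {w. p w .+ q w ~= \<zero>}" using p q by (auto simp: free_alg_carrier intro: finite_subset)
  moreover have "w:lists Z" if "p w .+ q w ~= \<zero>" for w
  proof -
   have "p w ~= \<zero> | q w ~= \<zero>" using that by auto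
   thus ?thesis using p q by (auto simp: free_alg_carrier)
  qed
  ultimately show "p +[?F] q#:?F" using p q by (simp add: free_alg_carrier free_alg_simps)
  show "p +[?F] q = q +[?F] p" using p q by (auto simp: free_alg_carrier free_alg_simps a_comm)
 next
  fix p q r assume "p#:?F" "q#:?F" "r#:?F"
  thus "p +[?F] q +[?F] r = p +[?F] (q +[?F] r)" by (auto simp: free_alg_carrier free_alg_simps a_assoc)
 next
  fix p assume p: "p#:?F"
  have "{w. .- p w ~= \<zero>} <= {w. p w ~= \<zero>}" by auto
  hence "(%w. .- p w)#:?F" using p by (auto simp: free_alg_carrier intro: finite_subset)
  moreover have "(%w. .- p w) +[?F] p = 0[?F]" using p by (auto simp: free_alg_carrier free_alg_simps l_neg)
  ultimately show "EX q:carrier ?F. q +[?F] p = 0[?F]" by blast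
  show "0[?F] +[?F] p = p" using p by (auto simp: free_alg_carrier free_alg_simps)
 qed (simp add: free_alg_carrier free_alg_simps)
 show "Group.monoid ?F"
 proof (rule monoidI)
  fix p q assume p: "p#:?F" and q: "q#:?F"
  hence c: "p w#:R" "q w#:R" for w by (auto simp: free_alg_carrier)
  have "{w. conv p q w ~= \<zero>} <= (%(u, v). u @ v) ` ({w. p w ~= \<zero>} \<times> {w. q w ~= \<zero>})"
   using conv_support[of p q] c by fastforce
  hence "finite {w. conv p q w ~= \<zero>}" by (rule finite_subset) (use p q in "auto simp: free_alg_carrier")
  moreover have "w:lists Z" if n: "conv p q w ~= \<zero>" for w
  proof -
   obtain u v where "w = u @ v" "p u ~= \<zero>" "q v ~= \<zero>" using conv_support[of p q w] c n by blast
   thus ?thesis using p q by (auto simp: free_alg_carrier)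
  qed
  ultimately show "p *[?F] q#:?F" using c by (simp add: free_alg_carrier free_alg_simps conv_closed)
 next
  fix p q r assume "p#:?F" "q#:?F" "r#:?F"
  thus "p *[?F] q *[?F] r = p *[?F] (q *[?F] r)"
   by (auto simp: free_alg_simps free_alg_carrier conv_assoc)
 next
  fix p assume "p#:?F"
  hence c: "p w#:R" for w by (auto simp: free_alg_carrier)
  show "1[?F] *[?F] p = p" using c by (auto simp: free_alg_simps conv_single)
  have "conv p (single \<one> []) w = p w" for w
   using c
  proof (induction w arbitrary: p)
   case Nil
   thus ?case by (subst conv_Nil) (auto simp: single_def)
  next
   case (Cons z w)
   thus ?case by (subst conv_Cons) (auto simp: single_def[of _ "[]"])
  qed
  thus "p *[?F] 1[?F] = p" by (auto simp: free_alg_simps)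
 qed (simp add: free_alg_simps)
 fix p q r assume "p#:?F" "q#:?F" "r#:?F"
 thus "(p +[?F] q) *[?F] r = p *[?F] r +[?F] q *[?F] r"
  "r *[?F] (p +[?F] q) = r *[?F] p +[?F] r *[?F] q"
  by (auto simp: free_alg_simps free_alg_carrier conv_add_left conv_add_right)
qed

lemma free_alg_induct [consumes 1, case_names zero single add]:
 assumes p: "p#:(free_alg R Z)"
  and zero: "P (%w. \<zero>)"
  and single: "!!c w. c#:R ==> w:lists Z ==> P (single c w)"
  and add: "!!p q. p#:(free_alg R Z) ==> q#:(free_alg R Z) ==> P p ==> P q ==> P (%w. p w .+ q w)"
 shows "P p"
proof -
 have "finite S ==> p#:(free_alg R Z) ==> {w. p w ~= \<zero>} <= S ==> P p" for S p
 proof (induction S arbitrary: p rule: finite_induct)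
  case empty
  hence "p = (%w. \<zero>)" by auto
  thus ?case using zero by simp
 next
  case (insert u S)
  let ?q = "p(u := \<zero>)"
  have pu: "p u#:R" using insert.prems by (simp add: free_alg_carrier)
  have q: "?q#:(free_alg R Z)"
   using insert.prems(1) unfolding free_alg_carrier
   by (auto intro: finite_subset[of _ "{w. p w ~= \<zero>}"])
  hence Pq: "P ?q" by (rule insert.IH) (use insert.prems in auto)
  show ?case
  proof (cases "p u = \<zero>")
   case True
   hence "?q = p" by auto
   thus ?thesis using Pq by simp
  next
   case False
   hence u: "u:lists Z" using insert.prems by (simp add: free_alg_carrier)
   have "p = (%w. ?q w .+ single (p u) u w)"
    using insert.prems(1) by (auto simp: single_def free_alg_carrier)
   thus ?thesis using add[OF q single_closed[OF pu u] Pq single[OF pu u]] by simp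
  qed
 qed
 thus ?thesis using p by (simp add: free_alg_carrier) (metis free_alg_carrier p subset_refl)
qed

end

section \<open>The enveloping algebra\<close>

declare in_listsD [rule del] in_listsI [rule del]

context lie_algebroid
begin

abbreviation U where "U == env_alg K R L"
abbreviation F where "F == free_RL K R L"
abbreviation I where "I == env_ideal K R L"
abbreviation Z where "Z == carrier (sum_lie R L)"
abbreviation uR where "uR == env_of_R K R L"
abbreviation uL where "uL == env_of_L K R L"
abbreviation cls where "cls p == I +>\<^bsub>F\<^esub> p"

lemma sum_lie_simps [simp]:
 "(r, x)#:(sum_lie R L) <-> r#:R & x#:L"
 "ring.zero (sum_lie R L) = (0[R], 0[L])"
 "(r, x) +[sum_lie R L] (s, y) = (r +! s, x +: y)"
 "a **[sum_lie R L] (r, x) = (a *! r, a *: x)"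
 "bracket (sum_lie R L) (r, x) (s, y) = (x |> s -! y |> r, br x y)"
 by (simp_all add: sum_lie_def)

end

sublocale lie_algebroid < F: ring F
 by (rule K.free_alg_ring)

context lie_algebroid
begin

lemma gen_closed [simp]: "z:Z ==> gen K z#:F"
 by (auto simp: K.gen_single)

lemma F_smult: 
 assumes "c#:K" "p#:F"
 shows "c **[F] p = K.single c [] *[F] p" "c **[F] p#:F"
proof -
 show e: "c **[F] p = K.single c [] *[F] p"
  using assms by (auto simp: K.free_alg_simps K.free_alg_carrier K.conv_single)
 show "c **[F] p#:F" unfolding e by (rule F.m_closed) (use assms in auto)
qed

lemma env_rels_closed: "env_rels K R L <= carrier F"
proof
 fix p assume "p:env_rels K R L"
 thus "p#:F"
  unfolding env_rels_def lie_env_rels_def Let_def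
  by (auto intro!: F.minus_closed F.a_closed F.m_closed gen_closed F_smult)
qed

lemma I_ideal: "ideal I F"
 unfolding env_ideal_def by (rule F.genideal_ideal[OF env_rels_closed])

lemma rel_cls:
 assumes "p -[F] q:env_rels K R L" "p#:F" "q#:F"
 shows "cls p = cls q"
proof -
 interpret I: ideal I F by (rule I_ideal)
 have "p -[F] q:I" using assms(1) F.genideal_self[OF env_rels_closed] by (auto simp: env_ideal_def)
 thus ?thesis using assms F.quotient_eq_iff_same_a_r_cos[OF I_ideal] by blast
qed

end

sublocale lie_algebroid < U: ring U
 unfolding env_alg_def by (rule ideal.quotient_is_ring[OF I_ideal])

context lie_algebroid
begin

lemma cls_hom: "cls:ring_hom F U"
 unfolding env_alg_def by (rule ideal.rcos_ring_hom[OF I_ideal])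

lemma cls_closed [simp]: "p#:F ==> cls p#:U"
 and cls_mult: "p#:F ==> q#:F ==> cls (p *[F] q) = cls p *[U] cls q"
 and cls_add: "p#:F ==> q#:F ==> cls (p +[F] q) = cls p +[U] cls q"
 and cls_one: "cls 1[F] = 1[U]"
 using cls_hom by (auto simp: ring_hom_def)

lemma cls_zero: "cls 0[F] = 0[U]"
 using cls_add[of "0[F]" "0[F]"] by (metis F.l_zero F.zero_closed U.add.r_cancel_one' cls_closed)

lemma cls_minus: "p#:F ==> q#:F ==> cls (p -[F] q) = cls p -[U] cls q"
 using ring_hom_ring.axioms cls_add[of "p -[F] q" q]
 by (metis F.add.inv_solve_right F.minus_closed F.minus_eq U.add.inv_solve_right U.minus_eq cls_closed)

lemma U_cases:
 assumes "D#:U" obtains p where "p#:F" "D = cls p"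
 using assms unfolding env_alg_def FactRing_def A_RCOSETS_def' by auto

lemma uR_closed [simp]: "r#:R ==> uR r#:U"
 unfolding env_of_R_def by (rule cls_closed) simp

lemma uL_closed [simp]: "x#:L ==> uL x#:U"
 unfolding env_of_L_def by (rule cls_closed) simp

lemma env_rels_mem:
 shows "z:Z ==> z':Z ==> gen K (z +[sum_lie R L] z') -[F] (gen K z +[F] gen K z'):env_rels K R L"
  and "c#:K ==> z:Z ==> gen K (kap c **[sum_lie R L] z) -[F] (c **[F] gen K z):env_rels K R L"
  and "z:Z ==> z':Z ==> (gen K z *[F] gen K z' -[F] gen K z' *[F] gen K z) -[F] gen K (bracket (sum_lie R L) z z'):env_rels K R L"
  and "r#:R ==> z:Z ==> gen K (r, 0[L]) *[F] gen K z -[F] gen K (r **[sum_lie R L] z):env_rels K R L"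
  and "gen K (1[R], 0[L]) -[F] 1[F]:env_rels K R L"
 unfolding env_rels_def lie_env_rels_def Let_def by blast+

lemma gen_rel_add: 
 assumes "z:Z" "z':Z"
 shows "cls (gen K (z +[sum_lie R L] z')) = cls (gen K z) +[U] cls (gen K z')"
proof -
 have c: "z +[sum_lie R L] z':Z" using assms by (cases z; cases z') auto
 have "cls (gen K (z +[sum_lie R L] z')) = cls (gen K z +[F] gen K z')"
  by (rule rel_cls[OF env_rels_mem(1)]) (use assms c in simp_all)
 thus ?thesis using assms by (simp add: cls_add)
qed

lemma gen_rel_kap:
 assumes "c#:K" "z:Z"
 shows "cls (gen K (kap c **[sum_lie R L] z)) = cls (c **[F] gen K z)"
proof -
 have c: "kap c **[sum_lie R L] z:Z" using assms by (cases z) auto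
 show ?thesis
  by (rule rel_cls[OF env_rels_mem(2)]) (use assms c F_smult(2) in simp_all)
qed

lemma gen_rel_bracket:
 assumes "z:Z" "z':Z"
 shows "cls (gen K (bracket (sum_lie R L) z z')) = cls (gen K z) *[U] cls (gen K z') -[U] cls (gen K z') *[U] cls (gen K z)"
proof -
 have c: "bracket (sum_lie R L) z z':Z" using assms by (cases z; cases z') auto
 have "cls (gen K z *[F] gen K z' -[F] gen K z' *[F] gen K z) = cls (gen K (bracket (sum_lie R L) z z'))"
  by (rule rel_cls[OF env_rels_mem(3)]) (use assms c in simp_all)
 thus ?thesis using assms by (simp add: cls_mult cls_minus)
qed

lemma gen_rel_smult:
 assumes "r#:R" "z:Z"
 shows "cls (gen K (r **[sum_lie R L] z)) = uR r *[U] cls (gen K z)"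
proof -
 have c: "r **[sum_lie R L] z:Z" "(r, 0[L]):Z" using assms by (cases z; auto)+
 have "cls (gen K (r, 0[L]) *[F] gen K z) = cls (gen K (r **[sum_lie R L] z))"
  by (rule rel_cls[OF env_rels_mem(4)]) (use assms c in simp_all)
 thus ?thesis using assms c by (simp add: cls_mult env_of_R_def)
qed

lemma gen_uR_uL: "r#:R ==> x#:L ==> cls (gen K (r, x)) = uR r +[U] uL x"
 using gen_rel_add[of "(r, 0[L])" "(0[R], x)"] by (simp add: env_of_R_def env_of_L_def)

lemma uR_one [simp]: "uR 1[R] = 1[U]"
proof -
 have "cls (gen K (1[R], 0[L])) = cls 1[F]"
  by (rule rel_cls[OF env_rels_mem(5)]) simp_all
 thus ?thesis by (simp add: env_of_R_def cls_one)
qed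

lemma uR_add: "r#:R ==> s#:R ==> uR (r +! s) = uR r +[U] uR s"
 using gen_rel_add[of "(r, 0[L])" "(s, 0[L])"] by (simp add: env_of_R_def)

lemma uL_add: "x#:L ==> y#:L ==> uL (x +: y) = uL x +[U] uL y"
 using gen_rel_add[of "(0[R], x)" "(0[R], y)"] by (simp add: env_of_L_def)

lemma uR_mult: "r#:R ==> s#:R ==> uR (r *! s) = uR r *[U] uR s"
 using gen_rel_smult[of r "(s, 0[L])"] by (simp add: env_of_R_def)

lemma uL_smult: "r#:R ==> x#:L ==> uL (r *: x) = uR r *[U] uL x"
 using gen_rel_smult[of r "(0[R], x)"] by (simp add: env_of_L_def)

lemma uR_zero [simp]: "uR 0[R] = 0[U]"
 using uR_add[of "0[R]" "0[R]"] by (metis R.l_zero R.zero_closed U.add.r_cancel_one' uR_closed)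

lemma uL_zero [simp]: "uL 0[L] = 0[U]"
 using uL_add[of "0[L]" "0[L]"] by (metis L.l_zero L.zero_closed U.add.r_cancel_one' uL_closed)

lemma U_swap: "a#:U ==> b#:U ==> c#:U ==> c = a -[U] b ==> a = b +[U] c"
 by (simp add: U.minus_eq U.a_ac U.r_neg2 U.r_neg1 U.r_neg)

lemma uL_uR: "x#:L ==> r#:R ==> uL x *[U] uR r = uR r *[U] uL x +[U] uR (x |> r)"
 by (rule U_swap) (use gen_rel_bracket[of "(0[R], x)" "(r, 0[L])"] in "simp_all add: env_of_R_def env_of_L_def")

lemma uL_bracket: "x#:L ==> y#:L ==> uL x *[U] uL y = uL y *[U] uL x +[U] uL (br x y)"
 by (rule U_swap) (use gen_rel_bracket[of "(0[R], x)" "(0[R], y)"] in "simp_all add: env_of_L_def")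

lemma cls_const: 
 assumes "c#:K"
 shows "cls (K.single c []) = uR (kap c)"
proof -
 have "cls (K.single c []) = cls (K.single c []) *[U] cls (gen K (1[R], 0[L]))"
  using uR_one assms by (simp add: env_of_R_def)
 also have "... = cls (c **[F] gen K (1[R], 0[L]))"
  using assms by (simp add: F_smult cls_mult)
 also have "... = uR (kap c)"
  using gen_rel_kap[of c "(1[R], 0[L])"] assms by (simp add: env_of_R_def)
 finally show ?thesis .
qed

definition mon where "mon w = foldr (%x D. uL x *[U] D) w 1[U]"

lemma mon_Nil [simp]: "mon [] = 1[U]" and mon_Cons [simp]: "mon (x # w) = uL x *[U] mon w"
 by (simp_all add: mon_def)

lemma mon_closed [simp]: "w:lists (carrier L) ==> mon w#:U"
 by (induction w) auto

lemma mon_append: "v:lists (carrier L) ==> w:lists (carrier L) ==> mon (v @ w) = mon v *[U] mon w"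
 by (induction v) (auto simp: U.m_assoc)

text \<open>The spanning half of a normal form: scalars can be moved to the left through
  \<open>uL_uR\<close>, so this left \<open>R\<close>-span is stable under multiplication by
  generators and is all of \<open>U\<close>.\<close>

inductive_set mspan where
 base: "r#:R ==> w:lists (carrier L) ==> uR r *[U] mon w:mspan"
| add: "D:mspan ==> E:mspan ==> D +[U] E:mspan"

lemma mspan_closed: "D:mspan ==> D#:U"
 by (induction rule: mspan.induct) auto

lemma mspan_uR: "D:mspan ==> s#:R ==> uR s *[U] D:mspan"
proof (induction rule: mspan.induct)
 case (base r w)
 hence "uR s *[U] (uR r *[U] mon w) = uR (s *! r) *[U] mon w" by (simp add: uR_mult U.m_assoc)
 thus ?case using base mspan.base[of "s *! r" w] by simp
next
 case (add D E)
 thus ?case by (simp add: U.r_distr mspan_closed mspan.add)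
qed

lemma uL_base: 
 assumes "x#:L" "r#:R" "D#:U"
 shows "uL x *[U] (uR r *[U] D) = uR r *[U] (uL x *[U] D) +[U] uR (x |> r) *[U] D"
 using assms by (simp add: U.m_assoc[symmetric] uL_uR U.l_distr)

lemma mspan_uL: "D:mspan ==> x#:L ==> uL x *[U] D:mspan"
proof (induction rule: mspan.induct)
 case (base r w)
 thus ?case using mspan.base[of r "x # w"] mspan.base[of "x |> r" w] by (simp add: uL_base mspan.add)
next
 case (add D E)
 thus ?case by (simp add: U.r_distr mspan_closed mspan.add)
qed

lemma cls_single_mspan: "w:lists Z ==> c#:K ==> cls (K.single c w):mspan"
proof (induction w)
 case Nil
 thus ?case using mspan.base[of "kap c" "[]"] by (simp add: cls_const)
next
 case (Cons z w)
 obtain r x where z: "z = (r, x)" by (cases z)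
 have w: "w:lists Z" and zZ: "z:Z" using Cons.prems(1) by simp_all
 hence rx: "r#:R" "x#:L" using z by simp_all
 have "K.single c (z # w) = gen K z *[F] K.single c w"
  using Cons.prems(2) by (simp add: K.gen_single K.free_alg_simps K.conv_single_single)
 hence "cls (K.single c (z # w)) = (uR r +[U] uL x) *[U] cls (K.single c w)"
  using gen_uR_uL[OF rx] z zZ w Cons.prems(2) by (simp add: cls_mult)
 also have "... = uR r *[U] cls (K.single c w) +[U] uL x *[U] cls (K.single c w)"
  using rx w Cons.prems(2) by (simp add: U.l_distr)
 finally show ?case
  using mspan.add[OF mspan_uR mspan_uL] Cons.IH[OF w Cons.prems(2)] rx by simp
qed

lemma mspan_all:
 assumes "D#:U" shows "D:mspan"
proof -
 obtain p where p: "p#:F" and D: "D = cls p" using assms by (rule U_cases)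
 from p have "cls p:mspan"
 proof (induction rule: K.free_alg_induct)
  case zero
  have "cls (%w. 0[K]) = uR 0[R] *[U] mon []"
   using cls_zero by (simp add: K.free_alg_simps)
  thus ?case using mspan.base[of "0[R]" "[]"] by simp
 next
  case (single c w)
  thus ?case by (intro cls_single_mspan)
 next
  case (add p q)
  thus ?case using cls_add[of p q] by (simp add: K.free_alg_simps mspan.add)
 qed
 thus ?thesis using D by simp
qed

lemma U_induct [consumes 1, case_names base add]:
 assumes "D#:U"
  and "!!r w. r#:R ==> w:lists (carrier L) ==> P (uR r *[U] mon w)"
  and "!!D E. D#:U ==> E#:U ==> P D ==> P E ==> P (D +[U] E)"
 shows "P D"
proof -
 have "D:mspan" by (rule mspan_all[OF assms(1)])
 thus ?thesis by (induction rule: mspan.induct) (use assms mspan_closed in auto)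
qed

lemma U_gen_induct [consumes 1, case_names one uR uL add]:
 assumes D: "D#:U" and one: "P 1[U]"
  and uR: "!!r D. r#:R ==> D#:U ==> P D ==> P (uR r *[U] D)"
  and uL: "!!x D. x#:L ==> D#:U ==> P D ==> P (uL x *[U] D)"
  and add: "!!D E. D#:U ==> E#:U ==> P D ==> P E ==> P (D +[U] E)"
 shows "P D"
 using D
proof (induction rule: U_induct)
 case (base r w)
 have "P (mon w)" using base(2) by (induction w) (auto intro: one uL)
 thus ?case using base uR by simp
qed (rule add)

end

subsection \<open>Representations\<close>

lemma (in abelian_group) add_minus_cancel: "b#:G ==> c#:G ==> b .+ c .- b .- c = \<zero>"
 by algebra

text \<open>Besides \<open>K\<close>-linearity the assumptions are the defining relations of
  \<open>U\<close>, read as identities between operators. The bracket relation is written without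
  subtraction.\<close>

locale env_rep = lie_algebroid K R L + M: module K M
 for K :: "'k ring" and R :: "('k, 'r) module" and L :: "('r, 'l) lie_module" and M :: "('k, 'a, 'm) module_scheme" +
 fixes g :: "'r \<times> 'l => 'a => 'a"
 assumes g_closed: "[|r#:R; x#:L; m#:M|] ==> g (r, x) m#:M"
  and g_add: "[|r#:R; x#:L; m#:M; m'#:M|]
   ==> g (r, x) (m +[M] m') = g (r, x) m +[M] g (r, x) m'"
  and g_scal: "[|r#:R; x#:L; m#:M; c#:K|]
   ==> g (r, x) (c **[M] m) = c **[M] g (r, x) m"
  and g_plus: "[|r#:R; x#:L; s#:R; y#:L; m#:M|]
   ==> g (r +[R] s, x +[L] y) m = g (r, x) m +[M] g (s, y) m"
  and g_kap: "[|r#:R; x#:L; m#:M; c#:K|]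
   ==> g (base_scalar R c *[R] r, base_scalar R c **[L] x) m = c **[M] g (r, x) m"
  and g_bracket: "[|r#:R; x#:L; s#:R; y#:L; m#:M|]
   ==> g (r, x) (g (s, y) m) = g (s, y) (g (r, x) m) +[M] g (anchor L x s -[R] anchor L y r, br x y) m"
  and g_mult: "[|r#:R; s#:R; x#:L; m#:M|]
   ==> g (r, 0[L]) (g (s, x) m) = g (r *[R] s, r **[L] x) m"
  and g_one: "m#:M ==> g (1[R], 0[L]) m = m"
begin

definition rho where "rho p m = (\<Oplus>\<^bsub>M\<^esub>w\<in>{w. p w ~= 0[K]}. p w **[M] foldr g w m)"

lemma g_closed' [simp]: "z:Z ==> m#:M ==> g z m#:M"
 using g_closed by (cases z) simp

lemma g_add': "z:Z ==> m#:M ==> m'#:M ==> g z (m +[M] m') = g z m +[M] g z m'"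
 using g_add by (cases z) simp

lemma g_scal': "z:Z ==> m#:M ==> c#:K ==> g z (c **[M] m) = c **[M] g z m"
 using g_scal by (cases z) simp

lemma foldr_closed [simp]: "w:lists Z ==> m#:M ==> foldr g w m#:M"
 by (induction w) (auto)

lemma rho_alt:
 assumes "p#:F" "finite S" "{w. p w ~= 0[K]} <= S" "S <= lists Z" "m#:M"
 shows "rho p m = (\<Oplus>\<^bsub>M\<^esub>w\<in>S. p w **[M] foldr g w m)"
 unfolding rho_def
 by (rule M.add.finprod_mono_neutral_cong_left[folded finsum_def, simplified])
  (use assms in "auto simp: K.free_alg_carrier")

lemma rho_closed [simp]: "p#:F ==> m#:M ==> rho p m#:M"
 unfolding rho_def by (rule M.finsum_closed) (auto simp: K.free_alg_carrier)

lemma rho_add: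
 assumes p: "p#:F" and q: "q#:F" and m: "m#:M"
 shows "rho (%w. p w +[K] q w) m = rho p m +[M] rho q m"
proof -
 let ?S = "{w. p w ~= 0[K]} \<union> {w. q w ~= 0[K]}"
 have S: "finite ?S" "?S <= lists Z" using p q by (auto simp: K.free_alg_carrier)
 have pq: "(%w. p w +[K] q w)#:F" using F.a_closed[OF p q] by (simp add: K.free_alg_simps)
 have c: "p w#:K" "q w#:K" for w using p q by (auto simp: K.free_alg_carrier)
 have "rho (%w. p w +[K] q w) m = (\<Oplus>\<^bsub>M\<^esub>w\<in>?S. (p w +[K] q w) **[M] foldr g w m)"
  by (rule rho_alt[OF pq S(1) _ S(2) m]) (use c in auto)
 also have "... = (\<Oplus>\<^bsub>M\<^esub>w\<in>?S. p w **[M] foldr g w m +[M] q w **[M] foldr g w m)"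
  by (rule M.finsum_cong') (use S m c in "auto simp: M.smult_l_distr")
 also have "... = (\<Oplus>\<^bsub>M\<^esub>w\<in>?S. p w **[M] foldr g w m) +[M] (\<Oplus>\<^bsub>M\<^esub>w\<in>?S. q w **[M] foldr g w m)"
  by (rule M.finsum_addf) (use S m c in "auto")
 also have "... = rho p m +[M] rho q m"
  using rho_alt[OF p S(1) _ S(2) m] rho_alt[OF q S(1) _ S(2) m] by simp
 finally show ?thesis .
qed

lemma rho_single:
 assumes "c#:K" "w:lists Z" "m#:M"
 shows "rho (K.single c w) m = c **[M] foldr g w m"
proof -
 have "rho (K.single c w) m = (\<Oplus>\<^bsub>M\<^esub>u\<in>{w}. K.single c w u **[M] foldr g u m)"
  by (rule rho_alt[OF K.single_closed]) (use assms in "auto simp: K.single_def split: if_splits")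
 thus ?thesis using assms by (simp add: K.single_def)
qed

lemma rho_zero: "m#:M ==> rho (%w. 0[K]) m = 0[M]"
 by (simp add: rho_def)

lemma g_zero: "z:Z ==> g z 0[M] = 0[M]"
 using g_scal'[of z "0[M]" "0[K]"] by simp

lemma foldr_add: "w:lists Z ==> m#:M ==> m'#:M ==>
  foldr g w (m +[M] m') = foldr g w m +[M] foldr g w m'"
 by (induction w) (auto simp: g_add')

lemma foldr_scal: "w:lists Z ==> m#:M ==> c#:K ==>
  foldr g w (c **[M] m) = c **[M] foldr g w m"
 by (induction w) (auto simp: g_scal')

lemma rho_add_right:
 assumes "p#:F" "m#:M" "m'#:M"
 shows "rho p (m +[M] m') = rho p m +[M] rho p m'"
 using assms(1)
proof (induction rule: K.free_alg_induct)
 case (single c w)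
 thus ?case using assms by (simp add: rho_single foldr_add M.smult_r_distr)
next
 case (add p q)
 thus ?case using assms by (simp add: rho_add M.add.m_ac)
qed (use assms in "simp add: rho_zero")

lemma rho_scal:
 assumes "p#:F" "m#:M" "c#:K"
 shows "rho p (c **[M] m) = c **[M] rho p m"
 using assms(1)
proof (induction rule: K.free_alg_induct)
 case (single d w)
 thus ?case using assms
  by (simp add: rho_single foldr_scal M.smult_assoc1[symmetric] K.m_comm)
next
 case (add p q)
 thus ?case using assms by (simp add: rho_add M.smult_r_distr)
qed (use assms in "simp add: rho_zero")

lemma rho_mult:
 assumes p: "p#:F" and q: "q#:F" and m: "m#:M"
 shows "rho (p *[F] q) m = rho p (rho q m)"
 using p
proof (induction rule: K.free_alg_induct)
 case zero
 thus ?case using F.l_null[OF q] m q by (simp add: K.free_alg_simps(1) rho_zero)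
next
 case (single c u)
 show ?case using q
 proof (induction rule: K.free_alg_induct)
  case zero
  have "K.single c u *[F] (%w. 0[K]) = (%w. 0[K])" 
   using F.r_null[of "K.single c u"] single by (simp add: K.free_alg_simps(1))
  moreover have "foldr g u 0[M] = 0[M]" using single(2) by (induction u) (auto simp: g_zero)
  ultimately show ?case using single m by (simp add: rho_zero rho_single)
 next
  case (single d v)
  with \<open>c#:K\<close> \<open>u:lists Z\<close> m show ?case
   by (simp add: K.free_alg_simps K.conv_single_single rho_single foldr_scal M.smult_assoc1)
 next
  case (add q r)
  have s: "K.single c u#:F" using single by (rule K.single_closed)
  have "K.single c u *[F] (%w. q w +[K] r w) = (%w. (K.single c u *[F] q) w +[K] (K.single c u *[F] r) w)"
   using F.r_distr[OF add(1,2) s] by (simp add: K.free_alg_simps(2))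
  thus ?case using add s m by (simp add: rho_add rho_add_right)
 qed
next
 case (add p p')
 have "(%w. p w +[K] p' w) *[F] q = (%w. (p *[F] q) w +[K] (p' *[F] q) w)"
  using F.l_distr[OF add(1,2) q] by (simp add: K.free_alg_simps(2))
 thus ?case using add q m by (simp add: rho_add)
qed

lemma rho_gen: "z:Z ==> m#:M ==> rho (gen K z) m = g z m"
 by (simp add: K.gen_single rho_single)

lemma rho_minus:
 assumes p: "p#:F" and q: "q#:F" and m: "m#:M"
 shows "rho (p -[F] q) m = rho p m -[M] rho q m"
proof -
 have "p = (p -[F] q) +[F] q" using p q by (simp add: F.minus_eq F.a_assoc F.l_neg)
 hence "rho p m = rho (p -[F] q) m +[M] rho q m"
  using rho_add[OF F.minus_closed[OF p q] q m] by (simp add: K.free_alg_simps)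
 thus ?thesis using p q m by (simp add: a_minus_def M.add.m_assoc M.r_neg)
qed

lemma rho_rels:
 assumes "p:env_rels K R L" "m#:M" shows "rho p m = 0[M]"
proof -
 note m = assms(2)
 have add': "rho (p +[F] q) m = rho p m +[M] rho q m" if "p#:F" "q#:F" for p q
  using rho_add[OF that m] by (simp add: K.free_alg_simps)
 have smult: "rho (c **[F] p) m = c **[M] rho p m" if "c#:K" "p#:F" for c p
  using that m by (simp add: F_smult rho_mult rho_single)
 from assms(1) consider
  (add) z z' where "z:Z" "z':Z" "p = gen K (z +[sum_lie R L] z') -[F] (gen K z +[F] gen K z')"
 | (kap) c z where "c#:K" "z:Z" "p = gen K (kap c **[sum_lie R L] z) -[F] (c **[F] gen K z)"
 | (br) z z' where "z:Z" "z':Z"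
   "p = (gen K z *[F] gen K z' -[F] gen K z' *[F] gen K z) -[F] gen K (bracket (sum_lie R L) z z')"
 | (smult) r z where "r#:R" "z:Z" "p = gen K (r, 0[L]) *[F] gen K z -[F] gen K (r **[sum_lie R L] z)"
 | (one) "p = gen K (1[R], 0[L]) -[F] 1[F]"
  unfolding env_rels_def lie_env_rels_def Let_def by blast
 thus ?thesis
 proof cases
  case add
  then obtain r x s y where zz: "z = (r, x)" "z' = (s, y)" by (cases z; cases z')
  with add m show ?thesis by (simp add: rho_minus add' rho_gen g_plus g_closed)
 next
  case kap
  then obtain r x where zz: "z = (r, x)" by (cases z)
  with kap m show ?thesis by (simp add: rho_minus F_smult(2) smult rho_gen g_kap g_closed)
 next
  case br
  then obtain r x s y where zz: "z = (r, x)" "z' = (s, y)" by (cases z; cases z')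
  with br m show ?thesis
   by (simp add: rho_minus rho_mult rho_gen g_closed g_bracket[of r x s y] M.add_minus_cancel)
 next
  case smult
  then obtain s x where zz: "z = (s, x)" by (cases z)
  with smult m show ?thesis by (simp add: rho_minus rho_mult rho_gen g_mult g_closed)
 next
  case one
  have "rho 1[F] m = m" using m by (simp add: K.free_alg_simps(3) rho_single)
  with one m show ?thesis by (simp add: rho_minus rho_gen g_one)
 qed
qed

text \<open>The elements of the free algebra that act by zero form a two-sided ideal containing the
  relations. This makes the definite description in \<open>env_act\<close> meaningful.\<close>

lemma rho_ideal:
 assumes "p:I" "m#:M" shows "rho p m = 0[M]"
proof -
 let ?J = "{p\<in>carrier F. ALL m:carrier M. rho p m = 0[M]}"
 have z: "rho p 0[M] = 0[M]" if "p#:F" for p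
  using rho_scal[OF that M.zero_closed K.zero_closed] that by simp
 have "ideal ?J F"
 proof (rule idealI[OF F.ring_axioms])
  show "subgroup ?J (add_monoid F)"
  proof (rule F.add.subgroupI)
   show "?J ~= {}" using rho_zero F.zero_closed by (auto simp: K.free_alg_simps)
   fix a b assume a: "a:?J" and b: "b:?J"
   have "-[F] a = 0[F] -[F] a" using a by (simp add: F.minus_eq)
   thus "-[F] a:?J" using a rho_zero by (auto simp: rho_minus) (auto simp: K.free_alg_simps a_minus_def)
   show "a +[F] b:?J" using a b F.a_closed[of a b] rho_add[of a b] by (auto simp: K.free_alg_simps)
  qed auto
 qed (auto simp: rho_mult z)
 moreover have "env_rels K R L <= ?J" using rho_rels env_rels_closed by auto
 ultimately have "I <= ?J" unfolding env_ideal_def by (rule F.genideal_minimal)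
 thus ?thesis using assms by blast
qed

abbreviation eact where "eact == env_act K M g"

lemma eact_cls:
 assumes p: "p#:F" and m: "m#:M"
 shows "eact (cls p) m = rho p m"
proof -
 interpret I: ideal I F by (rule I_ideal)
 have e: "rho q m = rho p m" if qp: "q:cls p" for q
 proof -
  obtain h where h: "h:I" "q = h +[F] p" using qp by (auto simp: a_r_coset_def r_coset_def)
  thus ?thesis
   using rho_add[OF I.Icarr[OF h(1)] p m] rho_ideal[OF h(1) m] p m by (simp add: K.free_alg_simps)
 qed
 have "p:cls p" by (rule I.a_rcos_self[OF p])
 thus ?thesis unfolding env_act_def rho_def[symmetric]
  by (intro the_equality ballI) (rule e[symmetric], assumption, blast)
qed

lemma eact_closed [simp]: "D#:U ==> m#:M ==> eact D m#:M"
 by (erule U_cases) (simp add: eact_cls)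

lemma eact_add: "D#:U ==> E#:U ==> m#:M ==> eact (D +[U] E) m = eact D m +[M] eact E m"
 by (elim U_cases) (simp add: eact_cls cls_add[symmetric], simp add: K.free_alg_simps rho_add)

lemma eact_mult: "D#:U ==> E#:U ==> m#:M ==> eact (D *[U] E) m = eact D (eact E m)"
 by (elim U_cases) (simp add: eact_cls cls_mult[symmetric] rho_mult)

lemma eact_add_right: "D#:U ==> m#:M ==> m'#:M ==> eact D (m +[M] m') = eact D m +[M] eact D m'"
 by (elim U_cases) (simp add: eact_cls rho_add_right)

lemma eact_uR: "r#:R ==> m#:M ==> eact (uR r) m = g (r, 0[L]) m"
 by (simp add: env_of_R_def eact_cls rho_gen)

lemma eact_uL: "x#:L ==> m#:M ==> eact (uL x) m = g (0[R], x) m"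
 by (simp add: env_of_L_def eact_cls rho_gen)

lemma eact_one: "m#:M ==> eact 1[U] m = m"
 using eact_uR[of "1[R]" m] by (simp add: g_one)

end

section \<open>Tensor powers\<close>

lemmas frag_induct = free_Abelian_group_induct [consumes 1, case_names zero diff of]

context abelian_group
begin

lemma minus_zero_eq:
 assumes "a .- b = \<zero>" "a#:G" "b#:G"
 shows "a = b"
 using assms by (metis a_minus_def a_inv_closed minus_equality minus_minus)

abbreviation lift where "lift == tensor_lift G"

lemma add_pow_int:
 "add_pow G (0::int) a = \<zero>"
 "a#:G ==> add_pow G (1::int) a = a"
 "a#:G ==> add_pow G (k::int) a#:G"
 "a#:G ==> add_pow G (k + l::int) a = add_pow G k a .+ add_pow G l a"
 "a#:G ==> b#:G ==> add_pow G (k::int) (a .+ b) = add_pow G k a .+ add_pow G k b"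
 using group.int_pow_mult[OF a_group, of a k l] group.int_pow_closed[OF a_group, of a k]
  group.int_pow_1[OF a_group, of a]
  comm_group.int_pow_distrib[OF a_comm_group, of a b k]
 by (simp_all add: add_pow_def)

lemma lift_alt:
 assumes "finite S" "supp p <= S" "!!xs. xs:S ==> f xs#:G"
 shows "lift f p = (\<Oplus>xs\<in>S. add_pow G (Poly_Mapping.lookup p xs) (f xs))"
 unfolding tensor_lift_def
 by (rule add.finprod_mono_neutral_cong_left[folded finsum_def, simplified])
  (use assms in "auto simp: in_keys_iff add_pow_int")

lemma lift_closed [simp]: "(!!xs. xs:supp p ==> f xs#:G) ==> lift f p#:G"
 unfolding tensor_lift_def by (rule finsum_closed) (auto intro: add_pow_int)

lemma lift_zero [simp]: "lift f 0 = \<zero>"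
 by (simp add: tensor_lift_def)

lemma lift_frag_of [simp]: "f xs#:G ==> lift f (frag_of xs) = f xs"
 by (simp add: tensor_lift_def add_pow_int)

lemma lift_add:
 assumes "!!xs. xs:supp p \<union> supp q ==> f xs#:G"
 shows "lift f (p + q) = lift f p .+ lift f q"
proof -
 let ?S = "supp p \<union> supp q"
 have S: "finite ?S" by simp
 have "lift f (p + q) = (\<Oplus>xs\<in>?S. add_pow G (Poly_Mapping.lookup p xs) (f xs) .+ add_pow G (Poly_Mapping.lookup q xs) (f xs))"
  by (subst lift_alt[OF S keys_add assms], assumption, rule finsum_cong')
   (use assms in "auto simp: lookup_add add_pow_int")
 also have "... = lift f p .+ lift f q"
  by (subst (1 2) lift_alt[OF S _ assms]; (rule Un_upper1 Un_upper2 finsum_addf)?) (use assms in "auto intro!: add_pow_int(3)")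
 finally show ?thesis .
qed

lemma lift_uminus:
 assumes "!!xs. xs:supp p ==> f xs#:G"
 shows "lift f (- p) = .- lift f p"
proof -
 have "lift f p .+ lift f (- p) = \<zero>"
  using lift_add[of p "- p" f] assms by simp
 thus ?thesis using assms by (metis lift_closed keys_minus minus_equality a_comm)
qed

lemma lift_diff:
 assumes "!!xs. xs:supp p \<union> supp q ==> f xs#:G"
 shows "lift f (p - q) = lift f p .- lift f q"
 using lift_add[of p "- q" f] assms by (simp add: lift_uminus a_minus_def)

lemma lift_hom:
 assumes H: "abelian_group H" and "supp p <= S" "!!xs. xs:S ==> f xs#:G"
  and h: "!!a. a#:G ==> h a#:H"
  "!!a b. a#:G ==> b#:G ==> h (a .+ b) = h a +[H] h b"
 shows "h (lift f p) = tensor_lift H (%xs. h (f xs)) p"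
proof -
 interpret H: abelian_group H by (rule H)
 have h0: "h \<zero> = 0[H]" using h(2)[of \<zero> \<zero>] h(1)[of \<zero>] by simp
 have "h (.- a) = -[H] h a" if a: "a#:G" for a
  using h(2)[of ".- a" a] a h h0 by (metis H.minus_equality a_inv_closed l_neg)
 hence hm: "h (a .- b) = h a -[H] h b" if "a#:G" "b#:G" for a b
  using that h by (simp add: a_minus_def)
 show ?thesis
  using assms(2)
 proof (induction p rule: frag_induct)
  case zero
  show ?case using h0 by simp
 next
  case (diff x y)
  have c: "!!xs. xs:supp x \<union> supp y ==> f xs#:G" using diff assms(3) by auto
  thus ?case using diff by (subst lift_diff, simp, subst H.lift_diff) (auto simp: hm h)
 next
  case (of a)
  thus ?case using assms(3) h by simp
 qed
qed

lemma lift_cong: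
 assumes "!!xs. xs:supp p ==> f xs = g xs" "!!xs. xs:supp p ==> g xs#:G"
 shows "lift f p = lift g p"
 unfolding tensor_lift_def by (rule finsum_cong') (use assms in "auto intro: add_pow_int")

lemma lift_plus:
 assumes "!!xs. xs:supp p ==> f xs#:G" "!!xs. xs:supp p ==> g xs#:G"
 shows "lift (%xs. f xs .+ g xs) p = lift f p .+ lift g p"
 unfolding tensor_lift_def
 by (subst finsum_addf[symmetric], (use assms in "auto intro!: add_pow_int(3)")[2], rule finsum_cong')
  (use assms in "auto simp: add_pow_int(5) intro!: add_pow_int(3) a_closed")

end

text \<open>One clause for each family of relations in \<open>tensor_null\<close>: under these
  conditions the sum of \<open>f\<close> over the terms of a representative depends only on the
  class.\<close>

definition balanced ::
  "('b, 'q) ring_scheme => 'r set => ('a, 'm) ring_scheme => ('a => 'r => 'a) => ('r => 'a => 'a) => nat => 'a set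
   => ('a list => 'b) => bool" where
 "balanced T A M ra la n Z f <-> (ALL xs:tuples M n. f xs#:T & (set xs \<inter> Z ~= {} --> f xs = 0[T]))
  & (ALL xs a ys. ALL b:carrier M. xs @ [a] @ ys:tuples M n -->
     f (xs @ [a +[M] b] @ ys) = f (xs @ [a] @ ys) +[T] f (xs @ [b] @ ys))
  & (ALL xs a b ys. ALL r:A. xs @ [a, b] @ ys:tuples M n --> f (xs @ [ra a r, b] @ ys) = f (xs @ [a, la r b] @ ys))"

lemma tuples_iff: "xs:tuples M n <-> set xs <= carrier M & length xs = n"
 by (auto simp: tuples_def lists_eq_set)

lemma append_single2: "xs @ a # ys = [p, q] <-> (xs = [] & a = p & ys = [q]) | (xs = [p] & a = q & ys = [])"
 by (cases xs; cases "tl xs") auto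

lemma balanced2I:
 assumes "!!a b. a#:M ==> b#:M ==> f [a, b]#:T"
  and "!!a b. a#:M ==> b#:M ==> a:Z | b:Z ==> f [a, b] = 0[T]"
  and "!!a a' b. a#:M ==> a'#:M ==> b#:M ==> f [a +[M] a', b] = f [a, b] +[T] f [a', b]"
  and "!!a b b'. a#:M ==> b#:M ==> b'#:M ==> f [a, b +[M] b'] = f [a, b] +[T] f [a, b']"
  and "!!a b r. a#:M ==> b#:M ==> r:A ==> f [ra a r, b] = f [a, la r b]"
 shows "balanced T A M ra la 2 Z f"
proof -
 have 1: "EX a b. xs = [a, b] & a#:M & b#:M" if "xs:tuples M 2" for xs
  using that by (cases xs; cases "tl xs") (auto simp: tuples_iff)
 show ?thesis
  unfolding balanced_def
 proof (intro conjI ballI allI impI)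
  fix xs assume "xs:tuples M 2"
  then obtain a b where "xs = [a, b]" "a#:M" "b#:M" using 1 by blast
  thus "f xs#:T" "set xs \<inter> Z ~= {} ==> f xs = 0[T]" using assms by auto
 next
  fix xs a ys b assume b: "b#:M" and x: "xs @ [a] @ ys:tuples M 2"
  obtain p q where pq: "xs @ a # ys = [p, q]" "p#:M" "q#:M" using 1[OF x] by auto
  thus "f (xs @ [a +[M] b] @ ys) = f (xs @ [a] @ ys) +[T] f (xs @ [b] @ ys)"
   using assms b by (auto simp: append_single2)
 next
  fix xs a b ys r assume r: "r:A" and x: "xs @ [a, b] @ ys:tuples M 2"
  hence "xs = []" "ys = []" "a#:M" "b#:M" by (auto simp: tuples_iff)
  thus "f (xs @ [ra a r, b] @ ys) = f (xs @ [a, la r b] @ ys)" using assms(5) r by simp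
 qed
qed

lemma append_single3: "xs @ a # ys = [p, q, t] <-> (xs = [] & a = p & ys = [q, t]) | (xs = [p] & a = q & ys = [t])
  | (xs = [p, q] & a = t & ys = [])"
 by (cases xs; cases "tl xs"; cases "tl (tl xs)") auto

lemma balanced3I:
 assumes "!!a b c. a#:M ==> b#:M ==> c#:M ==> f [a, b, c]#:T"
  and "!!a b c. a#:M ==> b#:M ==> c#:M ==> a:Z | b:Z | c:Z ==> f [a, b, c] = 0[T]"
  and "!!a a' b c. [|a#:M; a'#:M; b#:M; c#:M|] ==> f [a +[M] a', b, c] = f [a, b, c] +[T] f [a', b, c]"
  and "!!a b b' c. [|a#:M; b'#:M; b#:M; c#:M|] ==> f [a, b +[M] b', c] = f [a, b, c] +[T] f [a, b', c]"
  and "!!a b c c'. [|a#:M; c'#:M; b#:M; c#:M|] ==> f [a, b, c +[M] c'] = f [a, b, c] +[T] f [a, b, c']"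
  and "!!a b c r. [|a#:M; b#:M; c#:M; r:A|] ==> f [ra a r, b, c] = f [a, la r b, c]"
  and "!!a b c r. [|a#:M; b#:M; c#:M; r:A|] ==> f [a, ra b r, c] = f [a, b, la r c]"
 shows "balanced T A M ra la 3 Z f"
proof -
 have 1: "EX a b c. xs = [a, b, c] & a#:M & b#:M & c#:M" if "xs:tuples M 3" for xs
  using that by (cases xs; cases "tl xs"; cases "tl (tl xs)") (auto simp: tuples_iff)
 show ?thesis
  unfolding balanced_def
 proof (intro conjI ballI allI impI)
  fix xs assume "xs:tuples M 3"
  then obtain a b c where "xs = [a, b, c]" "a#:M" "b#:M" "c#:M" using 1 by blast
  thus "f xs#:T" "set xs \<inter> Z ~= {} ==> f xs = 0[T]" using assms(1,2) by auto
 next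
  fix xs a ys b assume b: "b#:M" and x: "xs @ [a] @ ys:tuples M 3"
  obtain p q t where pq: "xs @ a # ys = [p, q, t]" "p#:M" "q#:M" "t#:M" using 1[OF x] by auto
  thus "f (xs @ [a +[M] b] @ ys) = f (xs @ [a] @ ys) +[T] f (xs @ [b] @ ys)"
   using assms(3-5) b by (auto simp: append_single3)
 next
  fix xs a b ys r assume r: "r:A" and x: "xs @ [a, b] @ ys:tuples M 3"
  obtain p q t where pq: "xs @ a # (b # ys) = [p, q, t]" "p#:M" "q#:M" "t#:M" using 1[OF x] by auto
  thus "f (xs @ [ra a r, b] @ ys) = f (xs @ [a, la r b] @ ys)"
   using assms(6,7) r by (auto simp: append_single3)
 qed
qed

locale tensor_power = M: abelian_group M
 for A :: "'r set" and M :: "('a, 'm) ring_scheme" and ra :: "'a => 'r => 'a" and la :: "'r => 'a => 'a"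
  and n :: nat and Z :: "'a set" +
 assumes ra_closed: "r:A ==> a#:M ==> ra a r#:M"
  and la_closed: "r:A ==> a#:M ==> la r a#:M"
begin

abbreviation FG where "FG == free_Abelian_group (tuples M n)"
abbreviation Null where "Null == tensor_null A M ra la n Z"
abbreviation cl where "cl == tensor_class A M ra la n Z"
abbreviation TG where "TG == tensor_group A M ra la n Z"

text \<open>The tensor group in additive form, so that the sums \<open>tensor_lift\<close> can take
  values in it.\<close>

definition TA :: "('a list \<Rightarrow>\<^sub>0 int) set ring" where
 "TA = \<lparr>carrier = carrier TG, monoid.mult = undefined, one = undefined, ring.zero = 1[TG], add = monoid.mult TG\<rparr>"

definition rels where "rels =
 {frag_of (xs @ [a +[M] b] @ ys) - frag_of (xs @ [a] @ ys) - frag_of (xs @ [b] @ ys)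
     | xs a b ys. xs @ [a] @ ys:tuples M n & b#:M}
  \<union> {frag_of (xs @ [ra a r, b] @ ys) - frag_of (xs @ [a, la r b] @ ys)
     | xs a b r ys. xs @ [a, b] @ ys:tuples M n & r:A}
  \<union> {frag_of xs | xs. xs:tuples M n & set xs \<inter> Z ~= {}}"

lemma Null_rels: "Null = generate FG rels"
 by (simp add: tensor_null_def rels_def)

lemma keys_diff2: "supp p <= S ==> supp q <= S ==> supp (p - q) <= S"
 using keys_diff[of p q] by blast

lemma keys_add2: "supp p <= S ==> supp q <= S ==> supp (p + q) <= S"
 using keys_add[of p q] by blast

lemma rels_closed: "rels <= carrier FG"
proof
 fix p assume "p:rels"
 thus "p#:FG"
  unfolding rels_def
  by (elim UnE CollectE exE conjE; simp; (intro keys_diff2)?) (auto simp: tuples_iff ra_closed la_closed)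
qed

interpretation FG: comm_group FG by (rule abelian_free_Abelian_group)

lemma Null_subgroup: "subgroup Null FG"
 unfolding Null_rels by (rule FG.generate_is_subgroup[OF rels_closed])

lemma Null_normal: "Null \<lhd> FG"
 by (rule FG.subgroup_imp_normal[OF Null_subgroup])

interpretation N: normal Null FG by (rule Null_normal)

lemma Null_keys: "p:Null ==> supp p <= tuples M n"
 using N.mem_carrier by auto

lemma Null_zero [simp]: "0:Null" using N.one_closed by simp

lemma Null_add: "p:Null ==> q:Null ==> p + q:Null" using N.m_closed by simp

lemma Null_uminus: "p:Null ==> - p:Null" using N.m_inv_closed[of p] Null_keys by simp

lemma Null_diff: "p:Null ==> q:Null ==> p - q:Null" using Null_add[of p "- q"] Null_uminus by simp

lemma cl_def': "cl p = {h + p | h. h:Null}"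
 by (auto simp: tensor_class_def r_coset_def)

lemma cl_mem: "supp p <= tuples M n ==> q:cl p <-> q - p:Null"
 unfolding cl_def' by (auto intro: exI[of _ "q - p"])

lemma cl_self [simp]: "p:cl p" unfolding cl_def' by (auto intro: exI[of _ 0])

lemma cl_eq_iff: 
 shows "cl p = cl q <-> p - q:Null"
proof
 assume "cl p = cl q"
 hence "p:cl q" using cl_self[of p] by simp
 thus "p - q:Null" unfolding cl_def' by auto
next
 assume a: "p - q:Null"
 have "h + p:cl q" if "h:Null" for h
  unfolding cl_def' using Null_add[OF that a] by (auto intro!: exI[of _ "h + (p - q)"])
 moreover have "h + q:cl p" if "h:Null" for h
  unfolding cl_def' using Null_diff[OF that a] by (auto intro!: exI[of _ "h - (p - q)"])
 ultimately show "cl p = cl q" unfolding cl_def'[of p] cl_def'[of q] by (auto simp: cl_def')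
qed

lemma TG_carrier: "V#:TG <-> (EX p. supp p <= tuples M n & V = cl p)"
 unfolding tensor_group_def carrier_FactGroup tensor_class_def carrier_free_Abelian_group_iff[symmetric] by blast

lemma cl_closed: "supp p <= tuples M n ==> cl p#:TG"
 by (auto simp: TG_carrier)

lemma TG_rep:
 assumes "V#:TG" "p:V"
 shows "supp p <= tuples M n" "V = cl p"
proof -
 obtain q where q: "supp q <= tuples M n" "V = cl q" using assms(1) by (auto simp: TG_carrier)
 hence "p - q:Null" using assms(2) cl_mem by blast
 hence "cl p = cl q" using cl_eq_iff by blast
 thus "V = cl p" using q by simp
 show "supp p <= tuples M n" using keys_add2[OF Null_keys[OF \<open>p - q:Null\<close>] q(1)] by simp
qed

lemma TG_nonempty: "V#:TG ==> EX p. p:V"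
 using TG_carrier cl_self by blast

lemma TG_mult: "supp p <= tuples M n ==> supp q <= tuples M n ==> cl p *[TG] cl q = cl (p + q)"
 using N.rcos_sum[of p q] by (simp add: tensor_group_def tensor_class_def)

lemma TG_one: "1[TG] = cl 0"
 using FG.coset_mult_one[of Null] Null_keys by (simp add: tensor_group_def tensor_class_def subset_eq)

lemma TG_comm_group: "comm_group TG"
 unfolding tensor_group_def by (rule FG.abelian_FactGroup[OF Null_subgroup])

lemma TA_simps [simp]: "carrier TA = carrier TG" "ring.zero TA = 1[TG]" "add TA = monoid.mult TG"
 by (simp_all add: TA_def)

lemma TA_abelian: "abelian_group TA"
proof -
 interpret T: comm_group TG by (rule TG_comm_group)
 show ?thesis
  by (rule abelian_groupI) (auto simp: T.m_ac intro: T.l_inv_ex)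
qed

lemma Null_lift:
 assumes T: "abelian_group T" and b: "balanced T A M ra la n Z f" and p: "p:Null"
 shows "tensor_lift T f p = 0[T]"
proof -
 interpret T: abelian_group T by (rule T)
 have c: "xs:tuples M n ==> f xs#:T" for xs using b unfolding balanced_def by blast
 have r: "tensor_lift T f p = 0[T]" if "p:rels" for p
  using that unfolding rels_def
 proof (elim UnE CollectE exE conjE)
  fix xs a b' ys assume p: "p = frag_of (xs @ [a +[M] b'] @ ys) - frag_of (xs @ [a] @ ys) - frag_of (xs @ [b'] @ ys)"
   and xs: "xs @ [a] @ ys:tuples M n" "b'#:M"
  have t: "xs @ [a +[M] b'] @ ys:tuples M n" "xs @ [b'] @ ys:tuples M n" using xs by (auto simp: tuples_iff)
  note cc = c[OF xs(1)] c[OF t(1)] c[OF t(2)]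
  have "tensor_lift T f p = f (xs @ [a +[M] b'] @ ys) -[T] f (xs @ [a] @ ys) -[T] f (xs @ [b'] @ ys)"
   unfolding p using cc by (subst T.lift_diff, (auto dest!: subsetD[OF keys_diff])[1], subst T.lift_diff) auto
  moreover have "f (xs @ [a +[M] b'] @ ys) = f (xs @ [a] @ ys) +[T] f (xs @ [b'] @ ys)"
   using b xs unfolding balanced_def by blast
  ultimately show ?thesis using cc by (simp add: T.add_minus_cancel)
 next
  fix xs a b' r ys assume p: "p = frag_of (xs @ [ra a r, b'] @ ys) - frag_of (xs @ [a, la r b'] @ ys)"
   and xs: "xs @ [a, b'] @ ys:tuples M n" "r:A"
  have t: "xs @ [ra a r, b'] @ ys:tuples M n" "xs @ [a, la r b'] @ ys:tuples M n"
   using xs ra_closed la_closed by (auto simp: tuples_iff)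
  have "f (xs @ [ra a r, b'] @ ys) = f (xs @ [a, la r b'] @ ys)" using b xs unfolding balanced_def by blast
  thus ?thesis unfolding p using c[OF t(1)] c[OF t(2)] by (subst T.lift_diff) auto
 next
  fix xs assume p: "p = frag_of xs" and xs: "xs:tuples M n" "set xs \<inter> Z ~= {}"
  hence "f xs = 0[T]" using b unfolding balanced_def by blast
  thus ?thesis by (simp add: p)
 qed
 show ?thesis using p unfolding Null_rels
 proof (induction rule: generate.induct)
  case (inv h)
  hence "h#:FG" using rels_closed by blast
  hence "supp h <= tuples M n" by simp
  thus ?case using r[OF inv] c by (simp add: T.lift_uminus subset_iff)
 next
  case (eng h1 h2)
  hence "supp h1 <= tuples M n" "supp h2 <= tuples M n"
   using Null_keys by (auto simp: Null_rels)
  hence "f xs#:T" if "xs:supp h1 \<union> supp h2" for xs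
   using that c by blast
  thus ?case using eng T.lift_add[of h1 h2 f] by simp
 qed (use r in auto)
qed

lemma lift_rep:
 assumes T: "abelian_group T" and b: "balanced T A M ra la n Z f"
  and V: "V#:TG" "p:V" "q:V"
 shows "tensor_lift T f p = tensor_lift T f q"
proof -
 interpret T: abelian_group T by (rule T)
 have c: "xs:tuples M n ==> f xs#:T" for xs using b unfolding balanced_def by blast
 note k = TG_rep(1)[OF V(1,2)] TG_rep(1)[OF V(1,3)]
 have "cl p = cl q" using TG_rep(2)[OF V(1,2)] TG_rep(2)[OF V(1,3)] by (rule subst)
 hence "p - q:Null" using cl_eq_iff by blast
 moreover have c': "f xs#:T" if "xs:supp p \<union> supp q" for xs
  using that k c by blast
 ultimately have "tensor_lift T f p -[T] tensor_lift T f q = 0[T]"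
  using Null_lift[OF T b] T.lift_diff[of p q f, OF c'] by simp
 moreover have "tensor_lift T f p#:T" "tensor_lift T f q#:T"
  by (rule T.lift_closed, use c' in blast)+
 ultimately show ?thesis using T.minus_zero_eq by blast
qed

lemma cl_frag_add:
 assumes "xs @ [a] @ ys:tuples M n" "b#:M"
 shows "cl (frag_of (xs @ [a +[M] b] @ ys)) = cl (frag_of (xs @ [a] @ ys)) *[TG] cl (frag_of (xs @ [b] @ ys))"
proof -
 have t: "xs @ [b] @ ys:tuples M n" using assms by (auto simp: tuples_iff)
 have "frag_of (xs @ [a +[M] b] @ ys) - frag_of (xs @ [a] @ ys) - frag_of (xs @ [b] @ ys):rels"
  using assms unfolding rels_def by blast
 hence "frag_of (xs @ [a +[M] b] @ ys) - (frag_of (xs @ [a] @ ys) + frag_of (xs @ [b] @ ys)):Null"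
  unfolding Null_rels by (simp add: diff_diff_eq generate.incl)
 thus ?thesis using assms t by (subst TG_mult) (auto simp: cl_eq_iff)
qed

lemma cl_frag_bal:
 assumes "xs @ [a, b] @ ys:tuples M n" "r:A"
 shows "cl (frag_of (xs @ [ra a r, b] @ ys)) = cl (frag_of (xs @ [a, la r b] @ ys))"
proof -
 have "frag_of (xs @ [ra a r, b] @ ys) - frag_of (xs @ [a, la r b] @ ys):rels"
  using assms unfolding rels_def by blast
 thus ?thesis unfolding cl_eq_iff Null_rels by (rule generate.incl)
qed

lemma cl_frag_null:
 assumes "xs:tuples M n" "set xs \<inter> Z ~= {}"
 shows "cl (frag_of xs) = 1[TG]"
proof -
 have "frag_of xs:rels" using assms unfolding rels_def by blast
 thus ?thesis unfolding TG_one cl_eq_iff Null_rels by (simp add: generate.incl)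
qed

lemma cl_extend:
 assumes "supp p <= S" "!!xs. xs:S ==> supp (f xs) <= tuples M n"
 shows "cl (frag_extend f p) = tensor_lift TA (%xs. cl (f xs)) p"
  "supp (frag_extend f p) <= tuples M n"
proof -
 interpret T: abelian_group TA by (rule TA_abelian)
 have "supp (frag_extend f p) <= tuples M n & cl (frag_extend f p) = tensor_lift TA (%xs. cl (f xs)) p"
  using assms(1)
 proof (induction p rule: frag_induct)
  case zero
  show ?case by (simp add: TG_one)
 next
  case (diff x y)
  have c: "!!xs. xs:supp x \<union> supp y ==> cl (f xs)#:TA"
   using diff assms(2) by (auto intro!: cl_closed)
  let ?p = "frag_extend f x" and ?q = "frag_extend f y"
  have k1: "supp ?p <= tuples M n" "supp ?q <= tuples M n" using diff by auto
  note k = k1 keys_diff2[OF k1]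
  have "cl (?p - ?q) +[TA] cl ?q = cl ?p" using k by (simp add: TG_mult)
  hence "cl (?p - ?q) = cl ?p -[TA] cl ?q"
   using cl_closed[OF k(1)] cl_closed[OF k(2)] cl_closed[OF k(3)]
   by (metis T.add.inv_solve_right T.minus_eq TA_simps(1))
  thus ?case using diff k T.lift_diff[of x y "%xs. cl (f xs)", OF c] by (simp add: frag_extend_diff)
 next
  case (of a)
  thus ?case using assms(2)[of a] cl_closed[of "f a"] by simp
 qed
 thus "cl (frag_extend f p) = tensor_lift TA (%xs. cl (f xs)) p"
  "supp (frag_extend f p) <= tuples M n" by auto
qed

end

context abelian_group
begin

lemma lift_neg:
 assumes "!!xs. xs:supp p ==> f xs#:G"
 shows "lift (%xs. .- f xs) p = .- lift f p"
 by (rule lift_hom[OF abelian_group_axioms order_refl, symmetric]) (use assms in "auto simp: minus_add")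

lemma lift_null [simp]: "lift (%xs. \<zero>) p = \<zero>"
 unfolding tensor_lift_def by (simp add: add.int_pow_one[folded add_pow_def])

lemma lift_extend:
 assumes "supp p <= S" "!!xs. xs:S ==> supp (h xs) <= S'" "!!ys. ys:S' ==> f ys#:G"
 shows "lift f (frag_extend h p) = lift (%xs. lift f (h xs)) p"
proof -
 have "supp (frag_extend h p) <= S' & lift f (frag_extend h p) = lift (%xs. lift f (h xs)) p"
  using assms(1)
 proof (induction p rule: frag_induct)
  case (diff x y)
  have "lift f (h xs)#:G" if "xs:S" for xs using assms(2)[OF that] assms(3) by (intro lift_closed) auto
  hence c: "lift f (h xs)#:G" if "xs:supp x \<union> supp y" for xs
   using that diff by blast
  have c': "f ys#:G" if "ys:supp (frag_extend h x) \<union> supp (frag_extend h y)" for ys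
   using that diff assms(3) by blast
  have d: "lift (%xs. lift f (h xs)) (x - y) = lift (%xs. lift f (h xs)) x .- lift (%xs. lift f (h xs)) y"
   by (rule lift_diff) (rule c)
  have d': "lift f (frag_extend h x - frag_extend h y) = lift f (frag_extend h x) .- lift f (frag_extend h y)"
   by (rule lift_diff) (rule c')
  show ?case using diff keys_diff[of "frag_extend h x" "frag_extend h y"]
   by (auto simp: frag_extend_diff d d')
 next
  case (of a)
  have "lift f (h a)#:G" using assms(2)[OF of] assms(3) by (intro lift_closed) auto
  thus ?case using assms(2)[OF of] by simp
 qed simp
 thus ?thesis by simp
qed

lemma lift_swap:
 assumes "supp p <= S" "supp q <= S'" "!!xs ys. xs:S ==> ys:S' ==> F xs ys#:G"
 shows "lift (%xs. lift (F xs) q) p = lift (%ys. lift (%xs. F xs ys) p) q"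
 using assms(1)
proof (induction p rule: frag_induct)
 case (diff x y)
 have c: "lift (F xs) q#:G" if "xs:supp x \<union> supp y" for xs
  using that diff assms by (intro lift_closed) blast
 have c': "F xs ys#:G" if "ys:S'" "xs:supp x \<union> supp y" for xs ys
  using that diff assms by blast
 have d: "lift (%xs. lift (F xs) q) (x - y) = lift (%xs. lift (F xs) q) x .- lift (%xs. lift (F xs) q) y"
  by (rule lift_diff) (rule c)
 have "lift (%xs. lift (F xs) q) (x - y) = lift (%ys. lift (%xs. F xs ys) x) q .+ lift (%ys. .- lift (%xs. F xs ys) y) q"
  unfolding d diff(3,4) a_minus_def
  by (subst lift_neg) (use assms(2) c' in "auto intro!: lift_closed")
 also have "... = lift (%ys. lift (%xs. F xs ys) x .+ .- lift (%xs. F xs ys) y) q"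
  by (rule lift_plus[symmetric]) (use assms(2) c' in "auto intro!: lift_closed a_inv_closed")
 also have "... = lift (%ys. lift (%xs. F xs ys) (x - y)) q"
 proof (rule lift_cong)
  fix ys assume "ys:supp q"
  hence c2: "F xs ys#:G" if "xs:supp x \<union> supp y" for xs
   using c' that assms(2) by blast
  show "lift (%xs. F xs ys) x .+ .- lift (%xs. F xs ys) y = lift (%xs. F xs ys) (x - y)"
   using lift_diff[of x y "%xs. F xs ys", OF c2] by (simp add: a_minus_def)
  show "lift (%xs. F xs ys) (x - y)#:G"
   by (rule lift_closed) (use c2 keys_diff[of x y] in blast)
 qed
 finally show ?case .
next
 case (of a)
 have "lift (F a) q#:G" by (rule lift_closed) (use of assms in blast)
 moreover have "lift (%ys. lift (%xs. F xs ys) (frag_of a)) q = lift (F a) q"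
  by (rule lift_cong) (use of assms in auto)
 ultimately show ?case by simp
qed simp

end

context tensor_power
begin

definition ind :: "('b, 'q) ring_scheme => ('a list => 'b) => ('a list \<Rightarrow>\<^sub>0 int) set => 'b" where
 "ind T f t = tensor_lift T f (SOME p. p:t)"

abbreviation bal where "bal T == balanced T A M ra la n Z"

context
 fixes T :: "('b, 'q) ring_scheme" and f assumes T: "abelian_group T" and f: "bal T f"
begin

interpretation T: abelian_group T by (rule T)

lemma bal_closed: "xs:tuples M n ==> f xs#:T"
 using f unfolding balanced_def by blast

lemma ind_eq:
 assumes "t#:TG" "p:t" shows "ind T f t = tensor_lift T f p"
 unfolding ind_def by (rule lift_rep[OF T f assms(1) _ assms(2)]) (rule someI[of _ p], rule assms(2))

lemma ind_cl: "supp p <= tuples M n ==> ind T f (cl p) = tensor_lift T f p"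
 by (rule ind_eq) (auto intro: cl_closed)

lemma ind_frag: "xs:tuples M n ==> ind T f (cl (frag_of xs)) = f xs"
 using bal_closed by (simp add: ind_cl)

lemma ind_closed: "t#:TG ==> ind T f t#:T"
 by (auto simp: TG_carrier ind_cl intro!: T.lift_closed bal_closed)

lemma ind_add: 
 assumes "t#:TG" "t'#:TG" shows "ind T f (t *[TG] t') = ind T f t +[T] ind T f t'"
proof -
 obtain p where p: "supp p <= tuples M n" "t = cl p" using assms(1) TG_carrier by blast
 obtain q where q: "supp q <= tuples M n" "t' = cl q" using assms(2) TG_carrier by blast
 have "tensor_lift T f (p + q) = tensor_lift T f p +[T] tensor_lift T f q"
  by (rule T.lift_add) (use p q bal_closed in blast)
 thus ?thesis using p q keys_add2[OF p(1) q(1)] by (simp add: TG_mult ind_cl)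
qed

end

lemma cl_lift: "supp p <= tuples M n ==> cl p = tensor_lift TA (%xs. cl (frag_of xs)) p"
 using cl_extend(1)[of p "tuples M n" frag_of] frag_expansion[of p] by simp

text \<open>Additive maps are determined by the decomposable tensors. Identities between induced
  maps are verified in this way from here on.\<close>

lemma TG_hom_eq:
 assumes T: "abelian_group T"
  and h: "!!t. t#:TG ==> h t#:T"
   "!!t t'. t#:TG ==> t'#:TG ==> h (t *[TG] t') = h t +[T] h t'"
  and k: "!!t. t#:TG ==> k t#:T"
   "!!t t'. t#:TG ==> t'#:TG ==> k (t *[TG] t') = k t +[T] k t'"
  and hk: "!!xs. xs:tuples M n ==> h (cl (frag_of xs)) = k (cl (frag_of xs))"
  and t: "t#:TG"
 shows "h t = k t"
proof -
 interpret A: abelian_group TA by (rule TA_abelian)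
 interpret T: abelian_group T by (rule T)
 obtain p where p: "supp p <= tuples M n" "t = cl p" using t by (auto simp: TG_carrier)
 have "f (A.lift (%xs. cl (frag_of xs)) p) = T.lift (%xs. f (cl (frag_of xs))) p"
  if "!!t. t#:TG ==> f t#:T"
   "!!t t'. t#:TG ==> t'#:TG ==> f (t *[TG] t') = f t +[T] f t'" for f
  by (rule A.lift_hom[OF T p(1), of "%xs. cl (frag_of xs)" f]) (use that in "auto intro: cl_closed")
 note this[of h, OF h] this[of k, OF k]
 moreover have "T.lift (%xs. h (cl (frag_of xs))) p = T.lift (%xs. k (cl (frag_of xs))) p"
  by (rule T.lift_cong) (use hk p k(1) in "auto intro!: k(1) cl_closed")
 ultimately show ?thesis using p by (simp add: cl_lift[symmetric])
qed

end

section \<open>Actions on abelian groups\<close>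

text \<open>On an abelian group with suitable operators the scalars from \<open>K\<close> act through \<open>R\<close>.\<close>

definition scal_module :: "('k, 'r) module => ('r, 'l) lie_module => ('a, 'm) ring_scheme => ('r \<times> 'l => 'a => 'a) => ('k, 'a) module" where
 "scal_module R L G g = \<lparr>carrier = carrier G, monoid.mult = undefined, one = undefined,
   ring.zero = ring.zero G, add = add G, smult = (%c m. g (base_scalar R c, 0[L]) m)\<rparr>"

lemma scal_module_simps [simp]:
 "carrier (scal_module R L G g) = carrier G" "ring.zero (scal_module R L G g) = ring.zero G"
 "add (scal_module R L G g) = add G" "smult (scal_module R L G g) c m = g (base_scalar R c, 0[L]) m"
 by (simp_all add: scal_module_def)

locale env_ops = lie_algebroid K R L + G: abelian_group G
 for K :: "'k ring" and R :: "('k, 'r) module" and L :: "('r, 'l) lie_module" and G :: "('a, 'm) ring_scheme" +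
 fixes g :: "'r \<times> 'l => 'a => 'a"
 assumes op_closed: "[|r#:R; x#:L; m#:G|] ==> g (r, x) m#:G"
  and op_add: "[|r#:R; x#:L; m#:G; m'#:G|]
   ==> g (r, x) (m +[G] m') = g (r, x) m +[G] g (r, x) m'"
  and op_plus: "[|r#:R; x#:L; s#:R; y#:L; m#:G|]
   ==> g (r +[R] s, x +[L] y) m = g (r, x) m +[G] g (s, y) m"
  and op_bracket: "[|r#:R; x#:L; s#:R; y#:L; m#:G|]
   ==> g (r, x) (g (s, y) m) = g (s, y) (g (r, x) m) +[G] g (anchor L x s -[R] anchor L y r, br x y) m"
  and op_mult: "[|r#:R; s#:R; x#:L; m#:G|]
   ==> g (r, 0[L]) (g (s, x) m) = g (r *[R] s, r **[L] x) m"
  and op_one: "m#:G ==> g (1[R], 0[L]) m = m"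
begin

lemma op_null: "m#:G ==> g (0[R], 0[L]) m = 0[G]"
 using op_plus[of "0[R]" "0[L]" "0[R]" "0[L]" m] op_closed[of "0[R]" "0[L]" m] by simp

lemma scal_module: "module K (scal_module R L G g)"
proof (rule moduleI)
 show "cring K" by (rule K.is_cring)
 show "abelian_group (scal_module R L G g)"
  by (rule abelian_groupI) (auto intro: G.a_assoc G.a_comm G.add.l_inv_ex)
qed (use op_closed op_add op_one op_plus[of _ "0[L]" _ "0[L]"] op_mult[of _ _ "0[L]"] in "auto simp: kap_add kap_times")

end

sublocale env_ops < env_rep K R L "scal_module R L G g" g
proof -
 interpret M: module K "scal_module R L G g" by (rule scal_module)
 show "env_rep K R L (scal_module R L G g) g"
 proof unfold_locales
  fix r x m c assume "r#:R" "x#:L" "m#:(scal_module R L G g)" "c#:K"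
  thus "g (r, x) (c **[scal_module R L G g] m) = c **[scal_module R L G g] g (r, x) m"
   \<comment> \<open>The bracket of \<open>(r, x)\<close> with \<open>(kap c, 0)\<close> is zero
     because the anchor kills constants, so the operators commute with the scalars from
     \<open>K\<close>.\<close>
   using op_bracket[of r x "kap c" "0[L]" m] by (simp add: op_null op_closed)
 qed (auto intro: op_closed op_add op_one op_plus op_mult op_mult[symmetric] op_bracket)
qed

section \<open>The coproduct of the enveloping algebra\<close>

sublocale lie_algebroid < T2: tensor_power "carrier R" "env_alg K R L" "%D r. env_of_R K R L r *[env_alg K R L] D"
  "%r D. env_of_R K R L r *[env_alg K R L] D" 2 "{}"
 by unfold_locales simp_all

sublocale lie_algebroid < TA: abelian_group T2.TA
 by (rule T2.TA_abelian)

sublocale lie_algebroid < TG: comm_group T2.TG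
 by (rule T2.TG_comm_group)

context lie_algebroid
begin

abbreviation TA2 where "TA2 == T2.TA"
abbreviation TG2 where "TG2 == T2.TG"
abbreviation umult (infixr \<open>*&\<close> 75) where "D *& E == D *[U] E"
abbreviation uadd (infixl \<open>+&\<close> 65) where "D +& E == D +[U] E"
abbreviation tadd (infixl \<open>+~\<close> 65) where "s +~ t == s *[TG2] t"

lemma env_smult_eq: "env_smult K R L = (%r D. uR r *& D)" by (intro ext) (simp add: env_smult_def)

lemma env_tensor_TG: "env_tensor K R L = TG2" by (simp add: env_tensor_def env_smult_eq)
lemma env_tensor_class_cl: "env_tensor_class K R L = T2.cl" by (simp add: env_tensor_class_def env_smult_eq)

lemma tuples_U2: "xs:tuples U 2 <-> (EX D:carrier U. EX E:carrier U. xs = [D, E])"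
 by (cases xs; cases "tl xs") (auto simp: tuples_iff)

definition tn where "tn D E = T2.cl (frag_of [D, E])"

lemma tn_closed [simp]: "D#:U ==> E#:U ==> tn D E#:TG2"
 unfolding tn_def by (rule T2.cl_closed) (simp add: tuples_U2)

lemma tn_add_left: "D#:U ==> D'#:U ==> E#:U ==> tn (D +& D') E = tn D E +~ tn D' E"
 using T2.cl_frag_add[of "[]" D "[E]" D'] by (simp add: tn_def tuples_U2)

lemma tn_add_right: "D#:U ==> E'#:U ==> E#:U ==> tn D (E +& E') = tn D E +~ tn D E'"
 using T2.cl_frag_add[of "[D]" E "[]" E'] by (simp add: tn_def tuples_U2)

lemma TG_idem: "t#:TG2 ==> t = t +~ t ==> t = 1[TG2]"
 by (metis TG.l_cancel_one)

lemma tn_zero_left [simp]: "E#:U ==> tn 0[U] E = 1[TG2]"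
 using tn_add_left[of "0[U]" "0[U]" E] by (intro TG_idem) simp_all

lemma tn_zero_right [simp]: "D#:U ==> tn D 0[U] = 1[TG2]"
 using tn_add_right[of D "0[U]" "0[U]"] by (intro TG_idem) simp_all

lemma tn_bal: "D#:U ==> E#:U ==> r#:R ==> tn D (uR r *& E) = tn (uR r *& D) E"
 using T2.cl_frag_bal[of "[]" D E "[]" r] by (simp add: tn_def tuples_U2)

lemma uR_uR: "r#:R ==> s#:R ==> D#:U ==> uR r *& uR s *& D = uR (r *! s) *& D"
 by (simp add: uR_mult U.m_assoc)

lemma uL_uL: "x#:L ==> y#:L ==> D#:U ==>
  uL x *& uL y *& D = uL y *& uL x *& D +& uL (br x y) *& D"
 using uL_bracket[of x y] by (simp add: U.m_assoc[symmetric] U.l_distr)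

lemma uR_minus_add: "a#:R ==> b#:R ==> D#:U ==> 
  uR a *& D = uR b *& D +& uR (a -! b) *& D"
 by (simp add: U.l_distr[symmetric] uR_add[symmetric] a_minus_def R.add.m_lcomm R.r_neg)

text \<open>The generators act on the tensor square by derivations. This is the action through the
  coproduct, written down on generators first; the coproduct is recovered from it.\<close>

primrec top_gen where "top_gen (r, x) xs = tn (uR r *& xs ! 0 +& uL x *& xs ! 0) (xs ! 1) +~ tn (xs ! 0) (uL x *& xs ! 1)"

definition top where "top z = T2.ind TA2 (top_gen z)"

text \<open>If a scalar \<open>s\<close> stands on either side of the tensor sign, moving
  \<open>x\<close> past it yields the same additional term with \<open>x |> s\<close>. A single one
  of the two summands would not be balanced.\<close>

lemma top_gen_bal:
 assumes r: "r#:R" and x: "x#:L"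
 shows "T2.bal TA2 (top_gen (r, x))"
proof (rule balanced2I)
 fix D E s assume "D#:U" "E#:U" "s#:R"
 thus "top_gen (r, x) [uR s *& D, E] = top_gen (r, x) [D, uR s *& E]"
  using r x by (simp add: U.r_distr U.l_distr uL_base tn_bal tn_add_left tn_add_right uR_uR R.m_comm[of s r] TG.m_ac)
qed (use r x in "simp_all add: U.r_distr U.l_distr tn_add_left tn_add_right TG.m_ac")

lemma top_closed [simp]: "r#:R ==> x#:L ==> t#:TG2 ==> top (r, x) t#:TG2"
 unfolding top_def using T2.ind_closed[OF TA.abelian_group_axioms top_gen_bal] by simp

lemma top_add: "r#:R ==> x#:L ==> t#:TG2 ==> t'#:TG2 ==>
  top (r, x) (t +~ t') = top (r, x) t +~ top (r, x) t'"
 unfolding top_def using T2.ind_add[OF TA.abelian_group_axioms top_gen_bal] by simp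

lemma top_tn: "r#:R ==> x#:L ==> D#:U ==> E#:U ==>
  top (r, x) (tn D E) = tn (uR r *& D) E +~ tn (uL x *& D) E +~ tn D (uL x *& E)"
 unfolding top_def tn_def[of D E] using T2.ind_frag[OF TA.abelian_group_axioms top_gen_bal, of r x "[D, E]"]
 by (simp add: tuples_U2 U.l_distr tn_add_left)

lemma TG2_eqI:
 assumes "abelian_group T"
  and "!!t. t#:TG2 ==> h t#:T"
   "!!t t'. t#:TG2 ==> t'#:TG2 ==> h (t +~ t') = h t +[T] h t'"
  and "!!t. t#:TG2 ==> k t#:T"
   "!!t t'. t#:TG2 ==> t'#:TG2 ==> k (t +~ t') = k t +[T] k t'"
  and "!!D E. D#:U ==> E#:U ==> h (tn D E) = k (tn D E)"
  and "t#:TG2"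
 shows "h t = k t"
 by (rule T2.TG_hom_eq[OF assms(1-5) _ assms(7)]) (use assms(6) in "auto simp: tuples_U2 tn_def")

lemmas TG2_endo_eqI = TG2_eqI[OF TA.abelian_group_axioms, simplified]

end

sublocale lie_algebroid < TO: env_ops K R L T2.TA top
proof unfold_locales
 fix r x s y m m' assume r: "r#:R" and x: "x#:L" and s: "s#:R" and y: "y#:L"
  and m: "m#:TA2" and m': "m'#:TA2"
 thus "top (r, x) m#:TA2" "top (r, x) (m +[TA2] m') = top (r, x) m +[TA2] top (r, x) m'"
  by (simp_all add: top_add)
 have m: "m#:TG2" using m by simp
 show "top (r +! s, x +: y) m = top (r, x) m +[TA2] top (s, y) m"
  unfolding T2.TA_simps
  by (rule TG2_endo_eqI[OF _ _ _ _ _ m]) (use r s x y in "simp_all add: top_add top_tn uR_add uL_add U.l_distr tn_add_left tn_add_right TG.m_ac")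
 show "top (r, 0[L]) (top (s, x) m) = top (r *! s, r *: x) m"
  by (rule TG2_endo_eqI[OF _ _ _ _ _ m]) (use r s x y in "simp_all add: top_add top_tn uR_uR uL_smult U.m_assoc tn_bal TG.m_ac")
 show "top (r, x) (top (s, y) m) = top (s, y) (top (r, x) m) +[TA2] top (x |> s -! y |> r, br x y) m"
  unfolding T2.TA_simps
 proof (rule TG2_endo_eqI[OF _ _ _ _ _ m])
  fix D E assume D: "D#:U" and E: "E#:U"
  show "top (r, x) (top (s, y) (tn D E)) = top (s, y) (top (r, x) (tn D E)) +~ top (x |> s -! y |> r, br x y) (tn D E)"
   using r s x y D E uR_minus_add[of "x |> s" "y |> r" D] uL_uL[of x y D] uL_uL[of x y E] R.m_comm[of r s]
   by (simp add: top_tn top_add uL_base tn_add_left tn_add_right uR_uR TG.m_ac)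
 qed (use r s x y in "simp_all add: top_add TG.m_ac")
next
 fix m assume "m#:TA2"
 hence m: "m#:TG2" by simp
 show "top (1[R], 0[L]) m = m"
  by (rule TG2_endo_eqI[OF _ _ _ _ _ m]) (simp_all add: top_add top_tn)
qed

context lie_algebroid
begin

text \<open>Right multiplications are linear over the left action of \<open>R\<close>, so they are
  defined on the tensor square, in contrast to left multiplications.\<close>

definition rmul where "rmul A B = T2.ind TA2 (%xs. tn (xs ! 0 *& A) (xs ! 1 *& B))"

context
 fixes A B assumes A: "A#:U" and B: "B#:U"
begin

lemma rmul_bal: "T2.bal TA2 (%xs. tn (xs ! 0 *& A) (xs ! 1 *& B))"
 by (rule balanced2I) (use A B in "simp_all add: U.l_distr tn_add_left tn_add_right U.m_assoc tn_bal")

lemma rmul_closed: "t#:TG2 ==> rmul A B t#:TG2"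
 unfolding rmul_def using T2.ind_closed[OF TA.abelian_group_axioms rmul_bal] by simp

lemma rmul_add: "t#:TG2 ==> t'#:TG2 ==> rmul A B (t +~ t') = rmul A B t +~ rmul A B t'"
 unfolding rmul_def using T2.ind_add[OF TA.abelian_group_axioms rmul_bal] by simp

lemma rmul_tn: "D#:U ==> E#:U ==> rmul A B (tn D E) = tn (D *& A) (E *& B)"
 unfolding rmul_def tn_def[of D E] using T2.ind_frag[OF TA.abelian_group_axioms rmul_bal, of "[D, E]"]
 by (simp add: tuples_U2)

lemma rmul_top:
 assumes "r#:R" "x#:L" "t#:TG2"
 shows "rmul A B (top (r, x) t) = top (r, x) (rmul A B t)"
 by (rule TG2_endo_eqI[OF _ _ _ _ _ assms(3)])
  (use assms(1,2) A B in "simp_all add: top_add top_tn rmul_closed rmul_add rmul_tn U.m_assoc")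

lemma rmul_eact:
 assumes D: "D#:U" and t: "t#:TG2"
 shows "rmul A B (TO.eact D t) = TO.eact D (rmul A B t)"
 using D
proof (induction rule: U_gen_induct)
 case one
 thus ?case using t by (simp add: TO.eact_one rmul_closed)
next
 case (uR r D)
 thus ?case using t TO.eact_closed[of D t] TO.eact_closed[of D "rmul A B t"]
  by (simp add: TO.eact_mult TO.eact_uR rmul_closed rmul_top)
next
 case (uL x D)
 thus ?case using t TO.eact_closed[of D t] TO.eact_closed[of D "rmul A B t"]
  by (simp add: TO.eact_mult TO.eact_uL rmul_closed rmul_top)
next
 case (add D E)
 thus ?case using t TO.eact_closed[of _ t]
  by (simp add: TO.eact_add rmul_closed rmul_add)
qed

end

definition cop where "cop = (\<lambda>D\<in>carrier U. TO.eact D (tn 1[U] 1[U]))"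

lemma eact_TG [simp]: "D#:U ==> t#:TG2 ==> TO.eact D t#:TG2"
 using TO.eact_closed by simp

lemma cop_closed [simp]: "D#:U ==> cop D#:TG2"
 by (simp add: cop_def)

lemma cop_add: "D#:U ==> E#:U ==> cop (D +& E) = cop D +~ cop E"
 by (simp add: cop_def TO.eact_add)

lemma cop_one: "cop 1[U] = tn 1[U] 1[U]"
 by (simp add: cop_def TO.eact_one)

lemma cop_uR: "r#:R ==> D#:U ==> cop (uR r *& D) = top (r, 0[L]) (cop D)"
 by (simp add: cop_def TO.eact_mult TO.eact_uR)

lemma cop_uL: "x#:L ==> D#:U ==> cop (uL x *& D) = top (0[R], x) (cop D)"
 by (simp add: cop_def TO.eact_mult TO.eact_uL)

text \<open>A factorwise product is well defined if its left factor represents a value of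
  \<open>cop\<close>. For a fixed term of \<open>q\<close> it is \<open>rmul\<close> applied to
  \<open>D\<close> acting on 1 (x) 1; right multiplication commutes with the action, which leaves
  \<open>D\<close> acting on the class of \<open>q\<close>.\<close>

lemma frag_mult_cop:
 assumes D: "D#:U" and p: "p:cop D" and q: "supp q <= tuples U 2"
 shows "T2.cl (frag_mult U p q) = TO.eact D (T2.cl q)" "supp (frag_mult U p q) <= tuples U 2"
proof -
 let ?h = "%xs ys. frag_of (map2 (%x y. x *& y) xs ys)"
 have pk: "supp p <= tuples U 2" and pc: "cop D = T2.cl p" using T2.TG_rep[OF cop_closed[OF D] p] by auto
 have t: "map2 (%x y. x *& y) xs ys:tuples U 2" if "xs:tuples U 2" "ys:tuples U 2" for xs ys
  using that by (auto simp: tuples_U2)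
 hence k: "supp (?h xs ys) <= tuples U 2" if "xs:tuples U 2" "ys:tuples U 2" for xs ys
  using that by simp
 note e1 = T2.cl_extend[OF q, of "?h xs" for xs, OF k]
 note e2 = T2.cl_extend[OF pk, of "%xs. frag_extend (?h xs) q", OF e1(2)]
 show "supp (frag_mult U p q) <= tuples U 2" unfolding frag_mult_def by (rule e2(2)) assumption+
 have "T2.cl (frag_mult U p q) = TA.lift (%xs. T2.cl (frag_extend (?h xs) q)) p"
  unfolding frag_mult_def by (rule e2(1)) assumption+
 also have "... = TA.lift (%xs. TA.lift (%ys. T2.cl (?h xs ys)) q) p"
 proof (rule TA.lift_cong)
  fix xs assume "xs:supp p"
  hence xs: "xs:tuples U 2" using pk by blast
  show "T2.cl (frag_extend (?h xs) q) = TA.lift (%ys. T2.cl (?h xs ys)) q" by (rule e1(1)[OF xs])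
  have "T2.cl (?h xs ys)#:TA2" if "ys:supp q" for ys
   using T2.cl_closed[OF k[OF xs subsetD[OF q that]]] by simp
  thus "TA.lift (%ys. T2.cl (?h xs ys)) q#:TA2" by (rule TA.lift_closed)
 qed
 also have "... = TA.lift (%ys. TA.lift (%xs. T2.cl (?h xs ys)) p) q"
  by (rule TA.lift_swap[OF pk q], subst T2.TA_simps, rule T2.cl_closed[OF k])
 also have "... = TA.lift (%ys. TO.eact D (T2.cl (frag_of ys))) q"
 proof (rule TA.lift_cong)
  fix ys assume "ys:supp q"
  then obtain A B where ys: "ys = [A, B]" and A: "A#:U" and B: "B#:U" using q tuples_U2 by blast
  have "TA.lift (%xs. T2.cl (?h xs ys)) p = TA.lift (%xs. tn (xs ! 0 *& A) (xs ! 1 *& B)) p"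
  proof (rule TA.lift_cong)
   fix xs assume "xs:supp p"
   then obtain A' B' where "xs = [A', B']" "A'#:U" "B'#:U" using pk tuples_U2 by blast
   thus "T2.cl (?h xs ys) = tn (xs ! 0 *& A) (xs ! 1 *& B)" "tn (xs ! 0 *& A) (xs ! 1 *& B)#:TA2"
    using A B by (simp_all add: ys) (simp add: tn_def)
  qed
  also have "... = rmul A B (cop D)"
   unfolding rmul_def using T2.ind_eq[OF TA.abelian_group_axioms rmul_bal[OF A B] cop_closed[OF D] p] by simp
  also have "... = TO.eact D (rmul A B (tn 1[U] 1[U]))"
   using D by (simp add: cop_def rmul_eact[OF A B])
  also have "... = TO.eact D (T2.cl (frag_of ys))" using A B by (simp add: rmul_tn[OF A B]) (simp add: tn_def ys)
  finally show "TA.lift (%xs. T2.cl (?h xs ys)) p = TO.eact D (T2.cl (frag_of ys))" .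
  show "TO.eact D (T2.cl (frag_of ys))#:TA2" using D A B by (simp add: ys tn_def[symmetric])
 qed
 also have "... = TO.eact D (TA.lift (%ys. T2.cl (frag_of ys)) q)"
  by (rule TA.lift_hom[OF TA.abelian_group_axioms q, symmetric])
   (use D in "auto intro!: T2.cl_closed eact_TG simp: TO.eact_add_right[simplified]")
 also have "... = TO.eact D (T2.cl q)" using T2.cl_lift[OF q] by simp
 finally show "T2.cl (frag_mult U p q) = TO.eact D (T2.cl q)" .
qed

lemma cop_is_coprod: "is_env_coprod K R L cop"
 unfolding is_env_coprod_def Let_def env_tensor_TG env_tensor_class_cl
proof (intro conjI ballI)
 show "cop:extensional (carrier U)" by (simp add: cop_def)
 show "cop:hom (add_monoid U) TG2" by (auto simp: hom_def cop_add)
 fix D E p q assume D: "D#:U" and E: "E#:U" and p: "p:cop D" and q: "q:cop E"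
 have "supp q <= tuples U 2" "cop E = T2.cl q" using T2.TG_rep[OF cop_closed[OF E] q] by auto
 thus "cop (D *& E) = T2.cl (frag_mult U p q)"
  using frag_mult_cop[OF D p] D E by (simp add: cop_def TO.eact_mult)
next
 fix r assume "r#:R"
 thus "cop (uR r) = T2.cl (frag_of [uR r, 1[U]])" using cop_uR[of r "1[U]"] top_tn[of r "0[L]"] by (simp add: cop_one tn_def[symmetric])
next
 fix x assume x: "x#:L"
 hence "T2.cl (frag_of [uL x, 1[U]] + frag_of [1[U], uL x]) = tn (uL x) 1[U] +~ tn 1[U] (uL x)"
  unfolding tn_def by (subst T2.TG_mult) (auto simp: tuples_U2)
 thus "cop (uL x) = T2.cl (frag_of [uL x, 1[U]] + frag_of [1[U], uL x])"
  using x cop_uL[of x "1[U]"] top_tn[of "0[R]" x] by (simp add: cop_one)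
qed

text \<open>The multiplicativity condition covers all representatives, hence two solutions that
  agree on the generators agree on all products of generators.\<close>

lemma env_coprod_cop: "env_coprod K R L = cop"
 unfolding env_coprod_def
proof (rule the_equality)
 show "is_env_coprod K R L cop" by (rule cop_is_coprod)
next
 fix \<Delta> assume 1: "is_env_coprod K R L \<Delta>"
 note d1 = 1[unfolded is_env_coprod_def Let_def env_tensor_TG env_tensor_class_cl]
  and d2 = cop_is_coprod[unfolded is_env_coprod_def Let_def env_tensor_TG env_tensor_class_cl]
 have step: "\<Delta> (G *& D) = cop (G *& D)" if G: "G#:U" "\<Delta> G = cop G" and D: "D#:U" "\<Delta> D = cop D" for G D
 proof -
  obtain p q where "p:cop G" "q:cop D" using T2.TG_nonempty cop_closed G D by metis
  hence "\<Delta> (G *& D) = T2.cl (frag_mult U p q)" "cop (G *& D) = T2.cl (frag_mult U p q)"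
   using d1 d2 G D by auto
  thus ?thesis by simp
 qed
 have R: "\<Delta> (uR r) = cop (uR r)" if "r#:R" for r using d1 d2 that by simp
 have L: "\<Delta> (uL x) = cop (uL x)" if "x#:L" for x using d1 d2 that by simp
 have "\<Delta> D = cop D" if "D#:U" for D
  using that
 proof (induction rule: U_gen_induct)
  case one
  thus ?case using R[of "1[R]"] by simp
 next
  case (add D E)
  thus ?case using d1 by (simp add: hom_def cop_add)
 next
  case (uR r D)
  thus ?case by (intro step R uR_closed)
 next
  case (uL x D)
  thus ?case by (intro step L uL_closed)
 qed
 thus "\<Delta> = cop" using d1 d2 by (intro extensionalityI) auto
qed

end

section \<open>The jet algebra\<close>

lemma (in cring) anchor_id:
 "[|r#:R; s#:R; m#:R; a#:R; b#:R; c#:R; d#:R; e#:R; f#:R|] ==>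
  r .* (s .* m .+ a) .+ (c .* m .+ s .* b .+ e) = s .* (r .* m .+ b) .+ (d .* m .+ r .* a .+ f) .+ ((c .- d) .* m .+ (e .- f))"
 by algebra

sublocale lie_algebroid < AR: env_rep K R L R "%(r, x) s. r *[R] s +[R] anchor L x s"
proof unfold_locales
 fix r x s y m assume "r#:R" "x#:L" "s#:R" "y#:L" "m#:R"
 thus "(%(r, x) s. r *! s +! x |> s) (r, x) ((%(r, x) s. r *! s +! x |> s) (s, y) m) =
  (%(r, x) s. r *! s +! x |> s) (s, y) ((%(r, x) s. r *! s +! x |> s) (r, x) m) +!
  (%(r, x) s. r *! s +! x |> s) (x |> s -! y |> r, br x y) m"
  by (simp add: anchor_add_right anchor_leibniz anchor_bracket) (rule R.anchor_id; simp)
qed (auto simp: anchor_add_left anchor_add_right anchor_smult kap_mult anchor_kap_mult R.l_distr R.r_distr R.m_assoc R.m_lcomm R.a_ac)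

context lie_algebroid
begin

abbreviation J where "J == jet K R L"
abbreviation jr where "jr \<equiv> jet_right K R L"
abbreviation jl where "jl \<equiv> jet_left K R L"
abbreviation actR where "actR == env_act_R K R L"
abbreviation ep where "ep == jet_counit K R L"

lemma actR_eact: "actR = AR.eact" by (simp add: env_act_R_def)

lemma actR_closed [simp]: "D#:U ==> r#:R ==> actR D r#:R"
 by (simp add: actR_eact)

lemma actR_add: "D#:U ==> E#:U ==> r#:R ==> actR (D +& E) r = actR D r +! actR E r"
 by (simp add: actR_eact AR.eact_add)

lemma actR_mult: "D#:U ==> E#:U ==> r#:R ==> actR (D *& E) r = actR D (actR E r)"
 by (simp add: actR_eact AR.eact_mult)

lemma actR_uR: "s#:R ==> r#:R ==> actR (uR s) r = s *! r"
 by (simp add: actR_eact AR.eact_uR)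

lemma actR_uL: "x#:L ==> r#:R ==> actR (uL x) r = x |> r"
 by (simp add: actR_eact AR.eact_uL)

lemma actR_one [simp]: "r#:R ==> actR 1[U] r = r"
 by (simp add: actR_eact AR.eact_one)

lemma jet_carrier: "al#:J <-> al:carrier U \<rightarrow>\<^sub>E carrier R
  & (ALL D:carrier U. ALL E:carrier U. al (D +& E) = al D +! al E)
  & (ALL r:carrier R. ALL D:carrier U. al (uR r *& D) = r *! al D)"
 by (simp add: jet_def Let_def env_smult_def)

lemma jetD [simp]: "al#:J ==> D#:U ==> al D#:R"
 by (auto simp: jet_carrier)

lemma jet_plus: "al#:J ==> D#:U ==> E#:U ==> al (D +& E) = al D +! al E"
 by (simp add: jet_carrier)

lemma jet_uR: "al#:J ==> D#:U ==> r#:R ==> al (uR r *& D) = r *! al D"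
 by (simp add: jet_carrier)

lemma jetI:
 assumes "f:extensional (carrier U)" "!!D. D#:U ==> f D#:R"
  "!!D E. D#:U ==> E#:U ==> f (D +& E) = f D +! f E"
  "!!r D. r#:R ==> D#:U ==> f (uR r *& D) = r *! f D"
 shows "f#:J"
 using assms by (auto simp: jet_carrier PiE_def)

lemma jet_eqD: 
 assumes "al#:J" "be#:J" "!!D. D#:U ==> al D = be D"
 shows "al = be"
 by (rule extensionalityI[of _ "carrier U"]) (use assms in "auto simp: jet_carrier PiE_def")

lemma jet_one: "1[J] = (\<lambda>D\<in>carrier U. actR D 1[R])"
 by (simp add: jet_def Let_def)

lemma jet_add [simp]: "D#:U ==> (al +[J] be) D = al D +! be D"
 by (simp add: jet_def Let_def)

lemma jet_zero [simp]: "D#:U ==> 0[J] D = 0[R]"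
 by (simp add: jet_def Let_def)

lemma jet_smult: "D#:U ==> al#:J ==> c#:K ==> (c **[J] al) D = kap c *! al D"
 by (simp add: jet_def Let_def kap_mult jet_carrier PiE_mem)

lemma jet_ext [simp]: "al +[J] be:extensional (carrier U)" "0[J]:extensional (carrier U)"
  "c **[J] al:extensional (carrier U)" "al *[J] be:extensional (carrier U)"
 by (simp_all add: jet_def Let_def)

lemma jet_one_closed: "1[J]#:J"
 by (rule jetI) (auto simp: jet_one actR_add actR_mult actR_uR)

lemma jet_add_closed: "al#:J ==> be#:J ==> al +[J] be#:J"
 by (rule jetI) (simp_all add: jet_plus jet_uR R.r_distr R.a_ac)

lemma jet_zero_closed: "0[J]#:J"
 by (rule jetI) simp_all

lemma jet_smult_closed: "al#:J ==> c#:K ==> c **[J] al#:J"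
 by (rule jetI) (simp_all add: jet_smult jet_plus jet_uR R.r_distr R.m_lcomm)

text \<open>An explicit representative of the coproduct of a monomial. Unlike an arbitrary one it
  shows the orders of both legs, which later fixes a level for all of its terms at once.\<close>

primrec delta where
 "delta [] = frag_of [1[U], 1[U]]"
| "delta (x # w) = frag_extend (%xs. frag_of [uL x *& xs ! 0, xs ! 1]) (delta w)
   + frag_extend (%xs. frag_of [xs ! 0, uL x *& xs ! 1]) (delta w)"

lemma delta_cop: "w:lists (carrier L) ==> supp (delta w) <= tuples U 2 & cop (mon w) = T2.cl (delta w)"
proof (induction w)
 case Nil
 thus ?case by (simp add: tuples_U2 cop_one tn_def)
next
 case (Cons x w)
 hence x: "x#:L" and w: "w:lists (carrier L)" and k: "supp (delta w) <= tuples U 2"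
  and c: "cop (mon w) = T2.cl (delta w)" by auto
 let ?f = "%xs. frag_of [uL x *& xs ! 0, xs ! 1]" and ?g = "%xs. frag_of [xs ! 0, uL x *& xs ! 1]"
 have fg: "supp (?f xs) <= tuples U 2" "supp (?g xs) <= tuples U 2" if "xs:tuples U 2" for xs
  using that x by (auto simp: tuples_U2)
 note f = T2.cl_extend[OF k, of ?f, OF fg(1)] and g = T2.cl_extend[OF k, of ?g, OF fg(2)]
 have "cop (mon (x # w)) = top (0[R], x) (T2.cl (delta w))" using x w by (simp add: cop_uL c)
 also have "... = TA.lift (top_gen (0[R], x)) (delta w)"
  unfolding top_def using x by (intro T2.ind_cl[OF TA.abelian_group_axioms top_gen_bal k]) auto
 also have "... = TA.lift (%xs. T2.cl (?f xs) +[TA2] T2.cl (?g xs)) (delta w)"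
 proof (rule TA.lift_cong)
  fix xs assume "xs:supp (delta w)"
  then obtain D E where "xs = [D, E]" "D#:U" "E#:U" using k tuples_U2 by blast
  thus "top_gen (0[R], x) xs = T2.cl (?f xs) +[TA2] T2.cl (?g xs)" "T2.cl (?f xs) +[TA2] T2.cl (?g xs)#:TA2"
   using x by (simp_all add: tn_def[symmetric])
 qed
 also have "... = TA.lift (%xs. T2.cl (?f xs)) (delta w) +[TA2] TA.lift (%xs. T2.cl (?g xs)) (delta w)"
  by (rule TA.lift_plus) (use k fg in "auto intro!: T2.cl_closed")
 also have "... = T2.cl (frag_extend ?f (delta w)) +~ T2.cl (frag_extend ?g (delta w))"
  using f(1) g(1) by simp
 also have "... = T2.cl (delta (x # w))" using f(2) g(2) by (simp add: T2.TG_mult)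
 finally show ?case using T2.keys_add2[OF f(2) g(2)] by simp
qed

definition jpair where "jpair al be = (%Ds. al (Ds ! 0) *! be (Ds ! 1))"

context
 fixes al be assumes al: "al#:J" and be: "be#:J"
begin

lemma jpair_bal: "T2.bal R (jpair al be)"
 by (rule balanced2I) (use al be in "simp_all add: jpair_def jet_plus jet_uR R.l_distr R.r_distr R.m_ac")

lemma jet_mult: 
 assumes D: "D#:U" shows "(al *[J] be) D = T2.ind R (jpair al be) (cop D)"
proof -
 obtain p where p: "p:cop D" using T2.TG_nonempty cop_closed[OF D] by blast
 note e = T2.ind_eq[OF R.abelian_group_axioms jpair_bal cop_closed[OF D]]
 have "(THE v. ALL p:cop D. v = R.lift (jpair al be) p) = T2.ind R (jpair al be) (cop D)"
  by (rule the_equality) (use p e in auto)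
 thus ?thesis using D by (simp add: jet_def Let_def env_coprod_cop jpair_def)
qed

end

lemma jet_comp:
 assumes "ga#:J" and f: "!!D. D#:U ==> f D#:U"
  "!!D E. D#:U ==> E#:U ==> f (D +& E) = f D +& f E"
  "!!r D. r#:R ==> D#:U ==> f (uR r *& D) = uR r *& f D"
 shows "(\<lambda>D\<in>carrier U. ga (f D))#:J"
 by (rule jetI) (use assms in "simp_all add: jet_plus jet_uR")

lemma jet_abelian: "abelian_group J"
proof (rule abelian_groupI)
 fix al assume a: "al#:J"
 let ?b = "\<lambda>D\<in>carrier U. -[R] al D"
 have b: "?b#:J" by (rule jetI) (use a in "auto simp: jet_plus jet_uR R.minus_add R.r_minus")
 moreover have "?b +[J] al = 0[J]"
  by (rule jet_eqD) (use a b in "auto simp: jet_add_closed jet_zero_closed R.l_neg")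
 ultimately show "EX be:carrier J. be +[J] al = 0[J]" by blast
next
 fix al be assume "al#:J" "be#:J"
 thus "al +[J] be = be +[J] al" by (intro jet_eqD) (auto simp: jet_add_closed R.a_comm)
qed (auto intro!: jet_eqD simp: jet_add_closed jet_zero_closed R.a_assoc)

lemma jet_module: "module K J"
 by (rule moduleI[OF K.is_cring jet_abelian])
  (auto intro!: jet_eqD simp: jet_smult_closed jet_add_closed jet_smult kap_add kap_times R.l_distr R.r_distr R.m_assoc)

end

sublocale lie_algebroid < JR: abelian_group "jet K R L"
 by (rule jet_abelian)

section \<open>The two commuting module structures on jets\<close>

lemma (in abelian_group) nabla_id:
 "[|d#:G; a#:G; f#:G; k#:G; p#:G; h#:G; u#:G; c#:G; e#:G; v#:G|] ==>
  (d .+ a .+ (f .- k)) .- (p .+ (h .- u)) .+ ((c .- d) .+ ((e .- f) .- (u .- v))) = a .+ c .+ e .- k .- p .- h .+ v"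
 by algebra

lemma (in abelian_group) nabla_id2:
 "[|m#:G; a#:G; b#:G; k#:G; p#:G; h#:G; q#:G; c#:G; e#:G; v#:G|] ==>
  m .+ (a .- p) .+ ((c .+ b .+ (e .- h)) .- (q .+ (k .- v))) = m .+ (b .- q) .+ (a .+ c .+ e .- k .- p .- h .+ v)"
 by algebra

lemma (in cring) nabla_idR:
 assumes "r#:R" "s#:R" "m#:R" "a#:R" "b#:R" "p#:R" "q#:R"
  "c#:R" "d#:R" "e#:R" "f#:R" "h#:R" "k#:R" "u#:R" "v#:R"
 shows "r .* (s .* m .+ (a .- p)) .+ ((c .* m .+ s .* b .+ (e .- h)) .- (s .* q .+ (k .- v)))
  = s .* (r .* m .+ (b .- q)) .+ ((d .* m .+ r .* a .+ (f .- k)) .- (r .* p .+ (h .- u))) .+ ((c .- d) .* m .+ ((e .- f) .- (u .- v)))"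
  (is "?l = ?s .+ ?x .+ ?y")
proof -
 have 1: "r .* (s .* m .+ (a .- p)) = s .* (r .* m) .+ (r .* a .- r .* p)"
  "?s = s .* (r .* m) .+ (s .* b .- s .* q)" "(c .- d) .* m = c .* m .- d .* m"
  using assms by algebra+
 have "?s .+ ?x .+ ?y = ?s .+ (?x .+ ?y)" by (rule a_assoc) (use assms in simp_all)
 also have "?x .+ ?y = r .* a .+ c .* m .+ e .- k .- r .* p .- h .+ v"
  unfolding 1(3) by (rule nabla_id) (use assms in simp_all)
 also have "?s .+ ... = ?l" unfolding 1 by (rule nabla_id2[symmetric]) (use assms in simp_all)
 finally show ?thesis by simp
qed

lemma (in cring) nabla_idC:
 assumes "r#:R" "s#:R" "m#:R" "b#:R" "q#:R" "c#:R"
 shows "r .* (s .* m) .+ (c .* m .+ s .* b .- (s .* q .+ c .* m)) = s .* (r .* m .+ (b .- q))"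
 using assms by algebra

lemma (in cring) nabla_idA:
 assumes "r#:R" "m#:R" "m'#:R" "b#:R" "q#:R" "b'#:R" "q'#:R"
 shows "r .* (m .+ m') .+ (b .+ b' .- (q .+ q')) = r .* m .+ (b .- q) .+ (r .* m' .+ (b' .- q'))"
  "(r .+ m) .* m' .+ (b .+ b' .- (q .+ q')) = r .* m' .+ (b .- q) .+ (m .* m' .+ (b' .- q'))"
  "r .* (m .* m' .+ (b .- q)) = r .* m .* m' .+ (r .* b .- r .* q)"
  "r .* m .+ (r .* b .- r .* q) = r .* (m .+ (b .- q))"
  "m .* (r .* m') .+ (r .* b .- r .* q) = r .* (m .* m' .+ (b .- q))"
  "r .* m .* m' .+ (r .* b .- r .* q) = r .* (m .* m' .+ (b .- q))"
 using assms by algebra+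

context lie_algebroid
begin

lemma U_kap_central: "D#:U ==> c#:K ==> D *& uR (kap c) = uR (kap c) *& D"
proof (induction D rule: U_gen_induct)
 case (uR r D)
 thus ?case by (simp add: U.m_assoc uR_uR R.m_comm[of r])
next
 case (uL x D)
 thus ?case by (simp add: U.m_assoc uL_base)
qed (simp_all add: U.l_distr U.r_distr)

lemma jet_null [simp]: "al#:J ==> al 0[U] = 0[R]"
 using jet_uR[of al "0[U]" "0[R]"] by simp

primrec g1 where "g1 (r, x) al = (\<lambda>D\<in>carrier U. r *! al D +! (x |> al D -! al (uL x *& D)))"

lemma g1_app [simp]: "D#:U ==> g1 (r, x) al D = r *! al D +! (x |> al D -! al (uL x *& D))"
 by simp

declare g1.simps [simp del]

lemma g1_closed: "r#:R ==> x#:L ==> al#:J ==> g1 (r, x) al#:J"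
proof (rule jetI)
 show "g1 (r, x) al:extensional (carrier U)" by (simp add: g1.simps)
qed (simp_all add: jet_plus jet_uR U.r_distr uL_base anchor_add_right anchor_leibniz R.nabla_idC R.nabla_idA(1))

end

sublocale lie_algebroid < N1: env_rep K R L "jet K R L" g1
proof -
 interpret A: module K "jet K R L" by (rule jet_module)
 show "env_rep K R L (jet K R L) g1"
 proof unfold_locales
  fix r x s y al assume "r#:R" "x#:L" "s#:R" "y#:L" "al#:J"
  thus "g1 (r, x) (g1 (s, y) al) = g1 (s, y) (g1 (r, x) al) +[J] g1 (x |> s -! y |> r, br x y) al"
  proof (intro jet_eqD)
   fix D assume "r#:R" "x#:L" "s#:R" "y#:L" "al#:J" "D#:U"
   moreover from this have "al (uL (br x y) *& D) = al (uL x *& uL y *& D) -! al (uL y *& uL x *& D)"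
    by (simp add: uL_uL[of x y] jet_plus) (simp add: a_minus_def R.a_ac R.r_neg)
   ultimately show "g1 (r, x) (g1 (s, y) al) D = (g1 (s, y) (g1 (r, x) al) +[J] g1 (x |> s -! y |> r, br x y) al) D"
    by (simp add: anchor_add_right anchor_minus anchor_leibniz anchor_bracket) (rule R.nabla_idR; simp)
  qed (simp_all add: g1_closed jet_add_closed)
 next
  fix r x al be assume a: "r#:R" "x#:L" "al#:J" "be#:J"
  show "g1 (r, x) (al +[J] be) = g1 (r, x) al +[J] g1 (r, x) be"
  proof (rule jet_eqD)
   fix D assume "D#:U"
   thus "g1 (r, x) (al +[J] be) D = (g1 (r, x) al +[J] g1 (r, x) be) D"
    using a by (simp add: anchor_add_right) (rule R.nabla_idA(1); simp)
  qed (use a in "simp_all add: g1_closed jet_add_closed")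
 next
  fix r x al c assume a: "r#:R" "x#:L" "al#:J" "c#:K"
  show "g1 (r, x) (c **[J] al) = c **[J] g1 (r, x) al"
  proof (rule jet_eqD)
   fix D assume "D#:U"
   thus "g1 (r, x) (c **[J] al) D = (c **[J] g1 (r, x) al) D"
    using a by (simp add: anchor_kap_mult jet_smult g1_closed) (rule R.nabla_idA(5); simp)
  qed (use a in "simp_all add: g1_closed jet_smult_closed")
  show "g1 (kap c *! r, kap c *: x) al = c **[J] g1 (r, x) al"
  proof (rule jet_eqD)
   fix D assume "D#:U"
   thus "g1 (kap c *! r, kap c *: x) al D = (c **[J] g1 (r, x) al) D"
    using a by (simp add: anchor_smult jet_smult g1_closed uL_smult U.m_assoc jet_uR) (rule R.nabla_idA(6); simp)
  qed (use a in "simp_all add: g1_closed jet_smult_closed")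
 next
  fix r x s y al assume a: "r#:R" "x#:L" "s#:R" "y#:L" "al#:J"
  show "g1 (r +! s, x +: y) al = g1 (r, x) al +[J] g1 (s, y) al"
  proof (rule jet_eqD)
   fix D assume "D#:U"
   thus "g1 (r +! s, x +: y) al D = (g1 (r, x) al +[J] g1 (s, y) al) D"
    using a by (simp add: anchor_add_left uL_add U.l_distr jet_plus) (rule R.nabla_idA(2); simp)
  qed (use a in "simp_all add: g1_closed jet_add_closed")
 next
  fix r s x al assume a: "r#:R" "s#:R" "x#:L" "al#:J"
  show "g1 (r, 0[L]) (g1 (s, x) al) = g1 (r *! s, r *: x) al"
  proof (rule jet_eqD)
   fix D assume "D#:U"
   thus "g1 (r, 0[L]) (g1 (s, x) al) D = g1 (r *! s, r *: x) al D"
    using a by (simp add: anchor_smult uL_smult U.m_assoc jet_uR) (rule R.nabla_idA(3); simp)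
  qed (use a in "simp_all add: g1_closed")
 next
  fix al assume a: "al#:J"
  show "g1 (1[R], 0[L]) al = al" by (rule jet_eqD) (use a in "simp_all add: g1_closed")
 qed (simp add: g1_closed)
qed

context lie_algebroid
begin

abbreviation n1 where "n1 == nabla1 K R L"
abbreviation n2 where "n2 == nabla2 K R L"

lemma n1_eact: "n1 = N1.eact"
proof -
 have "(%(r, x) al. \<lambda>D\<in>carrier U. r *! al D +! (x |> al D -! al (uL x *& D))) = g1"
  by (intro ext) (auto simp: g1.simps)
 thus ?thesis by (simp only: nabla1_def Let_def)
qed

lemma n1_closed [simp]: "D#:U ==> al#:J ==> n1 D al#:J"
 by (simp add: n1_eact)

lemma n1_add: "D#:U ==> E#:U ==> al#:J ==> n1 (D +& E) al = n1 D al +[J] n1 E al"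
 by (simp add: n1_eact N1.eact_add)

lemma n1_mult: "D#:U ==> E#:U ==> al#:J ==> n1 (D *& E) al = n1 D (n1 E al)"
 by (simp add: n1_eact N1.eact_mult)

lemma n1_add_right: "D#:U ==> be#:J ==> al#:J ==> n1 D (al +[J] be) = n1 D al +[J] n1 D be"
 by (simp add: n1_eact N1.eact_add_right)

lemma n1_scal: "D#:U ==> c#:K ==> al#:J ==> n1 D (c **[J] al) = c **[J] n1 D al"
 unfolding n1_eact by (erule U_cases) (simp add: N1.eact_cls N1.rho_scal)

lemma n1_one [simp]: "al#:J ==> n1 1[U] al = al"
 by (simp add: n1_eact N1.eact_one)

lemma n1_uR: "r#:R ==> al#:J ==> D#:U ==> n1 (uR r) al D = r *! al D"
 using jet_uR[of al D "0[R]"] by (simp add: n1_eact N1.eact_uR)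

lemma n1_uL: "x#:L ==> al#:J ==> D#:U ==> n1 (uL x) al D = x |> al D -! al (uL x *& D)"
 by (simp add: n1_eact N1.eact_uL)

lemma n2_app [simp]: "D#:U ==> n2 E al D = al (D *& E)"
 by (simp add: nabla2_def)

lemma n2_closed [simp]: "E#:U ==> al#:J ==> n2 E al#:J"
proof (rule jetI)
 show "n2 E al:extensional (carrier U)" by (simp add: nabla2_def)
qed (simp_all add: U.l_distr jet_plus jet_uR U.m_assoc)

lemma n2_mult: "D#:U ==> E#:U ==> al#:J ==> n2 (D *& E) al = n2 D (n2 E al)"
 by (rule jet_eqD) (simp_all add: U.m_assoc)

lemma n2_add: "D#:U ==> E#:U ==> al#:J ==> n2 (D +& E) al = n2 D al +[J] n2 E al"
 by (rule jet_eqD) (simp_all add: U.r_distr jet_plus)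

text \<open>On the argument one structure multiplies from the left and the other from the right, and
  \<open>nabla2\<close> leaves the values alone.\<close>

lemma n1_n2: "D#:U ==> E#:U ==> al#:J ==> n1 D (n2 E al) = n2 E (n1 D al)"
proof (induction D rule: U_gen_induct)
 case (uR r D)
 have "n1 (uR r) (n2 E (n1 D al)) = n2 E (n1 (uR r) (n1 D al))"
  by (rule jet_eqD) (use uR in "simp_all add: n1_uR")
 thus ?case using uR by (simp add: n1_mult)
next
 case (uL x D)
 have "n1 (uL x) (n2 E (n1 D al)) = n2 E (n1 (uL x) (n1 D al))"
  by (rule jet_eqD) (use uL in "simp_all add: n1_uL U.m_assoc")
 thus ?case using uL by (simp add: n1_mult)
next
 case (add D D')
 have "n2 E (n1 D al) +[J] n2 E (n1 D' al) = n2 E (n1 D al +[J] n1 D' al)"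
  by (rule jet_eqD) (use add in simp_all)
 thus ?case using add by (simp add: n1_add)
qed simp

section \<open>Contraction of a jet with a differential operator\<close>

definition cind where "cind al = T2.ind U (%xs. uR (al (xs ! 0)) *& xs ! 1)"

text \<open>\<open>al\<close> applied to the first leg of the coproduct of \<open>D\<close>. By
  \<open>con_pair\<close> this is the transpose of multiplication by \<open>al\<close>, so the ring
  axioms for jets become identities between operators on \<open>U\<close>.\<close>

definition con where "con al D = cind al (cop D)"

context
 fixes al assumes a: "al#:J"
begin

lemma con_bal: "T2.bal U (%xs. uR (al (xs ! 0)) *& xs ! 1)"
 by (rule balanced2I) (use a in "simp_all add: jet_plus jet_uR uR_add U.l_distr U.r_distr uR_uR R.m_comm")

lemma con_ind_tn: "D#:U ==> E#:U ==> cind al (tn D E) = uR (al D) *& E"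
 unfolding tn_def cind_def using T2.ind_frag[OF U.abelian_group_axioms con_bal, of "[D, E]"] by (simp add: tuples_U2)

lemma con_ind_closed [simp]: "t#:TG2 ==> cind al t#:U"
 unfolding cind_def by (rule T2.ind_closed[OF U.abelian_group_axioms con_bal])

lemma con_ind_add: "t#:TG2 ==> t'#:TG2 ==> cind al (t +~ t')
  = cind al t +& cind al t'"
 unfolding cind_def by (rule T2.ind_add[OF U.abelian_group_axioms con_bal])

lemma con_closed [simp]: "D#:U ==> con al D#:U"
 by (simp add: con_def)

lemma con_add: "D#:U ==> E#:U ==> con al (D +& E) = con al D +& con al E"
 by (simp add: con_def cop_add con_ind_add)

lemma con_one: "con al 1[U] = uR (al 1[U])"
 using a by (simp add: con_def cop_one con_ind_tn)

lemma con_uR: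
 assumes r: "r#:R" and D: "D#:U"
 shows "con al (uR r *& D) = uR r *& con al D"
proof -
 let ?f = "cind al"
 have "?f (top (r, 0[L]) t) = uR r *& ?f t" if t: "t#:TG2" for t
  by (rule TG2_eqI[OF U.abelian_group_axioms _ _ _ _ _ t])
   (use r a in "simp_all add: con_ind_add top_add top_tn con_ind_tn jet_uR uR_uR U.r_distr")
 thus ?thesis using r D by (simp add: con_def cop_uR)
qed

end

text \<open>In the product of \<open>x\<close> with the contraction, \<open>x\<close> also
  differentiates the coefficient coming from the first leg, while the coproduct of
  \<open>x D\<close> evaluates \<open>al\<close> at \<open>x\<close> times that leg. The difference
  of the two is the value of \<open>nabla1\<close>.\<close>

lemma con_uL_add:
 assumes x: "x#:L" and D: "D#:U" and a: "al#:J"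
 shows "con al (uL x *& D) +& con (n1 (uL x) al) D = uL x *& con al D"
proof -
 let ?f = "cind"
 have b: "n1 (uL x) al#:J" using x a by simp
 have "?f al (top (0[R], x) t) +& ?f (n1 (uL x) al) t = uL x *& ?f al t" if t: "t#:TG2" for t
 proof (rule TG2_eqI[OF U.abelian_group_axioms _ _ _ _ _ t])
  fix D E assume D: "D#:U" and E: "E#:U"
  let ?p = "uR (al (uL x *& D)) *& E" and ?q = "uR (al D) *& uL x *& E"
   and ?s = "uR (x |> al D -! al (uL x *& D)) *& E"
  have "?f al (top (0[R], x) (tn D E)) +& ?f (n1 (uL x) al) (tn D E) = ?p +& ?q +& ?s"
   using x a b D E by (simp add: top_tn con_ind_add con_ind_tn n1_uL)
  also have "... = ?q +& (?p +& ?s)" using x a D E by (simp add: U.a_ac)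
  also have "?p +& ?s = uR (x |> al D) *& E"
   using x a D E uR_minus_add[of "x |> al D" "al (uL x *& D)" E] by simp
  also have "?q +& uR (x |> al D) *& E = uL x *& ?f al (tn D E)" using x a D E by (simp add: con_ind_tn uL_base)
  finally show "?f al (top (0[R], x) (tn D E)) +& ?f (n1 (uL x) al) (tn D E) = uL x *& ?f al (tn D E)" .
 qed (use x a b in "simp_all add: con_ind_add top_add U.r_distr U.a_ac")
 from this[of "cop D"] show ?thesis using x D by (simp add: con_def cop_uL)
qed

lemma con_uL:
 assumes x: "x#:L" and D: "D#:U" and a: "al#:J"
 shows "con al (uL x *& D) = uL x *& con al D -[U] con (n1 (uL x) al) D"
proof -
 have b: "n1 (uL x) al#:J" using x a by simp
 from con_uL_add[OF assms] have "uL x *& con al D -[U] con (n1 (uL x) al) D = con al (uL x *& D) +& con (n1 (uL x) al) D -[U] con (n1 (uL x) al) D" by simp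
 thus ?thesis using x D a b by (simp add: a_minus_def U.a_assoc U.r_neg)
qed

lemma con_jet_add: "al#:J ==> be#:J ==> D#:U ==> con (al +[J] be) D = con al D +& con be D"
 unfolding con_def
 by (rule TG2_eqI[OF U.abelian_group_axioms]) (simp_all add: con_ind_add con_ind_tn uR_add U.l_distr U.a_ac jet_add_closed)

lemma con_jet_uR: "al#:J ==> r#:R ==> D#:U ==> con (n1 (uR r) al) D = uR r *& con al D"
 unfolding con_def
 by (rule TG2_eqI[OF U.abelian_group_axioms]) (simp_all add: con_ind_add con_ind_tn n1_uR uR_uR U.r_distr)

lemma con_pair:
 assumes a: "al#:J" and b: "be#:J" and D: "D#:U"
 shows "be (con al D) = (al *[J] be) D"
 unfolding con_def jet_mult[OF a b D]
proof (rule TG2_eqI[OF R.abelian_group_axioms])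
 fix D E assume "D#:U" "E#:U"
 thus "be (cind al (tn D E)) = T2.ind R (jpair al be) (tn D E)"
  using a b T2.ind_frag[OF R.abelian_group_axioms jpair_bal[OF a b], of "[D, E]"]
  by (simp add: con_ind_tn jet_uR) (simp add: tn_def tuples_U2 jpair_def)
qed (use a b D in "simp_all add: con_ind_add jet_plus T2.ind_closed[OF R.abelian_group_axioms jpair_bal[OF a b]]
  T2.ind_add[OF R.abelian_group_axioms jpair_bal[OF a b]]")

lemma jet_one_one: "1[J] 1[U] = 1[R]" by (simp add: jet_one)

lemma n1_uL_one: "x#:L ==> n1 (uL x) 1[J] = 0[J]"
 by (rule jet_eqD) (simp_all add: jet_one_closed jet_zero_closed n1_uL, simp add: jet_one actR_mult actR_uL)

lemma con_unit: "D#:U ==> con 1[J] D = D"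
proof (induction rule: U_gen_induct)
 case one
 thus ?case using con_one[OF jet_one_closed] by (simp add: jet_one_one)
next
 case (uL x D)
 \<comment> \<open>The zero jet is the unit jet multiplied by the scalar 0, which brings the claim
   under \<open>con_jet_uR\<close>.\<close>
 have "con 0[J] D = 0[U]"
  using con_jet_uR[OF jet_one_closed R.zero_closed uL(2)] jet_eqD[of "n1 (uR 0[R]) 1[J]" "0[J]"] uL
   con_closed[OF jet_one_closed uL(2)] n1_uR[of "0[R]" "1[J]"] jet_one_closed jet_zero_closed n1_closed[OF uR_closed[OF R.zero_closed] jet_one_closed]
  by (simp del: uR_zero) simp
 thus ?case using uL by (simp add: con_uL jet_one_closed n1_uL_one)
qed (simp_all add: con_uR con_add jet_one_closed)

end

section \<open>The product of jets\<close>

context lie_algebroid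
begin

abbreviation u1 where "u1 == jet_unit1 K R L"
abbreviation u2 where "u2 == jet_unit2 K R L"

lemma u1_closed [simp]: "r#:R ==> u1 r#:J"
 by (simp add: jet_unit1_def jet_one_closed)

lemma u2_closed [simp]: "r#:R ==> u2 r#:J"
 by (simp add: jet_unit2_def jet_one_closed)

lemma u1_app: "r#:R ==> D#:U ==> u1 r D = r *! actR D 1[R]"
 by (simp add: jet_unit1_def jet_one_closed n1_uR) (simp add: jet_one)

lemma u2_app: "r#:R ==> D#:U ==> u2 r D = actR D r"
 by (simp add: jet_unit2_def) (simp add: jet_one actR_mult actR_uR)

lemma n1_uL_app: "x#:L ==> ga#:J ==> D#:U ==> n1 (uL x) ga D +! ga (uL x *& D) = x |> ga D"
 by (simp add: n1_uL R.minus_eq R.a_assoc R.l_neg)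

lemma jet_mult_closed: "al#:J ==> be#:J ==> al *[J] be#:J"
proof -
 assume a: "al#:J" and b: "be#:J"
 have "(\<lambda>D\<in>carrier U. be (con al D))#:J" by (rule jet_comp[OF b]) (use a in "simp_all add: con_add con_uR")
 moreover have "(\<lambda>D\<in>carrier U. be (con al D)) = al *[J] be"
  by (rule extensionalityI[of _ "carrier U"]) (use a b in "simp_all add: con_pair")
 ultimately show ?thesis by simp
qed

lemma jet_mult_uL:
 assumes x: "x#:L" and a: "al#:J" and b: "be#:J" and D: "D#:U"
 shows "(al *[J] be) (uL x *& D) +! ((n1 (uL x) al *[J] be) D +! (al *[J] n1 (uL x) be) D) = x |> (al *[J] be) D"
proof -
 have "be (con al (uL x *& D)) +! be (con (n1 (uL x) al) D) = be (uL x *& con al D)"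
  using jet_plus[OF b, of "con al (uL x *& D)" "con (n1 (uL x) al) D"] x a D by (simp add: con_uL_add)
 thus ?thesis using n1_uL_app[OF x b, of "con al D"] x a b D jet_mult_closed
  by (simp add: con_pair R.a_assoc[symmetric]) (simp add: con_pair[symmetric] R.a_comm)
qed

lemma jet_mult_uR: "r#:R ==> al#:J ==> be#:J ==> D#:U ==>
  (al *[J] be) (uR r *& D) = r *! (al *[J] be) D"
 by (simp add: jet_mult_closed jet_uR)

lemma jet_mult_one: "al#:J ==> be#:J ==> (al *[J] be) 1[U] = al 1[U] *! be 1[U]"
 using con_pair[of al be "1[U]"] jet_uR[of be "1[U]" "al 1[U]"] by (simp add: con_one)

lemma n1_leibniz:
 assumes x: "x#:L" and a: "al#:J" and b: "be#:J"
 shows "n1 (uL x) (al *[J] be) = n1 (uL x) al *[J] be +[J] al *[J] n1 (uL x) be"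
proof (rule jet_eqD)
 fix D assume D: "D#:U"
 note c = jet_mult_closed
 have "n1 (uL x) (al *[J] be) D +! (al *[J] be) (uL x *& D)
   = ((n1 (uL x) al *[J] be) D +! (al *[J] n1 (uL x) be) D) +! (al *[J] be) (uL x *& D)"
  unfolding n1_uL_app[OF x c[OF a b] D] jet_mult_uL[OF x a b D, symmetric] using x a b D c by (simp add: R.a_comm)
 thus "n1 (uL x) (al *[J] be) D = (n1 (uL x) al *[J] be +[J] al *[J] n1 (uL x) be) D"
  using x a b D c by simp
qed (use x a b in "simp_all add: jet_mult_closed jet_add_closed")

text \<open>By \<open>jet_mult_uL\<close> the value of a product at \<open>x D\<close> is given by
  values at \<open>D\<close> of products with differentiated factors, so the induction on
  \<open>D\<close> has to run over all pairs of jets.\<close>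

lemma jet_mult_comm: "al#:J ==> be#:J ==> al *[J] be = be *[J] al"
proof (rule jet_eqD)
 fix D assume "D#:U" and a: "al#:J" and b: "be#:J"
 thus "(al *[J] be) D = (be *[J] al) D"
 proof (induction D arbitrary: al be rule: U_gen_induct)
  case (uL x D)
  let ?s = "(n1 (uL x) al *[J] be) D +! (al *[J] n1 (uL x) be) D"
  have s: "(n1 (uL x) be *[J] al) D +! (be *[J] n1 (uL x) al) D = ?s"
   using uL.hyps uL.prems uL.IH[of al "n1 (uL x) be"] uL.IH[of "n1 (uL x) al" be] jet_mult_closed by (simp add: R.a_comm)
  have "(al *[J] be) (uL x *& D) +! ?s = (be *[J] al) (uL x *& D) +! ?s"
   using jet_mult_uL[of x al be D] jet_mult_uL[of x be al D] uL.hyps uL.prems uL.IH[of al be] unfolding s by simp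
  thus ?case using uL.hyps uL.prems jet_mult_closed by simp
 qed (simp_all add: jet_mult_one jet_mult_uR jet_mult_closed jet_plus R.m_comm)
qed (simp_all add: jet_mult_closed)

lemma con_mult: "D#:U ==> al#:J ==> be#:J ==> con (al *[J] be) D = con be (con al D)"
proof (induction D arbitrary: al be rule: U_gen_induct)
 case one
 thus ?case using con_uR[of be "al 1[U]" "1[U]"] by (simp add: con_one jet_mult_one jet_mult_closed uR_mult)
next
 case (uL x D)
 note h = uL.hyps uL.prems
 let ?a = "n1 (uL x) al" and ?b = "n1 (uL x) be"
 have "con (n1 (uL x) (al *[J] be)) D = con be (con ?a D) +& con ?b (con al D)"
  using h uL.IH[of ?a be] uL.IH[of al ?b] by (simp add: n1_leibniz con_jet_add jet_mult_closed)
 hence "con (al *[J] be) (uL x *& D) +& (con be (con ?a D) +& con ?b (con al D)) = uL x *& con be (con al D)"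
  using con_uL_add[of x D "al *[J] be"] h uL.IH[of al be] by (simp add: jet_mult_closed)
 also have "... = con be (con al (uL x *& D) +& con ?a D) +& con ?b (con al D)"
  using con_uL_add[of x "con al D" be] h by (simp add: con_uL_add)
 also have "... = con be (con al (uL x *& D)) +& (con be (con ?a D) +& con ?b (con al D))"
  using h by (simp add: con_add U.a_assoc)
 finally show ?case using h by (simp add: jet_mult_closed)
qed (simp_all add: con_uR con_add jet_mult_closed)

lemma jet_left_app: "r#:R ==> al#:J ==> D#:U ==> jl r al D = r *! al D"
 using con_pair[of "u1 r" al D] by (simp add: jet_left_def jet_unit1_def jet_one_closed con_jet_uR con_unit jet_uR)

lemma jet_left_n1: "r#:R ==> al#:J ==> jl r al = n1 (uR r) al"
 by (rule jet_eqD) (simp_all add: jet_left_app n1_uR, simp add: jet_left_def jet_mult_closed)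

text \<open>Right multiplication of an operator by a scalar \<open>r\<close> is the sum of the first
  legs of its coproduct, each multiplied by the value of the second leg at \<open>r\<close>. Hence
  multiplication by \<open>u2 r\<close> is \<open>nabla2\<close> along \<open>r\<close>.\<close>

lemma actR_con:
 assumes r: "r#:R"
 shows "D#:U ==> al#:J ==> actR (con al D) r = al (D *& uR r)"
proof (induction D arbitrary: al rule: U_gen_induct)
 case one
 thus ?case using r jet_uR[of al "1[U]" r] by (simp add: con_one actR_uR R.m_comm)
next
 case (uL x D)
 have "actR (con al (uL x *& D)) r +! n1 (uL x) al (D *& uR r) = actR (con al (uL x *& D) +& con (n1 (uL x) al) D) r"
  using uL r uL.IH[of "n1 (uL x) al"] by (simp add: actR_add)
 also have "... = al ((uL x *& D) *& uR r) +! n1 (uL x) al (D *& uR r)"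
  using uL r n1_uL_app[of x al "D *& uR r"] by (simp add: con_uL_add actR_mult actR_uL U.m_assoc R.a_comm)
 finally show ?case using uL r by simp
qed (use r in "simp_all add: con_uR con_add actR_add actR_mult actR_uR U.m_assoc U.l_distr jet_uR jet_plus")

lemma jet_right_n2: "r#:R ==> al#:J ==> jr al r = n2 (uR r) al"
 by (rule jet_eqD) (simp_all add: jet_right_def jet_mult_closed con_pair[symmetric] u2_app actR_con)

lemma jet_cring: "cring J"
proof (rule cringI[OF jet_abelian])
 show "comm_monoid J"
 proof (rule comm_monoidI)
  fix al be ga assume a: "al#:J" and b: "be#:J" and c: "ga#:J"
  show "al *[J] be = be *[J] al" using a b by (rule jet_mult_comm)
  show "al *[J] be *[J] ga = al *[J] (be *[J] ga)"
   by (rule jet_eqD) (use a b c in "simp_all add: jet_mult_closed con_pair[symmetric] con_mult")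
  show "1[J] *[J] al = al"
   by (rule jet_eqD) (use a in "simp_all add: jet_mult_closed jet_one_closed con_pair[symmetric] con_unit")
 qed (simp_all add: jet_mult_closed jet_one_closed)
 fix al be ga assume "al#:J" "be#:J" "ga#:J"
 thus "(al +[J] be) *[J] ga = al *[J] ga +[J] be *[J] ga"
  by (intro jet_eqD) (simp_all add: jet_mult_closed jet_add_closed con_pair[symmetric] con_jet_add jet_plus)
qed

lemma jet_smult_n1: "c#:K ==> al#:J ==> c **[J] al = n1 (uR (kap c)) al"
 by (rule jet_eqD) (simp_all add: jet_smult_closed jet_smult n1_uR)

lemma jet_smult_mult:
 assumes "al#:J" "be#:J" "c#:K"
 shows "(c **[J] al) *[J] be = c **[J] (al *[J] be)"
 by (rule jet_eqD) (use assms in "simp_all add: jet_mult_closed jet_smult_n1 n1_uR con_pair[symmetric] con_jet_uR jet_uR")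

lemma jet_algebra: "algebra K J"
 by (rule algebra.intro[OF jet_module jet_cring algebra_axioms.intro]) (rule jet_smult_mult)

end

sublocale lie_algebroid < JR: cring "jet K R L"
 by (rule jet_cring)

context lie_algebroid
begin

lemma jet_units:
 shows "u1:alg_hom K R J" "u2:alg_hom K R J"
proof -
 have m: "u1 r *[J] u1 s = u1 (r *! s)" if "r#:R" "s#:R" for r s
  using that jet_left_app[of r "u1 s"] by (intro jet_eqD) (simp_all add: jet_left_def jet_mult_closed u1_app R.m_assoc)
 have o: "u1 1[R] = 1[J]" by (rule jet_eqD) (simp_all add: u1_app jet_one_closed, simp add: jet_one)
 have a: "u1 (r +! s) = u1 r +[J] u1 s" if "r#:R" "s#:R" for r s
  by (rule jet_eqD) (use that in "simp_all add: u1_app R.l_distr jet_add_closed")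
 have c: "u1 (c **[R] r) = c **[J] u1 r" if "c#:K" "r#:R" for c r
  by (rule jet_eqD) (use that in "simp_all add: u1_app kap_mult R.m_assoc jet_smult jet_smult_closed")
 show "u1:alg_hom K R J" by (auto simp: alg_hom_def ring_hom_def m o a c)
 have m: "u2 (r *! s) = u2 r *[J] u2 s" if "r#:R" "s#:R" for r s
  using that jet_right_n2[of s "u2 r"] R.m_comm[of r s] by (simp add: jet_right_def) (rule jet_eqD; simp add: u2_app actR_mult actR_uR)
 have o: "u2 1[R] = 1[J]" by (rule jet_eqD) (simp_all add: u2_app jet_one_closed, simp add: jet_one)
 have a: "u2 (r +! s) = u2 r +[J] u2 s" if "r#:R" "s#:R" for r s
  by (rule jet_eqD) (use that in "simp_all add: u2_app actR_eact AR.eact_add_right jet_add_closed")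
 have c: "u2 (c **[R] r) = c **[J] u2 r" if cr: "c#:K" "r#:R" for c r
 proof (rule jet_eqD)
  fix D assume D: "D#:U"
  have "actR D (kap c *! r) = actR (D *& uR (kap c)) r" using cr D by (simp add: actR_mult actR_uR)
  also have "... = actR (uR (kap c) *& D) r" using cr D by (simp add: U_kap_central)
  also have "... = kap c *! actR D r" using cr D by (simp add: actR_mult actR_uR)
  finally show "u2 (c **[R] r) D = (c **[J] u2 r) D" using cr D by (simp add: u2_app kap_mult jet_smult)
 qed (use cr in "simp_all add: jet_smult_closed kap_mult")
 show "u2:alg_hom K R J" by (auto simp: alg_hom_def ring_hom_def m o a c)
qed

lemma ep_app: "ep al = al 1[U]" by (simp add: jet_counit_def)

lemma ep_closed [simp]: "al#:J ==> ep al#:R" by (simp add: ep_app)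

lemma ep_hom: "ep:alg_hom K J R"
 by (auto simp: alg_hom_def ring_hom_def ep_app jet_smult kap_mult jet_mult_one jet_one_one)

lemma ep_units: "r#:R ==> ep (u1 r) = r" "r#:R ==> ep (u2 r) = r"
 by (simp_all add: ep_app u1_app u2_app)

lemma ep_bimod:
 assumes "r#:R" "al#:J"
 shows "ep (jl r al) = r *! ep al" "ep (jr al r) = ep al *! r"
 using assms jet_uR[of al "1[U]" r] by (simp_all add: ep_app jet_left_app jet_right_n2 R.m_comm)

lemma n1_zero: "al#:J ==> n1 0[U] al = 0[J]"
 using n1_add[of "0[U]" "0[U]" al] by (simp add: JR.add.l_cancel_one)

definition n1pair where "n1pair al be Ds = n1 (Ds ! 0) al *[J] n1 (Ds ! 1) be"

context
 fixes al be assumes a: "al#:J" and b: "be#:J"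
begin

lemma n1_jet_left: "r#:R ==> D#:U ==> ga#:J ==> n1 (uR r *& D) ga = u1 r *[J] n1 D ga"
 using jet_left_n1[of r "n1 D ga"] by (simp add: n1_mult jet_left_def)

lemma n1pair_bal: "T2.bal J (n1pair al be)"
 by (rule balanced2I) (use a b in "simp_all add: n1pair_def n1_add JR.l_distr JR.r_distr n1_jet_left JR.m_ac")

lemma n1_product:
 assumes "D#:U"
 shows "n1 D (al *[J] be) = T2.ind J (n1pair al be) (cop D)"
proof -
 let ?f = "T2.ind J (n1pair al be)"
 note fc = T2.ind_closed[OF JR.abelian_group_axioms n1pair_bal]
 note fa = T2.ind_add[OF JR.abelian_group_axioms n1pair_bal]
 have ft: "?f (tn D E) = n1 D al *[J] n1 E be" if "D#:U" "E#:U" for D E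
  using T2.ind_frag[OF JR.abelian_group_axioms n1pair_bal, of "[D, E]"] that by (simp add: tn_def tuples_U2 n1pair_def)
 have R: "?f (top (r, 0[L]) t) = n1 (uR r) (?f t)" if t: "t#:TG2" and r: "r#:R" for t r
  by (rule TG2_eqI[OF JR.abelian_group_axioms _ _ _ _ _ t])
   (use r a b fc in "simp_all add: fa top_add top_tn ft n1_add_right n1_jet_left n1_zero JR.m_assoc
    jet_left_n1[symmetric] jet_left_def[symmetric], simp_all add: jet_left_def JR.r_distr JR.m_assoc")
 have L: "?f (top (0[R], x) t) = n1 (uL x) (?f t)" if t: "t#:TG2" and x: "x#:L" for t x
  by (rule TG2_eqI[OF JR.abelian_group_axioms _ _ _ _ _ t])
   (use x a b fc in "simp_all add: fa top_add top_tn ft n1_add_right n1_zero n1_leibniz n1_mult")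
 show ?thesis using assms
 proof (induction rule: U_gen_induct)
  case one
  thus ?case using a b by (simp add: cop_one ft)
 next
  case (uR r D)
  thus ?case using a b by (simp add: n1_mult cop_uR R)
 next
  case (uL x D)
  thus ?case using a b by (simp add: n1_mult cop_uL L)
 next
  case (add D E)
  thus ?case using a b by (simp add: n1_add cop_add fa)
 qed
qed

end

end

section \<open>The antipode\<close>

context lie_algebroid
begin

text \<open>The first pairing, viewed as a jet in \<open>D\<close>. The condition that defines the
  antipode asks for a preimage under this map; as the map is an involution, the preimage is its
  value.\<close>

definition anti where "anti al = (\<lambda>D\<in>carrier U. ep (n1 D al))"

lemma anti_app: "D#:U ==> anti al D = n1 D al 1[U]" by (simp add: anti_def ep_app)

lemma anti_closed [simp]: "al#:J ==> anti al#:J"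
proof (rule jetI)
 show "anti al:extensional (carrier U)" by (simp add: anti_def)
qed (simp_all add: anti_app n1_add n1_mult n1_uR)

lemma anti_n1: "E#:U ==> al#:J ==> anti (n1 E al) = n2 E (anti al)"
 by (rule jet_eqD) (simp_all add: anti_app n1_mult)

lemma anti_add: "al#:J ==> be#:J ==> anti (al +[J] be) = anti al +[J] anti be"
 by (rule jet_eqD) (simp_all add: anti_app n1_add_right)

lemma anti_n2: "E#:U ==> al#:J ==> anti (n2 E al) = n1 E (anti al)"
proof (induction E arbitrary: al rule: U_gen_induct)
 case one
 have "n2 1[U] al = al" by (rule jet_eqD) (use one in simp_all)
 thus ?case using one by simp
next
 case (uR r E)
 have "anti (n2 (uR r) be) = n1 (uR r) (anti be)" if b: "be#:J" for be
 proof (rule jet_eqD)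
  fix D assume D: "D#:U"
  show "anti (n2 (uR r) be) D = n1 (uR r) (anti be) D"
   using D b uR(1) jet_uR[of "n1 D be" "1[U]" r] by (simp add: anti_app n1_n2 n1_uR)
 qed (use b uR(1) in simp_all)
 thus ?case using uR by (simp add: n2_mult n1_mult)
next
 case (uL x E)
 have "anti (n2 (uL x) be) = n1 (uL x) (anti be)" if b: "be#:J" for be
 proof (rule jet_eqD)
  fix D assume D: "D#:U"
  show "anti (n2 (uL x) be) D = n1 (uL x) (anti be) D"
   using D b uL(1) by (simp add: anti_app n1_n2 n1_uL n1_mult) (simp add: a_minus_def R.minus_add R.r_neg1 R.r_neg2)
 qed (use b uL(1) in simp_all)
 thus ?case using uL by (simp add: n2_mult n1_mult)
next
 case (add E E')
 thus ?case by (simp add: n2_add n1_add anti_add)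
qed

lemma ep_anti: "al#:J ==> ep (anti al) = ep al"
 by (simp add: ep_app anti_app)

text \<open>The map exchanges the two module structures and preserves the counit, so the first
  pairing of \<open>anti al\<close> is the second pairing of \<open>al\<close>.\<close>

lemma anti_anti: "al#:J ==> anti (anti al) = al"
proof (rule jet_eqD)
 fix D assume a: "al#:J" and D: "D#:U"
 have "anti (anti al) D = ep (anti (n2 D al))" using a D by (simp add: anti_app ep_app anti_n2)
 also have "... = al D" using a D by (simp add: ep_anti) (simp add: ep_app)
 finally show "anti (anti al) D = al D" .
qed simp_all

text \<open>Both sides are evaluations at the coproduct of \<open>D\<close>: on the left by the
  Leibniz rule for \<open>n1\<close> and multiplicativity of the counit, on the right by the product
  of jets.\<close>

lemma anti_mult:
 assumes a: "al#:J" and b: "be#:J"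
 shows "anti (al *[J] be) = anti al *[J] anti be"
proof (rule jet_eqD)
 fix D assume D: "D#:U"
 have ab: "anti al#:J" "anti be#:J" using a b by simp_all
 note n = n1pair_bal[OF a b] and j = jpair_bal[OF ab]
 have "T2.ind J (n1pair al be) t 1[U] = T2.ind R (jpair (anti al) (anti be)) t" if t: "t#:TG2" for t
 proof (rule TG2_eqI[OF R.abelian_group_axioms _ _ _ _ _ t])
  fix D E assume "D#:U" "E#:U"
  thus "T2.ind J (n1pair al be) (tn D E) 1[U] = T2.ind R (jpair (anti al) (anti be)) (tn D E)"
   using T2.ind_frag[OF JR.abelian_group_axioms n, of "[D, E]"] T2.ind_frag[OF R.abelian_group_axioms j, of "[D, E]"] a b
   by (simp add: tn_def tuples_U2 n1pair_def jpair_def jet_mult_one anti_app)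
 qed (use T2.ind_closed[OF JR.abelian_group_axioms n] T2.ind_add[OF JR.abelian_group_axioms n]
   T2.ind_closed[OF R.abelian_group_axioms j] T2.ind_add[OF R.abelian_group_axioms j] in simp_all)
 thus "anti (al *[J] be) D = (anti al *[J] anti be) D"
  using D jet_mult[OF ab D] by (simp add: anti_app n1_product[OF a b D])
qed (use a b in simp_all)

text \<open>A multiplicative involution fixes the unit, as one sees by applying it to its value at
  the unit.\<close>

lemma anti_one: "anti 1[J] = 1[J]"
proof -
 have "1[J] = anti (anti 1[J] *[J] 1[J])" using jet_one_closed by (simp add: anti_anti)
 also have "... = anti 1[J]" using jet_one_closed by (subst anti_mult) (simp_all add: anti_anti)
 finally show ?thesis by simp
qed

lemma anti_hom: "anti:alg_hom K J J"
 by (auto simp: alg_hom_def ring_hom_def anti_mult anti_add anti_one)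
  (rule jet_eqD, simp_all add: anti_app n1_scal jet_smult jet_smult_closed)

lemma anti_bimod:
 assumes "r#:R" "al#:J"
 shows "anti (jl r al) = jr (anti al) r" "anti (jr al r) = jl r (anti al)"
 using assms by (simp_all add: jet_left_n1 jet_right_n2 anti_n1 anti_n2)

lemma pairing1: "D#:U ==> pairing1 K R L al D = anti al D"
 by (simp add: pairing1_def anti_def)

lemma pairing2: "D#:U ==> pairing2 K R L al D = al D"
 by (simp add: pairing2_def ep_app)

lemma is_jet_antipode_iff: "al#:J ==> is_jet_antipode K R L al be <-> be = anti al"
proof
 assume a: "al#:J" and "is_jet_antipode K R L al be"
 hence b: "be#:J" and e: "!!D. D#:U ==> anti be D = al D"
  by (auto simp: is_jet_antipode_def pairing1 pairing2)
 have "anti be = al" by (rule jet_eqD[OF anti_closed[OF b] a e])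
 thus "be = anti al" using anti_anti[OF b] by simp
qed (simp add: is_jet_antipode_def pairing1 pairing2 anti_anti)

lemma jet_antipode_anti: "al#:J ==> jet_antipode K R L al = anti al"
 unfolding jet_antipode_def by (rule the_equality) (simp_all add: is_jet_antipode_iff)

end

section \<open>Dual bases of locally free modules\<close>

context cring
begin

text \<open>The factor \<open>c\<close> is carried along for the induction: splitting one factor off
  the power multiplies it by \<open>a\<close> or by \<open>b\<close> and lowers one
  exponent.\<close>

lemma rad_add:
 assumes "ideal I R" "a#:R" "b#:R"
 shows "c#:R ==> c .* a [^] n:I ==> c .* b [^] m:I ==> c .* (a .+ b) [^] (n + m :: nat):I"
proof (induction "n + m" arbitrary: n m c rule: less_induct)
 case less
 interpret I: ideal I R by (rule assms(1))
 show ?case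
 proof (cases "n = 0 | m = 0")
  case True
  hence "c:I" using less.prems by auto
  thus ?thesis using assms by (simp add: I.I_r_closed)
 next
  case False
  then obtain n' m' where nm: "n = Suc n'" "m = Suc m'" by (metis not0_implies_Suc)
  let ?p = "(a .+ b) [^] (n' + m)"
  have e: "(a .+ b) [^] (n + m) = (a .+ b) .* ?p" "n' + m = n + m'" using assms nm by (simp_all add: m_comm)
  have 1: "(c .* a) .* ?p:I"
  proof (rule less.hyps)
   show "c .* a .* a [^] n':I" using less.prems assms nm by (simp add: m_ac)
   have "c .* a .* b [^] m = a .* (c .* b [^] m)" using less.prems assms by (simp add: m_assoc m_lcomm)
   thus "c .* a .* b [^] m:I" using less.prems assms I.I_l_closed by simp
  qed (use nm less.prems assms in auto)
  have 2: "(c .* b) .* (a .+ b) [^] (n + m'):I"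
  proof (rule less.hyps)
   show "c .* b .* b [^] m':I" using less.prems assms nm by (simp add: m_ac)
   have "c .* b .* a [^] n = b .* (c .* a [^] n)" using less.prems assms by (simp add: m_assoc m_lcomm)
   thus "c .* b .* a [^] n:I" using less.prems assms I.I_l_closed by simp
  qed (use nm less.prems assms in auto)
  have "c .* (a .+ b) [^] (n + m) = (c .* a) .* ?p .+ (c .* b) .* ?p"
   unfolding e(1) using less.prems assms by (simp add: m_assoc[symmetric] r_distr l_distr)
  thus ?thesis using 1 2 I.a_closed unfolding e(2) by simp
 qed
qed

lemma radical_one:
 assumes F: "F <= carrier R" "genideal R F = carrier R" and I: "ideal I R"
  and n: "!!f. f:F ==> EX n::nat. f [^] n:I"
 shows "\<one>:I"
proof -
 interpret I: ideal I R by (rule I)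
 let ?J = "{r\<in>carrier R. EX n::nat. r [^] n:I}"
 have mult: "r .* a:?J" if "a:?J" "r#:R" for r a
  using that by (auto simp: nat_pow_distrib intro: I.I_l_closed)
 have "ideal ?J R"
 proof (rule idealI[OF ring_axioms])
  show "subgroup ?J (add_monoid R)"
  proof (rule add.subgroupI)
   have "\<zero> [^] (1::nat):I" by simp
   thus "?J ~= {}" by blast
   fix a assume a: "a:?J"
   hence ".- \<one> .* a:?J" by (intro mult) auto
   thus ".- a:?J" using a by (simp add: l_minus)
   fix b assume "b:?J"
   with a obtain n m :: nat where "a [^] n:I" "b [^] m:I" by blast
   hence "(a .+ b) [^] (n + m):I" using rad_add[OF I, of a b \<one> n m] a \<open>b:?J\<close> by simp
   thus "a .+ b:?J" using a \<open>b:?J\<close> by blast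
  qed auto
 qed (use mult m_comm in "auto simp: m_comm")
 moreover have "F <= ?J" using F n by auto
 ultimately have "carrier R <= ?J" using genideal_minimal[of ?J F] F by simp
 thus ?thesis by auto
qed

text \<open>Quasi-compactness of the spectrum: the elements reached from finite subsets of
  \<open>F\<close> form an ideal, which contains 1.\<close>

lemma genideal_finite:
 assumes "F <= carrier R" "genideal R F = carrier R"
 obtains F0 where "finite F0" "F0 <= F" "genideal R F0 = carrier R"
proof -
 let ?J = "{r\<in>carrier R. EX F0. finite F0 & F0 <= F & r:genideal R F0}"
 have id: "ideal (genideal R F0) R" if "F0 <= F" for F0 using that assms by (intro genideal_ideal) auto
 have mono: "genideal R F0 <= genideal R F1" if "F0 <= F1" "F1 <= F" for F0 F1
  using that assms genideal_self[of F1] by (intro genideal_minimal id) auto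
 have "ideal ?J R"
 proof (rule idealI[OF ring_axioms])
  show "subgroup ?J (add_monoid R)"
  proof (rule add.subgroupI)
   have "\<zero>:genideal R {}" using additive_subgroup.zero_closed[OF ideal.axioms(1)[OF id[of "{}"]]] by simp
   thus "?J ~= {}" by blast
   fix a assume a: "a:?J"
   then obtain F0 where "finite F0" "F0 <= F" "a:genideal R F0" by blast
   moreover from this have ".- a:genideal R F0"
    using additive_subgroup.a_inv_closed[OF ideal.axioms(1)[OF id]] by blast
   ultimately show ".- a:?J" using a by auto
   fix b assume "b:?J"
   with a obtain F0 F1 where F: "finite F0" "F0 <= F" "a:genideal R F0" "finite F1" "F1 <= F" "b:genideal R F1" by blast
   hence "a:genideal R (F0 \<union> F1)" "b:genideal R (F0 \<union> F1)" using mono[of F0 "F0 \<union> F1"] mono[of F1 "F0 \<union> F1"] by auto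
   hence "a .+ b:genideal R (F0 \<union> F1)"
    using F additive_subgroup.a_closed[OF ideal.axioms(1)[OF id[of "F0 \<union> F1"]]] by simp
   thus "a .+ b:?J" using a \<open>b:?J\<close> F by (auto intro!: exI[of _ "F0 \<union> F1"])
  qed auto
 next
  fix a x assume a: "a:?J" and x: "x#:R"
  then obtain F0 where F: "finite F0" "F0 <= F" "a:genideal R F0" by blast
  thus "x .* a:?J" "a .* x:?J"
   using a x ideal.I_l_closed[OF id[OF F(2)] F(3)] ideal.I_r_closed[OF id[OF F(2)] F(3)] by auto
 qed
 moreover have "F <= ?J"
 proof
  fix f assume "f:F"
  thus "f:?J" using assms genideal_self[of "{f}"] by (auto intro!: exI[of _ "{f}"])
 qed
 ultimately have "carrier R <= ?J" using genideal_minimal[of ?J F] assms by simp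
 then obtain F0 where "finite F0" "F0 <= F" "\<one>:genideal R F0" by blast
 thus thesis using that ideal.one_imp_carrier[OF id] by blast
qed

end

context module
begin

definition lc where "lc A c g = (\<Oplus>\<^bsub>M\<^esub>x\<in>A. c x **[M] g x)"

lemma lc_closed [simp]: "c:A -> carrier R ==> g:A -> carrier M ==> lc A c g#:M"
 unfolding lc_def by (rule M.finsum_closed) auto

lemma lc_add: "c:A -> carrier R ==> c':A -> carrier R ==> g:A -> carrier M ==>
  lc A (%x. c x .+ c' x) g = lc A c g +[M] lc A c' g"
 unfolding lc_def by (subst M.finsum_addf[symmetric], (force simp: Pi_iff)+, rule M.finsum_cong') (auto simp: smult_l_distr Pi_iff)

lemma lc_smult: "finite A ==> c:A -> carrier R ==> r#:R ==> g:A -> carrier M ==>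
  lc A (%x. r .* c x) g = r **[M] lc A c g"
 unfolding lc_def by (subst finsum_smult_ldistr, (force simp: Pi_iff)+, rule M.finsum_cong') (auto simp: smult_assoc1 Pi_iff)

lemma lc_insert: "finite A ==> a \<notin> A ==> c:insert a A -> carrier R ==> g:insert a A -> carrier M ==>
  lc (insert a A) c g = c a **[M] g a +[M] lc A c g"
 unfolding lc_def by (subst M.finsum_insert) (auto simp: Pi_iff)

lemma lc_empty [simp]: "lc {} c g = 0[M]" by (simp add: lc_def)

lemma lc_cong: "(!!x. x:A ==> c x = c' x) ==> (!!x. x:A ==> g x = g' x) ==> c':A -> carrier R ==> g':A -> carrier M ==>
  lc A c g = lc A c' g'"
 unfolding lc_def by (rule M.finsum_cong') (auto simp: Pi_iff)

lemma lc_zero: "(!!x. x:A ==> c x = \<zero>) ==> g:A -> carrier M ==> lc A c g = 0[M]"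
 unfolding lc_def by (rule M.add.finprod_one_eqI) (auto simp: Pi_iff)

lemma lc_single:
 assumes "finite A" "a:A" "c a#:R" "!!x. x:A ==> x ~= a ==> c x = \<zero>" "g:A -> carrier M"
 shows "lc A c g = c a **[M] g a"
proof -
 have c: "c:A -> carrier R" using assms by (metis Pi_I R.zero_closed)
 have "lc A c g = lc (insert a (A - {a})) c g" using assms by (simp add: insert_absorb)
 also have "... = c a **[M] g a +[M] lc (A - {a}) c g" by (rule lc_insert) (use assms c in auto)
 also have "lc (A - {a}) c g = 0[M]" by (rule lc_zero) (use assms in auto)
 finally show ?thesis using assms by (simp add: Pi_iff)
qed

lemma lc_swap:
 assumes "finite A" "finite B" "r:A -> carrier R" "!!j i. j:A ==> i:B ==> a j i#:R" "m:B -> carrier M"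
 shows "lc B (%i. \<Oplus>j\<in>A. r j .* a j i) m = lc A r (%j. lc B (a j) m)"
 using assms(1,3,4)
proof (induction A)
 case empty
 thus ?case using assms by (simp add: lc_zero)
next
 case (insert x A)
 hence x: "r x#:R" "!!i. i:B ==> a x i#:R" and r: "r:A -> carrier R"
  and a: "!!j i. j:A ==> i:B ==> a j i#:R" by auto
 have "lc B (%i. \<Oplus>j\<in>insert x A. r j .* a j i) m = lc B (%i. r x .* a x i .+ (\<Oplus>j\<in>A. r j .* a j i)) m"
  by (rule lc_cong) (use insert.hyps x r a assms(5) in "auto simp: Pi_iff intro!: R.finsum_insert R.finsum_closed")
 also have "... = lc B (%i. r x .* a x i) m +[M] lc B (%i. \<Oplus>j\<in>A. r j .* a j i) m"
  by (rule lc_add) (use x r a assms(5) in "auto simp: Pi_iff intro!: R.finsum_closed")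
 also have "... = r x **[M] lc B (a x) m +[M] lc A r (%j. lc B (a j) m)"
  using x insert.IH[OF r a] assms by (simp add: lc_smult Pi_iff)
 also have "... = lc (insert x A) r (%j. lc B (a j) m)"
  by (rule lc_insert[symmetric]) (use insert assms in "auto simp: Pi_iff")
 finally show ?case .
qed

end

section \<open>Localised modules\<close>

locale mod_loc = module R M for R (structure) and M (structure) +
 fixes S :: "'a set"
 assumes S_sub: "S <= carrier R" and S_one: "\<one>:S" and S_mult: "s:S ==> t:S ==> s .* t:S"
begin

abbreviation rel where "rel == frac_rel R S M"
abbreviation fr where "fr m s == frac R S M m s"
abbreviation LM where "LM == loc_module R S M"

lemma S_carr [simp]: "s:S ==> s#:R" using S_sub by blast

lemma minus_zero_iff: "a#:M ==> b#:M ==> a -[M] b = 0[M] <-> a = b"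
 by (metis a_minus_def M.a_inv_closed M.minus_equality M.minus_minus M.minus_self)

lemma frac_rel_iff: "((m, s), (n, t)):rel <-> m#:M & n#:M & s:S & t:S &
  (EX u:S. (u .* t) **[M] m = (u .* s) **[M] n)"
proof -
 have "u **[M] (t **[M] m -[M] s **[M] n) = 0[M] <-> (u .* t) **[M] m = (u .* s) **[M] n"
  if "m#:M" "n#:M" "s:S" "t:S" "u:S" for u
 proof -
  have "u **[M] (t **[M] m -[M] s **[M] n) = (u .* t) **[M] m -[M] (u .* s) **[M] n"
   using that by (simp add: a_minus_def smult_r_distr smult_r_minus smult_assoc1)
  thus ?thesis using that minus_zero_iff by simp
 qed
 thus ?thesis unfolding frac_rel_def by (auto 0 3)
qed

lemma smult_swap: "a#:R ==> b#:R ==> m#:M ==> n#:M ==> c#:R ==>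
  a **[M] m = b **[M] n ==> (c .* a) **[M] m = (c .* b) **[M] n"
 by (simp add: smult_assoc1)

lemma equiv_rel: "equiv (carrier M \<times> S) rel"
proof (rule equivI)
 show "rel <= (carrier M \<times> S) \<times> (carrier M \<times> S)" by (auto simp: frac_rel_def)
 show "refl_on (carrier M \<times> S) rel" by (rule refl_onI) (use S_one in "auto simp: frac_rel_iff")
 show "sym rel" by (rule symI) (force simp: frac_rel_iff intro: sym)
 show "trans rel"
 proof (rule transI)
  fix x y z assume "(x, y):rel" "(y, z):rel"
  moreover obtain m s where x: "x = (m, s)" by (cases x)
  moreover obtain n t where y: "y = (n, t)" by (cases y)
  moreover obtain p w where z: "z = (p, w)" by (cases z)
  ultimately obtain u v where e: "x = (m, s)" "y = (n, t)" "z = (p, w)" "m#:M" "n#:M" "p#:M"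
   "s:S" "t:S" "w:S" "u:S" "v:S"
   and u: "(u .* t) **[M] m = (u .* s) **[M] n" and v: "(v .* w) **[M] n = (v .* t) **[M] p"
   by (auto simp: frac_rel_iff)
  have "((v .* w) .* (u .* t)) **[M] m = ((v .* w) .* (u .* s)) **[M] n" by (rule smult_swap) (use e u in auto)
  moreover have "((u .* s) .* (v .* w)) **[M] n = ((u .* s) .* (v .* t)) **[M] p" by (rule smult_swap) (use e v in auto)
  ultimately have "((u .* v .* t) .* w) **[M] m = ((u .* v .* t) .* s) **[M] p" using e by (simp add: R.m_ac)
  moreover have "u .* v .* t:S" using e S_mult by simp
  ultimately show "(x, z):rel" using e by (auto simp: frac_rel_iff)
 qed
qed

lemma frac_eq: "m#:M ==> n#:M ==> s:S ==> t:S ==>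
  fr m s = fr n t <-> (EX u:S. (u .* t) **[M] m = (u .* s) **[M] n)"
 by (subst eq_equiv_class_iff[OF equiv_rel]) (auto simp: frac_rel_iff)

lemma frac_mem: "(n, t):fr m s ==> n#:M & t:S & fr n t = fr m s"
 using equiv_class_eq[OF equiv_rel, of "(m, s)" "(n, t)"] by (auto simp: frac_rel_iff)

lemma frac_self: "m#:M ==> s:S ==> (m, s):fr m s"
 using S_one by (auto simp: frac_rel_iff)

lemma LM_carrier: "x#:LM <-> (EX m:carrier M. EX s:S. x = fr m s)"
 by (auto simp: loc_module_def quotient_def)

lemma frac_closed [simp]: "m#:M ==> s:S ==> fr m s#:LM"
 by (auto simp: LM_carrier)

lemma UN_frac2:
 assumes "x:V" "y:W" "!!p q. p:V ==> q:W ==> g p q = g x y"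
 shows "(\<Union>p\<in>V. \<Union>q\<in>W. g p q) = g x y"
 using assms by blast

lemma LM_add:
 assumes "m#:M" "n#:M" "s:S" "t:S"
 shows "fr m s +[LM] fr n t = fr (t **[M] m +[M] s **[M] n) (s .* t)"
proof -
 have "fr (t' **[M] m' +[M] s' **[M] n') (s' .* t') = fr (t **[M] m +[M] s **[M] n) (s .* t)"
  if mn: "(m', s'):fr m s" "(n', t'):fr n t" for m' s' n' t'
 proof -
  have c: "m'#:M" "s':S" "n'#:M" "t':S" using mn frac_mem by blast+
  obtain u where u: "u:S" "(u .* s) **[M] m' = (u .* s') **[M] m"
   using frac_mem[OF mn(1)] c assms by (auto simp: frac_eq)
  obtain v where v: "v:S" "(v .* t) **[M] n' = (v .* t') **[M] n"
   using frac_mem[OF mn(2)] c assms by (auto simp: frac_eq)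
  note cc = c assms u(1) v(1)
  have 1: "((v .* t .* t') .* (u .* s)) **[M] m' = ((v .* t .* t') .* (u .* s')) **[M] m" by (rule smult_swap) (use cc u in auto)
  have 2: "((u .* s .* s') .* (v .* t)) **[M] n' = ((u .* s .* s') .* (v .* t')) **[M] n" by (rule smult_swap) (use cc v in auto)
  have "((u .* v) .* (s .* t)) **[M] (t' **[M] m' +[M] s' **[M] n') = ((u .* v) .* (s' .* t')) **[M] (t **[M] m +[M] s **[M] n)"
   using cc 1 2 by (simp add: smult_r_distr smult_assoc1[symmetric] R.m_ac)
  thus ?thesis using cc S_mult by (subst frac_eq) auto
 qed
 thus ?thesis using UN_frac2[OF frac_self[OF assms(1,3)] frac_self[OF assms(2,4)],
   where g = "%(m, s) (n, t). fr (t **[M] m +[M] s **[M] n) (s .* t)"]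
  by (simp add: loc_module_def case_prod_unfold)
qed

lemma LM_zero: "0[LM] = fr 0[M] \<one>" by (simp add: loc_module_def)

lemma frac_zero: "s:S ==> fr 0[M] s = fr 0[M] \<one>"
 using S_one by (subst frac_eq) auto

lemma frac_cancel: "m#:M ==> s:S ==> t:S ==> fr (t **[M] m) (t .* s) = fr m s"
 using S_one S_mult by (subst frac_eq) (auto simp: smult_assoc1[symmetric] R.m_ac intro!: bexI[of _ \<one>])

lemma LM_add_same:
 assumes "m#:M" "n#:M" "s:S"
 shows "fr m s +[LM] fr n s = fr (m +[M] n) s"
 using assms frac_cancel[of "m +[M] n" s s] by (simp add: LM_add smult_r_distr)

lemma LM_monoid: "abelian_monoid LM"
proof (rule abelian_monoidI)
 fix x y z assume x: "x#:LM" and y: "y#:LM" and z: "z#:LM"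
 obtain m s where m: "m#:M" "s:S" "x = fr m s" using x by (auto simp: LM_carrier)
 obtain n t where n: "n#:M" "t:S" "y = fr n t" using y by (auto simp: LM_carrier)
 obtain p w where p: "p#:M" "w:S" "z = fr p w" using z by (auto simp: LM_carrier)
 show "x +[LM] y#:LM" using m n S_mult by (simp add: LM_add)
 show "x +[LM] y = y +[LM] x" using m n by (simp add: LM_add M.a_comm R.m_comm)
 show "x +[LM] y +[LM] z = x +[LM] (y +[LM] z)"
  using m n p S_mult by (simp add: LM_add smult_r_distr smult_assoc1[symmetric] M.a_ac R.m_ac)
 show "0[LM] +[LM] x = x" using m S_one by (simp add: LM_zero LM_add)
qed (simp add: LM_zero S_one)

lemma self_module_simps [simp]: "carrier (self_module R) = carrier R" "smult (self_module R) = monoid.mult R"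
 "ring.zero (self_module R) = ring.zero R" "add (self_module R) = add R"
 by (simp_all add: self_module_def)

lemma self_module: "module R (self_module R)"
proof (rule moduleI)
 show "abelian_group (self_module R)"
  by (rule abelian_groupI) (auto intro: R.a_assoc R.a_comm R.add.l_inv_ex)
qed (auto intro: R.is_cring R.l_distr R.r_distr R.m_assoc)

end

sublocale mod_loc < Q: mod_loc R "self_module R" S
 by (intro mod_loc.intro self_module mod_loc_axioms.intro S_sub S_one S_mult)

context mod_loc
begin

abbreviation LR where "LR == loc_ring R S"

lemma LR_carrier: "x#:LR <-> (EX a:carrier R. EX s:S. x = Q.fr a s)"
 using Q.LM_carrier by (simp add: loc_ring_def Let_def)

lemma LM_smult:
 assumes "a#:R" "m#:M" "s:S" "t:S"
 shows "Q.fr a s **[LM] fr m t = fr (a **[M] m) (s .* t)"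
proof -
 have "fr (a' **[M] m') (s' .* t') = fr (a **[M] m) (s .* t)"
  if mn: "(a', s'):Q.fr a s" "(m', t'):fr m t" for m' s' a' t'
 proof -
  have c: "m'#:M" "s':S" "a'#:R" "t':S" using mn frac_mem Q.frac_mem by fastforce+
  obtain u where u: "u:S" "(u .* s) .* a' = (u .* s') .* a"
   using Q.frac_mem[OF mn(1)] c assms by (auto simp: Q.frac_eq)
  obtain v where v: "v:S" "(v .* t) **[M] m' = (v .* t') **[M] m"
   using frac_mem[OF mn(2)] c assms by (auto simp: frac_eq)
  note cc = c assms u(1) v(1)
  have "((u .* v) .* (s .* t)) **[M] (a' **[M] m') = ((u .* s) .* a') **[M] ((v .* t) **[M] m')"
   using cc by (simp add: smult_assoc1[symmetric] R.m_ac)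
  also have "... = ((u .* v) .* (s' .* t')) **[M] (a **[M] m)"
   unfolding u(2) v(2) using cc by (simp add: smult_assoc1[symmetric] R.m_ac)
  finally show ?thesis using cc S_mult by (subst frac_eq) auto
 qed
 moreover have q: "(a, s):Q.fr a s" using Q.frac_self assms by simp
 ultimately show ?thesis using UN_frac2[OF q frac_self[OF assms(2,4)],
   where g = "%(a, s) (m, t). fr (a **[M] m) (s .* t)"]
  by (simp add: loc_module_def case_prod_unfold)
qed

text \<open>Clearing denominators: the numerators of a basis of the localisation generate
  \<open>M\<close> and are independent, both up to a factor from \<open>S\<close>.\<close>

lemma free_gen_indep:
 assumes "free_of_rank LR LM d"
 shows "EX m:{..<d} -> carrier M.
   (ALL y:carrier M. EX u:S. EX c:{..<d} -> carrier R. u **[M] y = lc {..<d} c m)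
  & (ALL c:{..<d} -> carrier R. lc {..<d} c m = 0[M] --> (ALL i<d. EX u:S. u .* c i = \<zero>))"
proof -
 interpret LM: abelian_monoid LM by (rule LM_monoid)
 obtain b where b: "b:{..<d} -> carrier LM" and ex: "!!x. x#:LM ==>
  EX! c. c:({..<d} \<rightarrow>\<^sub>E carrier LR) & x = (\<Oplus>\<^bsub>LM\<^esub>i\<in>{..<d}. c i **[LM] b i)"
  using assms[unfolded free_of_rank_def] by (elim bexE) (rule that, assumption, rule bspec)
 have "ALL i:{..<d}. EX m s. m#:M & s:S & b i = fr m s" using b LM_carrier by blast
 then obtain m s where ms: "!!i. i < d ==> m i#:M & s i:S & b i = fr (m i) (s i)"
  unfolding bchoice_iff by auto
 have m: "m:{..<d} -> carrier M" using ms by auto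
 have gen: "EX u:S. EX c:{..<d} -> carrier R. u **[M] y = lc {..<d} c m" if y: "y#:M" for y
 proof -
  obtain c where c: "c:({..<d} \<rightarrow>\<^sub>E carrier LR)" "fr y \<one> = (\<Oplus>\<^bsub>LM\<^esub>i\<in>{..<d}. c i **[LM] b i)"
   using ex[of "fr y \<one>"] y S_one by auto
  have "ALL i:{..<d}. EX a t. a#:R & t:S & c i = Q.fr a t" using c(1) LR_carrier by (meson PiE_mem)
  then obtain a t where at: "!!i. i < d ==> a i#:R & t i:S & c i = Q.fr (a i) (t i)"
   unfolding bchoice_iff by auto
  have cb: "c i **[LM] b i = fr (a i **[M] m i) (t i .* s i)" if "i < d" for i
   using ms[OF that] at[OF that] by (simp add: LM_smult)
  \<comment> \<open>A common denominator for the partial sums, by induction on the number of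
    summands.\<close>
  have "k <= d ==> EX u:S. EX r:{..<k} -> carrier R. (\<Oplus>\<^bsub>LM\<^esub>i\<in>{..<k}. c i **[LM] b i) = fr (lc {..<k} r m) u" for k
  proof (induction k)
   case 0
   thus ?case using S_one by (auto simp: LM_zero)
  next
   case (Suc k)
   then obtain u r where u: "u:S" and r: "r:{..<k} -> carrier R"
    and e: "(\<Oplus>\<^bsub>LM\<^esub>i\<in>{..<k}. c i **[LM] b i) = fr (lc {..<k} r m) u" by auto
   define v where "v = t k .* s k"
   let ?r = "%i. if i = k then u .* a k else v .* r i"
   have k: "k < d" using Suc.prems by simp
   have v: "v:S" using ms[OF k] at[OF k] S_mult unfolding v_def by blast
   have mk: "m:{..<k} -> carrier M" "m k#:M" "a k#:R" using m k at[OF k] by auto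
   have "lc {..<Suc k} ?r m = lc (insert k {..<k}) ?r m" by (simp add: lessThan_Suc)
   also have "... = (u .* a k) **[M] m k +[M] lc {..<k} ?r m"
    by (subst lc_insert) (use mk u v r in "auto simp: Pi_iff")
   also have "lc {..<k} ?r m = lc {..<k} (%i. v .* r i) m"
    by (rule lc_cong) (use mk u v r in "auto simp: Pi_iff")
   also have "... = v **[M] lc {..<k} r m" by (rule lc_smult) (use mk u v r in "auto simp: Pi_iff")
   finally have l: "lc {..<Suc k} ?r m = u **[M] (a k **[M] m k) +[M] v **[M] lc {..<k} r m"
    using mk u by (simp add: smult_assoc1)
   have "(\<Oplus>\<^bsub>LM\<^esub>i\<in>{..<Suc k}. c i **[LM] b i) = (\<Oplus>\<^bsub>LM\<^esub>i\<in>insert k {..<k}. c i **[LM] b i)" by (simp add: lessThan_Suc)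
   also have "... = c k **[LM] b k +[LM] (\<Oplus>\<^bsub>LM\<^esub>i\<in>{..<k}. c i **[LM] b i)"
   proof (rule LM.finsum_insert)
    have "c i **[LM] b i#:LM" if "i < d" for i
     unfolding cb[OF that] using ms[OF that] at[OF that] S_mult by simp
    thus "(%i. c i **[LM] b i):{..<k} -> carrier LM" "c k **[LM] b k#:LM" using k by auto
   qed auto
   also have "... = fr (lc {..<Suc k} ?r m) (v .* u)"
    unfolding l e cb[OF k] v_def[symmetric] by (subst LM_add) (use mk u v r in "auto simp: Pi_iff")
   finally show ?case using u v mk r S_mult by (intro bexI[of _ "v .* u"] bexI[of _ ?r]) (auto simp: Pi_iff)
  qed
  from this[of d] obtain u r where u: "u:S" and r: "r:{..<d} -> carrier R" and "fr y \<one> = fr (lc {..<d} r m) u"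
   using c(2) by auto
  then obtain v where v: "v:S" "(v .* u) **[M] y = (v .* \<one>) **[M] lc {..<d} r m"
   using y m S_one by (auto simp: frac_eq)
  hence "(v .* u) **[M] y = lc {..<d} (%i. v .* r i) m" using r m by (simp add: lc_smult Pi_iff)
  moreover have "(%i. v .* r i):{..<d} -> carrier R" using v r by (auto simp: Pi_iff)
  ultimately show ?thesis using S_mult[OF v(1) u] by blast
 qed
 have "EX u:S. u .* c i = \<zero>" if c: "c:{..<d} -> carrier R" and 0: "lc {..<d} c m = 0[M]" and i: "i < d" for c i
 proof -
  \<comment> \<open>In the localisation \<open>m i\<close> is \<open>s i\<close> times
    \<open>b i\<close>, so a relation between the \<open>m i\<close> with coefficients
    \<open>c i\<close> is one between the \<open>b i\<close> with coefficients
    \<open>c i .* s i\<close>. It is compared with the trivial relation.\<close>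
  let ?c = "\<lambda>i\<in>{..<d}. Q.fr (c i .* s i) \<one>" and ?z = "\<lambda>i\<in>{..<d}. Q.fr \<zero> \<one>"
  have sc: "?c i **[LM] b i = fr (c i **[M] m i) \<one>" "?z i **[LM] b i = 0[LM]" if i: "i < d" for i
  proof -
   have "c i#:R" using c i by auto
   thus "?c i **[LM] b i = fr (c i **[M] m i) \<one>"
    using i ms[OF i] S_one frac_cancel[of "c i **[M] m i" \<one> "s i"]
    by (simp add: LM_smult smult_assoc1[symmetric] R.m_comm)
   show "?z i **[LM] b i = 0[LM]" using i ms[OF i] S_one frac_zero[of "s i"] by (simp add: LM_smult LM_zero)
  qed
  have "k <= d ==> (\<Oplus>\<^bsub>LM\<^esub>i\<in>{..<k}. ?c i **[LM] b i) = fr (lc {..<k} c m) \<one>" for k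
  proof (induction k)
   case (Suc k)
   have k: "k < d" using Suc.prems by simp
   have ck: "c:{..<k} -> carrier R" "m:{..<k} -> carrier M" "c k#:R" "m k#:M" using c m k by auto
   have "(\<Oplus>\<^bsub>LM\<^esub>i\<in>{..<Suc k}. ?c i **[LM] b i) = (\<Oplus>\<^bsub>LM\<^esub>i\<in>insert k {..<k}. ?c i **[LM] b i)" by (simp add: lessThan_Suc)
   also have "... = ?c k **[LM] b k +[LM] (\<Oplus>\<^bsub>LM\<^esub>i\<in>{..<k}. ?c i **[LM] b i)"
   proof (rule LM.finsum_insert)
    have "?c i **[LM] b i#:LM" if "i < d" for i
     unfolding sc(1)[OF that] using that c m S_one by (auto simp: Pi_iff)
    thus "(%i. ?c i **[LM] b i):{..<k} -> carrier LM" "?c k **[LM] b k#:LM" using k by auto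
   qed auto
   also have "... = fr (c k **[M] m k +[M] lc {..<k} c m) \<one>"
    using Suc ck S_one unfolding sc(1)[OF k] by (simp add: LM_add_same)
   also have "c k **[M] m k +[M] lc {..<k} c m = lc (insert k {..<k}) c m"
    by (rule lc_insert[symmetric]) (use ck in "auto simp: Pi_iff")
   finally show ?case by (simp add: lessThan_Suc)
  qed (simp add: LM_zero)
  from this[of d] have "0[LM] = (\<Oplus>\<^bsub>LM\<^esub>i\<in>{..<d}. ?c i **[LM] b i)" using 0 by (simp add: LM_zero)
  moreover have "0[LM] = (\<Oplus>\<^bsub>LM\<^esub>i\<in>{..<d}. ?z i **[LM] b i)"
   by (rule LM.add.finprod_one_eqI[folded finsum_def, simplified, symmetric]) (use sc(2) in auto)
  moreover have "?c:{..<d} \<rightarrow>\<^sub>E carrier LR"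
   using c ms S_one LR_carrier by (auto simp: Pi_iff)
  moreover have "?z:{..<d} \<rightarrow>\<^sub>E carrier LR" using S_one LR_carrier by (auto simp: Pi_iff)
  moreover have un: "c = c'" if "EX! c. P c" "P c" "P c'" for P and c c' :: "nat => ('a \<times> 'a) set"
   using that by blast
  ultimately have "?c = ?z" by (intro un[OF ex[OF LM.zero_closed]] conjI)
  from fun_cong[OF this, of i] have "Q.fr (c i .* s i) \<one> = Q.fr \<zero> \<one>" using i by simp
  then obtain u where u: "u:S" "u .* (c i .* s i) = \<zero>"
   using c i ms[OF i] S_one Q.frac_eq[of "c i .* s i" \<zero> \<one> \<one>] by (auto simp: Pi_iff)
  have "(u .* s i) .* c i = \<zero>" using u c i ms[OF i] by (simp add: Pi_iff R.m_ac)
  moreover have "u .* s i:S" using u(1) ms[OF i] S_mult by blast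
  ultimately show ?thesis by blast
 qed
 thus ?thesis using gen by (intro bexI[OF _ m] conjI ballI allI impI)
qed

end

lemma (in cring) idealI':
 assumes "I <= carrier R" "\<zero>:I" "!!a b. a:I ==> b:I ==> a .+ b:I" "!!a r. a:I ==> r#:R ==> r .* a:I"
 shows "ideal I R"
proof (rule idealI[OF ring_axioms])
 show "subgroup I (add_monoid R)"
 proof (rule add.subgroupI)
  fix a assume a: "a:I"
  hence ".- \<one> .* a:I" by (intro assms) auto
  thus ".- a:I" using a assms(1) by (simp add: l_minus subset_iff)
 qed (use assms in auto)
 fix a r assume "a:I" "r#:R"
 thus "a .* r:I" using assms(1,4) m_comm by (metis subset_iff)
qed (rule assms(4))

context module
begin

lemma lc_smult_right: "finite A ==> c:A -> carrier R ==> r#:R ==> g:A -> carrier M ==>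
  lc A c (%x. r **[M] g x) = r **[M] lc A c g"
 unfolding lc_def
 by (subst finsum_smult_ldistr, (force simp: Pi_iff)+, rule M.finsum_cong')
  (auto simp: smult_assoc1[symmetric] Pi_iff R.m_comm)

lemma lc_const:
 assumes "finite A" "y#:M"
 shows "c:A -> carrier R ==> q:A -> carrier R ==> lc A c (%x. q x **[M] y) = (\<Oplus>x\<in>A. c x .* q x) **[M] y"
 using assms(1)
proof (induction A)
 case (insert x A)
 have "lc (insert x A) c (%x. q x **[M] y) = c x **[M] (q x **[M] y) +[M] lc A c (%x. q x **[M] y)"
  by (rule lc_insert) (use insert assms in "auto simp: Pi_iff")
 moreover have "(\<Oplus>x\<in>insert x A. c x .* q x) = c x .* q x .+ (\<Oplus>x\<in>A. c x .* q x)"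
  by (rule R.finsum_insert) (use insert in "auto simp: Pi_iff")
 moreover have "(\<Oplus>x\<in>A. c x .* q x)#:R" by (rule R.finsum_closed) (use insert in "auto simp: Pi_iff")
 ultimately show ?case using insert assms by (simp add: Pi_iff smult_l_distr smult_assoc1)
qed (use assms in simp)

lemma lc_Times:
 assumes "finite A" "finite B" "!!f i. f:A ==> i:B ==> p f i#:R" "!!f i. f:A ==> i:B ==> m f i#:M"
 shows "c:A -> carrier R ==> lc (A \<times> B) (%(f, i). c f .* p f i) (%(f, i). m f i) = lc A c (%f. lc B (p f) (m f))"
 using assms(1,3,4)
proof (induction A)
 case (insert x A)
 have e: "insert x A \<times> B = Pair x ` B \<union> A \<times> B" by auto
 have "lc (insert x A \<times> B) (%(f, i). c f .* p f i) (%(f, i). m f i)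
  = lc (Pair x ` B) (%(f, i). c f .* p f i) (%(f, i). m f i) +[M] lc (A \<times> B) (%(f, i). c f .* p f i) (%(f, i). m f i)"
  unfolding lc_def e by (rule M.finsum_Un_disjoint) (use insert assms(2) in "auto simp: Pi_iff")
 also have "lc (Pair x ` B) (%(f, i). c f .* p f i) (%(f, i). m f i) = lc B (%i. c x .* p x i) (m x)"
  unfolding lc_def by (subst M.finsum_reindex) (use insert in "auto simp: Pi_iff inj_on_def")
 also have "... = c x **[M] lc B (p x) (m x)" by (rule lc_smult) (use insert assms in "auto simp: Pi_iff")
 also have "lc (A \<times> B) (%(f, i). c f .* p f i) (%(f, i). m f i) = lc A c (%f. lc B (p f) (m f))"
  using insert by (intro insert.IH) auto
 also have "c x **[M] lc B (p x) (m x) +[M] lc A c (%f. lc B (p f) (m f)) = lc (insert x A) c (%f. lc B (p f) (m f))"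
  by (rule lc_insert[symmetric]) (use insert in "auto simp: Pi_iff intro!: lc_closed")
 finally show ?case .
qed simp

lemma lc_minus:
 assumes "finite A" "c:A -> carrier R" "c':A -> carrier R" "g:A -> carrier M" "lc A c g = lc A c' g"
 shows "lc A (%x. c x .- c' x) g = 0[M]"
proof -
 have "lc A (%x. c x .- c' x) g = lc A (%x. c x .+ .- \<one> .* c' x) g"
  by (rule lc_cong) (use assms in "auto simp: Pi_iff a_minus_def R.l_minus")
 also have "... = lc A c g +[M] .- \<one> **[M] lc A c' g"
  using assms by (subst lc_add) (auto simp: Pi_iff lc_smult)
 also have "... = 0[M]" using assms by (simp add: smult_l_minus M.r_neg)
 finally show ?thesis .
qed

lemma self_mod: "module R (self_module R)"
 using mod_loc.self_module[of R M "{\<one>}"] by (simp add: mod_loc_def mod_loc_axioms_def module_axioms)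

lemma finsum_self: "finsum (self_module R) f A = finsum R f A"
 by (simp add: finsum_def self_module_def finprod_def)

end

section \<open>Gluing localised bases into a dual basis\<close>

locale loc_free_data = module R M for R (structure) and M (structure) +
 fixes F0 :: "'a set" and S :: "'a => 'a set" and m :: "'a => nat => 'c" and d :: nat
 assumes F0: "finite F0" "F0 <= carrier R" "genideal R F0 = carrier R"
  and S_def: "S f = range (%n::nat. f [^] n)"
  and m_closed: "f:F0 ==> m f:{..<d} -> carrier M"
  and m_gen: "f:F0 ==> y#:M ==> EX u:S f. EX c:{..<d} -> carrier R. u **[M] y = lc {..<d} c (m f)"
  and m_indep: "f:F0 ==> c:{..<d} -> carrier R ==> lc {..<d} c (m f) = 0[M] ==> i < d ==> EX u:S f. u .* c i = \<zero>"
begin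

interpretation Q: module R "self_module R" by (rule self_mod)

lemma self_simps [simp]: "carrier (self_module R) = carrier R" "smult (self_module R) = monoid.mult R"
 "ring.zero (self_module R) = ring.zero R" "add (self_module R) = add R"
 by (simp_all add: self_module_def)

lemma Qlc: "Q.lc A c g = (\<Oplus>x\<in>A. c x .* g x)"
 by (simp add: Q.lc_def finsum_self)

lemma S_closed: "f:F0 ==> u:S f ==> u#:R" using F0 by (auto simp: S_def)

lemma S_mult: "f:F0 ==> u:S f ==> v:S f ==> u .* v:S f"
 using F0 by (auto simp: S_def R.nat_pow_mult subset_iff)

lemma S_one: "\<one>:S f" by (auto simp: S_def intro: image_eqI[of _ _ 0])

text \<open>Finitely many conditions, each stable under enlarging the factor, can be met by one
  factor: the product of the individual ones.\<close>

lemma S_common: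
 assumes f: "f:F0" and "finite B" "!!b. b:B ==> EX u:S f. P b u" "!!b u v. b:B ==> u:S f ==> v:S f ==> P b u ==> P b (v .* u)"
 shows "EX u:S f. ALL b:B. P b u"
 using assms(2-4)
proof (induction B)
 case empty
 thus ?case using S_one by auto
next
 case (insert b B)
 then obtain u v where u: "u:S f" "ALL b:B. P b u" and v: "v:S f" "P b v" by (metis insertCI)
 have "v .* u = u .* v" using S_closed[OF f] u v by (simp add: R.m_comm)
 thus ?case using u v insert.prems(2)[of b v u] insert.prems(2)[of _ u v] S_mult[OF f v(1) u(1)] by (intro bexI[of _ "v .* u"]) auto
qed

text \<open>The device for local verification. It is applied to the ideal of those \<open>r\<close>
  for which a claim holds after multiplication by \<open>r\<close>; a power of each element of
  \<open>F0\<close> in this ideal suffices.\<close>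

lemma local_one:
 assumes "ideal I R" "!!f. f:F0 ==> EX u:S f. u:I"
 shows "\<one>:I"
 by (rule R.radical_one[OF F0(2,3) assms(1)]) (use assms(2) in "fastforce simp: S_def")

lemma m_indep':
 assumes f: "f:F0" and c: "c:{..<d} -> carrier R" "c':{..<d} -> carrier R" "lc {..<d} c (m f) = lc {..<d} c' (m f)"
 shows "EX u:S f. ALL i:{..<d}. u .* c i = u .* c' i"
proof (rule S_common[OF f])
 fix i assume i: "i:{..<d}"
 have "lc {..<d} (%i. c i .- c' i) (m f) = 0[M]" by (rule lc_minus) (use c m_closed[OF f] in auto)
 then obtain u where u: "u:S f" "u .* (c i .- c' i) = \<zero>"
  using m_indep[OF f, of "%i. c i .- c' i" i] c i by (auto simp: Pi_iff)
 have cu: "u#:R" "c i#:R" "c' i#:R" using S_closed[OF f] u c i by auto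
 hence "u .* c i .- u .* c' i = \<zero>" using u by (simp add: a_minus_def R.r_distr R.r_minus)
 hence "u .* c i = u .* c' i" using cu
  by (metis R.m_closed a_minus_def R.a_inv_closed R.minus_equality R.minus_minus)
 thus "EX u:S f. u .* c i = u .* c' i" using u by blast
next
 fix i u v assume "i:{..<d}" "u:S f" "v:S f" "u .* c i = u .* c' i"
 thus "v .* u .* c i = v .* u .* c' i" using S_closed[OF f] c by (simp add: R.m_assoc Pi_iff)
qed simp

definition A where "A = F0 \<times> {..<d}"
definition g where "g = (%(f, i). m f i)"

lemma g_closed: "g:A -> carrier M" using m_closed by (fastforce simp: g_def A_def)

lemma A_finite: "finite A" using F0 by (simp add: A_def)

lemma g_gen:
 assumes y: "y#:M"
 shows "EX c:A -> carrier R. lc A c g = y"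
proof -
 let ?I = "{r\<in>carrier R. EX c:A -> carrier R. lc A c g = r **[M] y}"
 have "\<one>:?I"
 proof (rule local_one)
  show "ideal ?I R"
  proof (rule R.idealI')
   have "lc A (%_. \<zero>) g = \<zero> **[M] y" using y by (simp add: lc_zero g_closed)
   thus "\<zero>:?I" by (auto intro!: bexI[of _ "%_. \<zero>"])
  next
   fix a b assume "a:?I" "b:?I"
   then obtain c c' where "a#:R" "b#:R" "c:A -> carrier R" "c':A -> carrier R"
    "lc A c g = a **[M] y" "lc A c' g = b **[M] y" by auto
   hence "lc A (%x. c x .+ c' x) g = (a .+ b) **[M] y" "(%x. c x .+ c' x):A -> carrier R"
    using y by (simp add: lc_add g_closed smult_l_distr, auto)
   thus "a .+ b:?I" using \<open>a:?I\<close> \<open>b:?I\<close> by blast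
  next
   fix a r assume "a:?I" and r: "r#:R"
   then obtain c where c: "a#:R" "c:A -> carrier R" "lc A c g = a **[M] y" by auto
   hence "lc A (%x. r .* c x) g = (r .* a) **[M] y" "(%x. r .* c x):A -> carrier R"
    using y r by (simp add: lc_smult A_finite g_closed smult_assoc1, auto)
   thus "r .* a:?I" using c r by blast
  qed auto
 next
  fix f assume f: "f:F0"
  obtain u c where u: "u:S f" and c: "c:{..<d} -> carrier R" "u **[M] y = lc {..<d} c (m f)" using m_gen[OF f y] by blast
  let ?c = "%(f', i). (if f' = f then \<one> else \<zero>) .* c i"
  have "lc A ?c g = lc F0 (%f'. if f' = f then \<one> else \<zero>) (%f'. lc {..<d} c (m f'))"
   unfolding g_def A_def using F0 c m_closed by (intro lc_Times[where p = "%_. c"]) (auto simp: Pi_iff)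
  also have "... = \<one> **[M] lc {..<d} c (m f)"
   using lc_single[of F0 f "%f'. if f' = f then \<one> else \<zero>" "%f'. lc {..<d} c (m f')"] F0 f c m_closed by auto
  also have "... = u **[M] y" using c m_closed[OF f] by simp
  finally have "lc A ?c g = u **[M] y" .
  moreover have "?c:A -> carrier R" using c by (auto simp: Pi_iff A_def)
  ultimately show "EX u:S f. u:?I" using u S_closed[OF f] by blast
 qed
 thus ?thesis using y by auto
qed

lemma coef_ex: "f:F0 ==> EX u:S f. ALL a:A. EX c:{..<d} -> carrier R. u **[M] g a = lc {..<d} c (m f)"
proof (rule S_common[OF _ A_finite])
 assume f: "f:F0"
 fix a assume "a:A"
 hence a: "g a#:M" using g_closed by (rule funcset_mem[rotated])
 show "EX u:S f. EX c:{..<d} -> carrier R. u **[M] g a = lc {..<d} c (m f)" by (rule m_gen[OF f a])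
 fix u v assume uv: "u:S f" "v:S f" and "EX c:{..<d} -> carrier R. u **[M] g a = lc {..<d} c (m f)"
 then obtain c where c: "c:{..<d} -> carrier R" "u **[M] g a = lc {..<d} c (m f)" by blast
 hence "(v .* u) **[M] g a = lc {..<d} (%i. v .* c i) (m f)"
  using a uv S_closed[OF f] m_closed[OF f] by (simp add: lc_smult smult_assoc1)
 moreover have "(%i. v .* c i):{..<d} -> carrier R" using c uv S_closed[OF f] by (auto simp: Pi_iff)
 ultimately show "EX c:{..<d} -> carrier R. (v .* u) **[M] g a = lc {..<d} c (m f)" by blast
qed assumption

text \<open>A simultaneous choice: the generator \<open>g a\<close>, multiplied by
  \<open>uu f\<close>, has the coordinates \<open>cc f a\<close> in the local basis at
  \<open>f\<close>, with one factor for all generators.\<close>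

definition cu where "cu = (SOME p. ALL f:F0. fst p f:S f & (ALL a:A. snd p f a:{..<d} -> carrier R & fst p f **[M] g a = lc {..<d} (snd p f a) (m f)))"
definition "uu = fst cu"
definition "cc = snd cu"

lemma cu: 
 assumes "f:F0"
 shows "uu f:S f" "!!a. a:A ==> cc f a:{..<d} -> carrier R"
  "!!a. a:A ==> uu f **[M] g a = lc {..<d} (cc f a) (m f)"
proof -
 let ?P = "%f u. ALL a:A. EX c:{..<d} -> carrier R. u **[M] g a = lc {..<d} c (m f)"
 have "ALL f:F0. EX u. u:S f & ?P f u" using coef_ex by blast
 then obtain u where u: "!!f. f:F0 ==> u f:S f & ?P f (u f)" by (metis (no_types, lifting))
 have "ALL p:F0 \<times> A. EX c. c:{..<d} -> carrier R & u (fst p) **[M] g (snd p) = lc {..<d} c (m (fst p))"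
 proof
  fix p assume "p:F0 \<times> A"
  hence "fst p:F0" "snd p:A" by auto
  thus "EX c. c:{..<d} -> carrier R & u (fst p) **[M] g (snd p) = lc {..<d} c (m (fst p))" using u by blast
 qed
 from this[unfolded bchoice_iff] obtain c where
  c: "ALL p:F0 \<times> A. c p:{..<d} -> carrier R & u (fst p) **[M] g (snd p) = lc {..<d} (c p) (m (fst p))"
  by (rule exE)
 let ?Q = "%p. ALL f:F0. fst p f:S f & (ALL a:A. snd p f a:{..<d} -> carrier R & fst p f **[M] g a = lc {..<d} (snd p f a) (m f))"
 have "?Q (u, %f a. c (f, a))"
 proof (intro ballI conjI)
  fix f assume f: "f:F0" thus "fst (u, %f a. c (f, a)) f:S f" using u by simp
  fix a assume "a:A"
  thus "snd (u, %f a. c (f, a)) f a:{..<d} -> carrier R"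
   "fst (u, %f a. c (f, a)) f **[M] g a = lc {..<d} (snd (u, %f a. c (f, a)) f a) (m f)"
   using bspec[OF c, of "(f, a)"] f by simp_all
 qed
 hence "?Q cu" unfolding cu_def by (rule someI)
 thus "uu f:S f" "!!a. a:A ==> cc f a:{..<d} -> carrier R"
  "!!a. a:A ==> uu f **[M] g a = lc {..<d} (cc f a) (m f)"
  using assms unfolding uu_def cc_def by blast+
qed

lemma cc_closed: "f:F0 ==> a:A ==> i < d ==> cc f a i#:R"
 using cu(2)[of f a] by auto

lemma uu_closed: "f:F0 ==> uu f#:R" using cu(1) S_closed by blast

text \<open>If \<open>y\<close> is the combination of the generators with coefficients
  \<open>r\<close>, these are coordinates at \<open>f\<close> of \<open>uu f\<close> times
  \<open>y\<close>. They can depend on the choice of \<open>r\<close>, a defect that the factor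
  \<open>ww f\<close> will remove.\<close>

definition psi where "psi f r i = (\<Oplus>a\<in>A. r a .* cc f a i)"

lemma psi_lc: "psi f r i = Q.lc A r (%a. cc f a i)" by (simp add: psi_def Qlc)

lemma psi_closed: "f:F0 ==> r:A -> carrier R ==> i < d ==> psi f r i#:R"
 unfolding psi_lc using Q.lc_closed[of r A] cc_closed by (simp add: Pi_iff)

lemma psi_sum:
 assumes f: "f:F0" and r: "r:A -> carrier R"
 shows "lc {..<d} (psi f r) (m f) = uu f **[M] lc A r g"
proof -
 have "lc {..<d} (psi f r) (m f) = lc A r (%a. lc {..<d} (cc f a) (m f))"
  unfolding psi_def[abs_def] by (rule lc_swap) (use A_finite r f cc_closed m_closed in "auto simp: Pi_iff")
 also have "... = lc A r (%a. uu f **[M] g a)"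
  by (rule lc_cong) (use r f cu(3)[OF f, symmetric] uu_closed g_closed in "simp_all add: Pi_iff")
 also have "... = uu f **[M] lc A r g" by (rule lc_smult_right[OF A_finite r uu_closed[OF f] g_closed])
 finally show ?thesis .
qed

text \<open>At \<open>f\<close> the element \<open>uu h\<close> times \<open>g a\<close> obtains
  coordinates in two ways: from those of \<open>g a\<close>, and from its expansion in the local
  basis at \<open>h\<close>. They agree after multiplication by an element of \<open>S f\<close>,
  and there are finitely many cases.\<close>

lemma kill_ex:
 assumes f: "f:F0"
 shows "EX w:S f. ALL p:F0 \<times> A. ALL i:{..<d}. w .* (uu (fst p) .* cc f (snd p) i) = w .* psi f (%b. if fst b = fst p then cc (fst p) (snd p) (snd b) else \<zero>) i"
proof (rule S_common[OF f])
 show "finite (F0 \<times> A)" using F0 A_finite by simp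
 fix p assume "p:F0 \<times> A"
 then obtain h a where p: "p = (h, a)" "h:F0" "a:A" by (cases p) auto
 let ?r = "%b. if fst b = h then cc h a (snd b) else \<zero>"
 have r: "?r:A -> carrier R" using cc_closed p by (auto simp: A_def)
 have "lc A ?r g = lc A (%(f', i). (if f' = h then \<one> else \<zero>) .* cc h a i) g"
  by (rule lc_cong) (use p cc_closed g_closed in "auto simp: A_def")
 also have "... = lc F0 (%f'. if f' = h then \<one> else \<zero>) (%f'. lc {..<d} (cc h a) (m f'))"
  unfolding g_def A_def using F0 p cu(2) cc_closed m_closed by (intro lc_Times[where p = "%_. cc h a"]) (auto simp: Pi_iff)
 also have "... = \<one> **[M] lc {..<d} (cc h a) (m h)"
  using lc_single[of F0 h "%f'. if f' = h then \<one> else \<zero>" "%f'. lc {..<d} (cc h a) (m f')"] F0 p cu(2) m_closed by auto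
 also have "... = uu h **[M] g a" using cu(2,3)[OF p(2,3)] m_closed[OF p(2)] by simp
 finally have "lc {..<d} (psi f ?r) (m f) = uu f **[M] (uu h **[M] g a)" using psi_sum[OF f r] by simp
 also have "... = uu h **[M] lc {..<d} (cc f a) (m f)"
  using uu_closed[OF f] uu_closed[OF p(2)] g_closed p(3) cu(3)[OF f p(3), symmetric] by (simp add: smult_assoc1[symmetric] R.m_comm Pi_iff)
 also have "... = lc {..<d} (%i. uu h .* cc f a i) (m f)"
  using uu_closed[OF p(2)] cu(2)[OF f p(3)] m_closed[OF f] by (simp add: lc_smult)
 finally have "lc {..<d} (%i. uu h .* cc f a i) (m f) = lc {..<d} (psi f ?r) (m f)" by simp
 thus "EX w:S f. ALL i:{..<d}. w .* (uu (fst p) .* cc f (snd p) i) = w .* psi f (%b. if fst b = fst p then cc (fst p) (snd p) (snd b) else \<zero>) i"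
  using m_indep'[OF f, of "%i. uu h .* cc f a i" "psi f ?r"] uu_closed[OF p(2)] cu(2)[OF f p(3)] psi_closed[OF f r]
  unfolding p(1) fst_conv snd_conv by (simp add: Pi_iff)
next
 fix p u v assume p: "p:F0 \<times> A" and uv: "u:S f" "v:S f"
  and e: "ALL i:{..<d}. u .* (uu (fst p) .* cc f (snd p) i) = u .* psi f (%b. if fst b = fst p then cc (fst p) (snd p) (snd b) else \<zero>) i"
 have r: "(%b. if fst b = fst p then cc (fst p) (snd p) (snd b) else \<zero>):A -> carrier R" using cc_closed p by (auto simp: A_def)
 show "ALL i:{..<d}. v .* u .* (uu (fst p) .* cc f (snd p) i) = v .* u .* psi f (%b. if fst b = fst p then cc (fst p) (snd p) (snd b) else \<zero>) i"
 proof
  fix i assume i: "i:{..<d}"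
  have "uu (fst p)#:R" "cc f (snd p) i#:R" "u#:R" "v#:R" 
   using i p uv uu_closed[of "fst p"] cc_closed[OF f, of "snd p" i] S_closed[OF f] by auto
  thus "v .* u .* (uu (fst p) .* cc f (snd p) i) = v .* u .* psi f (%b. if fst b = fst p then cc (fst p) (snd p) (snd b) else \<zero>) i"
   using e i psi_closed[OF f r, of i] by (simp add: R.m_assoc)
 qed
qed

end

context loc_free_data
begin

interpretation Q: module R "self_module R" by (rule self_mod)

definition ww where "ww f = (SOME w. w:S f & (ALL p:F0 \<times> A. ALL i:{..<d}. w .* (uu (fst p) .* cc f (snd p) i)
  = w .* psi f (%b. if fst b = fst p then cc (fst p) (snd p) (snd b) else \<zero>) i))"

lemma ww:
 assumes "f:F0"
 shows "ww f:S f" "!!h a i. h:F0 ==> a:A ==> i < d ==>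
  ww f .* (uu h .* cc f a i) = ww f .* psi f (%b. if fst b = h then cc h a (snd b) else \<zero>) i"
proof -
 let ?P = "%w. w:S f & (ALL p:F0 \<times> A. ALL i:{..<d}. w .* (uu (fst p) .* cc f (snd p) i)
  = w .* psi f (%b. if fst b = fst p then cc (fst p) (snd p) (snd b) else \<zero>) i)"
 obtain w where "?P w" using kill_ex[OF assms] by (rule bexE) blast
 hence w: "?P (ww f)" unfolding ww_def by (rule someI[of ?P])
 thus "ww f:S f" by (rule conjunct1)
 fix h a i assume "h:F0" "a:A" "i < d"
 thus "ww f .* (uu h .* cc f a i) = ww f .* psi f (%b. if fst b = h then cc h a (snd b) else \<zero>) i"
  using bspec[OF bspec[OF conjunct2[OF w], of "(h, a)"], of i] unfolding fst_conv snd_conv by blast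
qed

lemma ww_closed: "f:F0 ==> ww f#:R" using ww(1) S_closed by blast

lemma psi_add: "f:F0 ==> r:A -> carrier R ==> r':A -> carrier R ==> i < d ==>
  psi f (%x. r x .+ r' x) i = psi f r i .+ psi f r' i"
 unfolding psi_lc using Q.lc_add[of r A r' "%a. cc f a i"] cc_closed by (simp add: Pi_iff)

lemma psi_smult: "f:F0 ==> r:A -> carrier R ==> s#:R ==> i < d ==>
  psi f (%x. s .* r x) i = s .* psi f r i"
 unfolding psi_lc using Q.lc_smult[of A r s "%a. cc f a i"] cc_closed A_finite by (simp add: Pi_iff)

text \<open>It suffices to argue at each \<open>h\<close>. Multiplied by \<open>uu h\<close>, every
  generator may be replaced by its expansion at \<open>h\<close>, thanks to the choice of
  \<open>ww f\<close>. The coefficients then become \<open>psi h r\<close>; these are coordinates of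
  zero at \<open>h\<close> and are killed by an element of \<open>S h\<close>.\<close>

lemma psi_kill:
 assumes f: "f:F0" and r: "r:A -> carrier R" and 0: "lc A r g = 0[M]" and i: "i < d"
 shows "ww f .* psi f r i = \<zero>"
proof -
 let ?w = "ww f" and ?p = "psi f r i"
 have wp: "?w#:R" "?p#:R" using ww_closed psi_closed assms by auto
 let ?I = "{s\<in>carrier R. s .* (?w .* ?p) = \<zero>}"
 have "\<one>:?I"
 proof (rule local_one)
  show "ideal ?I R" by (rule R.idealI') (use wp in "auto simp: R.l_distr R.m_assoc")
 next
  fix h assume h: "h:F0"
  have "lc {..<d} (psi h r) (m h) = lc {..<d} (%_. \<zero>) (m h)"
   using psi_sum[OF h r] 0 uu_closed[OF h] m_closed[OF h] by (simp add: lc_zero)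
  then obtain v where v: "v:S h" "ALL j:{..<d}. v .* psi h r j = v .* \<zero>"
   using m_indep'[OF h, of "psi h r" "%_. \<zero>"] psi_closed[OF h r] by (auto simp: Pi_iff)
  have vc: "v#:R" "uu h#:R" using v(1) S_closed[OF h] uu_closed[OF h] by auto
  let ?c = "%a. cc f a i" and ?rh = "%a b. if fst b = h then cc h a (snd b) else \<zero>"
  have c: "?c:A -> carrier R" using cc_closed[OF f] i by auto
  have rh: "?rh a b#:R" if "a:A" "b:A" for a b using that cc_closed[OF h] by (auto simp: A_def)
  have l: "Q.lc A r ?c = ?p" by (simp add: psi_lc)
  have "uu h .* (?w .* ?p) = Q.lc A r (%a. ?w .* (uu h .* ?c a))"
   using Q.lc_smult_right[OF A_finite, of r ?w "%a. uu h .* ?c a"] Q.lc_smult_right[OF A_finite, of r "uu h" ?c] wp vc c r l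
   by (simp add: Pi_iff R.m_lcomm)
  also have "... = Q.lc A r (%a. ?w .* psi f (?rh a) i)"
   by (rule Q.lc_cong) (use r ww(2)[OF f h _ i] psi_closed[OF f _ i] rh wp in "auto simp: Pi_iff")
  also have "... = ?w .* Q.lc A r (%a. psi f (?rh a) i)"
   using Q.lc_smult_right[OF A_finite, of r ?w "%a. psi f (?rh a) i"] wp r psi_closed[OF f _ i] rh by (simp add: Pi_iff)
  also have "Q.lc A r (%a. psi f (?rh a) i) = Q.lc A (%b. \<Oplus>a\<in>A. r a .* ?rh a b) ?c"
   unfolding psi_lc by (rule Q.lc_swap[OF A_finite A_finite r, symmetric]) (use rh c in auto)
  finally have e: "uu h .* (?w .* ?p) = ?w .* Q.lc A (%b. \<Oplus>a\<in>A. r a .* ?rh a b) ?c" .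
  have k: "(\<Oplus>a\<in>A. r a .* ?rh a b) = (if fst b = h then psi h r (snd b) else \<zero>)" if b: "b:A" for b
  proof (cases "fst b = h")
   case True thus ?thesis by (simp add: psi_def)
  next
   case False
   hence "(\<Oplus>a\<in>A. r a .* ?rh a b) = (\<Oplus>a\<in>A. \<zero>)" by (intro R.finsum_cong') (use r in "auto simp: Pi_iff")
   thus ?thesis using False by simp
  qed
  have kc: "(%b. \<Oplus>a\<in>A. r a .* ?rh a b):A -> carrier R"
   using k psi_closed[OF h r] by (auto simp: A_def)
  have "v .* Q.lc A (%b. \<Oplus>a\<in>A. r a .* ?rh a b) ?c = Q.lc A (%b. v .* (\<Oplus>a\<in>A. r a .* ?rh a b)) ?c"
   using Q.lc_smult[OF A_finite kc vc(1), of ?c] c by simp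
  also have "... = \<zero>" using Q.lc_zero[of A "%b. v .* (\<Oplus>a\<in>A. r a .* ?rh a b)" ?c] c v(2) vc k by (auto simp: A_def)
  finally have z: "v .* Q.lc A (%b. \<Oplus>a\<in>A. r a .* ?rh a b) ?c = \<zero>" .
  have "Q.lc A (%b. \<Oplus>a\<in>A. r a .* ?rh a b) ?c#:R" using Q.lc_closed[OF kc, of ?c] c by simp
  hence "(v .* uu h) .* (?w .* ?p) = \<zero>"
   using e z wp vc by (simp add: R.m_assoc) (simp add: R.m_lcomm[of v])
  hence "v .* uu h:?I" using vc by simp
  thus "EX u:S h. u:?I" using S_mult[OF h v(1) cu(1)[OF h]] by blast
 qed
 thus ?thesis using wp by simp
qed

definition rep where "rep y = (SOME c. c:A -> carrier R & lc A c g = y)"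

lemma rep: "y#:M ==> rep y:A -> carrier R & lc A (rep y) g = y"
 using g_gen[of y] unfolding rep_def Bex_def by (rule someI_ex)

definition phi where "phi f i y = ww f .* psi f (rep y) i"

lemma phi_eq:
 assumes f: "f:F0" and r: "r:A -> carrier R" and i: "i < d" and y: "lc A r g = y"
 shows "ww f .* psi f r i = phi f i y"
proof -
 have "y#:M" using y lc_closed[OF r g_closed] by simp
 note s = rep[OF this]
 let ?t = "%x. r x .- rep y x"
 have t: "?t:A -> carrier R" using r s by (auto simp: Pi_iff)
 have z: "lc A ?t g = 0[M]" by (rule lc_minus[OF A_finite r _ g_closed]) (use s y in auto)
 have "psi f r i = psi f (%x. ?t x .+ rep y x) i"
  unfolding psi_def by (rule R.finsum_cong') (use r s cc_closed[OF f _ i] in "auto simp: Pi_iff a_minus_def R.a_assoc R.l_neg")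
 also have "... = psi f ?t i .+ psi f (rep y) i" by (rule psi_add) (use f t s i in auto)
 finally have "ww f .* psi f r i = ww f .* psi f ?t i .+ ww f .* psi f (rep y) i"
  using f ww_closed psi_closed t s i by (simp add: R.r_distr)
 thus ?thesis using psi_kill[OF f t z i] f ww_closed psi_closed s i by (simp add: phi_def)
qed

lemma phi_closed: "f:F0 ==> i < d ==> y#:M ==> phi f i y#:R"
 unfolding phi_def using ww_closed psi_closed rep by blast

lemma phi_add:
 assumes f: "f:F0" and i: "i < d" and y: "y#:M" and z: "z#:M"
 shows "phi f i (y +[M] z) = phi f i y .+ phi f i z"
proof -
 note r = conjunct1[OF rep[OF y]] conjunct1[OF rep[OF z]]
 have "(%x. rep y x .+ rep z x):A -> carrier R" using r by auto
 moreover have "lc A (%x. rep y x .+ rep z x) g = y +[M] z"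
  using lc_add[OF r g_closed] rep[OF y] rep[OF z] by simp
 ultimately have "ww f .* psi f (%x. rep y x .+ rep z x) i = phi f i (y +[M] z)" by (intro phi_eq f i)
 thus ?thesis using psi_add[OF f r i] psi_closed[OF f r(1) i] psi_closed[OF f r(2) i] ww_closed[OF f]
  by (simp add: phi_def R.r_distr)
qed

lemma phi_smult:
 assumes f: "f:F0" and i: "i < d" and y: "y#:M" and s: "s#:R"
 shows "phi f i (s **[M] y) = s .* phi f i y"
proof -
 note r = conjunct1[OF rep[OF y]]
 have "(%x. s .* rep y x):A -> carrier R" using r s by auto
 moreover have "lc A (%x. s .* rep y x) g = s **[M] y"
  using lc_smult[OF A_finite r s g_closed] rep[OF y] by simp
 ultimately have "ww f .* psi f (%x. s .* rep y x) i = phi f i (s **[M] y)" by (intro phi_eq f i)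
 thus ?thesis using psi_smult[OF f r s i] psi_closed[OF f r i] ww_closed[OF f] s
  by (simp add: phi_def R.m_lcomm)
qed

lemma phi_sum:
 assumes f: "f:F0" and y: "y#:M"
 shows "lc {..<d} (%i. phi f i y) (m f) = (ww f .* uu f) **[M] y"
 unfolding phi_def using lc_smult[of "{..<d}" "psi f (rep y)" "ww f" "m f"] psi_sum[OF f, of "rep y"] rep[OF y] f y
  psi_closed[OF f, of "rep y"] ww_closed[OF f] uu_closed[OF f] m_closed[OF f]
 by (simp add: smult_assoc1 Pi_iff)

text \<open>The functionals \<open>phi f i\<close> reproduce \<open>y\<close> up to the factor
  \<open>ww f .* uu f\<close>. These factors lie in the sets \<open>S f\<close>, so they generate
  the unit ideal, and the coefficients \<open>c\<close> of a partition of unity turn the functionals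
  into a dual basis.\<close>

lemma dual_basis_F0:
 "EX ph. (ALL a:A. ALL y:carrier M. ph a y#:R)
  & (ALL a:A. ALL y:carrier M. ALL z:carrier M. ph a (y +[M] z) = ph a y .+ ph a z)
  & (ALL a:A. ALL y:carrier M. ALL s:carrier R. ph a (s **[M] y) = s .* ph a y)
  & (ALL y:carrier M. lc A (%a. ph a y) g = y)"
proof -
 let ?q = "%f. ww f .* uu f"
 have q: "?q:F0 -> carrier R" using ww_closed uu_closed by auto
 let ?I = "{r\<in>carrier R. EX c:F0 -> carrier R. Q.lc F0 c ?q = r}"
 have "\<one>:?I"
 proof (rule local_one)
  show "ideal ?I R"
  proof (rule R.idealI')
   show "\<zero>:?I" using Q.lc_zero[of F0 "%_. \<zero>" ?q] q by (auto intro!: bexI[of _ "%_. \<zero>"])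
  next
   fix a b assume "a:?I" "b:?I"
   then obtain c c' where c: "c:F0 -> carrier R" "c':F0 -> carrier R" "Q.lc F0 c ?q = a" "Q.lc F0 c' ?q = b" by blast
   hence "Q.lc F0 (%x. c x .+ c' x) ?q = a .+ b" using Q.lc_add[OF c(1,2), of ?q] q by simp
   moreover have "(%x. c x .+ c' x):F0 -> carrier R" using c by (auto simp: Pi_iff)
   ultimately show "a .+ b:?I" using \<open>a:?I\<close> \<open>b:?I\<close> by blast
  next
   fix a r assume "a:?I" and r: "r#:R"
   then obtain c where c: "c:F0 -> carrier R" "Q.lc F0 c ?q = a" by blast
   hence "Q.lc F0 (%x. r .* c x) ?q = r .* a" using Q.lc_smult[OF F0(1) c(1) r, of ?q] q by simp
   moreover have "(%x. r .* c x):F0 -> carrier R" using c r by (auto simp: Pi_iff)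
   ultimately show "r .* a:?I" using \<open>a:?I\<close> r by blast
  qed auto
 next
  fix f assume f: "f:F0"
  hence qf: "?q f:S f" "?q f#:R" using S_mult ww(1) cu(1) q by auto
  have "Q.lc F0 (%f'. if f' = f then \<one> else \<zero>) ?q = ?q f"
   using Q.lc_single[OF F0(1) f, of "%f'. if f' = f then \<one> else \<zero>" ?q] q qf by simp
  hence "?q f:?I" using qf by (auto intro!: bexI[of _ "%f'. if f' = f then \<one> else \<zero>"])
  thus "EX u:S f. u:?I" using qf by blast
 qed
 then obtain c where c: "c:F0 -> carrier R" "(\<Oplus>f\<in>F0. c f .* ?q f) = \<one>" by (auto simp: Qlc)
 let ?ph = "%a y. c (fst a) .* phi (fst a) (snd a) y"
 have cA: "c (fst a)#:R" "fst a:F0" "snd a < d" if "a:A" for a using that c by (auto simp: A_def)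
 have "lc A (%a. ?ph a y) g = y" if y: "y#:M" for y
 proof -
  have "lc A (%a. ?ph a y) g = lc (F0 \<times> {..<d}) (%(f, i). c f .* phi f i y) (%(f, i). m f i)"
   by (simp add: A_def g_def case_prod_unfold)
  also have "... = lc F0 c (%f. lc {..<d} (%i. phi f i y) (m f))"
   by (rule lc_Times[of F0 "{..<d}" "%f i. phi f i y" m, OF F0(1) _ _ _ c(1)]) (use phi_closed y m_closed in "auto simp: Pi_iff")
  also have "... = lc F0 c (%f. ?q f **[M] y)"
   by (rule lc_cong) (use phi_sum y q c in auto)
  also have "... = y" using lc_const[OF F0(1) y c(1) q] c(2) y by simp
  finally show ?thesis .
 qed
 thus ?thesis
  using cA phi_closed phi_add phi_smult
  by (intro exI[of _ ?ph] conjI ballI) (simp_all add: R.r_distr R.m_lcomm)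
qed

end

theorem (in module) locally_free_dual_basis:
 assumes "locally_free R M d"
 obtains B :: "('a \<times> nat) set" and e ph where "finite B" "e:B -> carrier M"
  "!!a y. a:B ==> y#:M ==> ph a y#:R"
  "!!a y z. a:B ==> y#:M ==> z#:M ==> ph a (y +[M] z) = ph a y .+ ph a z"
  "!!a y s. a:B ==> y#:M ==> s#:R ==> ph a (s **[M] y) = s .* ph a y"
  "!!y. y#:M ==> lc B (%a. ph a y) e = y"
proof -
 let ?S = "%f. range (%n::nat. f [^] n)"
 obtain F where F: "F <= carrier R" "genideal R F = carrier R"
  and free: "!!f. f:F ==> free_of_rank (loc_ring R (?S f)) (loc_module R (?S f) M) d"
  using assms[unfolded locally_free_def Let_def] by (elim exE conjE) (rule that, assumption+, rule bspec)
 obtain F0 where F0: "finite F0" "F0 <= F" "genideal R F0 = carrier R" by (rule R.genideal_finite[OF F])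
 let ?P = "%f m. m:{..<d} -> carrier M &
   (ALL y:carrier M. EX u:?S f. EX c:{..<d} -> carrier R. u **[M] y = lc {..<d} c m)
  & (ALL c:{..<d} -> carrier R. lc {..<d} c m = 0[M] --> (ALL i<d. EX u:?S f. u .* c i = \<zero>))"
 have "EX m. ?P f m" if f: "f:F0" for f
 proof -
  have "f#:R" using f F0 F by auto
  then interpret mod_loc R M "?S f"
   by unfold_locales (auto simp: R.nat_pow_mult intro: image_eqI[of _ _ 0])
  show ?thesis using free_gen_indep[OF free[of f]] f F0 by blast
 qed
 hence "ALL f:F0. EX m. ?P f m" by blast
 from this[unfolded bchoice_iff] obtain m where m: "ALL f:F0. ?P f (m f)" by (rule exE)
 interpret loc_free_data R M F0 ?S m d
 proof
  show "finite F0" "genideal R F0 = carrier R" "F0 <= carrier R" using F0 F by auto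
  fix f assume f: "f:F0"
  note P = bspec[OF m f]
  show "m f:{..<d} -> carrier M" by (rule conjunct1[OF P])
  fix y assume "y#:M"
  with conjunct1[OF conjunct2[OF P]] show "EX u:?S f. EX c:{..<d} -> carrier R. u **[M] y = lc {..<d} c (m f)" by (rule bspec)
 next
  fix f c i assume f: "f:F0" and c: "c:{..<d} -> carrier R" "lc {..<d} c (m f) = 0[M]" "i < d"
  show "EX u:?S f. u .* c i = \<zero>" using bspec[OF conjunct2[OF conjunct2[OF bspec[OF m f]]] c(1)] c by blast
 qed simp
 obtain ph where "(ALL a:A. ALL y:carrier M. ph a y#:R)
  & (ALL a:A. ALL y:carrier M. ALL z:carrier M. ph a (y +[M] z) = ph a y .+ ph a z)
  & (ALL a:A. ALL y:carrier M. ALL s:carrier R. ph a (s **[M] y) = s .* ph a y)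
  & (ALL y:carrier M. lc A (%a. ph a y) g = y)"
  using dual_basis_F0 by (rule exE)
 thus thesis by (intro that[OF A_finite g_closed]) blast+
qed

section \<open>Jets with prescribed linear part\<close>

context lie_connection
begin

definition FM :: "('c list => 'b) ring" where
 "FM = \<lparr>carrier = {a. a:extensional words & form a}, monoid.mult = undefined, one = undefined,
  ring.zero = (\<lambda>w\<in>words. 0[R]), add = (%a b. \<lambda>w\<in>words. a w +! b w)\<rparr>"

lemma FM_simps: "a#:FM <-> a:extensional words & form a"
 "ring.zero FM = (\<lambda>w\<in>words. 0[R])" "a +[FM] b = (\<lambda>w\<in>words. a w +! b w)"
 by (simp_all add: FM_def)

lemma FM_app: "w:words ==> (a +[FM] b) w = a w +! b w" "w:words ==> ring.zero FM w = 0[R]"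
 by (simp_all add: FM_simps)

lemma form_restrict: "form a ==> form (\<lambda>w\<in>words. a w)"
 unfolding form_def[of "\<lambda>w\<in>words. a w"] by (intro allI, rule good_cong[OF formD]) (simp_all add: lists_eq_set)

primrec gD where "gD (r, x) a = (\<lambda>w\<in>words. r *! a w +! D x a w)"

lemma D_restrict: "w:words ==> x#:L ==> D x (\<lambda>w\<in>words. a w) w = D x a w"
 by (rule D_cong) auto

lemma D_FM_add: "form a ==> form b ==> w:words ==> x#:L ==> D x (a +[FM] b) w = D x a w +! D x b w"
 by (simp add: FM_simps(3) D_restrict D_plus)

lemma D_null: "form a ==> w:words ==> D 0[L] a w = 0[R]"
 using D_smult_left[of a "0[L]" "0[R]" w] fclosed(1)[of a "0[L]" w] by simp

lemma gD_form: "form a ==> r#:R ==> x#:L ==> form (%w. r *! a w +! D x a w)"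
 by (intro form_plus form_scal form_D)

lemma gD_closed: "r#:R ==> x#:L ==> a#:FM ==> gD (r, x) a#:FM"
 by (simp add: FM_simps form_restrict gD_form)

lemma FM_eqI:
 assumes "a#:FM" "b#:FM" "!!w. w:words ==> a w = b w"
 shows "a = b"
 using assms by (intro extensionalityI[of _ words]) (auto simp: FM_simps)

lemma FM_add_closed: "a#:FM ==> b#:FM ==> a +[FM] b#:FM"
 by (simp add: FM_simps form_restrict form_plus)

lemma FM_zero_closed: "ring.zero FM#:FM"
 by (simp add: FM_simps form_restrict form_zero)

lemma FM_closed: "a#:FM ==> w:words ==> a w#:R"
 by (simp add: FM_simps form_closed)

lemma FM_abelian: "abelian_group FM"
proof (rule abelian_groupI)
 fix a assume a: "a#:FM"
 let ?b = "\<lambda>w\<in>words. -[R] 1[R] *! a w"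
 have b: "?b#:FM" using a by (simp add: FM_simps form_restrict form_scal)
 have "?b +[FM] a = 0[FM]"
  by (rule FM_eqI[OF FM_add_closed[OF b a] FM_zero_closed]) (use a FM_closed in "simp add: FM_app R.l_minus R.l_neg")
 thus "EX b:carrier FM. b +[FM] a = 0[FM]" using b by blast
next
 fix a b assume a: "a#:FM" and b: "b#:FM"
 show "a +[FM] b = b +[FM] a"
  by (rule FM_eqI) (use a b FM_closed FM_add_closed in "simp_all add: FM_app(1) R.a_comm")
 show "0[FM] +[FM] a = a"
  by (rule FM_eqI) (use a FM_closed FM_add_closed FM_zero_closed in "simp_all add: FM_app")
 fix c assume c: "c#:FM"
 show "a +[FM] b +[FM] c = a +[FM] (b +[FM] c)"
  by (rule FM_eqI) (use a b c FM_closed FM_add_closed in "simp_all add: FM_app(1) R.a_assoc")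
qed (rule FM_add_closed FM_zero_closed; assumption?)+

end

sublocale lie_connection < EF: env_ops K R L FM gD
proof -
 interpret G: abelian_group FM by (rule FM_abelian)
 show "env_ops K R L FM gD"
 proof unfold_locales
  fix r x s y a b assume r: "r#:R" and x: "x#:L" and s: "s#:R" and y: "y#:L"
   and a: "a#:FM"
  hence fa: "form a" by (simp add: FM_simps)
  show "gD (r, x) a#:FM" by (rule gD_closed[OF r x a])
  show "gD (r +! s, x +: y) a = gD (r, x) a +[FM] gD (s, y) a"
  proof (rule FM_eqI)
   fix w assume "w:words"
   thus "gD (r +! s, x +: y) a w = (gD (r, x) a +[FM] gD (s, y) a) w"
    using r x s y fa by (simp add: FM_app(1) D_add_left form_closed R.l_distr R.a_ac)
  qed (use r x s y a in "simp_all add: gD_closed FM_add_closed del: gD.simps")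
  show "gD (r, 0[L]) (gD (s, x) a) = gD (r *! s, r *: x) a"
  proof (rule FM_eqI)
   fix w assume "w:words"
   thus "gD (r, 0[L]) (gD (s, x) a) w = gD (r *! s, r *: x) a w"
    using r x s fa by (simp add: D_restrict D_null gD_form D_smult_left form_closed R.r_distr R.m_assoc)
  qed (use r x s a in "simp_all add: gD_closed del: gD.simps")
  show "gD (r, x) (gD (s, y) a) = gD (s, y) (gD (r, x) a) +[FM] gD (x |> s -! y |> r, br x y) a"
  proof (rule FM_eqI)
   have e: "D x (\<lambda>w\<in>words. s *! a w +! D y a w) w = x |> s *! a w +! s *! D x a w +! D x (D y a) w"
    if "w:words" "s#:R" "x#:L" "y#:L" for w s x y
    using that fa by (simp add: D_restrict D_plus[OF form_scal form_D] D_scal)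
   fix w assume w: "w:words"
   show "gD (r, x) (gD (s, y) a) w = (gD (s, y) (gD (r, x) a) +[FM] gD (x |> s -! y |> r, br x y) a) w"
    using w r x s y fa by (simp add: e FM_app(1) flat') (rule R.anchor_id; simp add: form_closed)
  qed (use r x s y a in "simp_all add: gD_closed FM_add_closed del: gD.simps")
 next
  fix r x a b assume r: "r#:R" and x: "x#:L" and a: "a#:FM" and b: "b#:FM"
  hence fa: "form a" "form b" by (simp_all add: FM_simps)
  show "gD (r, x) (a +[FM] b) = gD (r, x) a +[FM] gD (r, x) b"
  proof (rule FM_eqI)
   fix w assume "w:words"
   thus "gD (r, x) (a +[FM] b) w = (gD (r, x) a +[FM] gD (r, x) b) w"
    using r x fa by (simp add: FM_app(1) D_FM_add form_closed R.r_distr R.a_ac)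
  qed (use r x a b in "simp_all add: gD_closed FM_add_closed del: gD.simps")
 next
  fix a assume a: "a#:FM"
  hence fa: "form a" by (simp add: FM_simps)
  show "gD (1[R], 0[L]) a = a"
  proof (rule FM_eqI)
   fix w assume "w:words"
   thus "gD (1[R], 0[L]) a w = a w" using fa by (simp add: D_null form_closed)
  qed (use a in "simp_all add: gD_closed del: gD.simps")
 qed
qed

context lie_connection
begin

text \<open>By flatness \<open>D\<close> and the scalars give an action of \<open>U\<close> on
  forms. At the empty word the scalars act by multiplication, so the value there is a left linear
  function of the operator.\<close>

lemma jet_of_form:
 assumes a: "a#:FM"
 shows "(\<lambda>D\<in>carrier U. EF.eact D a [])#:J"
proof (rule jetI)
 have cl: "EF.eact D a#:FM" if "D#:U" for D using EF.eact_closed[OF that, of a] a by simp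
 fix D assume D: "D#:U"
 thus "(\<lambda>D\<in>carrier U. EF.eact D a []) D#:R" using FM_closed[OF cl, of D "[]"] by simp
 fix E assume "E#:U"
 thus "(\<lambda>D\<in>carrier U. EF.eact D a []) (D +& E) = (\<lambda>D\<in>carrier U. EF.eact D a []) D +! (\<lambda>D\<in>carrier U. EF.eact D a []) E"
  using D a by (simp add: EF.eact_add) (simp add: FM_app(1))
next
 have cl: "EF.eact D a#:FM" if "D#:U" for D using EF.eact_closed[OF that, of a] a by simp
 fix r D assume r: "r#:R" and D: "D#:U"
 have "form (EF.eact D a)" using cl[OF D] by (simp add: FM_simps)
 thus "(\<lambda>D\<in>carrier U. EF.eact D a []) (uR r *& D) = r *! (\<lambda>D\<in>carrier U. EF.eact D a []) D"
  using r D a cl[OF D] FM_closed[OF cl[OF D], of "[]"] by (simp add: EF.eact_mult EF.eact_uR D_null)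
qed simp

text \<open>The form is concentrated in degree one. At the empty word the correction vanishes and
  the covariant derivative differentiates zero, so \<open>D x\<close> reduces to the insertion of
  \<open>x\<close>.\<close>

lemma linear_jet:
 assumes "!!z. z#:L ==> f z#:R"
  and "!!y z. y#:L ==> z#:L ==> f (y +: z) = f y +! f z"
  and "!!r z. r#:R ==> z#:L ==> f (r *: z) = r *! f z"
 shows "EX al:carrier J. al 1[U] = 0[R] & (ALL x:carrier L. al (uL x) = f x)"
proof -
 define a where "a = (\<lambda>w\<in>words. if length w = 1 then f (hd w) else 0[R])"
 have "form (%w. if length w = 1 then f (hd w) else 0[R])"
  unfolding form_def
 proof (intro allI goodI)
  fix n and w w' :: "'c list" assume w: "w:words" 
  thus "(if length w = 1 then f (hd w) else 0[R])#:R" using assms(1) by (cases w) auto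
  assume "mset w' = mset w"
  thus "(if length w' = 1 then f (hd w') else 0[R]) = (if length w = 1 then f (hd w) else 0[R])"
   by (cases w; cases "tl w") (auto dest: mset_eq_length simp: length_Suc_conv)
 qed (use assms in auto)
 hence a: "a#:FM" and fa: "form a" by (simp_all add: FM_simps a_def form_restrict)
 let ?al = "\<lambda>D\<in>carrier U. EF.eact D a []"
 have "?al 1[U] = 0[R]" using a by (simp add: EF.eact_one) (simp add: a_def)
 moreover have "?al (uL x) = f x" if x: "x#:L" for x
 proof -
  have "?al (uL x) = 0[R] *! a [] +! D x a []" using x a by (simp add: EF.eact_uL)
  thus ?thesis using x assms(1) by (simp add: D_def cov_def a_def)
 qed
 ultimately show ?thesis using jet_of_form[OF a] by blast
qed

end

section \<open>Coordinate jets of a dual basis, and sums over lists\<close>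

primrec lsum :: "('b, 'm) ring_scheme => ('a => 'b) => 'a list => 'b" where
 "lsum G f [] = 0[G]"
| "lsum G f (x # xs) = f x +[G] lsum G f xs"

lemma lsum_cong: "(!!x. x:set xs ==> f x = g x) ==> lsum G f xs = lsum G g xs"
 by (induction xs) auto

lemma lsum_map: "lsum G f (map h xs) = lsum G (%x. f (h x)) xs"
 by (induction xs) auto

lemma (in abelian_group) lsum_finsum:
 "distinct xs ==> (!!x. x:set xs ==> f x#:G) ==> lsum G f xs = finsum G f (set xs)"
 by (induction xs) auto

text \<open>The jets \<open>y\<close> play the role of coordinates vanishing at the origin: on
  \<open>L\<close> they restrict to the functionals of a dual basis with vectors
  \<open>e\<close>.\<close>

locale jet_coords = lie_algebroid_char0 K R L
 for K :: "'k ring" and R :: "('k, 'r) module" and L :: "('r, 'l) lie_module" +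
 fixes Ys :: "('l \<times> ('k, 'r, 'l) jet) list"
 assumes e_closed: "(e, y):set Ys ==> e#:L"
  and y_closed: "(e, y):set Ys ==> y#:(jet K R L)"
  and y_one: "(e, y):set Ys ==> y 1[env_alg K R L] = 0[R]"
  and y_dual: "x#:L ==> lsum L (%(e, y). y (env_of_L K R L x) **[L] e) Ys = x"

lemma (in lie_algebroid_char0) jet_coords_exist:
 assumes "locally_free R L d"
 obtains Ys where "jet_coords K R L Ys"
proof -
 obtain B :: "('b \<times> nat) set" and e ph where B: "finite B" "e:B -> carrier L"
  and p: "!!a y. a:B ==> y#:L ==> ph a y#:R"
  and pa: "!!a y z. a:B ==> y#:L ==> z#:L ==> ph a (y +[L] z) = ph a y +! ph a z"
  and ps: "!!a y s. a:B ==> y#:L ==> s#:R ==> ph a (s *: y) = s *! ph a y"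
  and dual: "!!y. y#:L ==> L.lc B (%a. ph a y) e = y"
  using L.locally_free_dual_basis[OF assms] by blast
 define nab where "nab = (%x y. L.lc B (%a. x |> ph a y) e)"
 have c: "(%a. x |> ph a y):B -> carrier R" if "x#:L" "y#:L" for x y
  using that p by auto
 interpret C: lie_connection K R L nab
 proof unfold_locales
  fix x y assume x: "x#:L" and y: "y#:L"
  show "nab x y#:L" unfolding nab_def by (rule L.lc_closed[OF c[OF x y] B(2)])
  fix x' assume x': "x'#:L"
  have "nab (x +: x') y = L.lc B (%a. x |> ph a y +! x' |> ph a y) e"
   unfolding nab_def by (rule L.lc_cong) (use x y x' p B in "auto simp: anchor_add_left")
  thus "nab (x +: x') y = nab x y +: nab x' y"
   unfolding nab_def using L.lc_add[OF c[OF x y] c[OF x' y] B(2)] by simp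
  have "nab x (y +: x') = L.lc B (%a. x |> ph a y +! x |> ph a x') e"
   unfolding nab_def by (rule L.lc_cong) (use x y x' p B in "auto simp: anchor_add_right pa")
  thus "nab x (y +: x') = nab x y +: nab x x'"
   unfolding nab_def using L.lc_add[OF c[OF x y] c[OF x x'] B(2)] by simp
 next
  fix r x y assume r: "r#:R" and x: "x#:L" and y: "y#:L"
  have "nab (r *: x) y = L.lc B (%a. r *! x |> ph a y) e"
   unfolding nab_def by (rule L.lc_cong) (use x y r p B in "auto simp: anchor_smult")
  thus "nab (r *: x) y = r *: nab x y" unfolding nab_def using L.lc_smult[OF B(1) c[OF x y] r B(2)] by simp
  have py: "(%a. ph a y):B -> carrier R" using p y by auto
  have m: "(%a. x |> r *! ph a y):B -> carrier R" "(%a. r *! x |> ph a y):B -> carrier R" using p x y r by auto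
  have "nab x (r *: y) = L.lc B (%a. x |> r *! ph a y +! r *! x |> ph a y) e"
   unfolding nab_def by (rule L.lc_cong) (use x y r p B in "auto simp: ps anchor_leibniz")
  also have "... = L.lc B (%a. x |> r *! ph a y) e +: L.lc B (%a. r *! x |> ph a y) e"
   by (rule L.lc_add[OF m B(2)])
  also have "L.lc B (%a. x |> r *! ph a y) e = (x |> r) *: y"
   using L.lc_smult[OF B(1) py _ B(2), of "x |> r"] dual y x r by simp
  also have "L.lc B (%a. r *! x |> ph a y) e = r *: nab x y"
   unfolding nab_def by (rule L.lc_smult[OF B(1) c[OF x y] r B(2)])
  finally show "nab x (r *: y) = (x |> r) *: y +: r *: nab x y" .
 qed
 have "ALL a:B. EX al. al#:J & al 1[U] = 0[R] & (ALL x:carrier L. al (uL x) = ph a x)"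
 proof
  fix a assume a: "a:B"
  have "EX al:carrier J. al 1[U] = 0[R] & (ALL x:carrier L. al (uL x) = ph a x)"
   by (rule C.linear_jet) (use a p pa ps in auto)
  thus "EX al. al#:J & al 1[U] = 0[R] & (ALL x:carrier L. al (uL x) = ph a x)" by blast
 qed
 from this[unfolded bchoice_iff] obtain cy where
  cy: "ALL a:B. cy a#:J & cy a 1[U] = 0[R] & (ALL x:carrier L. cy a (uL x) = ph a x)" by (rule exE)
 obtain bs where bs: "distinct bs" "set bs = B" using finite_distinct_list[OF B(1)] by blast
 have "jet_coords K R L (map (%a. (e a, cy a)) bs)"
 proof unfold_locales
  fix x assume x: "x#:L"
  have "L.lc B (%a. cy a (uL x)) e = L.lc B (%a. ph a x) e"
   by (rule L.lc_cong) (use cy x p B in auto)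
  hence "(\<Oplus>\<^bsub>L\<^esub>i\<in>B. cy i (uL x) *: e i) = x" using dual[OF x] by (simp add: L.lc_def)
  moreover have "lsum L (%a. cy a (uL x) *: e a) bs = (\<Oplus>\<^bsub>L\<^esub>i\<in>B. cy i (uL x) *: e i)"
   using bs B cy x p by (subst L.lsum_finsum) (auto simp: Pi_iff)
  ultimately show "lsum L (%(e, y). y (uL x) *: e) (map (%a. (e a, cy a)) bs) = x" by (simp add: lsum_map)
 qed (use B bs cy in auto)
 thus thesis by (rule that)
qed

context abelian_group
begin

lemma lsum_closed [simp]: "(!!x. x:set xs ==> f x#:G) ==> lsum G f xs#:G"
 by (induction xs) auto

lemma lsum_add: "(!!x. x:set xs ==> f x#:G) ==> (!!x. x:set xs ==> g x#:G) ==>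
  lsum G (%x. f x .+ g x) xs = lsum G f xs .+ lsum G g xs"
 by (induction xs) (simp_all add: a_ac)

lemma lsum_append: "(!!x. x:set xs \<union> set ys ==> f x#:G) ==> lsum G f (xs @ ys) = lsum G f xs .+ lsum G f ys"
 by (induction xs) (simp_all add: a_assoc)

lemma lsum_concat: "(!!x y. x:set xs ==> y:set (g x) ==> f y#:G) ==>
  lsum G f (concat (map g xs)) = lsum G (%x. lsum G f (g x)) xs"
proof (induction xs)
 case (Cons x xs)
 have "lsum G f (g x @ concat (map g xs)) = lsum G f (g x) .+ lsum G f (concat (map g xs))"
  by (rule lsum_append) (use Cons.prems in auto)
 moreover have "lsum G f (concat (map g xs)) = lsum G (%x. lsum G f (g x)) xs"
  by (rule Cons.IH) (use Cons.prems in auto)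
 ultimately show ?case by simp
qed simp

lemma lsum_hom:
 assumes "!!x. x:set xs ==> f x#:G" "h \<zero> = 0[H]"
  "!!a b. a#:G ==> b#:G ==> h (a .+ b) = h a +[H] h b"
 shows "h (lsum G f xs) = lsum H (%x. h (f x)) xs"
 using assms(1) by (induction xs) (simp_all add: assms(2,3))

end

section \<open>The order filtration of the enveloping algebra\<close>

context lie_algebroid
begin

abbreviation lw where "lw == lists (carrier L)"

text \<open>The operators of order less than \<open>m\<close>. With this shift \<open>Um 0\<close>
  is zero, and the jets vanishing to order m are those that annihilate \<open>Um m\<close>.\<close>

inductive_set Um for m :: nat where
 zero: "0[U]:Um m"
| base: "r#:R ==> w:lw ==> length w < m ==> uR r *& mon w:Um m"
| add: "D:Um m ==> E:Um m ==> D +& E:Um m"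

lemma Um_closed [simp]: "D:Um m ==> D#:U"
 by (induction rule: Um.induct) auto

lemma Um_le: "D:Um m ==> m <= n ==> D:Um n"
 by (induction rule: Um.induct) (auto intro: Um.intros)

lemma Um_mon: "w:lw ==> length w < m ==> mon w:Um m"
 using Um.base[of "1[R]" w m] by simp

lemma Um_uR: "D:Um m ==> s#:R ==> uR s *& D:Um m"
 by (induction rule: Um.induct) (simp_all add: U.r_distr uR_uR Um.intros)

lemma Um_uminus: "D:Um m ==> -[U] D:Um m"
proof -
 assume D: "D:Um m"
 have "uR 1[R] +[U] uR (-[R] 1[R]) = 0[U]" by (simp add: uR_add[symmetric] R.r_neg del: uR_one)
 hence "uR (-[R] 1[R]) = -[U] 1[U]" using U.minus_equality[of "uR (-[R] 1[R])" "1[U]"] by (simp add: U.a_comm)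
 thus ?thesis using Um_uR[OF D, of "-[R] 1[R]"] D by (simp add: U.l_minus)
qed

lemma Um_uL: "D:Um m ==> x#:L ==> uL x *& D:Um (Suc m)"
proof (induction rule: Um.induct)
 case (base r w)
 thus ?case using Um.base[of r "x # w" "Suc m"] Um.base[of "x |> r" w "Suc m"] by (simp add: uL_base Um.add)
qed (simp_all add: U.r_distr Um.intros)

lemma Um_all: "D#:U ==> EX m. D:Um m"
proof (induction rule: U_induct)
 case (base r w)
 thus ?case using Um.base[of r w "Suc (length w)"] by blast
next
 case (add D E)
 then obtain m n where "D:Um m" "E:Um n" by blast
 hence "D:Um (max m n)" "E:Um (max m n)" using Um_le by (meson max.cobounded1, meson max.cobounded2)
 thus ?case using Um.add by blast
qed

lemma Um_right_uL: "D:Um m ==> x#:L ==> D *& uL x:Um (Suc m)"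
proof (induction rule: Um.induct)
 case (base r w)
 thus ?case using Um.base[of r "w @ [x]" "Suc m"] by (simp add: U.m_assoc mon_append)
qed (simp_all add: U.l_distr Um.intros)

definition eqm where "eqm n D E <-> D#:U & E#:U & (EX A:Um n. D = E +& A)"

lemma eqmI: "D#:U ==> E#:U ==> A:Um n ==> D = E +& A ==> eqm n D E"
 by (auto simp: eqm_def)

lemma eqm_refl [simp]: "D#:U ==> eqm n D D"
 by (rule eqmI[OF _ _ Um.zero]) auto

lemma eqm_sym: "eqm n D E ==> eqm n E D"
 by (auto simp: eqm_def U.a_assoc U.r_neg intro!: bexI[OF _ Um_uminus])

lemma eqm_trans [trans]: "eqm n D E ==> eqm n E F' ==> eqm n D F'"
proof -
 assume a: "eqm n D E" "eqm n E F'"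
 then obtain A A' where "A:Um n" "D = E +& A" "A':Um n" "E = F' +& A'" by (auto simp: eqm_def)
 thus ?thesis using a by (intro eqmI[of _ _ "A' +& A"]) (auto simp: eqm_def U.a_assoc Um.add)
qed

lemma eqm_add: "eqm n D E ==> eqm n D' E' ==> eqm n (D +& D') (E +& E')"
proof -
 assume a: "eqm n D E" "eqm n D' E'"
 then obtain A A' where "A:Um n" "D = E +& A" "A':Um n" "D' = E' +& A'" by (auto simp: eqm_def)
 thus ?thesis using a by (intro eqmI[of _ _ "A +& A'"]) (auto simp: eqm_def U.a_ac Um.add)
qed

lemma eqm_uminus: "eqm n D E ==> eqm n (-[U] D) (-[U] E)"
 by (auto simp: eqm_def U.minus_add intro!: bexI[OF _ Um_uminus])

lemma eqm_uL: "eqm n D E ==> x#:L ==> eqm (Suc n) (uL x *& D) (uL x *& E)"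
 by (auto simp: eqm_def U.r_distr intro!: bexI[OF _ Um_uL])

lemma eqm_right_uL: "eqm n D E ==> x#:L ==> eqm (Suc n) (D *& uL x) (E *& uL x)"
 by (auto simp: eqm_def U.l_distr intro!: bexI[OF _ Um_right_uL])

lemma eqm_uR: "eqm n D E ==> r#:R ==> eqm n (uR r *& D) (uR r *& E)"
 by (auto simp: eqm_def U.r_distr intro!: bexI[OF _ Um_uR])

lemma eqm_lsum: "(!!x. x:set xs ==> eqm n (f x) (g x)) ==> eqm n (lsum U f xs) (lsum U g xs)"
 by (induction xs) (auto intro: eqm_add)

lemma eqm_Um: "D:Um n ==> E:Um n ==> eqm n D E"
 by (rule eqmI[of _ _ "-[U] E +& D"]) (auto simp: Um.add Um_uminus U.a_assoc[symmetric] U.r_neg)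

lemma eqm_zero: "eqm n D 0[U] <-> D:Um n"
 by (auto simp: eqm_def)

lemma eqm_mem: "eqm n D E ==> E:Um n ==> D:Um n"
 by (auto simp: eqm_def Um.add)

text \<open>With \<open>mon_comm_uL\<close> this says that the graded algebra of the order
  filtration is commutative.\<close>

lemma mon_comm_uR: "w:lw ==> r#:R ==> eqm (length w) (mon w *& uR r) (uR r *& mon w)"
proof (induction w)
 case (Cons x w)
 hence x: "x#:L" and w: "w:lw" and r: "r#:R" by auto
 have "eqm (Suc (length w)) (uL x *& (mon w *& uR r)) (uL x *& (uR r *& mon w))"
  by (rule eqm_uL) (use Cons w r x in auto)
 also have "eqm (Suc (length w)) (uL x *& (uR r *& mon w)) (uR r *& uL x *& mon w)"
  by (rule eqmI[OF _ _ Um.base[of "x |> r" w]]) (use x r w in "auto simp: uL_base")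
 finally show ?case using x r w by (simp add: U.m_assoc)
qed simp

lemma mon_comm_uL: "w:lw ==> x#:L ==> eqm (Suc (length w)) (mon w *& uL x) (uL x *& mon w)"
proof (induction w)
 case (Cons y w)
 hence y: "y#:L" and w: "w:lw" and x: "x#:L" by auto
 have "eqm (Suc (Suc (length w))) (uL y *& (mon w *& uL x)) (uL y *& (uL x *& mon w))"
  by (rule eqm_uL) (use Cons w y x in auto)
 also have "eqm (Suc (Suc (length w))) (uL y *& (uL x *& mon w)) (uL x *& uL y *& mon w)"
  by (rule eqmI[OF _ _ Um_mon[of "br y x # w"]]) (use x y w uL_uL[of y x "mon w"] in auto)
 finally show ?case using x y w by (simp add: U.m_assoc)
qed simp

lemma Um_right_uR: "D:Um m ==> s#:R ==> D *& uR s:Um m"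
proof (induction rule: Um.induct)
 case (base r w)
 have "eqm (length w) (mon w *& uR s) (uR s *& mon w)" using mon_comm_uR base by blast
 hence "mon w *& uR s:Um m"
  using Um_le[of _ "length w" m] base Um.base[of s w m] by (auto simp: eqm_def intro!: Um.add)
 thus ?case using base Um_uR[of "mon w *& uR s" m r] by (simp add: U.m_assoc)
qed (simp_all add: U.l_distr Um.intros)

end

context lie_algebroid
begin

lemma lsum_right: "E#:U ==> (!!x. x:set xs ==> f x#:U) ==> lsum U f xs *& E = lsum U (%x. f x *& E) xs"
 by (rule U.lsum_hom) (auto simp: U.l_distr)

lemma lsum_left: "E#:U ==> (!!x. x:set xs ==> f x#:U) ==> E *& lsum U f xs = lsum U (%x. E *& f x) xs"
 by (rule U.lsum_hom) (auto simp: U.r_distr)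

lemma jet_lsum: "al#:J ==> (!!x. x:set xs ==> f x#:U) ==> al (lsum U f xs) = lsum R (%x. al (f x)) xs"
 by (rule U.lsum_hom) (auto simp: jet_plus)

lemma jet_lsum_app: "(!!x. x:set xs ==> f x#:J) ==> D#:U ==> lsum J f xs D = lsum R (%x. f x D) xs"
 by (induction xs) auto

section \<open>Jets vanishing to a given order\<close>

definition Jm where "Jm m = {al\<in>carrier J. ALL w:lw. length w < m --> al (mon w) = 0[R]}"

lemma JmD: "al:Jm m ==> al#:J" "al:Jm m ==> w:lw ==> length w < m ==> al (mon w) = 0[R]"
 by (simp_all add: Jm_def)

lemma JmI: "al#:J ==> (!!w. w:lw ==> length w < m ==> al (mon w) = 0[R]) ==> al:Jm m"
 by (simp add: Jm_def)

lemma Jm_Um: "al:Jm m ==> D:Um m ==> al D = 0[R]"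
 by (rotate_tac 1, induction rule: Um.induct) (auto simp: JmD jet_uR jet_plus)

lemma Jm_iff: "al:Jm m <-> al#:J & (ALL D:Um m. al D = 0[R])"
 using Jm_Um Um_mon by (auto simp: JmD intro: JmI)

lemma Jm_le: "al:Jm m ==> n <= m ==> al:Jm n"
 by (simp add: Jm_def)

lemma Jm_zero [simp]: "0[J]:Jm m" by (auto intro: JmI simp: jet_zero_closed)

lemma Jm_add: "al:Jm m ==> be:Jm m ==> al +[J] be:Jm m"
 by (rule JmI) (auto simp: JmD jet_add_closed)

lemma jet_uminus: "al#:J ==> D#:U ==> (-[J] al) D = -[R] al D"
proof -
 assume a: "al#:J" and D: "D#:U"
 have "(al +[J] -[J] al) D = 0[R]" using a D by (simp add: JR.r_neg)
 thus ?thesis using a D R.minus_equality[of "(-[J] al) D" "al D"] by (simp add: R.a_comm)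
qed

lemma jet_minus: "al#:J ==> be#:J ==> D#:U ==> (al -[J] be) D = al D -! be D"
 by (simp add: a_minus_def jet_uminus)

lemma Jm_minus: "al:Jm m ==> be:Jm m ==> al -[J] be:Jm m"
 by (rule JmI) (auto simp: JmD jet_minus)

lemma Jm_n1_uL: "be:Jm (Suc n) ==> x#:L ==> n1 (uL x) be:Jm n"
 by (rule JmI) (use JmD(2)[of be "Suc n" "x # _"] in "auto simp: JmD n1_uL")

lemma Um_zero: "D:Um 0 ==> D = 0[U]"
 by (induction rule: Um.induct) auto

text \<open>In \<open>con_uL\<close> the derivative of \<open>al\<close> loses one order of
  vanishing but meets a shorter monomial, so both terms obey the same bound. Truncated subtraction
  covers large \<open>p\<close>, where the contraction is zero.\<close>

lemma Um_con_mon: "w:lw ==> al:Jm p ==> con al (mon w):Um (Suc (length w) - p)"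
proof (induction w arbitrary: al p rule: list.induct)
 case Nil
 thus ?case using Um.base[of "al 1[U]" "[]" 1] JmD(2)[of al p "[]"] JmD(1)[of al p]
  by (cases p) (simp_all add: con_one Um.zero)
next
 case (Cons x w)
 hence x: "x#:L" "w:lw" and a: "al#:J" by (auto simp: JmD)
 let ?n = "Suc (Suc (length w)) - p"
 have "n1 (uL x) al:Jm (p - 1)" using Jm_n1_uL[of al "p - 1" x] Cons.prems(2) x a by (cases p) (simp_all add: Jm_def)
 hence 1: "con (n1 (uL x) al) (mon w):Um ?n" using Um_le[OF Cons.IH[OF x(2)]] by fastforce
 have w: "con al (mon w):Um (Suc (length w) - p)" by (rule Cons.IH[OF x(2) Cons.prems(2)])
 have "uL x *& con al (mon w):Um ?n"
 proof (cases "p <= Suc (length w)")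
  case True
  thus ?thesis using Um_uL[OF w x(1)] by (simp add: Suc_diff_le)
 next
  case False
  thus ?thesis using Um_zero[of "con al (mon w)"] w x by (simp add: Um.zero)
 qed
 thus ?case using Um.add[OF _ Um_uminus[OF 1]] x a by (simp add: con_uL a_minus_def)
qed

lemma Um_con: "D:Um m ==> al:Jm p ==> con al D:Um (m - p)"
proof (induction rule: Um.induct)
 case zero
 thus ?case using con_uR[of al "0[R]" "1[U]"] by (simp add: Um.zero JmD)
next
 case (base r w)
 thus ?case using Um_le[OF Um_con_mon[of w al p], of "m - p"] by (simp add: con_uR Um_uR JmD)
qed (simp add: con_add Um.add JmD)

lemma Jm_mult: "al:Jm p ==> be:Jm q ==> al *[J] be:Jm (p + q)"
 unfolding Jm_iff[of "al *[J] be"]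
 using Um_con[of _ "p + q" al p] Jm_Um[of be q] by (auto simp: JmD con_pair[symmetric])

lemma Jm_one: "al:Jm (Suc 0) <-> al#:J & al 1[U] = 0[R]"
 by (auto simp: Jm_def)

lemma jet_filt_Suc: "jet_filt K R L (Suc m) = ideal_prod J (Jm 1) (jet_filt K R L m)"
proof -
 have "a_kernel J R ep = Jm 1" by (auto simp: a_kernel_def' Jm_def ep_app)
 thus ?thesis by (simp add: jet_filt_def)
qed

lemma jet_filt_sub: "jet_filt K R L m <= Jm m"
proof (induction m)
 case 0
 thus ?case by (auto simp: jet_filt_def Jm_def)
next
 case (Suc m)
 show ?case
 proof
  fix al assume "al:jet_filt K R L (Suc m)"
  hence "al:ideal_prod J (Jm 1) (jet_filt K R L m)" by (simp add: jet_filt_Suc)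
  thus "al:Jm (Suc m)"
  proof (induction rule: ideal_prod.induct)
   case (prod i j)
   thus ?case using Suc Jm_mult[of i 1 j m] by auto
  qed (rule Jm_add)
 qed
qed

end

section \<open>The Euler operator and dual bases of the order filtration\<close>

context jet_coords
begin

text \<open>An Euler operator: contraction with a coordinate removes one factor of the symbol and
  the dual vector puts it back. On the top part of an operator of order k it is therefore
  multiplication by k.\<close>

definition N where "N D = lsum U (%(e, y). con y D *& uL e) Ys"

lemma Ys_closed: "p:set Ys ==> fst p#:L & snd p#:J & snd p 1[U] = 0[R]"
 using e_closed y_closed y_one by (cases p) auto

lemma N_alt: "N D = lsum U (%p. con (snd p) D *& uL (fst p)) Ys"
 by (simp add: N_def case_prod_unfold)

lemma N_closed [simp]: "D#:U ==> N D#:U"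
 unfolding N_alt by (rule U.lsum_closed) (simp add: Ys_closed)

lemma N_add: "D#:U ==> E#:U ==> N (D +& E) = N D +& N E"
 unfolding N_alt
 by (subst U.lsum_add[symmetric], (simp add: Ys_closed)+, rule lsum_cong) (simp add: Ys_closed con_add U.l_distr)

lemma N_uR: "D#:U ==> r#:R ==> N (uR r *& D) = uR r *& N D"
 unfolding N_alt
 by (subst lsum_left, (simp add: Ys_closed)+, rule lsum_cong) (simp add: Ys_closed con_uR U.m_assoc)

lemma dual_uL: "x#:L ==> lsum U (%p. uL (snd p (uL x) *: fst p)) Ys = uL x"
proof -
 assume x: "x#:L"
 have "uL (lsum L (%p. snd p (uL x) *: fst p) Ys) = lsum U (%p. uL (snd p (uL x) *: fst p)) Ys"
  by (rule L.lsum_hom) (use x Ys_closed in "auto simp: uL_add")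
 thus ?thesis using y_dual[OF x] by (simp add: case_prod_unfold)
qed

text \<open>At 1 the derivative of the coordinate along \<open>x\<close> has the value
  \<open>-[R] snd p (uL x)\<close>. Up to a jet vanishing at 1 it is this constant, and contraction
  with such a jet lowers the order.\<close>

lemma con_n1:
 assumes w: "w:lw" and x: "x#:L" and p: "p:set Ys"
 shows "eqm (length w) (con (n1 (uL x) (snd p)) (mon w)) (-[U] (mon w *& uR (snd p (uL x))))"
proof -
 let ?y = "snd p" and ?s = "snd p (uL x)"
 have y: "?y#:J" "?y 1[U] = 0[R]" and s: "?s#:R" using Ys_closed[OF p] x by auto
 let ?z = "n1 (uL x) ?y +[J] n1 (uR ?s) 1[J]"
 have z: "?z#:J" using x y s by (simp add: jet_add_closed jet_one_closed)
 have "?z 1[U] = 0[R]" using x y s jet_one_one by (simp add: n1_uL n1_uR jet_one_closed a_minus_def R.l_neg)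
 hence "con ?z (mon w):Um (length w)" using Um_con_mon[OF w, of ?z 1] z by (simp add: Jm_one)
 moreover have "con ?z (mon w) = con (n1 (uL x) ?y) (mon w) +& uR ?s *& mon w"
  using x y s w by (simp add: con_jet_add con_jet_uR con_unit jet_one_closed)
 ultimately have "eqm (length w) (con (n1 (uL x) ?y) (mon w) +& uR ?s *& mon w +& -[U] (uR ?s *& mon w)) (0[U] +& -[U] (uR ?s *& mon w))"
  using s w by (intro eqm_add eqm_refl) (auto simp: eqm_zero)
 also have "con (n1 (uL x) ?y) (mon w) +& uR ?s *& mon w +& -[U] (uR ?s *& mon w) = con (n1 (uL x) ?y) (mon w)"
  using x y s w by (simp add: U.a_assoc U.r_neg)
 finally have 1: "eqm (length w) (con (n1 (uL x) ?y) (mon w)) (-[U] (uR ?s *& mon w))" using s w by simp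
 have "eqm (length w) (-[U] (uR ?s *& mon w)) (-[U] (mon w *& uR ?s))"
  by (intro eqm_uminus eqm_sym[OF mon_comm_uR] w s)
 thus ?thesis by (rule eqm_trans[OF 1])
qed

text \<open>A new letter \<open>x\<close> adds one copy of the monomial: the values of the
  coordinates at \<open>x\<close> recombine with the dual vectors to \<open>uL x\<close>, which may
  be moved to the front up to lower order.\<close>

lemma N_mon: "w:lw ==> eqm (length w) (N (mon w)) (add_pow U (length w) (mon w))"
proof (induction w)
 case Nil
 have "N 1[U] = lsum U (%p. 0[U]) Ys"
  unfolding N_alt by (rule lsum_cong) (simp add: Ys_closed con_one)
 also have "... = 0[U]" by (induction Ys) auto
 finally show ?case by simp
next
 case (Cons x w)
 hence x: "x#:L" and w: "w:lw" by auto
 let ?k = "length w" and ?D = "mon w"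
 let ?s = "%p. snd p (uL x)"
 let ?c = "%p. con (n1 (uL x) (snd p)) ?D *& uL (fst p)"
 have ys: "fst p#:L" "snd p#:J" "?s p#:R" if "p:set Ys" for p using Ys_closed[OF that] x by auto
 have "N (mon (x # w)) = lsum U (%p. uL x *& (con (snd p) ?D *& uL (fst p)) +& -[U] ?c p) Ys"
  unfolding N_alt by (rule lsum_cong) (use x w ys in "simp add: con_uL a_minus_def U.l_distr U.l_minus U.m_assoc")
 also have "... = uL x *& N ?D +& lsum U (%p. -[U] ?c p) Ys"
  unfolding N_alt using x w ys by (subst U.lsum_add) (auto simp: lsum_left)
 finally have e1: "N (mon (x # w)) = uL x *& N ?D +& lsum U (%p. -[U] ?c p) Ys" .
 have e2: "eqm (Suc ?k) (uL x *& N ?D +& lsum U (%p. -[U] ?c p) Ys) (add_pow U ?k (uL x *& ?D) +& uL x *& ?D)"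
 proof (rule eqm_add)
  have "uL x *& add_pow U ?k ?D = add_pow U ?k (uL x *& ?D)"
   by (rule U.add_pow_rdistr) (use x w in auto)
  moreover have "eqm (Suc ?k) (uL x *& N ?D) (uL x *& add_pow U ?k ?D)" by (rule eqm_uL) (use Cons x in auto)
  ultimately show "eqm (Suc ?k) (uL x *& N ?D) (add_pow U ?k (uL x *& ?D))" by simp
  have "eqm (Suc ?k) (lsum U (%p. -[U] ?c p) Ys) (lsum U (%p. ?D *& uL (?s p *: fst p)) Ys)"
  proof (rule eqm_lsum)
   fix p assume p: "p:set Ys"
   have "eqm (Suc ?k) (-[U] ?c p) (-[U] (-[U] (?D *& uR (?s p)) *& uL (fst p)))"
    by (intro eqm_uminus eqm_right_uL con_n1 w x p ys)
   also have "-[U] (-[U] (?D *& uR (?s p)) *& uL (fst p)) = ?D *& uL (?s p *: fst p)"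
    using w ys[OF p] by (simp add: U.l_minus U.m_assoc uL_smult)
   finally show "eqm (Suc ?k) (-[U] ?c p) (?D *& uL (?s p *: fst p))" .
  qed
  also have "lsum U (%p. ?D *& uL (?s p *: fst p)) Ys = ?D *& uL x"
   using w ys by (subst lsum_left[symmetric]) (auto simp: dual_uL x)
  also have "eqm (Suc ?k) (?D *& uL x) (uL x *& ?D)" by (rule mon_comm_uL[OF w x])
  finally show "eqm (Suc ?k) (lsum U (%p. -[U] ?c p) Ys) (uL x *& ?D)" .
 qed
 have "add_pow U (length (x # w)) (mon (x # w)) = add_pow U ?k (uL x *& ?D) +& uL x *& ?D" by simp
 thus ?case using e2 unfolding e1 by simp
qed

lemma Um_nat: "D:Um m ==> add_pow U (n::nat) D:Um m"
 by (induction n) (auto simp: Um.zero Um.add)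

lemma N_Um: "D:Um (Suc k) ==> eqm k (N D) (add_pow U k D)"
proof (induction rule: Um.induct)
 case zero
 have "N 0[U] = 0[U]" using N_uR[of "1[U]" "0[R]"] by simp
 thus ?case by simp
next
 case (base r w)
 have "eqm k (N (mon w)) (add_pow U k (mon w))"
 proof (cases "length w = k")
  case True thus ?thesis using N_mon base by blast
 next
  case False
  hence l: "length w < k" using base by simp
  have "N (mon w):Um k" using N_mon[OF base(2)] Um_le[of _ "length w" k] l Um_mon[OF base(2) l]
   by (auto simp: eqm_def intro!: Um.add Um_nat)
  thus ?thesis using Um_nat[OF Um_mon[OF base(2) l]] by (intro eqm_Um)
 qed
 hence "eqm k (uR r *& N (mon w)) (uR r *& add_pow U k (mon w))" by (rule eqm_uR[OF _ base(1)])
 thus ?case using base U.add_pow_rdistr[of "uR r" "mon w" k] by (simp add: N_uR)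
next
 case (add D E)
 thus ?case using eqm_add by (simp add: N_add U.add.nat_pow_distrib)
qed

lemma N_Um': "D:Um m ==> N D:Um m"
proof (cases m)
 case 0
 assume "D:Um m"
 hence "D = 0[U]" unfolding 0 by (induction rule: Um.induct) auto
 moreover have "N 0[U] = 0[U]" using N_uR[of "1[U]" "0[R]"] by simp
 ultimately show ?thesis by (simp add: Um.zero)
next
 case (Suc k)
 assume D: "D:Um m"
 hence "eqm (Suc k) (N D) (add_pow U k D)" using N_Um[of D k] Suc Um_le[of _ k "Suc k"] by (auto simp: eqm_def)
 thus ?thesis using eqm_mem Um_nat[OF D] Suc by blast
qed

lemma rat_U: "D#:U ==> uR (rat n) *& add_pow U (Suc n) D = D"
proof -
 assume D: "D#:U"
 have h: "uR (add_pow R m 1[R]) = add_pow U m 1[U]" for m :: nat by (induction m) (simp_all add: uR_add)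
 have "add_pow U (Suc n) D = add_pow U (Suc n) 1[U] *& D" using U.add_pow_ldistr[of "1[U]" D "Suc n"] D by (simp del: U.add.nat_pow_Suc)
 hence "uR (rat n) *& add_pow U (Suc n) D = uR (rat n *! add_pow R (Suc n) 1[R]) *& D"
  using D by (simp add: uR_mult h U.m_assoc del: U.add.nat_pow_Suc R.add.nat_pow_Suc)
 thus ?thesis using D by (simp only: rat_one uR_one U.l_one)
qed

text \<open>\<open>rat k\<close> is the inverse of k + 1, the factor by which \<open>N\<close> acts
  on the top part of \<open>Um (Suc (Suc k))\<close>. Hence this difference drops that part.\<close>

definition Dk where "Dk k D = D +& -[U] (uR (rat k) *& N D)"

lemma Dk_low: "D:Um (Suc (Suc k)) ==> Dk k D:Um (Suc k)"
proof -
 assume D: "D:Um (Suc (Suc k))"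
 have "eqm (Suc k) (uR (rat k) *& N D) (uR (rat k) *& add_pow U (Suc k) D)" by (rule eqm_uR[OF N_Um[OF D]]) simp
 hence "eqm (Suc k) (uR (rat k) *& N D) D" using D by (simp only: rat_U Um_closed)
 hence "eqm (Suc k) (Dk k D) (D +& -[U] D)" unfolding Dk_def using D by (intro eqm_add eqm_uminus) auto
 thus ?thesis using D by (simp add: U.r_neg eqm_zero)
qed

lemma Dk_split: "D#:U ==> D = uR (rat k) *& N D +& Dk k D"
 unfolding Dk_def by (simp add: U.a_lcomm U.r_neg)

lemma Dk_linear:
 "D#:U ==> Dk k D#:U"
 "D#:U ==> E#:U ==> Dk k (D +& E) = Dk k D +& Dk k E"
 "r#:R ==> D#:U ==> Dk k (uR r *& D) = uR r *& Dk k D"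
 by (simp_all add: Dk_def N_add N_uR U.r_distr U.minus_add U.a_ac U.r_minus uR_uR R.m_comm[of _ "rat k"])

definition dual where "dual m P <-> (ALL p:set P. fst p#:J & snd p:Um m) &
 (ALL D:Um m. D = lsum U (%p. uR (fst p D) *& snd p) P)"

text \<open>\<open>D\<close> is \<open>rat k\<close> times \<open>N D\<close> plus
  \<open>Dk k D\<close>. The contractions inside \<open>N D\<close> have smaller order and are
  expanded by the induction hypothesis; their coefficients are values at \<open>D\<close> of
  products of jets, by \<open>con_pair\<close>. The other summand has smaller order itself.\<close>

lemma dual_exists: "EX P. dual m P"
proof (induction m)
 case 0
 show ?case using Um_zero by (intro exI[of _ "[]"]) (auto simp: dual_def)
next
 case (Suc m)
 then obtain P where P: "dual m P" by blast
 show ?case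
 proof (cases m)
  case 0
  have "D = uR (1[J] D) *& 1[U]" if "D:Um (Suc 0)" for D
   using that
  proof (induction rule: Um.induct)
   case (base r w)
   have "1[J] (uR r) = r" using base by (simp add: jet_one actR_uR)
   thus ?case using base by simp
  next
   case (add D E)
   thus ?case using jet_one_closed by (simp add: jet_plus uR_add)
  qed (simp add: jet_one_closed)
  thus ?thesis unfolding 0
   by (intro exI[of _ "[(1[J], 1[U])]"]) (use Um_mon[of "[]" 1] in "simp add: dual_def jet_one_closed")
 next
  case (Suc k)
  let ?c = "rat k"
  let ?new = "%q. map (%p. (n1 (uR ?c) (snd q *[J] fst p), snd p *& uL (fst q))) P"
  let ?old = "map (%p. (\<lambda>D\<in>carrier U. fst p (Dk k D), snd p)) P"
  have Pc: "fst p#:J" "snd p:Um m" "snd p#:U" if "p:set P" for p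
   using P that by (auto simp: dual_def)
  have Pd: "D = lsum U (%p. uR (fst p D) *& snd p) P" if "D:Um m" for D using P that by (simp add: dual_def)
  have oldc: "(\<lambda>D\<in>carrier U. fst p (Dk k D))#:J" if "p:set P" for p
   by (rule jet_comp[OF Pc(1)[OF that]]) (simp_all add: Dk_linear)
  have mem: "fst p#:J" "snd p:Um (Suc m)" if "p:set (concat (map ?new Ys) @ ?old)" for p
   using that Pc oldc Ys_closed by (auto simp: jet_mult_closed Um_right_uL intro: Um_le[of _ m "Suc m"])
  have "dual (Suc m) (concat (map ?new Ys) @ ?old)"
   unfolding dual_def
  proof (intro conjI ballI)
   fix p assume "p:set (concat (map ?new Ys) @ ?old)"
   thus "fst p#:J" "snd p:Um (Suc m)" by (rule mem)+
  next
   fix D assume D: "D:Um (Suc m)"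
   let ?f = "%p. uR (fst p D) *& snd p"
   have cl: "?f p#:U" if "p:set (concat (map ?new Ys) @ ?old)" for p
    using mem[OF that] D by simp
   have "lsum U ?f (concat (map ?new Ys) @ ?old) = lsum U ?f (concat (map ?new Ys)) +& lsum U ?f ?old"
    by (rule U.lsum_append) (use cl in auto)
   also have "lsum U ?f (concat (map ?new Ys)) = lsum U (%q. lsum U ?f (?new q)) Ys"
    by (rule U.lsum_concat) (use cl in auto)
   also have "... = lsum U (%q. uR ?c *& (con (snd q) D *& uL (fst q))) Ys"
   proof (rule lsum_cong)
    fix q assume q: "q:set Ys"
    have "con (snd q) D:Um m" using Um_con[OF D, of "snd q" 1] Ys_closed[OF q] by (simp add: Jm_one)
    hence c: "con (snd q) D = lsum U (%p. uR (fst p (con (snd q) D)) *& snd p) P" by (rule Pd)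
    have "lsum U ?f (?new q) = lsum U (%p. uR ?c *& (uR (fst p (con (snd q) D)) *& snd p *& uL (fst q))) P"
     unfolding lsum_map by (rule lsum_cong) (use Pc Ys_closed[OF q] D in "simp add: n1_uR jet_mult_closed con_pair uR_uR U.m_assoc")
    also have "... = uR ?c *& (lsum U (%p. uR (fst p (con (snd q) D)) *& snd p) P *& uL (fst q))"
     by (subst lsum_right, (use Pc Ys_closed[OF q] D in simp_all)[2], subst lsum_left, (use Pc Ys_closed[OF q] D in simp_all)[2],
      rule lsum_cong, use Pc Ys_closed[OF q] D in "simp add: U.m_assoc")
    finally show "lsum U ?f (?new q) = uR ?c *& (con (snd q) D *& uL (fst q))" using c by simp
   qed
   also have "... = uR ?c *& N D" unfolding N_alt by (rule lsum_left[symmetric]) (use Ys_closed D in auto)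
   also have "lsum U ?f ?old = Dk k D"
    using Pd[OF Dk_low[of D k, folded Suc]] D Suc by (simp add: lsum_map)
   finally have e: "lsum U ?f (concat (map ?new Ys) @ ?old) = uR ?c *& N D +& Dk k D" .
   show "D = lsum U ?f (concat (map ?new Ys) @ ?old)"
    by (rule trans[OF Dk_split[OF Um_closed[OF D]] e[symmetric]])
  qed
  thus ?thesis by blast
 qed
qed

end

section \<open>Powers of the augmentation ideal\<close>

context jet_coords
begin

definition compN where "compN ga = (\<lambda>D\<in>carrier U. ga (N D))"

lemma compN_closed [simp]: "ga#:J ==> compN ga#:J"
 unfolding compN_def by (rule jet_comp) (simp_all add: N_add N_uR)

lemma compN_Jm: "ga:Jm m ==> compN ga:Jm m"
 using N_Um' by (simp add: Jm_iff) (simp add: compN_def)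

text \<open>Successive approximation of a jet whose composition with \<open>N\<close> is
  \<open>al\<close>. On the part of order k + 1 the operator \<open>N\<close> is k + 1, so adding
  \<open>rat k\<close> times the error cancels the error in this order.\<close>

primrec gam where
 "gam al 0 = 0[J]"
| "gam al (Suc k) = gam al k +[J] n1 (uR (rat k)) (al -[J] compN (gam al k))"

abbreviation del where "del al k == al -[J] compN (gam al k)"

lemma Jm_closed: "al:Jm m ==> al#:J" by (rule JmD)

lemma Jm_n1_uR: "al:Jm m ==> r#:R ==> n1 (uR r) al:Jm m"
 by (rule JmI) (simp_all add: JmD n1_uR)

lemma gam_Jm: "al:Jm m ==> gam al k:Jm m"
 by (induction k) (simp_all add: Jm_add Jm_n1_uR Jm_minus compN_Jm)

lemma gam_closed [simp]: "al#:J ==> gam al k#:J"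
 by (induction k) (simp_all add: jet_add_closed jet_zero_closed)

lemma del_Jm:
 assumes a: "al:Jm 1"
 shows "del al k:Jm (Suc k)"
proof (induction k)
 case 0
 have "del al 0 = al"
 proof (rule jet_eqD)
  fix D assume D: "D#:U"
  have "del al 0 D = al D -! compN 0[J] D" unfolding gam.simps
   by (rule jet_minus) (use D Jm_closed[OF a] in "simp_all add: jet_zero_closed")
  thus "del al 0 D = al D" using D Jm_closed[OF a] by (simp add: compN_def a_minus_def)
 qed (use Jm_closed[OF a] in "simp_all add: jet_zero_closed")
 thus ?case using a by simp
next
 case (Suc k)
 have ac: "al#:J" using Jm_closed[OF a] .
 have dc: "del al k#:J" using ac by simp
 show ?case
  unfolding Jm_iff
 proof (intro conjI ballI)
  show "del al (Suc k)#:J" using ac by (simp add: jet_add_closed)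
  fix D assume D: "D:Um (Suc (Suc k))"
  have Dc: "D#:U" using D by simp
  obtain A where A: "A:Um (Suc k)" "N D = add_pow U (Suc k) D +& A" using N_Um[OF D] by (auto simp: eqm_def)
  have "uR (rat k) *& N D = D +& uR (rat k) *& A"
   using A Dc rat_U[OF Dc, of k] by (simp add: U.r_distr del: U.add.nat_pow_Suc)
  hence "del al k (uR (rat k) *& N D) = del al k D +! rat k *! del al k A"
   using A Dc dc by (simp add: jet_plus jet_uR)
  \<comment> \<open>\<open>N D\<close> is k + 1 times \<open>D\<close> up to \<open>A\<close>, and
    the error already vanishes on \<open>A\<close>.\<close>
  hence *: "rat k *! del al k (N D) = del al k D"
   using A Dc dc Jm_Um[OF Suc A(1)] by (simp add: jet_uR)
  have "gam al (Suc k) (N D) = gam al k (N D) +! rat k *! del al k (N D)"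
   using Dc dc by (simp add: n1_uR)
  also have "... = gam al k (N D) +! (al D -! gam al k (N D))"
   unfolding * using Dc ac by (simp add: jet_minus compN_def[of "gam al k"] del: compN_closed) (simp add: compN_def[symmetric] jet_minus, simp add: compN_def)
  also have "... = al D" using Dc ac by (simp add: a_minus_def R.a_lcomm R.r_neg)
  finally have e: "gam al (Suc k) (N D) = al D" .
  have "del al (Suc k) D = al D -! compN (gam al (Suc k)) D"
   by (rule jet_minus) (use Dc ac gam_closed[OF ac, of "Suc k"] in "simp_all del: gam.simps")
  thus "del al (Suc k) D = 0[R]" using e Dc ac by (simp add: compN_def del: gam.simps)
 qed
qed

lemma gam_stable:
 assumes a: "al:Jm 1" and D: "D:Um (Suc k)"
 shows "k <= j ==> gam al j D = gam al k D"
proof (induction j rule: dec_induct)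
 case (step j)
 have ac: "al#:J" using Jm_closed[OF a] .
 have "del al j D = 0[R]" using Jm_Um[OF del_Jm[OF a, of j]] Um_le[OF D, of "Suc j"] step by simp
 thus ?case using step ac D by (simp add: n1_uR)
qed simp

text \<open>On a given operator the approximations are eventually constant; the chosen index only
  has to bound its order.\<close>

definition glim where "glim al = (\<lambda>D\<in>carrier U. gam al (SOME k. D:Um (Suc k)) D)"

lemma glim_eq:
 assumes a: "al:Jm 1" and D: "D:Um (Suc k)"
 shows "glim al D = gam al k D"
proof -
 let ?j = "SOME k. D:Um (Suc k)"
 have j: "D:Um (Suc ?j)" by (rule someI[of _ k]) (rule D)
 have "gam al (max k ?j) D = gam al k D" "gam al (max k ?j) D = gam al ?j D"
  using gam_stable[OF a D, of "max k ?j"] gam_stable[OF a j, of "max k ?j"] by auto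
 thus ?thesis using D by (simp add: glim_def)
qed

lemma Um_common: "D#:U ==> E#:U ==> EX k. D:Um (Suc k) & E:Um (Suc k)"
proof -
 assume "D#:U" "E#:U"
 then obtain m n where "D:Um m" "E:Um n" using Um_all by blast
 thus ?thesis by (intro exI[of _ "max m n"]) (auto intro: Um_le)
qed

lemma glim_Jm:
 assumes a: "al:Jm 1" and am: "al:Jm m"
 shows "glim al:Jm m"
proof -
 have ac: "al#:J" using Jm_closed[OF a] .
 have "glim al#:J"
 proof (rule jetI)
  show "glim al:extensional (carrier U)" by (simp add: glim_def)
  fix D assume D: "D#:U"
  then obtain k where k: "D:Um (Suc k)" using Um_common by blast
  thus "glim al D#:R" using glim_eq[OF a k] ac by simp
  fix r assume r: "r#:R"
  thus "glim al (uR r *& D) = r *! glim al D" using glim_eq[OF a k] glim_eq[OF a Um_uR[OF k r]] ac D by (simp add: jet_uR)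
 next
  fix D E assume DE: "D#:U" "E#:U"
  then obtain k where k: "D:Um (Suc k)" "E:Um (Suc k)" using Um_common by blast
  thus "glim al (D +& E) = glim al D +! glim al E"
   using glim_eq[OF a k(1)] glim_eq[OF a k(2)] glim_eq[OF a Um.add[OF k]] ac DE by (simp add: jet_plus)
 qed
 moreover have "glim al D = 0[R]" if D: "D:Um m" for D
 proof -
  obtain k where "D:Um (Suc k)" using Um_common[of D D] D by auto
  thus ?thesis using glim_eq[OF a] Jm_Um[OF gam_Jm[OF am] D] by simp
 qed
 ultimately show ?thesis by (simp add: Jm_iff)
qed

lemma glim_N:
 assumes a: "al:Jm 1" and D: "D#:U"
 shows "glim al (N D) = al D"
proof -
 have ac: "al#:J" using Jm_closed[OF a] .
 obtain k where k: "D:Um (Suc k)" using Um_common[OF D D] by blast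
 have "0[R] = al D -! compN (gam al k) D" using Jm_Um[OF del_Jm[OF a] k] ac D by (simp add: jet_minus)
 also have "... = al D -! gam al k (N D)" using D by (simp add: compN_def)
 finally have "gam al k (N D) = al D" using R.minus_zero_eq[of "al D" "gam al k (N D)"] ac D by simp
 thus ?thesis using glim_eq[OF a N_Um'[OF k]] by simp
qed

text \<open>A Hadamard lemma. The value of \<open>al\<close> at \<open>D\<close> is that of
  \<open>glim al\<close> at \<open>N D\<close>, and by \<open>con_pair\<close> the definition of
  \<open>N\<close> turns this into a combination of the coordinates.\<close>

lemma jet_decomp:
 assumes a: "al:Jm 1"
 shows "al = lsum J (%p. snd p *[J] n2 (uL (fst p)) (glim al)) Ys"
proof -
 have g: "glim al#:J" using Jm_closed[OF glim_Jm[OF a a]] .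
 have c: "snd p *[J] n2 (uL (fst p)) (glim al)#:J" if "p:set Ys" for p
  using Ys_closed[OF that] g by (simp add: jet_mult_closed)
 show ?thesis
 proof (rule jet_eqD)
  fix D assume D: "D#:U"
  have "lsum J (%p. snd p *[J] n2 (uL (fst p)) (glim al)) Ys D = lsum R (%p. (snd p *[J] n2 (uL (fst p)) (glim al)) D) Ys"
   by (rule jet_lsum_app[OF c D])
  also have "... = lsum R (%p. glim al (con (snd p) D *& uL (fst p))) Ys"
   by (rule lsum_cong) (use Ys_closed g D in "simp add: con_pair[symmetric]")
  also have "... = glim al (N D)" unfolding N_alt by (rule jet_lsum[OF g, symmetric]) (use Ys_closed D in simp)
  finally show "al D = lsum J (%p. snd p *[J] n2 (uL (fst p)) (glim al)) Ys D" using glim_N[OF a D] by simp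
 qed (use Jm_closed[OF a] JR.lsum_closed[OF c] in auto)
qed

lemma Jm_n2_uL: "al:Jm (Suc m) ==> x#:L ==> n2 (uL x) al:Jm m"
 using Um_right_uL by (auto simp: Jm_iff)

text \<open>The first factors in \<open>jet_decomp\<close> lie in the augmentation ideal. The second
  ones vanish to one order less than \<open>al\<close>, because \<open>glim\<close> preserves the
  order of vanishing and \<open>n2 (uL x)\<close> costs one.\<close>

theorem jet_filt_Jm: "jet_filt K R L m = Jm m"
proof
 show "jet_filt K R L m <= Jm m" by (rule jet_filt_sub)
 show "Jm m <= jet_filt K R L m"
 proof (induction m)
  case 0
  thus ?case by (auto simp: jet_filt_def Jm_def)
 next
  case (Suc m)
  show ?case
  proof
   fix al assume a: "al:Jm (Suc m)"
   hence a1: "al:Jm 1" by (rule Jm_le) simp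
   let ?I = "ideal_prod J (Jm 1) (jet_filt K R L m)"
   have "0[J] *[J] 0[J]:?I" using Suc by (intro ideal_prod.prod) auto
   hence z: "0[J]:?I" by simp
   have "lsum J (%p. snd p *[J] n2 (uL (fst p)) (glim al)) ps:?I" if "set ps <= set Ys" for ps
    using that
   proof (induction ps)
    case Nil
    thus ?case using z by simp
   next
    case (Cons p ps)
    hence p: "fst p#:L" "snd p#:J" "snd p 1[U] = 0[R]" using Ys_closed[of p] by auto
    hence "snd p:Jm 1" by (auto simp: Jm_def)
    moreover have "n2 (uL (fst p)) (glim al):jet_filt K R L m"
     using Suc Jm_n2_uL[OF glim_Jm[OF a1 a] p(1)] by blast
    ultimately have "snd p *[J] n2 (uL (fst p)) (glim al):?I" by (rule ideal_prod.prod)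
    thus ?case using Cons by (simp add: ideal_prod.sum)
   qed
   from this[of Ys] show "al:jet_filt K R L (Suc m)" using jet_decomp[OF a1] by (simp add: jet_filt_Suc)
  qed
 qed
qed

end

context lie_algebroid
begin

lemma Jm_n1: "D:Um (Suc k) ==> al:Jm (m + k) ==> n1 D al:Jm m"
proof -
 have w: "n1 (mon w) al:Jm m" if "w:lw" "al:Jm (m + length w)" for w al m
  using that
 proof (induction w arbitrary: m rule: list.induct)
  case (Cons y w)
  have "n1 (mon w) al:Jm (Suc m)" by (rule Cons.IH) (use Cons.prems in auto)
  hence "n1 (uL y) (n1 (mon w) al):Jm m" using Jm_n1_uL Cons.prems(1) by auto
  moreover have "n1 (uL y *& mon w) al = n1 (uL y) (n1 (mon w) al)"
   by (rule n1_mult) (use Cons.prems JmD(1)[OF Cons.prems(2)] in auto)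
  ultimately show ?case using Cons.prems by simp
 qed (simp add: JmD)
 assume "D:Um (Suc k)" and a: "al:Jm (m + k)"
 thus "n1 D al:Jm m"
 proof (induction rule: Um.induct)
  case zero
  have "n1 0[U] al = 0[J]" using n1_uR[of "0[R]" al] a JmD(1)[OF a] n1_closed[OF U.zero_closed JmD(1)[OF a]]
   by (intro jet_eqD) (simp_all add: jet_zero_closed)
  thus ?case by simp
 next
  case (base r w)
  have "n1 (mon w) al:Jm m" by (rule w[OF base(2)]) (use a base(3) Jm_le in auto)
  hence "n1 (uR r) (n1 (mon w) al):Jm m" by (intro JmI) (use base in "simp_all add: JmD n1_uR")
  thus ?case using base JmD(1)[OF a] by (simp add: n1_mult)
 next
  case (add D E)
  thus ?case using JmD(1)[OF a] by (simp add: n1_add Jm_add)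
 qed
qed

text \<open>Continuity of the antipode: an operator of order k lowers the order of vanishing by at
  most k under \<open>n1\<close>.\<close>

lemma Jm_anti: "al:Jm m ==> anti al:Jm m"
proof (rule JmI)
 assume a: "al:Jm m"
 thus "anti al#:J" by (simp add: JmD)
 fix w assume w: "w:lw" "length w < m"
 have "n1 (mon w) al:Jm 1" by (rule Jm_n1[of _ "length w"]) (use w a Jm_le Um_mon in auto)
 thus "anti al (mon w) = 0[R]" using w JmD(2)[of _ 1 "[]"] by (simp add: anti_app)
qed

end

section \<open>Separation of completed tensors\<close>

lemma (in abelian_group) lsum_product:
 "(!!x y. x:set xs ==> y:set ys ==> f (x, y)#:G) ==>
  lsum G f (List.product xs ys) = lsum G (%x. lsum G (%y. f (x, y)) ys) xs"
proof (induction xs)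
 case (Cons x xs)
 have "lsum G f (map (Pair x) ys @ List.product xs ys) = lsum G f (map (Pair x) ys) .+ lsum G f (List.product xs ys)"
  by (rule lsum_append) (use Cons.prems in auto)
 thus ?case using Cons by (simp add: lsum_map)
qed simp

lemma frag_mult_of [simp]: "frag_mult M (frag_of xs) q = frag_extend (%ys. frag_of (map2 (%x y. x *[M] y) xs ys)) q"
 by (simp add: frag_mult_def)

lemma frag_mult_zero [simp]: "frag_mult M 0 q = 0"
 by (simp add: frag_mult_def)

lemma frag_mult_diff_left: "frag_mult M (p - p') q = frag_mult M p q - frag_mult M p' q"
 by (simp add: frag_mult_def frag_extend_diff)

lemma frag_mult_diff_right: "frag_mult M p (q - q') = frag_mult M p q - frag_mult M p q'"
 using subset_UNIV[of "supp p"]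
 by (induction p rule: frag_induct) (simp_all add: frag_mult_diff_left frag_extend_diff)

lemma frag_mult_zero_right [simp]: "frag_mult M p 0 = 0"
 using frag_mult_diff_right[of M p 0 0] by simp

lemma frag_mult_add_right: "frag_mult M p (q + q') = frag_mult M p q + frag_mult M p q'"
 using frag_mult_diff_right[of M p q "0 - q'"] frag_mult_diff_right[of M p 0 q'] by simp

text \<open>The neighbourhood \<open>G i\<close> is described as equality under a map
  \<open>h i\<close>, and these maps separate points. Convergence then means that each
  \<open>h i\<close> is eventually constant along the partial sums.\<close>

lemma csumI:
 assumes T: "abelian_group T" and y: "y#:T"
  and h: "!!a b i. a#:T ==> b#:T ==> a -[T] b:G i <-> h i a = h i b"
  and s: "!!a b. a#:T ==> b#:T ==> (!!i. h i a = h i b) ==> a = b"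
  and x: "!!m. EX p. p:x m" and c: "!!m p. p:x m ==> tensor_lift T ph p#:T"
  and l: "!!i. EX k. ALL m>=k. ALL p:x m. h i (tensor_lift T ph p) = h i y"
 shows "csum T G ph x y"
proof -
 have e: "(EX k. ALL m>=k. ALL p:x m. tensor_lift T ph p -[T] z:G i) <-> (EX k. ALL m>=k. ALL p:x m. h i (tensor_lift T ph p) = h i z)"
  if "z#:T" for z i
  by (intro iff_exI iff_allI imp_cong ball_cong refl) (use h[OF c that] in blast)
 have "z = y" if z: "z#:T" "ALL i. EX k. ALL m>=k. ALL p:x m. tensor_lift T ph p -[T] z:G i" for z
 proof (rule s[OF z(1) y])
  fix i
  obtain k where k: "ALL m>=k. ALL p:x m. h i (tensor_lift T ph p) = h i z"
   using iffD1[OF e[OF z(1)] z(2)[rule_format, of i]] by (rule exE)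
  obtain k' where k': "ALL m>=k'. ALL p:x m. h i (tensor_lift T ph p) = h i y" using l[of i] by (rule exE)
  from k k' show "h i z = h i y" using x[of "max k k'"] by (metis max.cobounded1 max.cobounded2)
 qed
 moreover have "ALL i. EX k. ALL m>=k. ALL p:x m. tensor_lift T ph p -[T] y:G i" using e[OF y] l by simp
 ultimately show ?thesis unfolding csum_def using y by blast
qed

sublocale lie_algebroid < CT: tensor_power "carrier R" "jet K R L" "jr" "jl" n "Jm m" for n m
 by unfold_locales (simp_all add: jet_right_n2 jet_left_n1)

sublocale lie_algebroid < CTA: abelian_group "CT.TA n m" for n m
 by (rule CT.TA_abelian)

context lie_algebroid
begin

lemma anti_zero: "anti 0[J] = 0[J]"
 using anti_add[of "0[J]" "0[J]"] jet_zero_closed by (simp add: JR.add.l_cancel_one)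

lemma anti_minus: "al#:J ==> be#:J ==> anti (al -[J] be) = anti al -[J] anti be"
 using anti_add[of "al -[J] be" be] by (simp add: JR.minus_eq JR.a_assoc JR.l_neg JR.r_neg)

end

context jet_coords
begin

lemma dual_expand:
 assumes P: "dual m P" and b: "b#:J"
 shows "b -[J] lsum J (%p. n1 (uR (b (snd p))) (fst p)) P:Jm m"
proof -
 have Pc: "fst p#:J" "snd p#:U" if "p:set P" for p
  using P that by (auto simp: dual_def)
 have c: "n1 (uR (b (snd p))) (fst p)#:J" if "p:set P" for p using Pc[OF that] b by simp
 have lc: "lsum J (%p. n1 (uR (b (snd p))) (fst p)) P#:J" by (rule JR.lsum_closed) (rule c)
 show ?thesis
  unfolding Jm_iff
 proof (intro conjI ballI)
  fix D assume D: "D:Um m"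
  have "b D = b (lsum U (%p. uR (fst p D) *& snd p) P)" using P D by (simp add: dual_def)
  also have "... = lsum R (%p. b (uR (fst p D) *& snd p)) P" by (rule jet_lsum[OF b]) (use Pc D in simp)
  also have "... = lsum R (%p. n1 (uR (b (snd p))) (fst p) D) P"
   by (rule lsum_cong) (use Pc D b in "simp add: jet_uR n1_uR R.m_comm")
  also have "... = lsum J (%p. n1 (uR (b (snd p))) (fst p)) P D" by (rule jet_lsum_app[OF c, symmetric]) (use D in simp_all)
  finally show "(b -[J] lsum J (%p. n1 (uR (b (snd p))) (fst p)) P) D = 0[R]"
   using b lc D by (simp add: jet_minus)
 qed (use b lc in simp)
qed

context
 fixes n m and ct defines "ct == %xs. CT.cl n m (frag_of xs)"
begin

lemma ct_closed: "xs:tuples J n ==> ct xs#:(CT.TG n m)"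
 unfolding ct_def by (rule CT.cl_closed) simp

lemma ct_lsum:
 assumes xy: "length xs + length ys + 1 = n" "set xs <= carrier J" "set ys <= carrier J" and b: "b#:J"
  and f: "!!p. p:set P ==> f p#:J" and bf: "b -[J] lsum J f P:Jm m"
 shows "ct (xs @ [b] @ ys) = lsum (CT.TA n m) (%p. ct (xs @ [f p] @ ys)) P"
proof -
 let ?h = "%c. ct (xs @ [c] @ ys)"
 let ?s = "lsum J f P"
 have s: "?s#:J" by (rule JR.lsum_closed) (rule f)
 have t: "xs @ [c] @ ys:tuples J n" if "c#:J" for c using that xy by (auto simp: tuples_iff)
 have add: "?h (c +[J] c') = ?h c +[CT.TA n m] ?h c'" if "c#:J" "c'#:J" for c c'
  using CT.cl_frag_add[OF t[OF that(1)] that(2)] by (simp add: ct_def)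
 have null: "?h c = 0[CT.TA n m]" if "c:Jm m" for c
  using CT.cl_frag_null[OF t[OF JmD(1)[OF that]]] that by (simp add: ct_def)
 have "b = (b -[J] ?s) +[J] ?s" using b s by (simp add: a_minus_def JR.a_assoc JR.l_neg)
 hence "?h b = ?h (b -[J] ?s) +[CT.TA n m] ?h ?s" using add[of "b -[J] ?s" ?s] b s by simp
 hence "?h b = ?h ?s" unfolding null[OF bf] using CTA.l_zero[of "?h ?s" n m] ct_closed[OF t[OF s]] by simp
 thus ?thesis using JR.lsum_hom[of P f ?h "CT.TA n m", OF f null[OF Jm_zero] add] by simp
qed

text \<open>The right factor is expanded in the dual basis. Its coefficients are left scalars, so
  they cross the tensor sign and become right scalars of the neighbour.\<close>

lemma ct_move:
 assumes P: "dual m P" and xy: "length xs + length ys + 2 = n" "set xs <= carrier J" "set ys <= carrier J"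
  and a: "a#:J" and b: "b#:J"
 shows "ct (xs @ [a, b] @ ys) = lsum (CT.TA n m) (%p. ct (xs @ [n2 (uR (b (snd p))) a, fst p] @ ys)) P"
proof -
 have Pc: "fst p#:J" "snd p#:U" if "p:set P" for p
  using P that by (auto simp: dual_def)
 have "ct ((xs @ [a]) @ [b] @ ys) = lsum (CT.TA n m) (%p. ct ((xs @ [a]) @ [n1 (uR (b (snd p))) (fst p)] @ ys)) P"
  by (rule ct_lsum) (use xy a b Pc dual_expand[OF P b] in auto)
 also have "... = lsum (CT.TA n m) (%p. ct (xs @ [n2 (uR (b (snd p))) a, fst p] @ ys)) P"
 proof (rule lsum_cong)
  fix p assume p: "p:set P"
  have "ct (xs @ [jr a (b (snd p)), fst p] @ ys) = ct (xs @ [a, jl (b (snd p)) (fst p)] @ ys)"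
   unfolding ct_def by (rule CT.cl_frag_bal) (use xy a b Pc[OF p] in "auto simp: tuples_iff")
  thus "ct ((xs @ [a]) @ [n1 (uR (b (snd p))) (fst p)] @ ys) = ct (xs @ [n2 (uR (b (snd p))) a, fst p] @ ys)"
   using a b Pc[OF p] by (simp add: jet_right_n2 jet_left_n1)
 qed
 finally show ?thesis by simp
qed

text \<open>The first factor has to be expanded with right scalars. Expanding its antipode and
  applying the antipode again achieves this, and the coefficients become values of the first
  pairing.\<close>

lemma ct_head:
 assumes P: "dual m P" and ys: "length ys + 1 = n" "set ys <= carrier J" and a: "a#:J"
 shows "ct (a # ys) = lsum (CT.TA n m) (%p. ct (n2 (uR (anti a (snd p))) (anti (fst p)) # ys)) P"
proof -
 have Pc: "fst p#:J" "snd p#:U" if "p:set P" for p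
  using P that by (auto simp: dual_def)
 let ?g = "%p. n1 (uR (anti a (snd p))) (fst p)"
 have g: "?g p#:J" if "p:set P" for p using a Pc[OF that] by simp
 have "anti (lsum J ?g P) = lsum J (%p. anti (?g p)) P"
  using anti_add by (intro JR.lsum_hom[OF g]) (auto simp: anti_zero)
 also have "... = lsum J (%p. n2 (uR (anti a (snd p))) (anti (fst p))) P"
  by (rule lsum_cong) (use a Pc in "simp add: anti_n1")
 finally have e: "anti (anti a -[J] lsum J ?g P) = a -[J] lsum J (%p. n2 (uR (anti a (snd p))) (anti (fst p))) P"
  using a JR.lsum_closed[of P ?g] g by (simp add: anti_minus anti_anti)
 have "ct ([] @ [a] @ ys) = lsum (CT.TA n m) (%p. ct ([] @ [n2 (uR (anti a (snd p))) (anti (fst p))] @ ys)) P"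
  by (rule ct_lsum) (use ys a Pc Jm_anti[OF dual_expand[OF P anti_closed[OF a]], unfolded e] in auto)
 thus ?thesis by simp
qed

lemma ct_scale:
 assumes "a#:J" "set ys <= carrier J" "length ys + 1 = n" 
 shows "r#:R ==> s#:R ==> 
   ct (n2 (uR (r +! s)) a # ys) = ct (n2 (uR r) a # ys) +[CT.TA n m] ct (n2 (uR s) a # ys)"
  "ct (n2 (uR 0[R]) a # ys) = 0[CT.TA n m]"
proof -
 have t: "[] @ [c] @ ys:tuples J n" if "c#:J" for c using that assms by (auto simp: tuples_iff)
 show "ct (n2 (uR (r +! s)) a # ys) = ct (n2 (uR r) a # ys) +[CT.TA n m] ct (n2 (uR s) a # ys)"
  if "r#:R" "s#:R"
  using CT.cl_frag_add[OF t, of "n2 (uR r) a" "n2 (uR s) a" m] that assms by (simp add: ct_def n2_add uR_add)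
 have "n2 (uR 0[R]) a = 0[J]" by (rule jet_eqD) (use assms in "simp_all add: jet_zero_closed")
 thus "ct (n2 (uR 0[R]) a # ys) = 0[CT.TA n m]"
  using CT.cl_frag_null[OF t, of "0[J]" m] by (simp add: ct_def jet_zero_closed)
qed

text \<open>A tensor is determined by the values of functionals which are the coefficients of an
  expansion of the decomposable tensors.\<close>

lemma ct_separate:
 assumes f: "!!i. i:set js ==> CT.bal n m R (f i)"
  and g: "!!i. i:set js ==> g i#:J & set (h i) <= carrier J & length (h i) + 1 = n"
  and e: "!!xs. xs:tuples J n ==> ct xs = lsum (CT.TA n m) (%i. ct (n2 (uR (f i xs)) (g i) # h i)) js"
  and t: "t#:(CT.TG n m)" "t'#:(CT.TG n m)"
  and tt: "!!i. i:set js ==> CT.ind R (f i) t = CT.ind R (f i) t'"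
 shows "t = t'"
proof -
 let ?k = "%t. lsum (CT.TA n m) (%i. ct (n2 (uR (CT.ind R (f i) t)) (g i) # h i)) js"
 note c = CT.ind_closed[OF R.abelian_group_axioms f]
 note a = CT.ind_add[OF R.abelian_group_axioms f]
 have kc: "ct (n2 (uR r) (g i) # h i)#:(CT.TA n m)" if "i:set js" "r#:R" for i r
  using g[OF that(1)] that(2) ct_closed by (simp add: tuples_iff)
 have "t = ?k t" if t: "t#:(CT.TG n m)" for t
 proof (rule CT.TG_hom_eq[OF CT.TA_abelian _ _ _ _ _ t, where h = "%t. t"])
  fix t assume t: "t#:(CT.TG n m)"
  show "?k t#:(CT.TA n m)" by (rule CTA.lsum_closed) (use kc c t in blast)
  fix t' assume t': "t'#:(CT.TG n m)"
  have "?k (t *[CT.TG n m] t') = lsum (CT.TA n m) (%i. ct (n2 (uR (CT.ind R (f i) t)) (g i) # h i)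
    +[CT.TA n m] ct (n2 (uR (CT.ind R (f i) t')) (g i) # h i)) js"
   by (rule lsum_cong) (use a[OF _ t t'] c[OF _ t] c[OF _ t'] g ct_scale(1) in "simp del: CT.TA_simps")
  also have "... = ?k t +[CT.TA n m] ?k t'"
   by (rule CTA.lsum_add) (use kc c t t' in blast)+
  finally show "?k (t *[CT.TG n m] t') = ?k t +[CT.TA n m] ?k t'" .
 next
  fix xs assume xs: "xs:tuples J n"
  have "?k (ct xs) = lsum (CT.TA n m) (%i. ct (n2 (uR (f i xs)) (g i) # h i)) js"
   unfolding ct_def by (rule lsum_cong) (use CT.ind_frag[OF R.abelian_group_axioms f xs] in simp)
  thus "CT.cl n m (frag_of xs) = ?k (CT.cl n m (frag_of xs))" using e[OF xs] by (simp add: ct_def)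
 qed simp_all
 note k = this
 have "?k t = ?k t'" by (rule lsum_cong) (simp add: tt)
 thus ?thesis using k[OF t(1)] k[OF t(2)] by simp
qed

end

section \<open>The coproduct of the jet algebra\<close>

definition pf where "pf D E as = anti (as ! 0) D *! (as ! 1) E"
text \<open>The value of the third factor enters the argument of the second as a right scalar. A
  plain product of three values would not be balanced between the last two factors.\<close>

definition qf where "qf D E H as = anti (as ! 0) D *! (as ! 1) (E *& uR ((as ! 2) H))"

lemma tuples_J2: "xs:tuples J 2 <-> (EX a:carrier J. EX b:carrier J. xs = [a, b])"
 by (cases xs; cases "tl xs") (auto simp: tuples_iff)

lemma tuples_J3: "xs:tuples J 3 <-> (EX a:carrier J. EX b:carrier J. EX c:carrier J. xs = [a, b, c])"
 by (cases xs; cases "tl xs"; cases "tl (tl xs)") (auto simp: tuples_iff)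

lemma pf_closed: "D#:U ==> E#:U ==> xs:tuples J 2 ==> pf D E xs#:R"
 by (auto simp: tuples_J2 pf_def)

lemma anti_n2_uR: "a#:J ==> r#:R ==> D#:U ==> anti (n2 (uR r) a) D = r *! anti a D"
 by (simp add: anti_n2 n1_uR)

lemma Jm_anti_Um: "a:Jm m ==> D:Um m ==> anti a D = 0[R]"
 using Jm_Um[OF Jm_anti] .

lemma pf_bal:
 assumes D: "D:Um m" and E: "E:Um m" shows "CT.bal 2 m R (pf D E)"
 by (rule balanced2I) (use D E in "auto simp: pf_def anti_add R.l_distr R.r_distr jet_right_n2 jet_left_n1 anti_n2_uR n1_uR R.m_ac
  Jm_anti_Um[OF _ D] Jm_Um[OF _ E]")

lemma qf_bal:
 assumes D: "D:Um m" and E: "E:Um m" and H: "H:Um m" shows "CT.bal 3 m R (qf D E H)"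
 by (rule balanced3I) (use D E H in "auto simp: qf_def anti_add R.l_distr R.r_distr jet_right_n2 jet_left_n1 anti_n2_uR n1_uR R.m_ac
  Jm_anti_Um[OF _ D] Jm_Um[OF _ Um_right_uR[OF E]] Jm_Um[OF _ H] uR_add U.r_distr jet_plus uR_mult[symmetric] U.m_assoc")

lemma Null_Suc: "CT.Null n (Suc m) <= CT.Null n m"
proof -
 interpret G: comm_group "free_Abelian_group (tuples J n)" by (rule abelian_free_Abelian_group)
 have "Jm (Suc m) <= Jm m" using Jm_le[of _ "Suc m" m] by auto
 hence "CT.rels n (Suc m) <= CT.rels n m" unfolding CT.rels_def by blast
 thus ?thesis unfolding CT.Null_rels by (rule G.mono_generate)
qed

lemma cl_Suc: "CT.cl n (Suc m) p <= CT.cl n m p"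
 using Null_Suc by (auto simp: CT.cl_def')

text \<open>Expanding the second factor by \<open>ct_move\<close> and then the first by
  \<open>ct_head\<close> leaves exactly the values of \<open>pf\<close> on pairs of dual operators
  as coefficients.\<close>

lemma sep2:
 assumes t: "t#:(CT.TG 2 m)" "t'#:(CT.TG 2 m)"
  and tt: "!!D E. D:Um m ==> E:Um m ==> CT.ind R (pf D E) t = CT.ind R (pf D E) t'"
 shows "t = t'"
proof -
 obtain P where P: "dual m P" using dual_exists by blast
 have Pc: "fst p#:J" "snd p:Um m" "snd p#:U" if "p:set P" for p using P that by (auto simp: dual_def)
 show ?thesis
 proof (rule ct_separate[where js = "List.product P P" and f = "%(q, p). pf (snd p) (snd q)"
    and g = "%(q, p). anti (fst p)" and h = "%(q, p). [fst q]", OF _ _ _ t])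
  fix xs assume "xs:tuples J 2"
  then obtain a b where xs: "xs = [a, b]" "a#:J" "b#:J" by (auto simp: tuples_J2)
  let ?ct = "%xs. CT.cl 2 m (frag_of xs)"
  have "?ct [a, b] = lsum (CT.TA 2 m) (%q. ?ct [n2 (uR (b (snd q))) a, fst q]) P"
   using ct_move[OF P _ _ _ xs(2,3), of "[]" "[]" 2] by simp
  also have "... = lsum (CT.TA 2 m) (%q. lsum (CT.TA 2 m) (%p. ?ct [n2 (uR (pf (snd p) (snd q) xs)) (anti (fst p)), fst q]) P) P"
  proof (rule lsum_cong)
   fix q assume q: "q:set P"
   have "?ct [n2 (uR (b (snd q))) a, fst q]
     = lsum (CT.TA 2 m) (%p. ?ct [n2 (uR (anti (n2 (uR (b (snd q))) a) (snd p))) (anti (fst p)), fst q]) P"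
    by (rule ct_head[OF P]) (use xs Pc[OF q] in simp_all)
   also have "... = lsum (CT.TA 2 m) (%p. ?ct [n2 (uR (pf (snd p) (snd q) xs)) (anti (fst p)), fst q]) P"
    by (rule lsum_cong) (use xs Pc Pc[OF q] in "simp add: anti_n2_uR pf_def R.m_comm")
   finally show "?ct [n2 (uR (b (snd q))) a, fst q]
    = lsum (CT.TA 2 m) (%p. ?ct [n2 (uR (pf (snd p) (snd q) xs)) (anti (fst p)), fst q]) P" .
  qed
  finally show "?ct xs = lsum (CT.TA 2 m) (%i. ?ct (n2 (uR ((case i of (q, p) => pf (snd p) (snd q)) xs)) (case i of (q, p) => anti (fst p))
     # (case i of (q, p) => [fst q]))) (List.product P P)"
   using xs Pc by (subst CTA.lsum_product) (auto simp: pf_def tuples_J2 intro!: CT.cl_closed)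
 qed (use Pc tt in "auto intro!: pf_bal")
qed

text \<open>The expansion proceeds from the right: each value is passed on to the next factor before
  that one is expanded, which produces the nested functionals \<open>qf\<close>.\<close>

lemma sep3:
 assumes t: "t#:(CT.TG 3 m)" "t'#:(CT.TG 3 m)"
  and tt: "!!D E H. D:Um m ==> E:Um m ==> H:Um m ==> CT.ind R (qf D E H) t = CT.ind R (qf D E H) t'"
 shows "t = t'"
proof -
 obtain P where P: "dual m P" using dual_exists by blast
 have Pc: "fst p#:J" "snd p:Um m" "snd p#:U" if "p:set P" for p using P that by (auto simp: dual_def)
 let ?ct = "%xs. CT.cl 3 m (frag_of xs)"
 let ?S = "lsum (CT.TA 3 m)"
 show ?thesis
 proof (rule ct_separate[where js = "List.product P (List.product P P)" and f = "%(p, q, l). qf (snd l) (snd q) (snd p)"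
    and g = "%(p, q, l). anti (fst l)" and h = "%(p, q, l). [fst q, fst p]", OF _ _ _ t])
  fix xs assume "xs:tuples J 3"
  then obtain a b c where xs: "xs = [a, b, c]" "a#:J" "b#:J" "c#:J" by (auto simp: tuples_J3)
  let ?G = "%p q l. ?ct [n2 (uR (qf (snd l) (snd q) (snd p) xs)) (anti (fst l)), fst q, fst p]"
  have G: "?G p q l#:(CT.TA 3 m)" if "p:set P" "q:set P" "l:set P" for p q l
   using xs Pc[OF that(1)] Pc[OF that(2)] Pc[OF that(3)] by (auto simp: qf_def tuples_J3 intro!: CT.cl_closed)
  have "?ct [a, b, c] = ?S (%p. ?ct [a, n2 (uR (c (snd p))) b, fst p]) P"
   using ct_move[OF P _ _ _ xs(3,4), of "[a]" "[]" 3] xs by simp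
  also have "... = ?S (%p. ?S (%q. ?S (?G p q) P) P) P"
  proof (rule lsum_cong)
   fix p assume p: "p:set P"
   let ?b = "n2 (uR (c (snd p))) b"
   have b: "?b#:J" using xs Pc[OF p] by simp
   have "?ct [a, ?b, fst p] = ?S (%q. ?ct [n2 (uR (?b (snd q))) a, fst q, fst p]) P"
    using ct_move[OF P _ _ _ xs(2) b, of "[]" "[fst p]" 3] Pc[OF p] by simp
   also have "... = ?S (%q. ?S (?G p q) P) P"
   proof (rule lsum_cong)
    fix q assume q: "q:set P"
    have "?ct [n2 (uR (?b (snd q))) a, fst q, fst p]
      = ?S (%l. ?ct [n2 (uR (anti (n2 (uR (?b (snd q))) a) (snd l))) (anti (fst l)), fst q, fst p]) P"
     by (rule ct_head[OF P]) (use xs b Pc[OF q] Pc[OF p] in simp_all)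
    also have "... = ?S (?G p q) P"
     by (rule lsum_cong) (use xs b Pc Pc[OF q] Pc[OF p] in "simp add: anti_n2_uR qf_def R.m_comm")
    finally show "?ct [n2 (uR (?b (snd q))) a, fst q, fst p] = ?S (?G p q) P" .
   qed
   finally show "?ct [a, ?b, fst p] = ?S (%q. ?S (?G p q) P) P" .
  qed
  also have "... = ?S (%p. ?S (%(q, l). ?G p q l) (List.product P P)) P"
   by (rule lsum_cong, subst CTA.lsum_product) (use G in auto)
  also have "... = ?S (%(p, q, l). ?G p q l) (List.product P (List.product P P))"
   by (subst CTA.lsum_product) (use G in auto)
  finally show "?ct xs = ?S (%i. ?ct (n2 (uR ((case i of (p, q, l) => qf (snd l) (snd q) (snd p)) xs)) (case i of (p, q, l) => anti (fst l))
     # (case i of (p, q, l) => [fst q, fst p]))) (List.product P (List.product P P))"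
   using xs(1) by (simp add: case_prod_unfold)
 qed (use Pc tt in "auto intro!: qf_bal")
qed

text \<open>The tensor with coefficients \<open>n1 P al Q\<close> over all pairs of dual operators
  \<open>P\<close>, \<open>Q\<close>. Its pairings with \<open>D\<close> and \<open>E\<close>
  reassemble the expansions of \<open>D\<close> and of \<open>E\<close>.\<close>

lemma coprod_comp:
 assumes a: "al#:J"
 shows "EX t:carrier (CT.TG 2 m). ALL D:Um m. ALL E:Um m. CT.ind R (pf D E) t = n1 D al E"
proof -
 obtain P where P: "dual m P" using dual_exists by blast
 have Pc: "fst p#:J" "snd p:Um m" "snd p#:U" if "p:set P" for p using P that by (auto simp: dual_def)
 let ?g = "%(p, q). [n2 (uR (n1 (snd p) al (snd q))) (anti (fst p)), fst q]"
 have g: "?g i:tuples J 2" if "i:set (List.product P P)" for i using that Pc a by (auto simp: tuples_J2)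
 have gc: "CT.cl 2 m (frag_of (?g i))#:(CT.TA 2 m)" if "i:set (List.product P P)" for i
  using g[OF that] by (simp add: CT.cl_closed)
 let ?t = "lsum (CT.TA 2 m) (%i. CT.cl 2 m (frag_of (?g i))) (List.product P P)"
 have "CT.ind R (pf D E) ?t = n1 D al E" if D: "D:Um m" and E: "E:Um m" for D E
 proof -
  note b = pf_bal[OF D E]
  have "CT.ind R (pf D E) 0[CT.TA 2 m] = 0[R]" using CT.ind_cl[OF R.abelian_group_axioms b, of 0] by (simp add: CT.TG_one)
  hence "CT.ind R (pf D E) ?t = lsum R (%i. CT.ind R (pf D E) (CT.cl 2 m (frag_of (?g i)))) (List.product P P)"
   using CT.ind_add[OF R.abelian_group_axioms b] by (intro CTA.lsum_hom[OF gc]) auto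
  also have "... = lsum R (%i. pf D E (?g i)) (List.product P P)"
   by (rule lsum_cong) (use CT.ind_frag[OF R.abelian_group_axioms b g] in simp)
  also have "... = lsum R (%p. lsum R (%q. pf D E (?g (p, q))) P) P"
   by (rule R.lsum_product) (use D E Pc a in "auto simp: pf_def")
  also have "... = lsum R (%p. n1 (uR (fst p D) *& snd p) al E) P"
  proof (rule lsum_cong)
   fix p assume p: "p:set P"
   let ?D = "uR (fst p D) *& snd p"
   have d: "n1 ?D al#:J" using Pc[OF p] D a by simp
   have "lsum R (%q. pf D E (?g (p, q))) P = lsum R (%q. n1 ?D al (uR (fst q E) *& snd q)) P"
    by (rule lsum_cong) (use p Pc D E a in "simp add: pf_def anti_n2_uR anti_anti n1_mult n1_uR jet_uR R.m_ac")
   also have "... = n1 ?D al (lsum U (%q. uR (fst q E) *& snd q) P)"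
    by (rule jet_lsum[OF d, symmetric]) (use Pc E in simp)
   also have "lsum U (%q. uR (fst q E) *& snd q) P = E" using P E by (simp add: dual_def)
   finally show "lsum R (%q. pf D E (?g (p, q))) P = n1 ?D al E" .
  qed
  also have "... = n1 (lsum U (%p. uR (fst p D) *& snd p) P) al E"
   by (rule U.lsum_hom[symmetric]) (use Pc D E a in "simp_all add: n1_zero n1_add")
  also have "lsum U (%p. uR (fst p D) *& snd p) P = D" using P D by (simp add: dual_def)
  finally show ?thesis .
 qed
 moreover have "?t#:(CT.TA 2 m)" by (rule CTA.lsum_closed) (rule gc)
 ultimately show ?thesis unfolding CT.TA_simps by blast
qed

section \<open>Passage to the inverse limit\<close>

lemma ctensor_group_TG: "ctensor_group K R L n m = CT.TG n m"
 by (simp add: ctensor_group_def jet_filt_Jm)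

lemma ctensor_class_cl: "ctensor_class K R L n m = CT.cl n m"
 by (simp add: ctensor_class_def jet_filt_Jm)

abbreviation Ct where "Ct n == carrier (ctensor K R L n)"

lemma ctensor_carrier: "x:Ct n <-> (ALL m. x m#:(CT.TG n m) & x (Suc m) <= x m)"
 by (simp add: ctensor_def ctensor_group_TG)

lemma ctensor_TG [simp]: "x:Ct n ==> x m#:(CT.TG n m)"
 by (simp add: ctensor_carrier)

lemma ctensor_le: "x:Ct n ==> m <= m' ==> x m' <= x m"
 by (rule lift_Suc_antimono_le[of x]) (auto simp: ctensor_carrier)

lemma ctensor_rep:
 assumes "x:Ct n" "p:x m"
 shows "supp p <= tuples J n" "x m = CT.cl n m p"
 using CT.TG_rep[OF ctensor_TG[OF assms(1)] assms(2)] by auto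

lemma ctensor_ex: "x:Ct n ==> EX p. p:x m"
 using CT.TG_nonempty[OF ctensor_TG] .

text \<open>A representative at a higher level is also one at level \<open>m\<close>, where
  \<open>pf D E\<close> is already well defined.\<close>

lemma pf_stable:
 assumes "x:Ct 2" "p:x m" "p':x m'" "D:Um m" "E:Um m" "m <= m'"
 shows "R.lift (pf D E) p = R.lift (pf D E) p'"
 using CT.lift_rep[OF R.abelian_group_axioms pf_bal[OF assms(4,5)] ctensor_TG[OF assms(1)] assms(2)] ctensor_le[OF assms(1,6)] assms(3)
 by auto

lemma Um_common2: "D#:U ==> E#:U ==> EX m. D:Um m & E:Um m"
 using Um_common by blast

text \<open>In the discrete topology of \<open>R\<close> a sum exists if it is eventually constant.
  For \<open>pf D E\<close> this holds from any level on whose filtration step contains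
  \<open>D\<close> and \<open>E\<close>.\<close>

lemma is_jet_coprod_iff:
 assumes a: "al#:J"
 shows "is_jet_coprod K R L al x <-> x:Ct 2 &
  (ALL D:carrier U. ALL E:carrier U. EX k. ALL m>=k. ALL p:x m. R.lift (pf D E) p = n1 D al E)" (is "?l <-> ?r")
proof (cases "x:Ct 2")
 case x: True
 have "csum R (%_. {0[R]}) (pf D E) x v <-> (EX k. ALL m>=k. ALL p:x m. R.lift (pf D E) p = v)"
  if D: "D#:U" and E: "E#:U" and v: "v#:R" for D E v
 proof -
  have c: "R.lift (pf D E) p#:R" if "p:x m" for p m
   by (rule R.lift_closed) (use ctensor_rep(1)[OF x that] pf_closed[OF D E] in blast)
  define Q where "Q z <-> (EX k. ALL m>=k. ALL p:x m. R.lift (pf D E) p = z)" for z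
  have e: "(EX m\<^sub>0. ALL m>=m\<^sub>0. ALL p:x m. R.lift (pf D E) p -! z:{0[R]}) <-> Q z"
   if "z#:R" for z unfolding Q_def
   by (intro iff_exI iff_allI imp_cong ball_cong refl) (use R.minus_zero_eq[OF _ c that] that in "auto simp: a_minus_def R.r_neg")
  have u: "z = z'" if q: "Q z" "Q z'" for z z'
  proof -
   obtain k k' where "ALL m>=k. ALL p:x m. R.lift (pf D E) p = z" "ALL m>=k'. ALL p:x m. R.lift (pf D E) p = z'"
    using q unfolding Q_def by blast
   thus ?thesis using ctensor_ex[OF x, of "max k k'"] by (metis max.cobounded1 max.cobounded2)
  qed
  have "EX z:carrier R. Q z"
  proof -
   obtain m where m: "D:Um m" "E:Um m" using Um_common2[OF D E] by blast
   obtain p where p: "p:x m" using ctensor_ex[OF x] by blast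
   show ?thesis unfolding Q_def
    by (rule bexI[OF _ c[OF p]], rule exI[of _ m]) (use pf_stable[OF x p _ m] in auto)
  qed
  then obtain z0 where z0: "z0#:R" "Q z0" by blast
  have "csum R (%_. {0[R]}) (pf D E) x v <-> (ALL z. z#:R & Q z <-> z = v)"
   unfolding csum_def by (rule iff_allI) (use e in "simp cong: conj_cong")
  also have "... <-> Q v" using z0 u[of _ v] v by blast
  finally show ?thesis by (simp add: Q_def)
 qed
 moreover have "ep (n1 D (n2 E al)) = n1 D al E" if "D#:U" "E#:U" for D E
  using that a by (simp add: ep_app n1_n2)
 moreover have "(%as. pairing1 K R L (as ! 0) D *! pairing2 K R L (as ! 1) E) = pf D E" if "D#:U" "E#:U" for D E
  using that by (intro ext) (simp add: pairing1 pairing2 pf_def)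
 ultimately show ?thesis using x a by (simp add: is_jet_coprod_def)
qed (simp add: is_jet_coprod_def)

lemma jet_coprod_pf:
 assumes a: "al#:J" and x: "is_jet_coprod K R L al x" and p: "p:x m" and D: "D:Um m" and E: "E:Um m"
 shows "R.lift (pf D E) p = n1 D al E"
proof -
 note x' = x[unfolded is_jet_coprod_iff[OF a]]
 then obtain k where k: "ALL m>=k. ALL p:x m. R.lift (pf D E) p = n1 D al E" using D E by (meson Um_closed)
 obtain q where q: "q:x (max k m)" using ctensor_ex x' by blast
 have "R.lift (pf D E) p = R.lift (pf D E) q" by (rule pf_stable[of x p m q "max k m"]) (use x' p q D E in auto)
 thus ?thesis using k[rule_format, of "max k m" q] q by simp
qed

lemma jet_coprod_ex1:
 assumes a: "al#:J"
 shows "EX! x. is_jet_coprod K R L al x"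
proof -
 have "EX x. ALL m. x m#:(CT.TG 2 m) & (ALL D:Um m. ALL E:Um m. CT.ind R (pf D E) (x m) = n1 D al E)"
  by (rule choice) (use coprod_comp[OF a] in blast)
 then obtain x where x: "!!m. x m#:(CT.TG 2 m)"
  and v: "!!m D E. D:Um m ==> E:Um m ==> CT.ind R (pf D E) (x m) = n1 D al E" by blast
 have vl: "R.lift (pf D E) p = n1 D al E" if "D:Um m" "E:Um m" "p:x m" for m D E p
  using CT.ind_eq[OF R.abelian_group_axioms pf_bal x] v that by fastforce
 \<comment> \<open>Read at level \<open>m\<close>, the next component has the pairings of
   \<open>x m\<close>, so \<open>sep2\<close> identifies the two.\<close>
 have "x (Suc m) <= x m" for m
 proof -
  obtain p where p: "p:x (Suc m)" using CT.TG_nonempty[OF x] by blast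
  note r = CT.TG_rep[OF x p]
  have "CT.cl 2 m p = x m"
  proof (rule sep2[OF CT.cl_closed[OF r(1)] x])
   fix D E assume D: "D:Um m" and E: "E:Um m"
   have "R.lift (pf D E) p = n1 D al E" by (rule vl[OF _ _ p]) (use Um_le[OF D] Um_le[OF E] in auto)
   thus "CT.ind R (pf D E) (CT.cl 2 m p) = CT.ind R (pf D E) (x m)"
    using CT.ind_cl[OF R.abelian_group_axioms pf_bal[OF D E] r(1)] v[OF D E] by simp
  qed
  thus ?thesis using cl_Suc[of 2 m p] r(2) by simp
 qed
 hence xc: "x:Ct 2" using x by (simp add: ctensor_carrier)
 have ix: "is_jet_coprod K R L al x"
  unfolding is_jet_coprod_iff[OF a]
 proof (intro conjI ballI)
  fix D E assume D: "D#:U" and E: "E#:U"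
  obtain k where k: "D:Um k" "E:Um k" using Um_common2[OF D E] by blast
  show "EX k. ALL m>=k. ALL p:x m. R.lift (pf D E) p = n1 D al E"
   by (intro exI[of _ k] allI impI ballI vl) (use Um_le k in auto)
 qed (rule xc)
 moreover have "y = x" if y: "is_jet_coprod K R L al y" for y
 proof
  fix m
  have yc: "y:Ct 2" using y is_jet_coprod_iff[OF a] by blast
  obtain p where p: "p:y m" using ctensor_ex[OF yc] by blast
  show "y m = x m"
  proof (rule sep2[OF ctensor_TG[OF yc] x])
   fix D E assume D: "D:Um m" and E: "E:Um m"
   show "CT.ind R (pf D E) (y m) = CT.ind R (pf D E) (x m)"
    using CT.ind_eq[OF R.abelian_group_axioms pf_bal[OF D E] ctensor_TG[OF yc] p] jet_coprod_pf[OF a y p D E] v[OF D E] by simp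
  qed
 qed
 ultimately show ?thesis by blast
qed

abbreviation dl where "dl == jet_coprod K R L"

lemma dl_is: "al#:J ==> is_jet_coprod K R L al (dl al)"
 unfolding jet_coprod_def by (rule theI'[of "is_jet_coprod K R L al"]) (rule jet_coprod_ex1)

lemma dl_eq: "al#:J ==> is_jet_coprod K R L al x ==> dl al = x"
 using jet_coprod_ex1 dl_is by blast

lemma dl_closed [simp]: "al#:J ==> dl al:Ct 2"
 using dl_is is_jet_coprod_iff by blast

lemma dl_pf: "al#:J ==> p:dl al m ==> D:Um m ==> E:Um m ==> R.lift (pf D E) p = n1 D al E"
 by (rule jet_coprod_pf[OF _ dl_is])

section \<open>The completed tensor square\<close>

abbreviation fm where "fm == frag_mult J"
abbreviation S2 where "S2 == tuples J 2"

lemma map2_S2: "xs:S2 ==> ys:S2 ==> map2 (%x y. x *[J] y) xs ys:S2"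
 by (auto simp: tuples_J2)

lemma fm_keys:
 assumes p: "supp p <= S2" and q: "supp q <= S2"
 shows "supp (fm p q) <= S2"
proof -
 have "supp (fm (frag_of xs) q) <= S2" if xs: "xs:S2" for xs
  using keys_frag_extend[of "%ys. frag_of (map2 (%x y. x *[J] y) xs ys)" q] map2_S2[OF xs] q by (auto simp: subset_eq)
 note s = this
 show ?thesis using p
 proof (induction p rule: frag_induct)
  case (diff a b)
  show ?case unfolding frag_mult_diff_left by (rule CT.keys_diff2[OF diff(3,4)])
 qed (use s in auto)
qed

lemma fm_comm:
 assumes p: "supp p <= S2" and q: "supp q <= S2"
 shows "fm p q = fm q p"
 using p
proof (induction p rule: frag_induct)
 case (of xs)
 show ?case using q
  by (induction q rule: frag_induct) (use of in "auto simp: frag_mult_diff_right frag_mult_diff_left frag_extend_diff tuples_J2 JR.m_comm")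
qed (simp_all add: frag_mult_diff_left frag_mult_diff_right)

lemma fm_assoc:
 assumes p: "supp p <= S2" and q: "supp q <= S2" and r: "supp r <= S2"
 shows "fm (fm p q) r = fm p (fm q r)"
 using p
proof (induction p rule: frag_induct)
 case (of xs)
 show ?case using q
 proof (induction q rule: frag_induct)
  case (of ys)
  show ?case using r
   by (induction r rule: frag_induct) (use of \<open>xs:S2\<close> in "auto simp: frag_extend_diff tuples_J2 JR.m_assoc")
 qed (simp_all add: frag_mult_diff_right frag_mult_diff_left del: frag_mult_of)
qed (simp_all add: frag_mult_diff_left)

lemma fm_one: "supp p <= S2 ==> fm (frag_of [1[J], 1[J]]) p = p"
 by (induction p rule: frag_induct) (auto simp: frag_extend_diff tuples_J2)

text \<open>Multiplication by a decomposable tensor respects every family of relations: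
  \<open>Jm m\<close> is an ideal, and by commutativity the scalars can still cross the tensor
  sign.\<close>

lemma fm_Null:
 assumes p: "p:CT.Null 2 m" and q: "supp q <= S2"
 shows "fm p q:CT.Null 2 m"
 using q
proof (induction q rule: frag_induct)
 case (of ys)
 note k = CT.Null_keys[OF p]
 obtain c d where ys: "ys = [c, d]" "c#:J" "d#:J" using of by (auto simp: tuples_J2)
 have e: "fm p (frag_of ys) = frag_extend (%xs. frag_of (map2 (%x y. x *[J] y) xs ys)) p"
  by (simp add: frag_mult_def)
 let ?f = "%xs. CT.cl 2 m (frag_of (map2 (%x y. x *[J] y) xs ys))"
 have "CT.bal 2 m (CT.TA 2 m) ?f"
 proof (rule balanced2I)
  fix a b assume a: "a#:J" and b: "b#:J"
  thus "?f [a, b]#:(CT.TA 2 m)" using ys by (auto simp: tuples_J2 intro!: CT.cl_closed)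
  show "?f [a, b] = 0[CT.TA 2 m]" if "a:Jm m | b:Jm m"
   unfolding CT.TA_simps
   by (rule CT.cl_frag_null) (use a b ys that Jm_mult[of a m c 0] Jm_mult[of b m d 0] in "auto simp: tuples_J2 Jm_def")
  fix a' assume a': "a'#:J"
  show "?f [a +[J] a', b] = ?f [a, b] +[CT.TA 2 m] ?f [a', b]"
   using CT.cl_frag_add[of "[]" "a *[J] c" "[b *[J] d]" 2 "a' *[J] c" m] a b a' ys by (simp add: tuples_J2 JR.l_distr)
  show "?f [b, a +[J] a'] = ?f [b, a] +[CT.TA 2 m] ?f [b, a']"
   using CT.cl_frag_add[of "[b *[J] c]" "a *[J] d" "[]" 2 "a' *[J] d" m] a b a' ys by (simp add: tuples_J2 JR.l_distr)
 next
  fix a b r assume "a#:J" "b#:J" "r#:R"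
  thus "?f [jr a r, b] = ?f [a, jl r b]"
   using CT.cl_frag_bal[of "[]" "a *[J] c" "b *[J] d" "[]" 2 r m] ys
   by (simp add: tuples_J2 jet_right_def jet_left_def JR.m_ac)
 qed
 from CT.Null_lift[OF CT.TA_abelian this p] have "CT.cl 2 m (fm p (frag_of ys)) = CT.cl 2 m 0"
  unfolding e by (subst CT.cl_extend(1)[OF k]) (use of in "auto simp: map2_S2 CT.TG_one")
 thus ?case by (simp only: CT.cl_eq_iff diff_zero)
qed (simp_all add: frag_mult_diff_right CT.Null_diff)

lemma cl_fm:
 assumes p: "supp p <= S2" "supp p' <= S2" "supp q <= S2" "supp q' <= S2"
  and e: "CT.cl 2 m p = CT.cl 2 m p'" "CT.cl 2 m q = CT.cl 2 m q'"
 shows "CT.cl 2 m (fm p q) = CT.cl 2 m (fm p' q')"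
proof -
 have "fm (p - p') q:CT.Null 2 m" using e(1) fm_Null p(3) by (simp add: CT.cl_eq_iff)
 moreover have "fm (q - q') p':CT.Null 2 m" using e(2) fm_Null p(2) by (simp add: CT.cl_eq_iff)
 moreover have "fm (q - q') p' = fm p' (q - q')" by (rule fm_comm[OF CT.keys_diff2[OF p(3,4)] p(2)])
 ultimately have "fm (p - p') q + fm p' (q - q'):CT.Null 2 m" using CT.Null_add by simp
 thus ?thesis by (simp add: CT.cl_eq_iff frag_mult_diff_left frag_mult_diff_right)
qed

abbreviation T where "T == ctensor K R L 2"

text \<open>Components at different levels are cosets in the same free group. Compatibility of
  levels, like equality in \<open>ctensor_eqI\<close>, is therefore certified by a common
  representative.\<close>

lemma ctensorI: "(!!m. x m#:(CT.TG n m)) ==> (!!m. EX p. p:x (Suc m) & p:x m) ==> x:Ct n"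
 unfolding ctensor_carrier
proof (intro allI conjI)
 fix m assume x: "!!m. x m#:(CT.TG n m)" and "!!m. EX p. p:x (Suc m) & p:x m"
 then obtain p where p: "p:x (Suc m)" "p:x m" by blast
 show "x (Suc m) <= x m" using CT.TG_rep(2)[OF x p(1)] CT.TG_rep(2)[OF x p(2)] cl_Suc by simp
qed

lemma ctensor_eqI: "x:Ct n ==> y:Ct n ==> (!!m. EX p. p:x m & p:y m) ==> x = y"
proof
 fix m assume x: "x:Ct n" and y: "y:Ct n" and "!!m. EX p. p:x m & p:y m"
 then obtain p where p: "p:x m" "p:y m" by blast
 show "x m = y m" using ctensor_rep(2)[OF x p(1)] ctensor_rep(2)[OF y p(2)] by simp
qed

lemma ctensor_Suc: "x:Ct n ==> p:x (Suc m) ==> p:x m"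
 by (auto simp: ctensor_carrier)

lemma ct_add: "x:Ct n ==> y:Ct n ==> p:x m ==> q:y m ==> (x +[ctensor K R L n] y) m = CT.cl n m (p + q)"
proof -
 assume x: "x:Ct n" and y: "y:Ct n" and pq: "p:x m" "q:y m"
 have "(x +[ctensor K R L n] y) m = x m *[CT.TG n m] y m" by (simp only: ctensor_def ctensor_group_TG ring_record_simps module.simps)
 thus ?thesis
  unfolding ctensor_rep(2)[OF x pq(1)] ctensor_rep(2)[OF y pq(2)]
  by (simp only: CT.TG_mult[OF ctensor_rep(1)[OF x pq(1)] ctensor_rep(1)[OF y pq(2)]])
qed

lemma rep_add: "x:Ct n ==> y:Ct n ==> p:x m ==> q:y m ==> p + q:(x +[ctensor K R L n] y) m"
 by (simp add: ct_add)

lemma ct_add_closed: "x:Ct n ==> y:Ct n ==> x +[ctensor K R L n] y:Ct n"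
proof (rule ctensorI)
 fix m assume x: "x:Ct n" and y: "y:Ct n"
 obtain p q where pq: "p:x (Suc m)" "q:y (Suc m)" using ctensor_ex[OF x] ctensor_ex[OF y] by blast
 show "EX p. p:(x +[ctensor K R L n] y) (Suc m) & p:(x +[ctensor K R L n] y) m"
  by (intro exI[of _ "p + q"] conjI rep_add) (use pq x y ctensor_Suc in auto)
next
 fix m assume x: "x:Ct n" and y: "y:Ct n"
 obtain p q where pq: "p:x m" "q:y m" using ctensor_ex[OF x] ctensor_ex[OF y] by blast
 thus "(x +[ctensor K R L n] y) m#:(CT.TG n m)"
  using ct_add[OF x y pq] CT.cl_closed[OF CT.keys_add2[OF ctensor_rep(1)[OF x pq(1)] ctensor_rep(1)[OF y pq(2)]]] by simp
qed

lemma ct_zero: "0[ctensor K R L n] m = CT.cl n m 0"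
 by (simp only: ctensor_def ctensor_group_TG CT.TG_one ring_record_simps module.simps)

lemma rep_zero: "0:0[ctensor K R L n] m" by (simp add: ct_zero)

lemma ct_zero_closed: "0[ctensor K R L n]:Ct n"
 by (rule ctensorI) (auto simp: ct_zero intro!: CT.cl_closed exI[of _ 0])

lemma ct_abelian: "abelian_group (ctensor K R L n)"
proof (rule abelian_groupI)
 fix x y z assume x: "x:Ct n" and y: "y:Ct n" and z: "z:Ct n"
 note c = ct_add_closed ct_zero_closed
 have e: "EX p q r. p:x m & q:y m & r:z m" for m using ctensor_ex[OF x] ctensor_ex[OF y] ctensor_ex[OF z] by blast
 show "x +[ctensor K R L n] y +[ctensor K R L n] z = x +[ctensor K R L n] (y +[ctensor K R L n] z)"
 proof (rule ctensor_eqI[where n = n])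
  fix m obtain p q r where "p:x m" "q:y m" "r:z m" using e by blast
  hence "p + q + r:(x +[ctensor K R L n] y +[ctensor K R L n] z) m" "p + (q + r):(x +[ctensor K R L n] (y +[ctensor K R L n] z)) m"
   using x y z by (auto intro!: rep_add c)
  thus "EX p. p:(x +[ctensor K R L n] y +[ctensor K R L n] z) m & p:(x +[ctensor K R L n] (y +[ctensor K R L n] z)) m"
   by (auto simp: add.assoc)
 qed (use x y z c in auto)
 show "x +[ctensor K R L n] y = y +[ctensor K R L n] x"
 proof (rule ctensor_eqI[where n = n])
  fix m obtain p q where "p:x m" "q:y m" using e by blast
  hence "p + q:(x +[ctensor K R L n] y) m" "q + p:(y +[ctensor K R L n] x) m" using x y by (auto intro!: rep_add)
  thus "EX p. p:(x +[ctensor K R L n] y) m & p:(y +[ctensor K R L n] x) m" by (auto simp: add.commute)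
 qed (use x y c in auto)
next
 fix x assume x: "x:Ct n"
 show "0[ctensor K R L n] +[ctensor K R L n] x = x"
 proof (rule ctensor_eqI[where n = n])
  fix m obtain p where p: "p:x m" using ctensor_ex[OF x] by blast
  have "0 + p:(0[ctensor K R L n] +[ctensor K R L n] x) m" by (intro rep_add rep_zero p x ct_zero_closed)
  thus "EX p. p:(0[ctensor K R L n] +[ctensor K R L n] x) m & p:x m" using p by auto
 qed (use x ct_add_closed ct_zero_closed in auto)
 obtain f where f: "!!m. f m:x m" using ctensor_ex[OF x] by metis
 let ?y = "%m. CT.cl n m (- f m)"
 have yk: "supp (- f m) <= tuples J n" for m using ctensor_rep(1)[OF x f] by (simp add: keys_minus)
 have yr: "- p:?y m" if p: "p:x m" for p m
 proof -
  have "CT.cl n m (f m) = CT.cl n m p" using ctensor_rep(2)[OF x f[of m]] ctensor_rep(2)[OF x p] by (rule subst)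
  hence "CT.cl n m (- p) = ?y m" by (simp add: CT.cl_eq_iff)
  thus ?thesis using CT.cl_self by blast
 qed
 have y: "?y:Ct n"
 proof (rule ctensorI)
  fix m
  show "?y m#:(CT.TG n m)" by (rule CT.cl_closed[OF yk])
  show "EX p. p:?y (Suc m) & p:?y m" by (intro exI[of _ "- f (Suc m)"] conjI yr f ctensor_Suc[OF x f])
 qed
 have "?y +[ctensor K R L n] x = 0[ctensor K R L n]"
 proof (rule ctensor_eqI[where n = n])
  fix m obtain p where p: "p:x m" using ctensor_ex[OF x] by blast
  have "- p + p:(?y +[ctensor K R L n] x) m" by (intro rep_add y x yr p)
  thus "EX p. p:(?y +[ctensor K R L n] x) m & p:0[ctensor K R L n] m" using rep_zero by auto
 qed (use x y ct_add_closed ct_zero_closed in auto)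
 thus "EX y:Ct n. y +[ctensor K R L n] x = 0[ctensor K R L n]" using y by blast
qed (simp_all add: ct_add_closed ct_zero_closed)

lemma ct_mult:
 assumes x: "x:Ct 2" and y: "y:Ct 2" and p: "p:x m" and q: "q:y m"
 shows "(x *[T] y) m = CT.cl 2 m (fm p q)"
proof -
 have "CT.cl 2 m (fm p' q') = CT.cl 2 m (fm p q)" if "p':x m" "q':y m" for p' q'
  by (rule cl_fm) (use that p q ctensor_rep[OF x] ctensor_rep[OF y] in auto)
 hence "(\<Union>p'\<in>x m. \<Union>q'\<in>y m. CT.cl 2 m (fm p' q')) = CT.cl 2 m (fm p q)" using p q by blast
 thus ?thesis by (simp only: ctensor_def ctensor_class_cl ring_record_simps module.simps)
qed

lemma rep_mult: "x:Ct 2 ==> y:Ct 2 ==> p:x m ==> q:y m ==> fm p q:(x *[T] y) m"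
 by (simp add: ct_mult)

lemma ct_mult_closed: "x:Ct 2 ==> y:Ct 2 ==> x *[T] y:Ct 2"
proof (rule ctensorI)
 fix m assume x: "x:Ct 2" and y: "y:Ct 2"
 obtain p q where pq: "p:x (Suc m)" "q:y (Suc m)" using ctensor_ex[OF x] ctensor_ex[OF y] by blast
 show "EX p. p:(x *[T] y) (Suc m) & p:(x *[T] y) m"
  by (intro exI[of _ "fm p q"] conjI rep_mult) (use pq x y ctensor_Suc in auto)
next
 fix m assume x: "x:Ct 2" and y: "y:Ct 2"
 obtain p q where pq: "p:x m" "q:y m" using ctensor_ex[OF x] ctensor_ex[OF y] by blast
 thus "(x *[T] y) m#:(CT.TG 2 m)"
  using ct_mult[OF x y pq] ctensor_rep[OF x pq(1)] ctensor_rep[OF y pq(2)] fm_keys by (simp add: CT.cl_closed)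
qed

definition pure where "pure xs = (%m. CT.cl 2 m (frag_of xs))"

lemma pure_closed [simp]: "xs:S2 ==> pure xs:Ct 2"
 by (rule ctensorI) (auto simp: pure_def intro!: CT.cl_closed exI[of _ "frag_of xs"])

lemma rep_pure: "frag_of xs:pure xs m" by (simp add: pure_def)

lemma ct_one: "1[T] = pure [1[J], 1[J]]"
proof -
 have "replicate 2 1[J] = [1[J], 1[J]]" by (simp add: numeral_2_eq_2)
 thus ?thesis by (simp only: ctensor_def pure_def ctensor_class_cl ring_record_simps module.simps)
qed

lemma pure_add: "a#:J ==> a'#:J ==> b#:J ==> pure [a +[J] a', b] = pure [a, b] +[T] pure [a', b]"
 using CT.cl_frag_add[of "[]" a "[b]" 2 a']
 by (intro ext) (simp add: pure_def tuples_J2, simp only: ctensor_def ctensor_group_TG ring_record_simps module.simps)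

lemma pure_mult:
 assumes "xs:S2" "ys:S2" shows "pure xs *[T] pure ys = pure (map2 (%x y. x *[J] y) xs ys)"
 using ct_mult[OF pure_closed pure_closed rep_pure rep_pure] assms by (intro ext) (simp add: pure_def)

lemma T_cring: "cring T"
proof (rule cringI)
 show "abelian_group T" by (rule ct_abelian)
 have S: "[1[J], 1[J]]:S2" by (simp add: tuples_J2)
 note c = ct_mult_closed ct_add_closed
 show "comm_monoid T"
 proof (rule comm_monoidI)
  fix x y z assume x: "x:Ct 2" and y: "y:Ct 2" and z: "z:Ct 2"
  have e: "EX p q r. p:x m & q:y m & r:z m" for m using ctensor_ex[OF x] ctensor_ex[OF y] ctensor_ex[OF z] by blast
  show "x *[T] y *[T] z = x *[T] (y *[T] z)"
  proof (rule ctensor_eqI[where n = 2])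
   fix m obtain p q r where r: "p:x m" "q:y m" "r:z m" using e by blast
   hence "fm (fm p q) r:(x *[T] y *[T] z) m" "fm p (fm q r):(x *[T] (y *[T] z)) m"
    using x y z by (auto intro!: rep_mult c)
   thus "EX p. p:(x *[T] y *[T] z) m & p:(x *[T] (y *[T] z)) m"
    using fm_assoc ctensor_rep(1)[OF x r(1)] ctensor_rep(1)[OF y r(2)] ctensor_rep(1)[OF z r(3)] by auto
  qed (use x y z c in auto)
  show "x *[T] y = y *[T] x"
  proof (rule ctensor_eqI[where n = 2])
   fix m obtain p q where r: "p:x m" "q:y m" using e by blast
   hence "fm p q:(x *[T] y) m" "fm q p:(y *[T] x) m" using x y by (auto intro!: rep_mult)
   thus "EX p. p:(x *[T] y) m & p:(y *[T] x) m"
    using fm_comm ctensor_rep(1)[OF x r(1)] ctensor_rep(1)[OF y r(2)] by auto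
  qed (use x y c in auto)
 next
  fix x assume x: "x:Ct 2"
  show "1[T] *[T] x = x"
   unfolding ct_one
  proof (rule ctensor_eqI[where n = 2])
   fix m obtain p where p: "p:x m" using ctensor_ex[OF x] by blast
   thus "EX p. p:(pure [1[J], 1[J]] *[T] x) m & p:x m"
    using rep_mult[OF pure_closed[OF S] x rep_pure p] fm_one[OF ctensor_rep(1)[OF x p]] by auto
  qed (use x S c in auto)
 qed (use c S in "auto simp: ct_one")
 fix x y z assume x: "x:Ct 2" and y: "y:Ct 2" and z: "z:Ct 2"
 have "z *[T] (x +[T] y) = z *[T] x +[T] z *[T] y"
 proof (rule ctensor_eqI[where n = 2])
  fix m obtain p q r where "p:x m" "q:y m" "r:z m" using ctensor_ex[OF x] ctensor_ex[OF y] ctensor_ex[OF z] by blast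
  hence "fm r (p + q):(z *[T] (x +[T] y)) m" "fm r p + fm r q:(z *[T] x +[T] z *[T] y) m"
   using x y z by (auto intro!: rep_mult rep_add c)
  thus "EX p. p:(z *[T] (x +[T] y)) m & p:(z *[T] x +[T] z *[T] y) m"
   by (auto simp: frag_mult_add_right)
 qed (use x y z c in auto)
 thus "(x +[T] y) *[T] z = x *[T] z +[T] y *[T] z"
  using comm_monoid.m_comm[OF \<open>comm_monoid T\<close>] x y z c by simp
qed

text \<open>The scalars from \<open>K\<close> and both actions of \<open>R\<close> are
  multiplications by decomposable tensors, so their properties follow from the ring
  structure.\<close>

lemma ctensor_map_mult:
 assumes x: "x:Ct 2" and z: "zs:S2" and f: "!!xs. xs:S2 ==> f xs = map2 (%x y. x *[J] y) zs xs"
 shows "ctensor_map K R L 2 f x = pure zs *[T] x"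
proof
 fix m
 obtain p where p: "p:x m" using ctensor_ex[OF x] by blast
 have e: "CT.cl 2 m (frag_extend (%xs. frag_of (f xs)) q) = (pure zs *[T] x) m" if q: "q:x m" for q
 proof -
  have "frag_extend (%xs. frag_of (f xs)) q = fm (frag_of zs) q"
   unfolding frag_mult_of by (rule frag_extend_eq) (use f ctensor_rep(1)[OF x q] in auto)
  thus ?thesis using ct_mult[OF pure_closed[OF z] x rep_pure q] by simp
 qed
 show "ctensor_map K R L 2 f x m = (pure zs *[T] x) m"
  using e p by (auto simp: ctensor_map_def ctensor_class_cl)
qed

lemma ct_smult: "x:Ct 2 ==> c#:K ==> c **[T] x = pure [c **[J] 1[J], 1[J]] *[T] x"
proof -
 assume x: "x:Ct 2" and c: "c#:K"
 have "ctensor_map K R L 2 (%xs. (c **[J] hd xs) # tl xs) x = pure [c **[J] 1[J], 1[J]] *[T] x"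
  by (rule ctensor_map_mult[OF x]) (use c in "auto simp: tuples_J2 jet_smult_closed jet_smult_mult")
 thus ?thesis by (simp only: ctensor_def ring_record_simps module.simps)
qed

lemma T_algebra: "algebra K T"
proof -
 interpret T: cring T by (rule T_cring)
 note ma = algebra.axioms(1)[OF jet_algebra]
 have p: "pure [c **[J] 1[J], 1[J]]:Ct 2" if "c#:K" for c
  using that by (simp add: tuples_J2)
 show ?thesis
 proof (rule algebraI)
  show "cring K" by (rule K.is_cring)
  show "cring T" by (rule T_cring)
 qed (use p in "simp_all add: ct_smult T.r_distr T.l_distr T.m_assoc[symmetric] module.smult_l_distr[OF ma] pure_add
   pure_mult tuples_J2 algebra.smult_assoc2[OF jet_algebra] module.smult_assoc1[OF ma] module.smult_one[OF ma] jet_smult_closed jet_one_closed ct_one[symmetric]")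
qed

lemma ctensor_left_mult: "x:Ct 2 ==> r#:R ==> ctensor_left K R L 2 r x = pure [u1 r, 1[J]] *[T] x"
 unfolding ctensor_left_def by (rule ctensor_map_mult) (auto simp: tuples_J2 jet_left_def)

lemma ctensor_right_mult: "x:Ct 2 ==> r#:R ==> ctensor_right K R L 2 x r = pure [1[J], u2 r] *[T] x"
 unfolding ctensor_right_def by (rule ctensor_map_mult) (auto simp: tuples_J2 jet_right_def JR.m_comm)

section \<open>The coproduct is a morphism of algebras and bimodules\<close>

lemma Um_con0: "D:Um m ==> al#:J ==> con al D:Um m"
 using Um_con[of D m al 0] by (simp add: Jm_def)

lemma n2_one: "D#:U ==> n2 D 1[J] = u2 (actR D 1[R])"
 by (rule jet_eqD) (simp_all add: u2_app jet_one_closed, simp add: jet_one actR_mult)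

lemma anti_u2: "r#:R ==> anti (u2 r) = u1 r"
 using anti_n2[of "uR r" "1[J]"] by (simp add: jet_unit1_def jet_unit2_def anti_one)

lemma n1_one_app: "D#:U ==> E#:U ==> n1 D 1[J] E = actR D 1[R] *! actR E 1[R]"
 using u1_app[of "actR D 1[R]" E] anti_n2[of D "1[J]"] by (simp add: anti_one n2_one anti_u2)

lemma lift_n1: "supp z <= S ==> (!!x. x:S ==> f x#:U) ==> al#:J ==>
  n1 (U.lift f z) al = JR.lift (%x. n1 (f x) al) z"
 by (rule U.lift_hom[OF JR.abelian_group_axioms, where h = "%D. n1 D al"]) (simp_all add: n1_add)

lemma lift_app: "supp z <= S ==> (!!x. x:S ==> f x#:J) ==> D#:U ==>
  JR.lift f z D = R.lift (%x. f x D) z"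
 by (rule JR.lift_hom[OF R.abelian_group_axioms, where h = "%al. al D"]) simp_all

text \<open>By \<open>pf_stable\<close> one representative at one sufficiently high level decides
  each pairing.\<close>

lemma dl_eqI:
 assumes a: "al#:J" and x: "x:Ct 2"
  and e: "!!D E. D#:U ==> E#:U ==> EX m p. p:x m & D:Um m & E:Um m & R.lift (pf D E) p = n1 D al E"
 shows "dl al = x"
proof (rule dl_eq[OF a])
 show "is_jet_coprod K R L al x"
  unfolding is_jet_coprod_iff[OF a]
 proof (intro conjI ballI x)
  fix D E assume "D#:U" "E#:U"
  then obtain m p where p: "p:x m" "D:Um m" "E:Um m" "R.lift (pf D E) p = n1 D al E" using e by blast
  show "EX k. ALL m>=k. ALL p:x m. R.lift (pf D E) p = n1 D al E"
   by (intro exI[of _ m] allI impI ballI) (use pf_stable[OF x p(1) _ p(2,3)] p(4) in simp)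
 qed
qed

lemma Um_finite:
 assumes "finite A" "A <= carrier U" shows "EX m. A <= Um m"
 using assms
proof (induction A)
 case (insert D A)
 then obtain m k where "A <= Um m" "D:Um k" using Um_all[of D] by blast
 thus ?case by (intro exI[of _ "max m k"]) (auto intro: Um_le)
qed simp

lemma lift_pf_mult:
 assumes p: "supp p <= S2" and q: "supp q <= S2" and D: "D#:U" and E: "E#:U"
 shows "R.lift (pf D E) (fm p q) = R.lift (%xs. R.lift (%ys. pf D E (map2 (%x y. x *[J] y) xs ys)) q) p"
proof -
 have k: "supp (fm (frag_of xs) q) <= S2" if "xs:S2" for xs by (rule fm_keys) (use that q in simp_all)
 have "R.lift (pf D E) (fm p q) = R.lift (%xs. R.lift (pf D E) (fm (frag_of xs) q)) p"
  unfolding frag_mult_def[of J p q] frag_mult_of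
  by (rule R.lift_extend[OF p k[unfolded frag_mult_of] pf_closed[OF D E]])
 also have "... = R.lift (%xs. R.lift (%ys. pf D E (map2 (%x y. x *[J] y) xs ys)) q) p"
 proof (rule R.lift_cong)
  fix xs assume "xs:supp p"
  hence xs: "xs:S2" using p by blast
  have c: "pf D E (map2 (%x y. x *[J] y) xs ys)#:R" if "ys:S2" for ys
   by (rule pf_closed[OF D E map2_S2[OF xs that]])
  show "R.lift (pf D E) (fm (frag_of xs) q) = R.lift (%ys. pf D E (map2 (%x y. x *[J] y) xs ys)) q"
   unfolding frag_mult_of
   by (subst R.lift_extend[OF q, of _ S2], use xs map2_S2 pf_closed[OF D E] in simp_all)
    (rule R.lift_cong, use c q pf_closed[OF D E] map2_S2[OF xs] in auto)
  show "R.lift (%ys. pf D E (map2 (%x y. x *[J] y) xs ys)) q#:R"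
   by (rule R.lift_closed) (use c q in blast)
 qed
 finally show ?thesis .
qed

text \<open>Contraction is the transpose of multiplication. So a term of \<open>dl al\<close> times
  \<open>dl be\<close>, paired with \<open>D\<close> and \<open>E\<close>, is \<open>dl be\<close>
  paired with contractions of \<open>D\<close> and \<open>E\<close>. Written over the legs of the
  coproduct of \<open>D\<close> and summed over \<open>dl al\<close>, this is the Leibniz rule
  \<open>n1_product\<close>.\<close>

lemma dl_mult:
 assumes a: "al#:J" and b: "be#:J"
 shows "dl (al *[J] be) = dl al *[T] dl be"
proof (rule dl_eqI)
 fix D E assume D: "D#:U" and E: "E#:U"
 obtain z where z: "z:cop D" using T2.TG_nonempty[OF cop_closed[OF D]] by blast
 note zk = T2.TG_rep(1)[OF cop_closed[OF D] z]
 have f1: "finite ({D, E} \<union> (%Ds. Ds ! 0) ` supp z)" by simp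
 have f2: "{D, E} \<union> (%Ds. Ds ! 0) ` supp z <= carrier U" using zk D E by (auto simp: tuples_U2 subset_eq)
 \<comment> \<open>The level has to accommodate the first legs of the chosen representative too,
   since \<open>dl al\<close> is paired with them.\<close>
 obtain m where m: "{D, E} \<union> (%Ds. Ds ! 0) ` supp z <= Um m" using Um_finite[OF f1 f2] by (rule exE)
 hence mD: "D:Um m" and mE: "E:Um m" and mz: "!!Ds. Ds:supp z ==> Ds ! 0:Um m" by auto
 obtain p where p: "p:dl al m" using ctensor_ex[OF dl_closed[OF a]] by blast
 obtain q where q: "q:dl be m" using ctensor_ex[OF dl_closed[OF b]] by blast
 note pk = ctensor_rep(1)[OF dl_closed[OF a] p] and qk = ctensor_rep(1)[OF dl_closed[OF b] q]
 let ?g = "%xs Ds. pf (Ds ! 0) (con (n1 (Ds ! 1) be) E) xs"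
 have gc: "?g xs Ds#:R" if "xs:S2" "Ds:tuples U 2" for xs Ds
  by (rule pf_closed) (use that b E in "auto simp: tuples_U2")
 have "R.lift (%ys. pf D E (map2 (%x y. x *[J] y) xs ys)) q = R.lift (?g xs) z" if xp: "xs:supp p" for xs
 proof -
  obtain c d where xs: "xs = [c, d]" and c: "c#:J" and d: "d#:J" using subsetD[OF pk xp, unfolded tuples_J2] by blast
  let ?D = "con (anti c) D" and ?E = "con d E"
  have DE: "?D:Um m" "?E:Um m" using Um_con0 mD mE c d by simp_all
  have "R.lift (%ys. pf D E (map2 (%x y. x *[J] y) xs ys)) q = R.lift (pf ?D ?E) q"
  proof (rule R.lift_cong)
   fix ys assume "ys:supp q"
   hence ys: "ys:S2" using qk by blast
   thus "pf ?D ?E ys#:R" using pf_closed DE by simp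
   show "pf D E (map2 (%x y. x *[J] y) xs ys) = pf ?D ?E ys"
    using ys c d D E by (auto simp: xs tuples_J2 pf_def anti_mult con_pair)
  qed
  also have "... = n1 ?D be ?E" by (rule dl_pf[OF b q DE])
  also have "?D = U.lift (%Ds. uR (anti c (Ds ! 0)) *& Ds ! 1) z"
   unfolding con_def cind_def by (rule T2.ind_eq[OF U.abelian_group_axioms con_bal cop_closed[OF D] z]) (use c in simp)
  also have "n1 ... be = JR.lift (%Ds. n1 (uR (anti c (Ds ! 0)) *& Ds ! 1) be) z"
   by (rule lift_n1[OF zk]) (use b c in "auto simp: tuples_U2")
  also have "... ?E = R.lift (%Ds. n1 (uR (anti c (Ds ! 0)) *& Ds ! 1) be ?E) z"
   by (rule lift_app[OF zk]) (use b c DE in "auto simp: tuples_U2")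
  also have "... = R.lift (?g xs) z"
  proof (rule R.lift_cong)
   fix Ds assume "Ds:supp z"
   hence Ds: "Ds:tuples U 2" using zk by blast
   thus "?g xs Ds#:R" using gc xp pk by blast
   show "n1 (uR (anti c (Ds ! 0)) *& Ds ! 1) be ?E = ?g xs Ds"
    using Ds b c d E DE by (auto simp: tuples_U2 xs pf_def n1_mult n1_uR) (simp add: con_pair JR.m_comm)
  qed
  finally show ?thesis .
 qed
 note inner = this
 have "R.lift (pf D E) (fm p q) = R.lift (%xs. R.lift (?g xs) z) p"
  unfolding lift_pf_mult[OF pk qk D E]
 proof (rule R.lift_cong)
  fix xs assume x: "xs:supp p"
  show "R.lift (%ys. pf D E (map2 (%x y. x *[J] y) xs ys)) q = R.lift (?g xs) z" by (rule inner[OF x])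
  show "R.lift (?g xs) z#:R" by (rule R.lift_closed, rule gc[OF subsetD[OF pk x]], erule subsetD[OF zk])
 qed
 also have "... = R.lift (%Ds. R.lift (%xs. ?g xs Ds) p) z"
  by (rule R.lift_swap[OF pk zk gc])
 also have "... = R.lift (%Ds. n1pair al be Ds E) z"
 proof (rule R.lift_cong)
  fix Ds assume Dz: "Ds:supp z"
  then obtain D1 D2 where Ds: "Ds = [D1, D2]" "D1#:U" "D2#:U" using subsetD[OF zk Dz, unfolded tuples_U2] by blast
  have "R.lift (pf D1 (con (n1 D2 be) E)) p = n1 D1 al (con (n1 D2 be) E)"
   by (rule dl_pf[OF a p]) (use mz[OF Dz] Ds Um_con0[OF mE] b in simp_all)
  thus "R.lift (%xs. ?g xs Ds) p = n1pair al be Ds E"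
   using a b Ds E by (simp add: n1pair_def con_pair JR.m_comm)
  show "n1pair al be Ds E#:R" using a b Ds E by (simp add: n1pair_def)
 qed
 also have "... = JR.lift (n1pair al be) z E"
  by (rule lift_app[OF zk, symmetric]) (use a b E in "auto simp: tuples_U2 n1pair_def")
 also have "JR.lift (n1pair al be) z = n1 D (al *[J] be)"
  unfolding n1_product[OF a b D] by (rule T2.ind_eq[OF JR.abelian_group_axioms n1pair_bal[OF a b] cop_closed[OF D] z, symmetric])
 finally have "R.lift (pf D E) (fm p q) = n1 D (al *[J] be) E" .
 thus "EX m p. p:(dl al *[T] dl be) m & D:Um m & E:Um m & R.lift (pf D E) p = n1 D (al *[J] be) E"
  using rep_mult[OF dl_closed[OF a] dl_closed[OF b] p q] mD mE by blast
qed (use a b ct_mult_closed in simp_all)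

lemma dl_add:
 assumes a: "al#:J" and b: "be#:J"
 shows "dl (al +[J] be) = dl al +[T] dl be"
proof (rule dl_eqI)
 fix D E assume D: "D#:U" and E: "E#:U"
 obtain m where m: "D:Um m" "E:Um m" using Um_common2[OF D E] by blast
 obtain p where p: "p:dl al m" using ctensor_ex[OF dl_closed[OF a]] by blast
 obtain q where q: "q:dl be m" using ctensor_ex[OF dl_closed[OF b]] by blast
 have "R.lift (pf D E) (p + q) = R.lift (pf D E) p +! R.lift (pf D E) q"
  by (rule R.lift_add) (use pf_closed[OF D E] ctensor_rep(1)[OF dl_closed[OF a] p] ctensor_rep(1)[OF dl_closed[OF b] q] in blast)
 hence "R.lift (pf D E) (p + q) = n1 D (al +[J] be) E"
  using dl_pf[OF a p m] dl_pf[OF b q m] a b D E by (simp add: n1_add_right)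
 thus "EX m p. p:(dl al +[T] dl be) m & D:Um m & E:Um m & R.lift (pf D E) p = n1 D (al +[J] be) E"
  using rep_add[OF dl_closed[OF a] dl_closed[OF b] p q] m by blast
qed (use a b ct_add_closed in "simp_all add: jet_add_closed")

lemma dl_one: "dl 1[J] = 1[T]"
proof (rule dl_eqI)
 fix D E assume D: "D#:U" and E: "E#:U"
 obtain m where m: "D:Um m" "E:Um m" using Um_common2[OF D E] by blast
 have "R.lift (pf D E) (frag_of [1[J], 1[J]]) = pf D E [1[J], 1[J]]"
  by (rule R.lift_frag_of) (use pf_closed[OF D E] in "simp add: tuples_J2 jet_one_closed")
 also have "... = n1 D 1[J] E"
  using D E by (simp add: pf_def anti_one n1_one_app) (simp add: jet_one)
 finally show "EX m p. p:1[T] m & D:Um m & E:Um m & R.lift (pf D E) p = n1 D 1[J] E"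
  using rep_pure[of _ m] m unfolding ct_one by blast
qed (simp_all add: ct_one tuples_J2 jet_one_closed)

text \<open>Both bimodule identities have this shape: multiplication by a decomposable tensor is
  transposed to a change of the operators in the pairing.\<close>

lemma dl_twist:
 assumes a: "al#:J" and b: "be#:J" and z: "zs:S2"
  and f: "!!D E. D#:U ==> E#:U ==> EX D':carrier U. EX E':carrier U. n1 D be E = n1 D' al E'
   & (ALL xs:S2. pf D E (map2 (%x y. x *[J] y) zs xs) = pf D' E' xs)"
 shows "dl be = pure zs *[T] dl al"
proof (rule dl_eqI[OF b])
 fix D E assume D: "D#:U" and E: "E#:U"
 from f[OF this] obtain D' E' where DE: "D'#:U" "E'#:U" and e: "n1 D be E = n1 D' al E'"
  and pe: "!!xs. xs:S2 ==> pf D E (map2 (%x y. x *[J] y) zs xs) = pf D' E' xs" by blast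
 have "EX m. {D, E, D', E'} <= Um m" by (rule Um_finite) (use D E DE in simp_all)
 then obtain m where m: "{D, E, D', E'} <= Um m" by blast
 obtain p where p: "p:dl al m" using ctensor_ex[OF dl_closed[OF a]] by blast
 note pk = ctensor_rep(1)[OF dl_closed[OF a] p]
 have c: "R.lift (%ys. pf D E (map2 (%x y. x *[J] y) zs ys)) p = R.lift (pf D' E') p"
  by (rule R.lift_cong) (use pk pe pf_closed[OF DE] in auto)
 have "R.lift (pf D E) (fm (frag_of zs) p) = R.lift (%ys. pf D E (map2 (%x y. x *[J] y) zs ys)) p"
  by (subst lift_pf_mult[OF _ pk D E], use z in simp, rule R.lift_frag_of)
   (use c pk pf_closed[OF DE] in "auto intro!: R.lift_closed")
 also have "... = n1 D be E" unfolding c e by (rule dl_pf[OF a p]) (use m in auto)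
 finally show "EX m p. p:(pure zs *[T] dl al) m & D:Um m & E:Um m & R.lift (pf D E) p = n1 D be E"
  using rep_mult[OF pure_closed[OF z] dl_closed[OF a] rep_pure p] m by blast
qed (use z a ct_mult_closed in simp)

lemma dl_left:
 assumes a: "al#:J" and r: "r#:R"
 shows "dl (jl r al) = ctensor_left K R L 2 r (dl al)"
 unfolding ctensor_left_mult[OF dl_closed[OF a] r]
proof (rule dl_twist[OF a])
 fix D E assume D: "D#:U" and E: "E#:U"
 have "anti (u1 r *[J] c) D = anti c (D *& uR r)" if "c#:J" for c
  using jet_left_n1[OF r that] that D r by (simp add: jet_left_def anti_n1)
 hence "ALL xs:S2. pf D E (map2 (%x y. x *[J] y) [u1 r, 1[J]] xs) = pf (D *& uR r) E xs" by (auto simp: tuples_J2 pf_def)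
 moreover have "n1 D (jl r al) E = n1 (D *& uR r) al E" using a r D by (simp add: jet_left_n1 n1_mult)
 ultimately show "EX D':carrier U. EX E':carrier U. n1 D (jl r al) E = n1 D' al E'
   & (ALL xs:S2. pf D E (map2 (%x y. x *[J] y) [u1 r, 1[J]] xs) = pf D' E' xs)"
  by (intro bexI[of _ "D *& uR r"] bexI[of _ E] conjI) (use D E r in simp_all)
qed (use a r in "simp_all add: jet_left_n1 tuples_J2")

lemma dl_right:
 assumes a: "al#:J" and r: "r#:R"
 shows "dl (jr al r) = ctensor_right K R L 2 (dl al) r"
 unfolding ctensor_right_mult[OF dl_closed[OF a] r]
proof (rule dl_twist[OF a])
 fix D E assume D: "D#:U" and E: "E#:U"
 have "(u2 r *[J] c) E = c (E *& uR r)" if "c#:J" for c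
  using jet_right_n2[OF r that] that E r by (simp add: jet_right_def JR.m_comm)
 hence "ALL xs:S2. pf D E (map2 (%x y. x *[J] y) [1[J], u2 r] xs) = pf D (E *& uR r) xs" by (auto simp: tuples_J2 pf_def)
 moreover have "n1 D (jr al r) E = n1 D al (E *& uR r)" using a r D E by (simp add: jet_right_n2 n1_n2)
 ultimately show "EX D':carrier U. EX E':carrier U. n1 D (jr al r) E = n1 D' al E'
   & (ALL xs:S2. pf D E (map2 (%x y. x *[J] y) [1[J], u2 r] xs) = pf D' E' xs)"
  by (intro bexI[of _ D] bexI[of _ "E *& uR r"] conjI) (use D E r in simp_all)
qed (use a r in "simp_all add: jet_right_n2 tuples_J2")

lemma dl_hom: "dl:alg_hom K J T"
proof -
 have s: "dl (c **[J] al) = c **[T] dl al" if c: "c#:K" and a: "al#:J" for c al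
 proof -
  have l: "jl (kap c) be = c **[J] be" if "be#:J" for be
   by (rule jet_eqD) (use that c in "simp_all add: jet_left_n1 n1_uR jet_smult jet_smult_closed")
  have "u1 (kap c) = c **[J] 1[J]" using l[of "1[J]"] c by (simp add: jet_left_def)
  thus ?thesis
   using dl_left[OF a, of "kap c"] c l[OF a] ctensor_left_mult[OF dl_closed[OF a], of "kap c"] ct_smult[OF dl_closed[OF a] c] by simp
 qed
 thus ?thesis unfolding alg_hom_def by (auto intro!: ring_hom_memI simp: dl_mult dl_add dl_one)
qed

section \<open>Sums over the coproduct\<close>

definition cross where "cross al Ds = n1 (Ds ! 0) al (Ds ! 1)"

lemma cross_bal: "al#:J ==> T2.bal R (cross al)"
 by (rule balanced2I) (simp_all add: cross_def n1_add n1_mult n1_uR jet_plus jet_uR)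

text \<open>For a generator \<open>x\<close>, the term that \<open>nabla1\<close> subtracts is the
  one contributed by \<open>x\<close> on the second leg. What remains is the derivative of the
  value.\<close>

lemma cross_cop:
 assumes a: "al#:J" and D: "D#:U"
 shows "T2.ind R (cross al) (cop D) = actR D (ep al)"
proof -
 let ?f = "T2.ind R (cross al)"
 note fc = T2.ind_closed[OF R.abelian_group_axioms cross_bal[OF a]]
 note fa = T2.ind_add[OF R.abelian_group_axioms cross_bal[OF a]]
 have ft: "?f (tn D E) = n1 D al E" if "D#:U" "E#:U" for D E
  using T2.ind_frag[OF R.abelian_group_axioms cross_bal[OF a], of "[D, E]"] that by (simp add: tn_def tuples_U2 cross_def)
 have R: "?f (top (r, 0[L]) t) = r *! ?f t" if t: "t#:TG2" and r: "r#:R" for t r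
  by (rule TG2_eqI[OF R.abelian_group_axioms _ _ _ _ _ t])
   (use r a fc in "simp_all add: fa top_add top_tn ft n1_mult n1_uR n1_zero R.r_distr")
 have L: "?f (top (0[R], x) t) = x |> ?f t" if t: "t#:TG2" and x: "x#:L" for t x
  by (rule TG2_eqI[OF R.abelian_group_axioms _ _ _ _ _ t])
   (use x a fc in "simp_all add: fa top_add top_tn ft n1_mult n1_uL n1_zero anchor_add_right a_minus_def R.a_assoc R.l_neg")
 show ?thesis using D
 proof (induction rule: U_gen_induct)
  case one
  thus ?case using a by (simp add: cop_one ft ep_app)
 next
  case (uR r D)
  thus ?case using a by (simp add: cop_uR R actR_mult actR_uR)
 next
  case (uL x D)
  thus ?case using a by (simp add: cop_uL L actR_mult actR_uL)
 next
  case (add D E)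
  thus ?case using a by (simp add: cop_add fa actR_add)
 qed
qed

lemma delta_Um: "w:lw ==> Ds:supp (delta w) ==> Ds ! 0:Um (Suc (length w)) & Ds ! 1:Um (Suc (length w))"
proof (induction w arbitrary: Ds rule: list.induct)
 case Nil
 thus ?case using Um_mon[of "[]" 1] by simp
next
 case (Cons x w)
 hence x: "x#:L" and w: "w:lw" by auto
 have "Ds:supp (frag_extend (%xs. frag_of [uL x *& xs ! 0, xs ! 1]) (delta w))
   \<union> supp (frag_extend (%xs. frag_of [xs ! 0, uL x *& xs ! 1]) (delta w))"
  using Cons.prems(2) keys_add by fastforce
 then obtain Es where Es: "Es:supp (delta w)" and Ds: "Ds = [uL x *& Es ! 0, Es ! 1] | Ds = [Es ! 0, uL x *& Es ! 1]"
  using keys_frag_extend by fastforce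
 have E: "Es ! 0:Um (Suc (length w))" "Es ! 1:Um (Suc (length w))" using Cons.IH[OF w Es] by auto
 show ?case using Ds E Um_uL[OF E(1) x] Um_uL[OF E(2) x] Um_le[OF E(1), of "Suc (Suc (length w))"] Um_le[OF E(2), of "Suc (Suc (length w))"] by auto
qed

lemma Um_mult: "E:Um j ==> D:Um i ==> D *& E:Um (i + j)"
proof (induction rule: Um.induct)
 case (base r w)
 have g: "A *& mon w:Um (i + length w)" if "w:lw" "A:Um i" for A i w
  using that
 proof (induction w arbitrary: A i rule: list.induct)
  case (Cons x w)
  have x: "x#:L" "w:lw" using Cons.prems by auto
  have "(A *& uL x) *& mon w:Um (Suc i + length w)"
   by (rule Cons.IH) (use Um_right_uL[OF Cons.prems(2) x(1)] x in auto)
  thus ?case using Cons.prems(2) x by (simp add: U.m_assoc)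
 qed simp
 have "D *& uR r *& mon w:Um (i + length w)"
  using g[OF base(2) Um_right_uR[OF base(4,1)]] base by (simp add: U.m_assoc)
 thus ?case by (rule Um_le) (use base in simp)
qed (simp_all add: U.r_distr Um.intros)

lemma one_Um: "0 < m ==> 1[U]:Um m" using Um_mon[of "[]" m] by simp

context
 fixes al assumes a: "al#:J"
begin

text \<open>Convergence of the sum over the coproduct of \<open>al\<close> with an explicit rate. In
  this form it can be checked on monomials and transported by the antipode.\<close>

definition "conv" where "conv ph y <-> y#:J & (ALL xs:S2. ph xs#:J) &
 (ALL i. ALL m>=Suc i. ALL p:dl al m. JR.lift ph p -[J] y:Jm i)"

lemma dl_keys: "p:dl al m ==> supp p <= S2"
 using ctensor_rep(1)[OF dl_closed[OF a]] .

lemma convI: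
 assumes y: "y#:J" and c: "!!xs. xs:S2 ==> ph xs#:J"
  and e: "!!w m p. w:lw ==> Suc (length w) <= m ==> p:dl al m ==> R.lift (%xs. ph xs (mon w)) p = y (mon w)"
 shows "conv ph y"
 unfolding conv_def
proof (intro conjI ballI allI impI y c)
 fix i m p assume m: "Suc i <= m" and p: "p:dl al m"
 have l: "JR.lift ph p#:J" by (rule JR.lift_closed) (use c dl_keys[OF p] in blast)
 show "JR.lift ph p -[J] y:Jm i"
 proof (rule JmI)
  fix w assume w: "w:lw" "length w < i"
  have "JR.lift ph p (mon w) = R.lift (%xs. ph xs (mon w)) p" by (rule lift_app[OF dl_keys[OF p] c]) (use w in simp_all)
  also have "... = y (mon w)" by (rule e[OF w(1) _ p]) (use w m in simp)
  finally show "(JR.lift ph p -[J] y) (mon w) = 0[R]" using l y w by (simp add: jet_minus)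
 qed (use l y in simp)
qed

lemma conv_anti:
 assumes "conv ph y" and e: "!!xs. xs:S2 ==> \<psi> xs = anti (ph xs)"
 shows "conv \<psi> (anti y)"
proof -
 have y: "y#:J" and c: "!!xs. xs:S2 ==> ph xs#:J"
  and l: "!!i m p. m >= Suc i ==> p:dl al m ==> JR.lift ph p -[J] y:Jm i"
  using assms(1) unfolding conv_def by auto
 show ?thesis
  unfolding conv_def
 proof (intro conjI ballI allI impI)
  fix i m p assume m: "Suc i <= m" and p: "p:dl al m"
  have lc: "JR.lift ph p#:J" by (rule JR.lift_closed) (use c dl_keys[OF p] in blast)
  have "JR.lift \<psi> p = JR.lift (%xs. anti (ph xs)) p"
   by (rule JR.lift_cong) (use e c dl_keys[OF p] in "auto simp: subset_eq")
  also have "... = anti (JR.lift ph p)"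
   by (rule JR.lift_hom[OF JR.abelian_group_axioms dl_keys[OF p] c, symmetric]) (simp_all add: anti_add)
  finally show "JR.lift \<psi> p -[J] anti y:Jm i"
   using Jm_anti[OF l[OF m p]] lc y by (simp add: anti_minus)
 qed (use y c e in simp_all)
qed

lemma conv_csum:
 assumes "conv ph y" shows "csum J (jet_filt K R L) ph (dl al) y"
proof (rule csumI[where h = "%i a. restrict a (Um i)"])
 have y: "y#:J" and c: "!!xs. xs:S2 ==> ph xs#:J"
  and l: "!!i m p. m >= Suc i ==> p:dl al m ==> JR.lift ph p -[J] y:Jm i"
  using assms unfolding conv_def by auto
 show "abelian_group J" by (rule JR.abelian_group_axioms)
 show "y#:J" by (rule y)
 show h: "a -[J] b:jet_filt K R L i <-> restrict a (Um i) = restrict b (Um i)" if "a#:J" "b#:J" for a b i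
 proof -
  have "a D -! b D = 0[R] <-> a D = b D" if "D:Um i" for D
   using R.minus_zero_eq[of "a D" "b D"] that \<open>a#:J\<close> \<open>b#:J\<close> by auto
  thus ?thesis using that by (auto simp: jet_filt_Jm Jm_iff jet_minus fun_eq_iff restrict_def)
 qed
 show "a = b" if ab: "a#:J" "b#:J" and e: "!!i. restrict a (Um i) = restrict b (Um i)" for a b
 proof (rule jet_eqD[OF ab])
  fix D assume "D#:U"
  then obtain i where "D:Um i" using Um_all by blast
  thus "a D = b D" using e[of i] by (metis restrict_apply')
 qed
 show "EX p. p:dl al m" for m by (rule ctensor_ex[OF dl_closed[OF a]])
 show lc: "JR.lift ph p#:J" if "p:dl al m" for p m
  by (rule JR.lift_closed) (use c dl_keys[OF that] in blast)
 show "EX k. ALL m>=k. ALL p:dl al m. restrict (JR.lift ph p) (Um i) = restrict y (Um i)" for i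
  using h[OF lc y] l unfolding jet_filt_Jm by (intro exI[of _ "Suc i"]) blast
qed

lemma conv_counit1: "conv (%as. u1 (ep (as ! 0)) *[J] as ! 1) al"
proof (rule convI[OF a])
 fix w m p assume w: "w:lw" "Suc (length w) <= m" and p: "p:dl al m"
 have "R.lift (%as. (u1 (ep (as ! 0)) *[J] as ! 1) (mon w)) p = R.lift (pf 1[U] (mon w)) p"
 proof (rule R.lift_cong)
  fix xs assume "xs:supp p"
  hence xs: "xs:S2" using dl_keys[OF p] by blast
  thus "(u1 (ep (xs ! 0)) *[J] xs ! 1) (mon w) = pf 1[U] (mon w) xs"
   using w ep_anti jet_left_app[unfolded jet_left_def] by (auto simp: tuples_J2 pf_def ep_app)
  show "pf 1[U] (mon w) xs#:R" using pf_closed[OF _ _ xs] w by simp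
 qed
 also have "... = al (mon w)" using dl_pf[OF a p one_Um Um_mon[OF w(1)]] w a by simp
 finally show "R.lift (%as. (u1 (ep (as ! 0)) *[J] as ! 1) (mon w)) p = al (mon w)" .
qed (auto simp: tuples_J2)

text \<open>Multiplication by \<open>u2\<close> changes the argument of a jet and not its value.
  After an application of the antipode the counit is an honest scalar, and the sum is the pairing
  with 1 in the second place.\<close>

lemma conv_counit2: "conv (%as. as ! 0 *[J] u2 (ep (as ! 1))) al"
proof -
 have "conv (%as. n1 (uR (ep (as ! 1))) (anti (as ! 0))) (anti al)"
 proof (rule convI)
  fix w m p assume w: "w:lw" "Suc (length w) <= m" and p: "p:dl al m"
  have "R.lift (%as. n1 (uR (ep (as ! 1))) (anti (as ! 0)) (mon w)) p = R.lift (pf (mon w) 1[U]) p"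
  proof (rule R.lift_cong)
   fix xs assume "xs:supp p"
   hence xs: "xs:S2" using dl_keys[OF p] by blast
   thus "n1 (uR (ep (xs ! 1))) (anti (xs ! 0)) (mon w) = pf (mon w) 1[U] xs"
    using w by (auto simp: tuples_J2 pf_def n1_uR) (simp add: ep_app R.m_comm)
   show "pf (mon w) 1[U] xs#:R" using pf_closed[OF _ _ xs] w by simp
  qed
  also have "... = anti al (mon w)" using dl_pf[OF a p Um_mon[OF w(1)] one_Um] w a by (simp add: anti_app)
  finally show "R.lift (%as. n1 (uR (ep (as ! 1))) (anti (as ! 0)) (mon w)) p = anti al (mon w)" .
 qed (use a in "auto simp: tuples_J2")
 hence "conv (%as. as ! 0 *[J] u2 (ep (as ! 1))) (anti (anti al))"
  by (rule conv_anti) (use jet_right_n2[unfolded jet_right_def] in "auto simp: tuples_J2 anti_anti anti_n1")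
 thus ?thesis by (simp only: anti_anti[OF a])
qed

text \<open>At a monomial the product runs over the legs of its coproduct. After an exchange of the
  sums each pair of legs is paired with the coproduct of \<open>al\<close>, and the total is
  computed by \<open>cross_cop\<close>.\<close>

lemma conv_antipode1: "conv (%as. jet_antipode K R L (as ! 0) *[J] as ! 1) (u2 (ep al))"
proof (rule convI)
 fix w m p assume w: "w:lw" "Suc (length w) <= m" and p: "p:dl al m"
 have z: "supp (delta w) <= tuples U 2" "cop (mon w) = T2.cl (delta w)" using delta_cop[OF w(1)] by auto
 have gc: "pf (Ds ! 0) (Ds ! 1) xs#:R" if "xs:S2" "Ds:tuples U 2" for xs Ds
  by (rule pf_closed) (use that in "auto simp: tuples_U2")
 have "R.lift (%as. (jet_antipode K R L (as ! 0) *[J] as ! 1) (mon w)) p = R.lift (%as. R.lift (%Ds. pf (Ds ! 0) (Ds ! 1) as) (delta w)) p"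
 proof (rule R.lift_cong)
  fix xs assume "xs:supp p"
  hence xs: "xs:S2" using dl_keys[OF p] by blast
  then obtain b c where bc: "xs = [b, c]" "b#:J" "c#:J" by (auto simp: tuples_J2)
  show "R.lift (%Ds. pf (Ds ! 0) (Ds ! 1) xs) (delta w)#:R"
   by (rule R.lift_closed, rule gc[OF xs], erule subsetD[OF z(1)])
  have "(anti b *[J] c) (mon w) = R.lift (jpair (anti b) c) (delta w)"
   using jet_mult[of "anti b" c "mon w"] bc w z T2.ind_cl[OF R.abelian_group_axioms jpair_bal[of "anti b" c] z(1)] by simp
  thus "(jet_antipode K R L (xs ! 0) *[J] xs ! 1) (mon w) = R.lift (%Ds. pf (Ds ! 0) (Ds ! 1) xs) (delta w)"
   using bc by (simp add: jet_antipode_anti pf_def jpair_def[abs_def])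
 qed
 also have "... = R.lift (%Ds. R.lift (pf (Ds ! 0) (Ds ! 1)) p) (delta w)"
  by (rule R.lift_swap[OF dl_keys[OF p] z(1) gc])
 also have "... = R.lift (cross al) (delta w)"
 proof (rule R.lift_cong)
  fix Ds assume Ds: "Ds:supp (delta w)"
  have D: "Ds ! 0:Um m" "Ds ! 1:Um m" using delta_Um[OF w(1) Ds] Um_le w(2) by auto
  thus "R.lift (pf (Ds ! 0) (Ds ! 1)) p = cross al Ds" unfolding cross_def by (rule dl_pf[OF a p])
  show "cross al Ds#:R" using D a by (simp add: cross_def)
 qed
 also have "... = actR (mon w) (ep al)"
  using cross_cop[OF a, of "mon w"] T2.ind_cl[OF R.abelian_group_axioms cross_bal[OF a] z(1)] z(2) w by simp
 finally show "R.lift (%as. (jet_antipode K R L (as ! 0) *[J] as ! 1) (mon w)) p = u2 (ep al) (mon w)" using a w by (simp add: u2_app)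
qed (use a in "auto simp: tuples_J2 jet_antipode_anti")

text \<open>The antipode, being multiplicative and involutive, carries the first identity to the
  second.\<close>

lemma conv_antipode2: "conv (%as. as ! 0 *[J] jet_antipode K R L (as ! 1)) (u1 (ep al))"
proof -
 have "conv (%as. as ! 0 *[J] jet_antipode K R L (as ! 1)) (anti (u2 (ep al)))"
  by (rule conv_anti[OF conv_antipode1]) (auto simp: tuples_J2 jet_antipode_anti anti_mult anti_anti)
 thus ?thesis using a by (simp only: anti_u2 ep_closed)
qed

end

section \<open>Coassociativity\<close>

lemma Jm_diff_eq: "al#:J ==> be#:J ==> al -[J] be:Jm m ==> D:Um m ==> al D = be D"
 using Jm_Um[of "al -[J] be" m D] R.minus_zero_eq[of "al D" "be D"] by (simp add: jet_minus)

abbreviation twist where "twist H as == n2 (uR ((as ! 1) H)) (as ! 0)"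

context
 fixes al p m H assumes a: "al#:J" and p: "p:dl al m" and H: "H:Um m"
begin

lemma twist_closed: "xs:S2 ==> twist H xs#:J" using H by (auto simp: tuples_J2)

lemma lift_twist_closed: "JR.lift (twist H) p#:J"
 by (rule JR.lift_closed) (use twist_closed dl_keys[OF a p] in blast)

text \<open>Pairing the second leg of the coproduct with \<open>H\<close> amounts to
  \<open>nabla2\<close> along \<open>H\<close>. Under the antipode this is a statement about values
  at \<open>D\<close>, and there it is the equation defining the coproduct.\<close>

lemma dl_twist_diff: "JR.lift (twist H) p -[J] n2 H al:Jm m"
proof -
 note pk = dl_keys[OF a p]
 have ac: "anti (twist H xs)#:J" if "xs:S2" for xs using twist_closed[OF that] by simp
 have e: "anti (JR.lift (twist H) p) = JR.lift (%xs. anti (twist H xs)) p"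
  by (rule JR.lift_hom[OF JR.abelian_group_axioms pk twist_closed]) (simp_all add: anti_add)
 have "anti (JR.lift (twist H) p) -[J] anti (n2 H al):Jm m"
  unfolding Jm_iff
 proof (intro conjI ballI)
  fix D assume D: "D:Um m"
  have "anti (JR.lift (twist H) p) D = R.lift (%xs. anti (twist H xs) D) p" unfolding e by (rule lift_app[OF pk ac]) (use D in simp_all)
  also have "... = R.lift (pf D H) p"
  proof (rule R.lift_cong)
   fix xs assume "xs:supp p"
   hence xs: "xs:S2" using pk by blast
   thus "anti (twist H xs) D = pf D H xs" using D H by (auto simp: tuples_J2 pf_def anti_n2_uR) (simp add: R.m_comm)
   show "pf D H xs#:R" using pf_closed xs D H by simp
  qed
  also have "... = n1 D al H" by (rule dl_pf[OF a p D H])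
  also have "... = anti (n2 H al) D" using a D H by (simp add: anti_app n1_n2)
  finally show "(anti (JR.lift (twist H) p) -[J] anti (n2 H al)) D = 0[R]"
   using lift_twist_closed a D H by (simp add: jet_minus)
 qed (use lift_twist_closed a H in simp)
 hence "anti (anti (JR.lift (twist H) p) -[J] anti (n2 H al)):Jm m" by (rule Jm_anti)
 thus ?thesis using lift_twist_closed a H by (simp add: anti_minus anti_anti)
qed

lemma dl_twist_app: "E:Um m ==> R.lift (%xs. twist H xs E) p = al (E *& H)"
 using Jm_diff_eq[OF lift_twist_closed _ dl_twist_diff, where D = E] lift_app[OF dl_keys[OF a p] twist_closed, where D = E] a H by simp

text \<open>For \<open>D\<close> in \<open>Um i\<close> the operator \<open>n1 D\<close> maps
  \<open>Jm (i + i)\<close> into \<open>Jm i\<close>, which annihilates \<open>E\<close>. This is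
  the reason for doubling the level.\<close>

lemma dl_twist_n1:
 assumes D: "D:Um i" and E: "E:Um i" and i: "i + i <= m"
 shows "R.lift (%xs. n1 D (twist H xs) E) p = n1 D al (E *& H)"
proof -
 have z: "n1 D (JR.lift (twist H) p -[J] n2 H al):Jm i"
  by (rule Jm_n1[of _ i]) (use Um_le[OF D] Jm_le[OF dl_twist_diff i] in auto)
 have "n1 D (JR.lift (twist H) p -[J] n2 H al) +[J] n1 D (n2 H al) = n1 D (JR.lift (twist H) p)"
  using n1_add_right[of D "n2 H al" "JR.lift (twist H) p -[J] n2 H al", symmetric] D H a lift_twist_closed
  by (simp add: a_minus_def JR.a_assoc JR.l_neg)
 hence "n1 D (JR.lift (twist H) p) E = n1 D (n2 H al) E"
  using Jm_Um[OF z E] jet_add[of E "n1 D (JR.lift (twist H) p -[J] n2 H al)" "n1 D (n2 H al)"] D E H a by simp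
 moreover have "n1 D (JR.lift (twist H) p) E = R.lift (%xs. n1 D (twist H xs) E) p"
  by (rule JR.lift_hom[OF R.abelian_group_axioms dl_keys[OF a p] twist_closed, where h = "%be. n1 D be E"])
   (use D E in "simp_all add: n1_add_right")
 ultimately show ?thesis using a D E H by (simp add: n1_n2)
qed

end

abbreviation T3 where "T3 == ctensor K R L 3"

context
 fixes f x
 assumes x: "x:Ct 2" and f: "!!xs. xs:S2 ==> f xs:tuples J 3"
  and b: "!!m. CT.bal 2 m (CT.TA 3 m) (%xs. CT.cl 3 m (frag_of (f xs)))"
begin

lemma ctensor_map3:
 assumes p: "p:x m"
 shows "ctensor_map K R L 3 f x m = CT.cl 3 m (frag_extend (%xs. frag_of (f xs)) p)"
  "supp (frag_extend (%xs. frag_of (f xs)) p) <= tuples J 3"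
proof -
 have fk: "supp (frag_of (f xs)) <= tuples J 3" if "xs:S2" for xs using f[OF that] by simp
 have e: "CT.cl 3 m (frag_extend (%xs. frag_of (f xs)) q) = CTA.lift 3 m (%xs. CT.cl 3 m (frag_of (f xs))) q" if "q:x m" for q
  by (rule CT.cl_extend(1)[OF ctensor_rep(1)[OF x that]]) (rule fk)
 have "CT.cl 3 m (frag_extend (%xs. frag_of (f xs)) q) = CT.cl 3 m (frag_extend (%xs. frag_of (f xs)) p)" if "q:x m" for q
  unfolding e[OF that] e[OF p] by (rule CT.lift_rep[OF CT.TA_abelian b ctensor_TG[OF x] that p])
 hence "(\<Union>q\<in>x m. CT.cl 3 m (frag_extend (%xs. frag_of (f xs)) q)) = CT.cl 3 m (frag_extend (%xs. frag_of (f xs)) p)"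
  using p by blast
 thus "ctensor_map K R L 3 f x m = CT.cl 3 m (frag_extend (%xs. frag_of (f xs)) p)"
  by (simp only: ctensor_map_def ctensor_class_cl)
 show "supp (frag_extend (%xs. frag_of (f xs)) p) <= tuples J 3"
  by (rule CT.cl_extend(2)[OF ctensor_rep(1)[OF x p] fk])
qed

lemma ctensor_map3_closed: "ctensor_map K R L 3 f x:Ct 3"
proof (rule ctensorI)
 fix m
 obtain p where p: "p:x (Suc m)" using ctensor_ex[OF x] by blast
 show "ctensor_map K R L 3 f x m#:(CT.TG 3 m)"
  unfolding ctensor_map3(1)[OF ctensor_Suc[OF x p]] by (rule CT.cl_closed[OF ctensor_map3(2)[OF p]])
 show "EX p. p:ctensor_map K R L 3 f x (Suc m) & p:ctensor_map K R L 3 f x m"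
  unfolding ctensor_map3(1)[OF ctensor_Suc[OF x p]] ctensor_map3(1)[OF p] using CT.cl_self by blast
qed

lemma qf_map3:
 assumes D: "D:Um m" and E: "E:Um m" and H: "H:Um m" and p: "p:x m"
 shows "CT.ind R (qf D E H) (ctensor_map K R L 3 f x m) = R.lift (%xs. qf D E H (f xs)) p"
proof -
 note q = CT.bal_closed[OF R.abelian_group_axioms qf_bal[OF D E H]]
 have "CT.ind R (qf D E H) (ctensor_map K R L 3 f x m) = R.lift (qf D E H) (frag_extend (%xs. frag_of (f xs)) p)"
  unfolding ctensor_map3(1)[OF p] by (rule CT.ind_cl[OF R.abelian_group_axioms qf_bal[OF D E H] ctensor_map3(2)[OF p]])
 also have "... = R.lift (%xs. R.lift (qf D E H) (frag_of (f xs))) p"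
  by (rule R.lift_extend[OF ctensor_rep(1)[OF x p] _ q]) (use f in auto)
 also have "... = R.lift (%xs. qf D E H (f xs)) p"
  by (rule R.lift_cong) (use f q ctensor_rep(1)[OF x p] in "auto simp: subset_eq")
 finally show ?thesis .
qed

end

abbreviation cmap1 where "cmap1 as == ctensor_map K R L 3 (%bs. bs @ [as ! 1]) (dl (as ! 0))"
abbreviation cmap2 where "cmap2 as == ctensor_map K R L 3 (%bs. (as ! 0) # bs) (dl (as ! 1))"

lemma cmap_bal:
 assumes c: "c#:J"
 shows "CT.bal 2 m (CT.TA 3 m) (%xs. CT.cl 3 m (frag_of (xs @ [c])))"
  "CT.bal 2 m (CT.TA 3 m) (%xs. CT.cl 3 m (frag_of (c # xs)))"
proof -
 have t: "xs:S2 ==> xs @ [c]:tuples J 3" "xs:S2 ==> c # xs:tuples J 3" for xs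
  using c by (auto simp: tuples_J2 tuples_J3)
 show "CT.bal 2 m (CT.TA 3 m) (%xs. CT.cl 3 m (frag_of (xs @ [c])))"
  unfolding balanced_def
 proof (intro conjI ballI allI impI)
  fix xs ys a b assume "b#:J" "xs @ [a] @ ys:S2"
  thus "CT.cl 3 m (frag_of ((xs @ [a +[J] b] @ ys) @ [c]))
    = CT.cl 3 m (frag_of ((xs @ [a] @ ys) @ [c])) +[CT.TA 3 m] CT.cl 3 m (frag_of ((xs @ [b] @ ys) @ [c]))"
   using CT.cl_frag_add[of xs a "ys @ [c]" 3 b m] t(1)[of "xs @ [a] @ ys"] by simp
 next
  fix xs ys a b r assume "r#:R" "xs @ [a, b] @ ys:S2"
  thus "CT.cl 3 m (frag_of ((xs @ [jr a r, b] @ ys) @ [c])) = CT.cl 3 m (frag_of ((xs @ [a, jl r b] @ ys) @ [c]))"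
   using CT.cl_frag_bal[of xs a b "ys @ [c]" 3 r m] t(1)[of "xs @ [a, b] @ ys"] by simp
 qed (use CT.cl_frag_null[OF t(1)] t in "auto intro!: CT.cl_closed")
 show "CT.bal 2 m (CT.TA 3 m) (%xs. CT.cl 3 m (frag_of (c # xs)))"
  unfolding balanced_def
 proof (intro conjI ballI allI impI)
  fix xs ys a b assume "b#:J" "xs @ [a] @ ys:S2"
  thus "CT.cl 3 m (frag_of (c # xs @ [a +[J] b] @ ys))
    = CT.cl 3 m (frag_of (c # xs @ [a] @ ys)) +[CT.TA 3 m] CT.cl 3 m (frag_of (c # xs @ [b] @ ys))"
   using CT.cl_frag_add[of "c # xs" a ys 3 b m] t(2)[of "xs @ [a] @ ys"] by simp
 next
  fix xs ys a b r assume "r#:R" "xs @ [a, b] @ ys:S2"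
  thus "CT.cl 3 m (frag_of (c # xs @ [jr a r, b] @ ys)) = CT.cl 3 m (frag_of (c # xs @ [a, jl r b] @ ys))"
   using CT.cl_frag_bal[of "c # xs" a b ys 3 r m] t(2)[of "xs @ [a, b] @ ys"] by simp
 qed (use CT.cl_frag_null[OF t(2)] t in "auto intro!: CT.cl_closed")
qed

lemma cmap_closed:
 assumes "as:S2" shows "cmap1 as:Ct 3" "cmap2 as:Ct 3"
 using assms by (auto simp: tuples_J2 tuples_J3 intro!: ctensor_map3_closed cmap_bal)

lemma cmap_qf:
 assumes as: "as:S2" and D: "D:Um m" and E: "E:Um m" and H: "H:Um m"
 shows "CT.ind R (qf D E H) (cmap1 as m) = n1 D (twist H as) E"
  "CT.ind R (qf D E H) (cmap2 as m) = pf D (E *& H) as"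
proof -
 obtain a c where ac: "as = [a, c]" "a#:J" "c#:J" using as by (auto simp: tuples_J2)
 obtain p where p: "p:dl a m" using ctensor_ex[OF dl_closed[OF ac(2)]] by blast
 have "CT.ind R (qf D E H) (cmap1 [a, c] m) = R.lift (%bs. qf D E H (bs @ [c])) p"
  using ac D E H p by (simp, intro qf_map3 cmap_bal) (auto simp: tuples_J2 tuples_J3)
 also have "... = R.lift (pf D (E *& uR (c H))) p"
  by (rule R.lift_cong) (use dl_keys[OF ac(2) p] ac D E H pf_closed in "auto simp: tuples_J2 qf_def pf_def subset_eq")
 also have "... = n1 D a (E *& uR (c H))" by (rule dl_pf[OF ac(2) p D Um_right_uR[OF E]]) (use ac H in simp)
 also have "... = n1 D (twist H as) E" using ac D E H by (simp add: n1_n2)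
 finally show "CT.ind R (qf D E H) (cmap1 as m) = n1 D (twist H as) E" using ac by simp
 obtain q where q: "q:dl c m" using ctensor_ex[OF dl_closed[OF ac(3)]] by blast
 note qk = dl_keys[OF ac(3) q]
 have tc: "twist H bs E#:R" if "bs:S2" for bs using that E H by (auto simp: tuples_J2)
 have "CT.ind R (qf D E H) (cmap2 [a, c] m) = R.lift (%bs. qf D E H (a # bs)) q"
  using ac D E H q by (simp, intro qf_map3 cmap_bal) (auto simp: tuples_J2 tuples_J3)
 also have "... = R.lift (%bs. anti a D *! twist H bs E) q"
  by (rule R.lift_cong) (use qk ac D E H in "auto simp: tuples_J2 qf_def subset_eq")
 also have "... = anti a D *! R.lift (%bs. twist H bs E) q"
  by (rule R.lift_hom[OF R.abelian_group_axioms qk tc, symmetric]) (use ac D in "simp_all add: R.r_distr")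
 also have "... = pf D (E *& H) as" unfolding dl_twist_app[OF ac(3) q H E] using ac by (simp add: pf_def)
 finally show "CT.ind R (qf D E H) (cmap2 as m) = pf D (E *& H) as" using ac by simp
qed

lemma T3_abelian: "abelian_group T3" by (rule ct_abelian)

lemma T3_lift_app:
 assumes p: "supp p <= S2" and f: "!!xs. xs:S2 ==> f xs:Ct 3"
 shows "tensor_lift T3 f p i = CTA.lift 3 i (%xs. f xs i) p"
proof (rule abelian_group.lift_hom[OF T3_abelian CT.TA_abelian p f, where h = "%x. x i"])
 fix x y assume "x:Ct 3" "y:Ct 3"
 show "(x +[T3] y) i = x i +[CT.TA 3 i] y i" by (simp only: ctensor_def ctensor_group_TG CT.TA_simps ring_record_simps module.simps)
qed simp_all

text \<open>Both iterated coproducts have the pairing \<open>n1 D al (E *& H)\<close> with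
  \<open>D\<close>, \<open>E\<close> and \<open>H\<close>: in one the twist by \<open>H\<close> is
  an instance of \<open>nabla2\<close>, in the other the last two pairings combine to the product
  \<open>E *& H\<close>, which lies in \<open>Um (i + i)\<close>.\<close>

lemma lift_cmap_qf:
 assumes a: "al#:J" and p: "p:dl al m" and i: "i + i <= m"
  and D: "D:Um i" and E: "E:Um i" and H: "H:Um i" and f: "f = cmap1 | f = cmap2"
 shows "CT.ind R (qf D E H) (tensor_lift T3 f p i) = n1 D al (E *& H)"
proof -
 note pk = dl_keys[OF a p]
 have fc: "f xs:Ct 3" if "xs:S2" for xs using f cmap_closed[OF that] by blast
 have ci: "f xs i#:(CT.TA 3 i)" if "xs:S2" for xs using fc[OF that] by simp
 note b = qf_bal[OF D E H]
 have e: "tensor_lift T3 f p i = CTA.lift 3 i (%xs. f xs i) p" by (rule T3_lift_app[OF pk fc])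
 have m: "D:Um m" "E:Um m" "H:Um m" using D E H i by (auto intro: Um_le)
 have "CT.ind R (qf D E H) (tensor_lift T3 f p i) = R.lift (%xs. CT.ind R (qf D E H) (f xs i)) p"
  unfolding e
  by (rule CTA.lift_hom[OF R.abelian_group_axioms pk ci])
   (use CT.ind_closed[OF R.abelian_group_axioms b] CT.ind_add[OF R.abelian_group_axioms b] in auto)
 also have "... = n1 D al (E *& H)"
 proof (cases "f = cmap1")
  case True
  have "R.lift (%xs. CT.ind R (qf D E H) (f xs i)) p = R.lift (%xs. n1 D (twist H xs) E) p"
   by (rule R.lift_cong) (use True pk cmap_qf(1)[OF _ D E H] D E H in "auto simp: subset_eq tuples_J2")
  thus ?thesis using dl_twist_n1[OF a p m(3) D E i] by simp
 next
  case False
  have "R.lift (%xs. CT.ind R (qf D E H) (f xs i)) p = R.lift (pf D (E *& H)) p"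
   by (rule R.lift_cong) (use False f pk cmap_qf(2)[OF _ D E H] D E H pf_closed in "auto simp: subset_eq")
  thus ?thesis using dl_pf[OF a p m(1) Um_le[OF Um_mult[OF H E] i]] by simp
 qed
 finally show ?thesis .
qed

lemma lift_cmap_closed:
 assumes a: "al#:J" and p: "p:dl al m" and f: "f = cmap1 | f = cmap2"
 shows "tensor_lift T3 f p:Ct 3"
 by (rule abelian_group.lift_closed[OF T3_abelian]) (use f cmap_closed dl_keys[OF a p] in blast)

lemma lift_cmap_unique:
 assumes a: "al#:J" and p: "p:dl al m" and q: "q:dl al n" and i: "i + i <= m" "i + i <= n"
  and f: "f = cmap1 | f = cmap2" and g: "g = cmap1 | g = cmap2"
 shows "tensor_lift T3 f p i = tensor_lift T3 g q i"
 by (rule sep3[OF ctensor_TG[OF lift_cmap_closed[OF a p f]] ctensor_TG[OF lift_cmap_closed[OF a q g]]])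
  (use lift_cmap_qf[OF a p i(1) _ _ _ f] lift_cmap_qf[OF a q i(2) _ _ _ g] in simp)

lemma coassociative:
 assumes a: "al#:J"
 shows "EX y. csum T3 (ctensor_filt K R L 3) cmap1 (dl al) y & csum T3 (ctensor_filt K R L 3) cmap2 (dl al) y"
proof -
 obtain p where p: "!!m. p m:dl al m" using ctensor_ex[OF dl_closed[OF a]] by metis
 \<comment> \<open>Level \<open>i + i\<close> of the coproduct determines component \<open>i\<close>
   of the iterated sum; by \<open>lift_cmap_unique\<close> neither the representative nor a higher
   level changes it.\<close>
 define y where "y = (%i. tensor_lift T3 cmap2 (p (i + i)) i)"
 have yc: "y:Ct 3"
  unfolding ctensor_carrier
 proof (intro allI conjI)
  fix i
  have c: "tensor_lift T3 cmap2 (p m):Ct 3" for m by (rule lift_cmap_closed[OF a p]) simp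
  show "y i#:(CT.TG 3 i)" unfolding y_def by (rule ctensor_TG[OF c])
  have "y i = tensor_lift T3 cmap2 (p (Suc i + Suc i)) i" unfolding y_def by (rule lift_cmap_unique[OF a p p]) simp_all
  moreover have "y (Suc i) <= tensor_lift T3 cmap2 (p (Suc i + Suc i)) i" unfolding y_def by (rule ctensor_le[OF c]) simp
  ultimately show "y (Suc i) <= y i" by simp
 qed
 interpret T3: abelian_group T3 by (rule T3_abelian)
 have "csum T3 (ctensor_filt K R L 3) f (dl al) y" if f: "f = cmap1 | f = cmap2" for f
 proof (rule csumI[OF T3_abelian yc, where h = "%i x. x i"])
  fix x z i assume x: "x:Ct 3" and z: "z:Ct 3"
  have add: "(u +[T3] v) i = u i +[CT.TA 3 i] v i" for u v
   by (simp only: ctensor_def ctensor_group_TG CT.TA_simps ring_record_simps module.simps)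
  have "x = (x -[T3] z) +[T3] z" using x z by (simp add: T3.minus_eq T3.a_assoc T3.l_neg)
  hence "x i = (x -[T3] z) i +[CT.TA 3 i] z i" using add[of "x -[T3] z" z] by simp
  moreover have d: "x -[T3] z:Ct 3" using x z by (rule T3.minus_closed)
  moreover have t: "t = 0[CT.TA 3 i] <-> t +[CT.TA 3 i] z i = z i" if "t#:(CT.TA 3 i)" for t
   using CTA.add.r_cancel_one[of "z i" 3 i t] that ctensor_TG[OF z] by simp
  ultimately have "(x -[T3] z) i = 1[CT.TG 3 i] <-> x i = z i" using t[of "(x -[T3] z) i"] ctensor_TG[OF d] by simp
  thus "x -[T3] z:ctensor_filt K R L 3 i <-> x i = z i" using d by (simp only: ctensor_filt_def ctensor_group_TG mem_Collect_eq simp_thms)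
 next
  fix m q assume "q:dl al m"
  thus "tensor_lift T3 f q:Ct 3" by (rule lift_cmap_closed[OF a _ f])
 next
  fix i
  show "EX k. ALL m>=k. ALL q:dl al m. tensor_lift T3 f q i = y i" unfolding y_def
   by (intro exI[of _ "i + i"] allI impI ballI lift_cmap_unique[OF a _ p _ _ f]) simp_all
 qed (use ctensor_ex[OF dl_closed[OF a]] in auto)
 thus ?thesis by blast
qed

lemma hopf_algebroid:
 "(ALL al:carrier J. EX! x. is_jet_coprod K R L al x)
   & (ALL al:carrier J. EX! be. is_jet_antipode K R L al be)"
 "bij_betw (jet_antipode K R L) (carrier J) (carrier J)"
 "jet_antipode K R L:alg_hom K J J"
 using jet_coprod_ex1 apply (simp add: is_jet_antipode_iff)
  apply (rule bij_betw_byWitness[of _ "anti"]; auto simp: jet_antipode_anti anti_anti)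
 using anti_hom by (auto simp: alg_hom_def ring_hom_def jet_antipode_anti jet_smult_closed jet_one_closed jet_add_closed Pi_iff)

end

theorem mainTheorem2:
  fixes K :: "'k ring" and R :: "('k, 'r) module" and L :: "('r, 'l) lie_module" and d :: nat
  assumes lie_algebroid: "lie_algebroid K R L"
    and char_zero: "\<forall>n::nat. n > 0 \<longrightarrow> [n] \<cdot>\<^bsub>K\<^esub> \<one>\<^bsub>K\<^esub> \<noteq> \<zero>\<^bsub>K\<^esub>"
    and locally_free: "locally_free R L d"
  shows
    "let J = jet K R L; J2 = ctensor K R L 2; J3 = ctensor K R L 3;
         u1 = jet_unit1 K R L; u2 = jet_unit2 K R L;
         \<Delta> = jet_coprod K R L; \<epsilon> = jet_counit K R L; S = jet_antipode K R L
     in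
     \<comment> \<open>the requirements defining \<open>\<Delta>\<close> and \<open>S\<close> have unique solutions\<close>
       (\<forall>\<alpha>\<in>carrier J. \<exists>!x. is_jet_coprod K R L \<alpha> x)
     \<and> (\<forall>\<alpha>\<in>carrier J. \<exists>!\<beta>. is_jet_antipode K R L \<alpha> \<beta>)
     \<and> algebra K J
     \<and> u1 \<in> alg_hom K R J \<and> u2 \<in> alg_hom K R J
     \<and> algebra K J2
     \<and> \<Delta> \<in> alg_hom K J J2
     \<and> (\<forall>r\<in>carrier R. \<forall>\<alpha>\<in>carrier J.
          \<Delta> (jet_left K R L r \<alpha>) = ctensor_left K R L 2 r (\<Delta> \<alpha>)
        \<and> \<Delta> (jet_right K R L \<alpha> r) = ctensor_right K R L 2 (\<Delta> \<alpha>) r)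
     \<and> \<epsilon> \<in> alg_hom K J R
     \<and> (\<forall>r\<in>carrier R. \<forall>\<alpha>\<in>carrier J.
          \<epsilon> (jet_left K R L r \<alpha>) = r \<otimes>\<^bsub>R\<^esub> \<epsilon> \<alpha>
        \<and> \<epsilon> (jet_right K R L \<alpha> r) = \<epsilon> \<alpha> \<otimes>\<^bsub>R\<^esub> r)
     \<and> bij_betw S (carrier J) (carrier J)
     \<and> S \<in> alg_hom K J J
     \<and> (\<forall>r\<in>carrier R. \<forall>\<alpha>\<in>carrier J.
          S (jet_left K R L r \<alpha>) = jet_right K R L (S \<alpha>) r
        \<and> S (jet_right K R L \<alpha> r) = jet_left K R L r (S \<alpha>))
     \<comment> \<open>coassociativity: \<open>\<Sum> \<Delta> \<alpha>\<^sub>1 \<otimes> \<alpha>\<^sub>2 = \<Sum> \<alpha>\<^sub>1 \<otimes> \<Delta> \<alpha>\<^sub>2\<close> in the completed triple tensor product\<close>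
     \<and> (\<forall>\<alpha>\<in>carrier J. \<exists>y.
          csum J3 (ctensor_filt K R L 3)
            (\<lambda>as. ctensor_map K R L 3 (\<lambda>bs. bs @ [as ! 1]) (\<Delta> (as ! 0))) (\<Delta> \<alpha>) y
        \<and> csum J3 (ctensor_filt K R L 3)
            (\<lambda>as. ctensor_map K R L 3 (\<lambda>bs. (as ! 0) # bs) (\<Delta> (as ! 1))) (\<Delta> \<alpha>) y)
     \<and> (\<forall>r\<in>carrier R. \<epsilon> (u1 r) = r \<and> \<epsilon> (u2 r) = r)
     \<and> (\<forall>\<alpha>\<in>carrier J.
          csum J (jet_filt K R L) (\<lambda>as. u1 (\<epsilon> (as ! 0)) \<otimes>\<^bsub>J\<^esub> as ! 1) (\<Delta> \<alpha>) \<alpha>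
        \<and> csum J (jet_filt K R L) (\<lambda>as. as ! 0 \<otimes>\<^bsub>J\<^esub> u2 (\<epsilon> (as ! 1))) (\<Delta> \<alpha>) \<alpha>)
     \<and> (\<forall>\<alpha>\<in>carrier J.
          csum J (jet_filt K R L) (\<lambda>as. S (as ! 0) \<otimes>\<^bsub>J\<^esub> as ! 1) (\<Delta> \<alpha>) (u2 (\<epsilon> \<alpha>))
        \<and> csum J (jet_filt K R L) (\<lambda>as. as ! 0 \<otimes>\<^bsub>J\<^esub> S (as ! 1)) (\<Delta> \<alpha>) (u1 (\<epsilon> \<alpha>)))
     \<and> (\<forall>\<alpha>\<in>carrier J. S (S \<alpha>) = \<alpha>)"
proof -
 have "lie_algebroid_char0 K R L"
  using lie_algebroid char_zero by (simp add: lie_algebroid_char0_def lie_algebroid_char0_axioms_def)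
 \<comment> \<open>The coordinates serve as a witness only: none of the structures in the statement
   refers to them.\<close>
 then obtain Ys where "jet_coords K R L Ys" using lie_algebroid_char0.jet_coords_exist[OF _ locally_free] by blast
 then interpret jet_coords K R L Ys .
 show ?thesis
  unfolding Let_def
 proof (intro conjI ballI)
  fix al r assume a: "al#:J" and r: "r#:R"
  show "jet_antipode K R L (jl r al) = jr (jet_antipode K R L al) r"
   "jet_antipode K R L (jr al r) = jl r (jet_antipode K R L al)"
   using anti_bimod[OF r a] a r by (simp_all add: jet_antipode_anti jet_left_n1 jet_right_n2)
 next
  fix al assume a: "al#:J"
  show "jet_antipode K R L (jet_antipode K R L al) = al" using a by (simp add: jet_antipode_anti anti_anti)
  show "EX y. csum T3 (ctensor_filt K R L 3) cmap1 (dl al) y & csum T3 (ctensor_filt K R L 3) cmap2 (dl al) y"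
   by (rule coassociative[OF a])
  show "csum J (jet_filt K R L) (%as. u1 (ep (as ! 0)) *[J] as ! 1) (dl al) al"
   "csum J (jet_filt K R L) (%as. as ! 0 *[J] u2 (ep (as ! 1))) (dl al) al"
   "csum J (jet_filt K R L) (%as. jet_antipode K R L (as ! 0) *[J] as ! 1) (dl al) (u2 (ep al))"
   "csum J (jet_filt K R L) (%as. as ! 0 *[J] jet_antipode K R L (as ! 1)) (dl al) (u1 (ep al))"
   by (rule conv_csum[OF a], rule conv_counit1[OF a] conv_counit2[OF a] conv_antipode1[OF a] conv_antipode2[OF a])+
 qed (use hopf_algebroid in "simp_all add: jet_algebra jet_units T_algebra dl_hom dl_left dl_right ep_hom ep_bimod ep_units")
qed

end
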